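(* Let $X$ be a reflexive Banach space such that $X$ and $X^*$ have finite cotype, $d\ge1$, and let $A_1,\ldots,A_d$ be commuting sectorial operators on $X$ such that each $A_k$ has an $H^\infty(\Sigma_{\theta_k})$ functional calculus for some $\theta_k\in(0,\frac\pi2)$. Let $p\in(1,\infty)$. Then there exist a measure space $\Omega$, commuting $C_0$-groups of isometries $(U_{1,t})_{t\in\mathbb{R}},\ldots,(U_{d,t})_{t\in\mathbb{R}}$ on $L^p(\Omega;X)$ and bounded operators $J:X\to L^p(\Omega;X)$, $Q:L^p(\Omega;X)\to X$ such that $e^{-t_1A_1}\cdots e^{-t_dA_d}=QU_{1,t_1}\cdots U_{d,t_d}J$ for all $t_1,\ldots,t_d\ge0$.
   Context: $\Sigma_\theta=\{z\ne0:|\mathrm{Arg}\,z|<\theta\}$. A closed densely defined operator $A$ is sectorial of type $\omega\in(0,\pi)$ if $\sigma(A)\subset\overline{\Sigma_\omega}$ and $\sup_{z\notin\overline{\Sigma_\theta}}\|zR(z,A)\|<\infty$ for every $\theta\in(\omega,\pi)$; sectorial operators commute if their resolvents commute. For $A$ of type $\omega<\theta$, $H^\infty_0(\Sigma_\theta)$ is the set of bounded holomorphic $f$ on $\Sigma_\theta$ with $|f(z)|\le c\frac{|z|^s}{1+|z|^{2s}}$ for some $c,s>0$, $f(A)=\frac1{2\pi i}\int_{\partial\Sigma_\nu}f(z)R(z,A)\,dz$ ($\nu\in(\omega,\theta)$, counterclockwise), and $A$ has an $H^\infty(\Sigma_\theta)$ functional calculus if $\|f(A)+aI\|\le K\sup_{\Sigma_\theta}|f+a|$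 for all $f\in H^\infty_0(\Sigma_\theta)$, $a\in\mathbb{C}$. A sectorial operator of type $<\frac\pi2$ is the negative generator of a bounded analytic semigroup $(e^{-tA})_{t\ge0}$. *)

theory Defs
  imports "HOL-Analysis.Analysis"
begin

class complex_banach = banach +
  fixes scaleC :: "complex \<Rightarrow> 'a \<Rightarrow> 'a" (infixr \<open>*\<^sub>C\<close> 75)
  assumes scaleC_add_right: "scaleC c (x + y) = scaleC c x + scaleC c y"
    and scaleC_add_left: "scaleC (b + c) x = scaleC b x + scaleC c x"
    and scaleC_scaleC: "scaleC b (scaleC c x) = scaleC (b * c) x"
    and scaleC_one: "scaleC 1 x = x"
    and scaleC_of_real: "scaleC (complex_of_real r) x = scaleR r x"
    and norm_scaleC: "norm (scaleC c x) = cmod c * norm x"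

definition bounded_op :: "('a::complex_banach \<Rightarrow> 'a) \<Rightarrow> bool" where
  "bounded_op T \<longleftrightarrow> (\<forall>x y. T (x + y) = T x + T y) \<and> (\<forall>c x. T (c *\<^sub>C x) = c *\<^sub>C T x)
     \<and> (\<exists>C. \<forall>x. norm (T x) \<le> C * norm x)"

definition dual_space :: "('a::complex_banach \<Rightarrow> complex) set" where
  "dual_space = {\<phi>. (\<forall>x y. \<phi> (x + y) = \<phi> x + \<phi> y) \<and> (\<forall>c x. \<phi> (c *\<^sub>C x) = c * \<phi> x)
     \<and> (\<exists>C. \<forall>x. cmod (\<phi> x) \<le> C * norm x)}"

definition dual_norm :: "('a::complex_banach \<Rightarrow> complex) \<Rightarrow> real" where
  "dual_norm \<phi> = (SUP x\<in>{x. norm x \<le> 1}. cmod (\<phi> x))"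

definition bidual_space :: "(('a::complex_banach \<Rightarrow> complex) \<Rightarrow> complex) set" where
  "bidual_space = {\<Phi>. (\<forall>\<phi>\<in>dual_space. \<forall>\<psi>\<in>dual_space. \<Phi> (\<lambda>x. \<phi> x + \<psi> x) = \<Phi> \<phi> + \<Phi> \<psi>)
     \<and> (\<forall>\<phi>\<in>dual_space. \<forall>c. \<Phi> (\<lambda>x. c * \<phi> x) = c * \<Phi> \<phi>)
     \<and> (\<exists>C. \<forall>\<phi>\<in>dual_space. cmod (\<Phi> \<phi>) \<le> C * dual_norm \<phi>)}"

definition reflexive_space :: "'a::complex_banach itself \<Rightarrow> bool" where
  "reflexive_space _ \<longleftrightarrow>
     (\<forall>\<Phi>\<in>(bidual_space :: (('a \<Rightarrow> complex) \<Rightarrow> complex) set).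
        \<exists>x::'a. \<forall>\<phi>\<in>dual_space. \<Phi> \<phi> = \<phi> x)"

text \<open>Sign vectors of length n (Rademacher averages are averages over these 2^n vectors).\<close>
definition signs :: "nat \<Rightarrow> (nat \<Rightarrow> real) set" where
  "signs n = {\<epsilon>. (\<forall>k<n. \<epsilon> k = 1 \<or> \<epsilon> k = -1) \<and> (\<forall>k\<ge>n. \<epsilon> k = 0)}"

text \<open>Cotype q (Hytoenen--van Neerven--Veraar--Weis, with L^q Rademacher averages).\<close>
definition has_cotype :: "'a::complex_banach itself \<Rightarrow> real \<Rightarrow> bool" where
  "has_cotype _ q \<longleftrightarrow> (\<exists>C. \<forall>n (x :: nat \<Rightarrow> 'a).
     (\<Sum>k<n. norm (x k) powr q) powr (1/q)
       \<le> C * ((1 / 2 ^ n) * (\<Sum>\<epsilon>\<in>signs n. norm (\<Sum>k<n. \<epsilon> k *\<^sub>R x k) powr q)) powr (1/q))"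

definition finite_cotype :: "'a::complex_banach itself \<Rightarrow> bool" where
  "finite_cotype T \<longleftrightarrow> (\<exists>q. 2 \<le> q \<and> has_cotype T q)"

definition dual_has_cotype :: "'a::complex_banach itself \<Rightarrow> real \<Rightarrow> bool" where
  "dual_has_cotype _ q \<longleftrightarrow> (\<exists>C. \<forall>n (\<phi> :: nat \<Rightarrow> 'a \<Rightarrow> complex).
     (\<forall>k<n. \<phi> k \<in> dual_space) \<longrightarrow>
     (\<Sum>k<n. dual_norm (\<phi> k) powr q) powr (1/q)
       \<le> C * ((1 / 2 ^ n) * (\<Sum>\<epsilon>\<in>signs n.
               dual_norm (\<lambda>x. \<Sum>k<n. complex_of_real (\<epsilon> k) * \<phi> k x) powr q)) powr (1/q))"

definition dual_finite_cotype :: "'a::complex_banach itself \<Rightarrow> bool" where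
  "dual_finite_cotype T \<longleftrightarrow> (\<exists>q. 2 \<le> q \<and> dual_has_cotype T q)"

text \<open>An (unbounded) operator is a pair (domain, action).\<close>
type_synonym 'a uop = "'a set \<times> ('a \<Rightarrow> 'a)"

definition linear_uop :: "'a::complex_banach uop \<Rightarrow> bool" where
  "linear_uop A \<longleftrightarrow> 0 \<in> fst A \<and> (\<forall>x\<in>fst A. \<forall>y\<in>fst A. x + y \<in> fst A \<and> snd A (x + y) = snd A x + snd A y)
     \<and> (\<forall>c. \<forall>x\<in>fst A. c *\<^sub>C x \<in> fst A \<and> snd A (c *\<^sub>C x) = c *\<^sub>C snd A x)"

definition closed_uop :: "'a::complex_banach uop \<Rightarrow> bool" where
  "closed_uop A \<longleftrightarrow> closed {(x, snd A x) | x. x \<in> fst A}"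

definition densely_defined :: "'a::complex_banach uop \<Rightarrow> bool" where
  "densely_defined A \<longleftrightarrow> closure (fst A) = UNIV"

definition is_resolvent :: "complex \<Rightarrow> 'a::complex_banach uop \<Rightarrow> ('a \<Rightarrow> 'a) \<Rightarrow> bool" where
  "is_resolvent z A R \<longleftrightarrow> bounded_op R \<and> (\<forall>x. R x \<in> fst A \<and> z *\<^sub>C R x - snd A (R x) = x)
     \<and> (\<forall>x\<in>fst A. R (z *\<^sub>C x - snd A x) = x)"

definition in_resolvent_set :: "complex \<Rightarrow> 'a::complex_banach uop \<Rightarrow> bool" where
  "in_resolvent_set z A \<longleftrightarrow> (\<exists>R. is_resolvent z A R)"

definition resolvent :: "complex \<Rightarrow> 'a::complex_banach uop \<Rightarrow> 'a \<Rightarrow> 'a" where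
  "resolvent z A = (SOME R. is_resolvent z A R)"

definition uop_spectrum :: "'a::complex_banach uop \<Rightarrow> complex set" where
  "uop_spectrum A = {z. \<not> in_resolvent_set z A}"

definition sector :: "real \<Rightarrow> complex set" where
  "sector \<theta> = {z. z \<noteq> 0 \<and> \<bar>Arg z\<bar> < \<theta>}"

definition sectorial :: "real \<Rightarrow> 'a::complex_banach uop \<Rightarrow> bool" where
  "sectorial \<omega> A \<longleftrightarrow> 0 < \<omega> \<and> \<omega> < pi \<and> linear_uop A \<and> closed_uop A \<and> densely_defined A
     \<and> uop_spectrum A \<subseteq> closure (sector \<omega>)
     \<and> (\<forall>\<theta>. \<omega> < \<theta> \<and> \<theta> < pi \<longrightarrow>
          (\<exists>C. \<forall>z. z \<notin> closure (sector \<theta>) \<longrightarrow> (\<forall>x. norm (z *\<^sub>C resolvent z A x) \<le> C * norm x)))"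

definition sectorial_op :: "'a::complex_banach uop \<Rightarrow> bool" where
  "sectorial_op A \<longleftrightarrow> (\<exists>\<omega>. sectorial \<omega> A)"

definition commuting_uops :: "'a::complex_banach uop \<Rightarrow> 'a uop \<Rightarrow> bool" where
  "commuting_uops A B \<longleftrightarrow> (\<forall>z w. in_resolvent_set z A \<and> in_resolvent_set w B \<longrightarrow>
     resolvent z A \<circ> resolvent w B = resolvent w B \<circ> resolvent z A)"

definition H0_infty :: "real \<Rightarrow> (complex \<Rightarrow> complex) set" where
  "H0_infty \<theta> = {f. f holomorphic_on sector \<theta> \<and> bounded (f ` sector \<theta>)
     \<and> (\<exists>c r. c > 0 \<and> r > 0 \<and> (\<forall>z\<in>sector \<theta>. cmod (f z) \<le> c * norm z powr r / (1 + norm z powr (2*r))))}"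

text \<open>f(A)x = (1/(2 pi i)) times the integral over the boundary of the sector of angle nu,
  oriented counterclockwise, i.e. from infinity*e^{i nu} to 0 and then to infinity*e^{-i nu}.\<close>
definition fcalc :: "'a::complex_banach uop \<Rightarrow> real \<Rightarrow> (complex \<Rightarrow> complex) \<Rightarrow> 'a \<Rightarrow> 'a" where
  "fcalc A \<nu> f x = (1 / (2 * pi * \<i>)) *\<^sub>C
     (integral {0<..} (\<lambda>t::real. (cis (-\<nu>) * f (t * cis (-\<nu>))) *\<^sub>C resolvent (t * cis (-\<nu>)) A x)
      - integral {0<..} (\<lambda>t::real. (cis \<nu> * f (t * cis \<nu>)) *\<^sub>C resolvent (t * cis \<nu>) A x))"

definition has_Hinfty_calculus :: "'a::complex_banach uop \<Rightarrow> real \<Rightarrow> bool" where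
  "has_Hinfty_calculus A \<theta> \<longleftrightarrow> (\<exists>\<omega>. \<omega> < \<theta> \<and> sectorial \<omega> A \<and>
     (\<exists>K. \<forall>f\<in>H0_infty \<theta>. \<forall>a. \<forall>\<nu>. \<omega> < \<nu> \<and> \<nu> < \<theta> \<longrightarrow>
        (\<forall>x. norm (fcalc A \<nu> f x + a *\<^sub>C x) \<le> K * (SUP z\<in>sector \<theta>. cmod (f z + a)) * norm x)))"

definition C0_semigroup :: "(real \<Rightarrow> 'a::complex_banach \<Rightarrow> 'a) \<Rightarrow> bool" where
  "C0_semigroup T \<longleftrightarrow> (\<forall>t\<ge>0. bounded_op (T t)) \<and> T 0 = id
     \<and> (\<forall>s\<ge>0. \<forall>t\<ge>0. T (s + t) = T s \<circ> T t) \<and> (\<forall>x. ((\<lambda>t. T t x) \<longlongrightarrow> x) (at_right 0))"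

definition neg_generator :: "'a::complex_banach uop \<Rightarrow> (real \<Rightarrow> 'a \<Rightarrow> 'a) \<Rightarrow> bool" where
  "neg_generator A T \<longleftrightarrow> (\<forall>x. x \<in> fst A \<longleftrightarrow> (\<exists>y. ((\<lambda>h. (1/h) *\<^sub>R (T h x - x)) \<longlongrightarrow> y) (at_right 0)))
     \<and> (\<forall>x\<in>fst A. ((\<lambda>h. (1/h) *\<^sub>R (T h x - x)) \<longlongrightarrow> - snd A x) (at_right 0))"

text \<open>e^{-tA}: the C0-semigroup whose generator is -A (unique for t >= 0 when it exists).\<close>
definition semigroup :: "'a::complex_banach uop \<Rightarrow> real \<Rightarrow> 'a \<Rightarrow> 'a" where
  "semigroup A = (SOME T. C0_semigroup T \<and> neg_generator A T)"

definition strongly_measurable :: "'w measure \<Rightarrow> ('w \<Rightarrow> 'a::real_normed_vector) \<Rightarrow> bool" where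
  "strongly_measurable M f \<longleftrightarrow> (\<exists>s :: nat \<Rightarrow> 'w \<Rightarrow> 'a.
      (\<forall>n. finite (s n ` space M) \<and> (\<forall>y. s n -` {y} \<inter> space M \<in> sets M))
      \<and> (AE x in M. (\<lambda>n. s n x) \<longlonglongrightarrow> f x))"

definition Lp :: "'w measure \<Rightarrow> real \<Rightarrow> ('w \<Rightarrow> 'a::real_normed_vector) set" where
  "Lp M p = {f. strongly_measurable M f \<and> (\<integral>\<^sup>+x. ennreal (norm (f x) powr p) \<partial>M) < \<infinity>}"

definition Lp_norm :: "'w measure \<Rightarrow> real \<Rightarrow> ('w \<Rightarrow> 'a::real_normed_vector) \<Rightarrow> real" where
  "Lp_norm M p f = enn2real (\<integral>\<^sup>+x. ennreal (norm (f x) powr p) \<partial>M) powr (1/p)"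

text \<open>Bounded complex-linear operators on L^p(M;X), acting on a.e.-classes.\<close>
definition Lp_bounded_op :: "'w measure \<Rightarrow> real \<Rightarrow> (('w \<Rightarrow> 'a::complex_banach) \<Rightarrow> ('w \<Rightarrow> 'a)) \<Rightarrow> bool" where
  "Lp_bounded_op M p T \<longleftrightarrow> (\<forall>f\<in>Lp M p. T f \<in> Lp M p)
     \<and> (\<forall>f\<in>Lp M p. \<forall>g\<in>Lp M p. (AE x in M. f x = g x) \<longrightarrow> (AE x in M. T f x = T g x))
     \<and> (\<forall>f\<in>Lp M p. \<forall>g\<in>Lp M p. \<forall>c. AE x in M. T (\<lambda>y. f y + c *\<^sub>C g y) x = T f x + c *\<^sub>C T g x)
     \<and> (\<exists>C. \<forall>f\<in>Lp M p. Lp_norm M p (T f) \<le> C * Lp_norm M p f)"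

definition isometric_C0_group :: "'w measure \<Rightarrow> real \<Rightarrow> (real \<Rightarrow> ('w \<Rightarrow> 'a::complex_banach) \<Rightarrow> ('w \<Rightarrow> 'a)) \<Rightarrow> bool" where
  "isometric_C0_group M p U \<longleftrightarrow>
     (\<forall>t. Lp_bounded_op M p (U t) \<and> (\<forall>f\<in>Lp M p. Lp_norm M p (U t f) = Lp_norm M p f))
     \<and> (\<forall>f\<in>Lp M p. AE x in M. U 0 f x = f x)
     \<and> (\<forall>s t. \<forall>f\<in>Lp M p. AE x in M. U (s + t) f x = U s (U t f) x)
     \<and> (\<forall>f\<in>Lp M p. \<forall>t0. ((\<lambda>t. Lp_norm M p (\<lambda>x. U t f x - U t0 f x)) \<longlongrightarrow> 0) (at t0))"

definition commuting_Lp_groups :: "'w measure \<Rightarrow> real \<Rightarrow> (real \<Rightarrow> ('w \<Rightarrow> 'a::complex_banach) \<Rightarrow> ('w \<Rightarrow> 'a))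
     \<Rightarrow> (real \<Rightarrow> ('w \<Rightarrow> 'a) \<Rightarrow> ('w \<Rightarrow> 'a)) \<Rightarrow> bool" where
  "commuting_Lp_groups M p U V \<longleftrightarrow>
     (\<forall>s t. \<forall>f\<in>Lp M p. AE x in M. U s (V t f) x = V t (U s f) x)"

definition bounded_into_Lp :: "'w measure \<Rightarrow> real \<Rightarrow> ('a::complex_banach \<Rightarrow> ('w \<Rightarrow> 'a)) \<Rightarrow> bool" where
  "bounded_into_Lp M p J \<longleftrightarrow> (\<forall>x. J x \<in> Lp M p)
     \<and> (\<forall>x y c. AE w in M. J (x + c *\<^sub>C y) w = J x w + c *\<^sub>C J y w)
     \<and> (\<exists>C. \<forall>x. Lp_norm M p (J x) \<le> C * norm x)"

definition bounded_from_Lp :: "'w measure \<Rightarrow> real \<Rightarrow> (('w \<Rightarrow> 'a::complex_banach) \<Rightarrow> 'a) \<Rightarrow> bool" where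
  "bounded_from_Lp M p Q \<longleftrightarrow>
     (\<forall>f\<in>Lp M p. \<forall>g\<in>Lp M p. (AE x in M. f x = g x) \<longrightarrow> Q f = Q g)
     \<and> (\<forall>f\<in>Lp M p. \<forall>g\<in>Lp M p. \<forall>c. Q (\<lambda>y. f y + c *\<^sub>C g y) = Q f + c *\<^sub>C Q g)
     \<and> (\<exists>C. \<forall>f\<in>Lp M p. norm (Q f) \<le> C * Lp_norm M p f)"

fun comp_chain :: "(nat \<Rightarrow> 'b \<Rightarrow> 'b) \<Rightarrow> nat \<Rightarrow> 'b \<Rightarrow> 'b" where
  "comp_chain F 0 = id"
| "comp_chain F (Suc n) = comp_chain F n \<circ> F (Suc n)"

end

theory Submission
  imports Defs "HOL-Probability.Probability"
begin

text \<open>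
  Let \<open>P\<close> be the projection onto the kernel of \<open>A\<close> along the closed range. Rotating contours gives
  \<open>exp(-tA) = P + \<Sum>\<^sub>\<kappa> \<integral>\<^sub>0\<^sup>1 exp(i t \<lambda>\<^sub>\<kappa>(u)) \<Psi>\<^sub>\<kappa>(u) \<Phi>\<^sub>\<kappa>(u) du\<close>, where \<open>\<lambda>\<^sub>\<kappa>(u) = \<plusminus> 2\<^sup>k (1 + u)\<close> runs through
  the dyadic intervals of the real line and \<open>\<Phi>\<^sub>\<kappa>(u)\<close>, \<open>\<Psi>\<^sub>\<kappa>(u)\<close> are rational functions of \<open>A\<close>.
  The \<open>H\<^sup>\<infinity>\<close> calculus bounds \<open>\<Sum> \<zeta>\<^sub>\<kappa> \<Phi>\<^sub>\<kappa>(u)\<close> and \<open>\<Sum> \<zeta>\<^sub>\<kappa> \<Psi>\<^sub>\<kappa>(u)\<close> uniformly over all unimodular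
  \<open>\<zeta>\<close>. Take \<open>u\<close> and the phases \<open>\<zeta>\<^sub>\<kappa>\<close> to be independent and uniformly distributed, let
  \<open>J = P + \<Sum> \<zeta>\<^sub>\<kappa> \<Phi>\<^sub>\<kappa>(u)\<close>, and let \<open>Q\<close> be the expectation of \<open>P + \<Sum> cnj \<zeta>\<^sub>\<kappa> \<Psi>\<^sub>\<kappa>(u)\<close>. Rotating each
  \<open>\<zeta>\<^sub>\<kappa>\<close> by the angle \<open>t \<lambda>\<^sub>\<kappa>(u)\<close> is a measure preserving flow, and orthogonality of the phases gives
  \<open>exp(-tA) = Q U\<^sub>t J\<close>. Commuting operators are treated simultaneously with independent blocks of
  coordinates.\<close>

section \<open>Complex Banach spaces and their duals\<close>

text \<open>Independent phases are orthogonal along a discrete index set, while the frequencies of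
  the group fill a line. Averaging over \<open>u\<close> bridges the two: for fixed \<open>u\<close>
  there is one frequency per sign and dyadic interval, and the symbols of \<open>Phi\<close> and
  \<open>Psi\<close> at these points have moduli that sum to a bounded function on the sector. That
  is why the H-infinity bound does not see the phases. The poles are \<open>-i l\<close>,
  \<open>i l\<close> for \<open>Phi\<close> and \<open>2 i l\<close>, \<open>3 i l\<close> for
  \<open>Psi\<close>: distinct, so that the resolvent identity gives partial fractions, and on the
  imaginary axis, outside all sectors of angle below \<open>pi / 2\<close>. The representation is
  not evaluated by residues: applying \<open>i l + A\<close> cancels the factor
  \<open>R(-i l)\<close>, what remains closes to 0 in the left half-plane, so the limit solves
  \<open>x' = - A x\<close>, and uniqueness does the rest. Absolute convergence is available on the
  kernel plus the range of a power of \<open>g = A (1 + A)^-2\<close>, which is dense by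
  reflexivity; uniform bounds carry the identities to the whole space. \<open>Q\<close> is an
  expectation in the weak sense, again by reflexivity.\<close>

lemma bounded_bilinear_scaleC: "bounded_bilinear (scaleC :: complex \<Rightarrow> 'a::complex_banach \<Rightarrow> 'a)"
proof
  fix a b :: complex and x y :: 'a and r :: real
  show "(a + b) *\<^sub>C x = a *\<^sub>C x + b *\<^sub>C x" by (rule scaleC_add_left)
  show "a *\<^sub>C (x + y) = a *\<^sub>C x + a *\<^sub>C y" by (rule scaleC_add_right)
  show "(r *\<^sub>R a) *\<^sub>C x = r *\<^sub>R (a *\<^sub>C x)"
    by (metis scaleC_of_real scaleC_scaleC scaleR_conv_of_real)
  show "a *\<^sub>C (r *\<^sub>R x) = r *\<^sub>R (a *\<^sub>C x)"
    by (metis mult.commute scaleC_of_real scaleC_scaleC)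
  show "\<exists>K. \<forall>a x. norm (a *\<^sub>C x :: 'a) \<le> norm a * norm x * K"
    by (rule exI[of _ 1]) (simp add: norm_scaleC)
qed

interpretation cscale: bounded_bilinear "scaleC :: complex \<Rightarrow> 'a::complex_banach \<Rightarrow> 'a"
  by (rule bounded_bilinear_scaleC)

lemmas [simp] = scaleC_one cscale.zero_left cscale.zero_right scaleC_scaleC norm_scaleC
lemmas cscale_algebra = cscale.add_left cscale.add_right cscale.diff_left cscale.diff_right
  cscale.minus_left cscale.minus_right
lemmas [continuous_intros] = cscale.continuous_on
lemmas [tendsto_intros] = cscale.tendsto

lemma scaleR_scaleC: "r *\<^sub>R x = complex_of_real r *\<^sub>C (x :: 'a::complex_banach)"
  by (simp add: scaleC_of_real)

text \<open>Real scaling is complex scaling by a real number, so library facts on real bounded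
  linear maps apply; limits, integrals and derivatives then commute with \<open>T\<close>.\<close>

lemma bounded_op_iff: "bounded_op T \<longleftrightarrow> bounded_linear T \<and> (\<forall>c x. T (c *\<^sub>C x) = c *\<^sub>C T x)"
proof
  assume T: "bounded_op T"
  then obtain C where C: "\<And>x. norm (T x) \<le> C * norm x" by (auto simp: bounded_op_def)
  have "bounded_linear T"
  proof (rule bounded_linear_intro)
    show "norm (T x) \<le> norm x * C" for x using C[of x] by (simp add: mult.commute)
  qed (use T in \<open>auto simp: bounded_op_def scaleR_scaleC\<close>)
  then show "bounded_linear T \<and> (\<forall>c x. T (c *\<^sub>C x) = c *\<^sub>C T x)" using T by (simp add: bounded_op_def)
next
  assume *: "bounded_linear T \<and> (\<forall>c x. T (c *\<^sub>C x) = c *\<^sub>C T x)"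
  then interpret bounded_linear T by simp
  obtain K where "\<And>x. norm (T x) \<le> norm x * K" using bounded by blast
  then show "bounded_op T" using * unfolding bounded_op_def by (auto simp: add mult.commute)
qed

lemma bounded_opD:
  assumes "bounded_op T"
  shows "T (x + y) = T x + T y" "T (c *\<^sub>C x) = c *\<^sub>C T x" "bounded_linear T"
    "T 0 = 0" "T (- x) = - T x" "T (x - y) = T x - T y" "T (r *\<^sub>R x) = r *\<^sub>R T x"
    "T (sum f F) = (\<Sum>i\<in>F. T (f i))"
proof -
  show "bounded_linear T" using assms by (simp add: bounded_op_iff)
  then interpret bounded_linear T .
  show "T (x + y) = T x + T y" "T (c *\<^sub>C x) = c *\<^sub>C T x"
    "T 0 = 0" "T (- x) = - T x" "T (x - y) = T x - T y" "T (r *\<^sub>R x) = r *\<^sub>R T x"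
    "T (sum f F) = (\<Sum>i\<in>F. T (f i))"
    using assms by (auto simp: bounded_op_iff add neg diff scaleR zero sum)
qed

lemma bounded_opI:
  assumes "\<And>x y. T (x + y) = T x + T y" "\<And>c x. T (c *\<^sub>C x) = c *\<^sub>C T x"
    "\<And>x. norm (T x) \<le> C * norm x"
  shows "bounded_op T"
  using assms unfolding bounded_op_def by blast

lemma bounded_op_comp: "bounded_op S \<Longrightarrow> bounded_op T \<Longrightarrow> bounded_op (\<lambda>x. S (T x))"
  unfolding bounded_op_iff by (auto intro: bounded_linear_compose)

lemma bounded_op_id: "bounded_op (\<lambda>x. x)" "bounded_op id"
  by (auto intro!: bounded_opI[of _ 1])

lemma bounded_op_scaleC: "bounded_op S \<Longrightarrow> bounded_op (\<lambda>x. c *\<^sub>C S x)"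
  unfolding bounded_op_iff
  by (auto intro: bounded_linear_compose cscale.bounded_linear_right simp: mult.commute)

lemma bounded_op_add: "bounded_op S \<Longrightarrow> bounded_op T \<Longrightarrow> bounded_op (\<lambda>x. S x + T x)"
  unfolding bounded_op_iff by (auto intro: bounded_linear_add simp: cscale.add_right)

lemma bounded_op_diff: "bounded_op S \<Longrightarrow> bounded_op T \<Longrightarrow> bounded_op (\<lambda>x. S x - T x)"
  unfolding bounded_op_iff by (auto intro: bounded_linear_sub simp: cscale.diff_right)

lemma dual_space_iff: "\<phi> \<in> dual_space \<longleftrightarrow> bounded_linear \<phi> \<and> (\<forall>c x. \<phi> (c *\<^sub>C x) = c * \<phi> x)"
proof
  assume T: "\<phi> \<in> dual_space"
  then obtain C where C: "\<And>x. norm (\<phi> x) \<le> C * norm x" by (auto simp: dual_space_def)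
  have "bounded_linear \<phi>"
  proof (rule bounded_linear_intro)
    show "norm (\<phi> x) \<le> norm x * C" for x using C[of x] by (simp add: mult.commute)
  qed (use T in \<open>auto simp: dual_space_def scaleR_scaleC scaleR_conv_of_real\<close>)
  then show "bounded_linear \<phi> \<and> (\<forall>c x. \<phi> (c *\<^sub>C x) = c * \<phi> x)" using T by (simp add: dual_space_def)
next
  assume *: "bounded_linear \<phi> \<and> (\<forall>c x. \<phi> (c *\<^sub>C x) = c * \<phi> x)"
  then interpret bounded_linear \<phi> by simp
  obtain K where "\<And>x. norm (\<phi> x) \<le> norm x * K" using bounded by blast
  then show "\<phi> \<in> dual_space" using * unfolding dual_space_def by (auto simp: add mult.commute)
qed

lemma dual_spaceD:
  assumes "\<phi> \<in> dual_space"
  shows "\<phi> (x + y) = \<phi> x + \<phi> y" "\<phi> (c *\<^sub>C x) = c * \<phi> x" "bounded_linear \<phi>"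
    "\<phi> 0 = 0" "\<phi> (- x) = - \<phi> x" "\<phi> (x - y) = \<phi> x - \<phi> y" "\<phi> (sum f F) = (\<Sum>i\<in>F. \<phi> (f i))"
proof -
  show "bounded_linear \<phi>" using assms by (simp add: dual_space_iff)
  then interpret bounded_linear \<phi> .
  show "\<phi> (x + y) = \<phi> x + \<phi> y" "\<phi> (c *\<^sub>C x) = c * \<phi> x"
    "\<phi> 0 = 0" "\<phi> (- x) = - \<phi> x" "\<phi> (x - y) = \<phi> x - \<phi> y" "\<phi> (sum f F) = (\<Sum>i\<in>F. \<phi> (f i))"
    using assms by (auto simp: dual_space_iff add neg diff zero sum)
qed

lemma dual_space_comp:
  assumes "\<phi> \<in> dual_space" "bounded_op T"
  shows "(\<lambda>x. \<phi> (T x)) \<in> dual_space"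
  using assms unfolding bounded_op_iff dual_space_iff by (auto intro: bounded_linear_compose)

lemma dual_norm_bound:
  assumes "\<phi> \<in> dual_space"
  shows "cmod (\<phi> x) \<le> dual_norm \<phi> * norm x"
proof (cases "x = 0")
  case True then show ?thesis using dual_spaceD(4)[OF assms] by simp
next
  case False
  obtain C where C: "\<And>x. norm (\<phi> x) \<le> C * norm x" using assms by (auto simp: dual_space_def)
  have bdd: "bdd_above ((\<lambda>x. cmod (\<phi> x)) ` {x. norm x \<le> 1})"
  proof (rule bdd_aboveI2)
    fix z :: 'a assume z: "z \<in> {x. norm x \<le> 1}"
    have "cmod (\<phi> z) \<le> C * norm z" by (rule C)
    also have "\<dots> \<le> \<bar>C\<bar> * norm z" by (intro mult_right_mono) auto
    also have "\<dots> \<le> \<bar>C\<bar> * 1" using z by (intro mult_left_mono) auto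
    finally show "cmod (\<phi> z) \<le> \<bar>C\<bar>" by simp
  qed
  have "cmod (\<phi> ((1 / norm x) *\<^sub>R x)) \<le> dual_norm \<phi>"
    unfolding dual_norm_def using False by (intro cSUP_upper[OF _ bdd]) auto
  then have "cmod (\<phi> x) / norm x \<le> dual_norm \<phi>"
    using dual_spaceD(2)[OF assms] False by (simp add: scaleR_scaleC norm_mult norm_divide)
  then show ?thesis using False by (simp add: field_simps)
qed

lemma dual_norm_le:
  assumes "\<And>x. norm x \<le> 1 \<Longrightarrow> cmod (\<phi> x) \<le> C"
  shows "dual_norm \<phi> \<le> C"
  unfolding dual_norm_def by (rule cSUP_least) (auto intro: assms exI[of _ 0])

section \<open>The Hahn-Banach theorem by minimal sublinear functionals\<close>

definition sublinear :: "('a::real_vector \<Rightarrow> real) \<Rightarrow> bool" where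
  "sublinear q \<longleftrightarrow> (\<forall>x y. q (x + y) \<le> q x + q y) \<and> (\<forall>t\<ge>0. \<forall>x. q (t *\<^sub>R x) = t * q x)"

lemma sublinearD:
  assumes "sublinear q"
  shows "q (x + y) \<le> q x + q y" "t \<ge> 0 \<Longrightarrow> q (t *\<^sub>R x) = t * q x" "q 0 = 0" "- q (- x) \<le> q x"
proof -
  show 1: "q (x + y) \<le> q x + q y" "t \<ge> 0 \<Longrightarrow> q (t *\<^sub>R x) = t * q x" for x y t
    using assms by (auto simp: sublinear_def)
  show 0: "q 0 = 0" using 1(2)[of 0 0] by simp
  show "- q (- x) \<le> q x" using 1(1)[of x "-x"] 0 by simp
qed

text \<open>Used for two infima, along a ray and along a chain. Homogeneity is asked only as an
  inequality for \<open>t > 0\<close>, since scaling back by \<open>1 / t\<close> reverses it;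
  \<open>zero\<close> covers the factor 0.\<close>

lemma sublinear_INF:
  fixes q :: "'i \<Rightarrow> 'a::real_vector \<Rightarrow> real"
  assumes "I \<noteq> {}" and bdd: "\<And>x. bdd_below ((\<lambda>i. q i x) ` I)"
    and tri: "\<And>i j x y. i \<in> I \<Longrightarrow> j \<in> I \<Longrightarrow> \<exists>k\<in>I. q k (x + y) \<le> q i x + q j y"
    and hom: "\<And>i t x. i \<in> I \<Longrightarrow> t > 0 \<Longrightarrow> \<exists>k\<in>I. q k (t *\<^sub>R x) \<le> t * q i x"
    and zero: "(INF i\<in>I. q i 0) = 0"
  shows "sublinear (\<lambda>x. INF i\<in>I. q i x)"
  unfolding sublinear_def
proof (intro conjI allI impI)
  fix x y
  have "(INF i\<in>I. q i (x + y)) - q j y \<le> q i x" if ij: "i \<in> I" "j \<in> I" for i j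
  proof -
    obtain k where "k \<in> I" "q k (x + y) \<le> q i x + q j y" using tri[OF ij, of x y] by blast
    then show ?thesis using cINF_lower[OF bdd, of k "x + y"] by force
  qed
  then have 1: "(INF i\<in>I. q i (x + y)) - q j y \<le> (INF i\<in>I. q i x)" if "j \<in> I" for j
    using that assms(1) by (intro cINF_greatest) auto
  have "(INF i\<in>I. q i (x + y)) - (INF i\<in>I. q i x) \<le> (INF i\<in>I. q i y)"
    using 1 assms(1) by (intro cINF_greatest) (auto simp: algebra_simps)
  then show "(INF i\<in>I. q i (x + y)) \<le> (INF i\<in>I. q i x) + (INF i\<in>I. q i y)" by simp
next
  have le: "(INF i\<in>I. q i (t *\<^sub>R x)) \<le> t * (INF i\<in>I. q i x)" if t: "t > 0" for t x
  proof -
    have "(INF i\<in>I. q i (t *\<^sub>R x)) / t \<le> q i x" if i: "i \<in> I" for i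
    proof -
      obtain k where "k \<in> I" "q k (t *\<^sub>R x) \<le> t * q i x" using hom[OF i t, of x] by blast
      then have "(INF i\<in>I. q i (t *\<^sub>R x)) \<le> t * q i x"
        using cINF_lower[OF bdd, of k "t *\<^sub>R x"] by linarith
      then show ?thesis using t by (simp add: field_simps)
    qed
    then have "(INF i\<in>I. q i (t *\<^sub>R x)) / t \<le> (INF i\<in>I. q i x)"
      using assms(1) by (intro cINF_greatest) auto
    then show ?thesis using t by (simp add: field_simps)
  qed
  fix t :: real and x assume "0 \<le> t"
  show "(INF i\<in>I. q i (t *\<^sub>R x)) = t * (INF i\<in>I. q i x)"
  proof (cases "t = 0")
    case True then show ?thesis using zero by simp
  next
    case False
    then have t: "t > 0" using \<open>0 \<le> t\<close> by simp
    have "(INF i\<in>I. q i ((1/t) *\<^sub>R t *\<^sub>R x)) \<le> (1/t) * (INF i\<in>I. q i (t *\<^sub>R x))" using t by (intro le) auto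
    then have "t * (INF i\<in>I. q i x) \<le> (INF i\<in>I. q i (t *\<^sub>R x))" using t by (simp add: field_simps)
    then show ?thesis using le[OF t, of x] by simp
  qed
qed

text \<open>Lowering \<open>q\<close> along the ray spanned by \<open>z\<close>; a pointwise minimal sublinear functional is
  unchanged by this, and hence additive.\<close>
lemma sublinear_lower:
  fixes z :: "'a::real_vector"
  assumes q: "sublinear q"
  defines "q' \<equiv> \<lambda>x. INF t\<in>{0::real..}. q (x + t *\<^sub>R z) - t * q z"
  shows "sublinear q'" "q' x \<le> q (x + z) - q z" "q' x \<le> q x"
proof -
  note S = sublinearD[OF q]
  \<comment> \<open>Subadditivity for \<open>t z = (x + t z) + (- x)\<close>; the infimum over
    \<open>t\<close> is therefore finite.\<close>
  have lb: "- q (- x) \<le> q (x + t *\<^sub>R z) - t * q z" if "t \<ge> 0" for x t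
    using S(1)[of "x + t *\<^sub>R z" "- x"] S(2)[of t z] that by simp
  then have bdd: "bdd_below ((\<lambda>t. q (x + t *\<^sub>R z) - t * q z) ` {0..})" for x
    by (intro bdd_belowI2) auto
  have "q' x \<le> q (x + t *\<^sub>R z) - t * q z" if "t \<ge> 0" for x t
    unfolding q'_def using that by (intro cINF_lower[OF bdd]) auto
  from this[of 1 x] this[of 0 x] show "q' x \<le> q (x + z) - q z" "q' x \<le> q x" by auto
  show "sublinear q'"
    unfolding q'_def
  proof (rule sublinear_INF)
    fix s t :: real and x y assume "s \<in> {0..}" "t \<in> {0..}"
    then show "\<exists>k\<in>{0..}. q (x + y + k *\<^sub>R z) - k * q z \<le> q (x + s *\<^sub>R z) - s * q z + (q (y + t *\<^sub>R z) - t * q z)"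
      using S(1)[of "x + s *\<^sub>R z" "y + t *\<^sub>R z"]
      by (intro bexI[of _ "s + t"]) (auto simp: algebra_simps)
  next
    fix s t :: real and x assume "s \<in> {0..}" "t > 0"
    then show "\<exists>k\<in>{0..}. q (t *\<^sub>R x + k *\<^sub>R z) - k * q z \<le> t * (q (x + s *\<^sub>R z) - s * q z)"
      using S(2)[of t "x + s *\<^sub>R z"] by (intro bexI[of _ "t * s"]) (auto simp: algebra_simps)
  next
    show "(INF t\<in>{0..}. q (0 + t *\<^sub>R z) - t * q z) = 0"
      using S(2)[of _ z] by (subst INF_cong[of "{0..}" "{0..}" _ "\<lambda>_. 0"]) auto
  qed (auto intro: bdd)
qed

text \<open>Zorn's lemma for the reversed pointwise order. The bound of a chain is its pointwise
  infimum: it is finite because every member lies above \<open>- p (- x)\<close>, and subadditivity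
  uses the smaller of two members.\<close>

lemma minimal_sublinear_exists:
  assumes p: "sublinear (p :: 'a::real_vector \<Rightarrow> real)"
  shows "\<exists>q. sublinear q \<and> q \<le> p \<and> (\<forall>q'. sublinear q' \<longrightarrow> q' \<le> q \<longrightarrow> q' = q)"
proof -
  define A where "A = {q. sublinear q \<and> q \<le> p}"
  have "\<exists>m\<in>A. \<forall>a\<in>A. a \<le> m \<longrightarrow> a = m"
  proof (rule predicate_Zorn[where P = "\<lambda>a b. b \<le> a"])
    show "partial_order_on A (relation_of (\<lambda>a b. b \<le> a) A)"
      by (rule partial_order_on_relation_ofI) auto
  next
    fix C assume C: "C \<in> Chains (relation_of (\<lambda>a b. b \<le> a) A)"
    have CA: "q \<in> C \<Longrightarrow> q \<in> A" for q using C unfolding Chains_def relation_of_def by auto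
    have cmp: "q \<in> C \<Longrightarrow> r \<in> C \<Longrightarrow> q \<le> r \<or> r \<le> q" for q r
      using C unfolding Chains_def relation_of_def by auto
    show "\<exists>u\<in>A. \<forall>a\<in>C. u \<le> a"
    proof (cases "C = {}")
      case True then show ?thesis using p by (intro bexI[of _ p]) (auto simp: A_def)
    next
      case False
      have lb: "- p (- x) \<le> q x" if "q \<in> C" for q x
      proof -
        have "sublinear q" "q (- x) \<le> p (- x)" using CA[OF that] by (auto simp: A_def le_fun_def)
        then show ?thesis using sublinearD(4)[of q x] by linarith
      qed
      then have bdd: "bdd_below ((\<lambda>q. q x) ` C)" for x by (intro bdd_belowI2) auto
      let ?u = "\<lambda>x. INF q\<in>C. q x"
      have le: "?u x \<le> q x" if "q \<in> C" for q x using that by (intro cINF_lower[OF bdd])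
      have "sublinear ?u"
      proof (rule sublinear_INF[where q = "\<lambda>q. q" and I = C])
        fix q r x y assume "q \<in> C" "r \<in> C"
        with cmp[of q r] obtain k where k: "k \<in> C" "k \<le> q" "k \<le> r" by auto
        then have "sublinear k" using CA by (auto simp: A_def)
        then show "\<exists>k\<in>C. k (x + y) \<le> q x + r y"
          using k sublinearD(1)[of k x y] by (intro bexI[of _ k]) (auto simp: le_fun_def intro: order_trans[OF _ add_mono])
      next
        fix q and t :: real and x assume "q \<in> C" "t > 0"
        then show "\<exists>k\<in>C. k (t *\<^sub>R x) \<le> t * q x"
          using CA sublinearD(2)[of q t x] by (intro bexI[of _ q]) (auto simp: A_def)
      next
        show "(INF q\<in>C. q 0) = 0"
          using CA False by (subst INF_cong[of C C _ "\<lambda>_. 0"]) (auto simp: A_def sublinearD(3))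
      qed (use False bdd in auto)
      moreover have "?u \<le> p" 
      proof (rule le_funI)
        fix x
        obtain q where "q \<in> C" using False by blast
        then show "?u x \<le> p x" using le[of q x] CA[of q] by (auto simp: A_def le_fun_def intro: order_trans)
      qed
      ultimately show ?thesis using le by (intro bexI[of _ ?u]) (auto simp: A_def le_fun_def)
    qed
  qed
  then show ?thesis by (auto simp: A_def)
qed

text \<open>The minimal functional is taken below \<open>p\<close> lowered along \<open>z\<close>,
  not below \<open>p\<close> itself. This forces the value at \<open>z\<close>: evaluation at
  \<open>- z\<close> gives \<open>f (- z) \<le> p 0 - p z\<close>.\<close>

theorem Hahn_Banach_sublinear:
  fixes p :: "'a::real_vector \<Rightarrow> real"
  assumes p: "sublinear p"
  shows "\<exists>f. linear f \<and> (\<forall>x. f x \<le> p x) \<and> f z = p z"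
proof -
  let ?p' = "\<lambda>x. INF t\<in>{0::real..}. p (x + t *\<^sub>R z) - t * p z"
  obtain f where f: "sublinear f" "f \<le> ?p'" and min: "\<And>g. sublinear g \<Longrightarrow> g \<le> f \<Longrightarrow> g = f"
    using minimal_sublinear_exists[OF sublinear_lower(1)[OF p, of z]] by auto
  note S = sublinearD[OF f(1)]
  have fp: "f x \<le> p x" for x
    using f(2) sublinear_lower(3)[OF p, where x=x and z=z] by (auto simp: le_fun_def intro: order_trans)
  have add: "f (x + y) = f x + f y" for x y
  proof -
    let ?f' = "\<lambda>x. INF t\<in>{0::real..}. f (x + t *\<^sub>R y) - t * f y"
    have "sublinear ?f'" by (rule sublinear_lower(1)[OF f(1)])
    moreover have "?f' \<le> f" by (rule le_funI) (rule sublinear_lower(3)[OF f(1)])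
    ultimately have "?f' = f" using min[of ?f'] by blast
    then have "?f' x = f x" by (rule fun_cong)
    then have "f x \<le> f (x + y) - f y"
      using sublinear_lower(2)[OF f(1), where x=x and z=y] by linarith
    then show ?thesis using S(1)[of x y] by simp
  qed
  have neg: "f (- x) = - f x" for x using add[of x "-x"] S(3) by simp
  have "linear f"
  proof (rule linearI)
    fix r :: real and x
    show "f (r *\<^sub>R x) = r *\<^sub>R f x"
      using S(2)[of r x] S(2)[of "-r" x] neg[of "r *\<^sub>R x"] by (cases "r \<ge> 0") auto
  qed (rule add)
  moreover have "f z = p z"
  proof (rule antisym[OF fp])
    have "f (- z) \<le> ?p' (- z)" using f(2) by (rule le_funD)
    also have "\<dots> \<le> p (- z + z) - p z" by (rule sublinear_lower(2)[OF p])
    finally show "p z \<le> f z" using neg[of z] sublinearD(3)[OF p] by simp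
  qed
  ultimately show ?thesis using fp by blast
qed

text \<open>The distance to a subspace is the quotient seminorm. As the majorant in the Hahn-Banach
  theorem it makes the functional vanish on \<open>Y\<close> and keeps it below the norm.\<close>

lemma sublinear_infdist:
  fixes Y :: "'a::complex_banach set"
  assumes Y: "0 \<in> Y" "\<And>x y. x \<in> Y \<Longrightarrow> y \<in> Y \<Longrightarrow> x + y \<in> Y" "\<And>c x. x \<in> Y \<Longrightarrow> c *\<^sub>C x \<in> Y"
  shows "sublinear (\<lambda>x. infdist x Y)" "infdist (c *\<^sub>C x) Y = cmod c * infdist x Y"
proof -
  have ne: "Y \<noteq> {}" using Y by auto
  have le: "infdist (c *\<^sub>C x) Y \<le> cmod c * infdist x Y" if "c \<noteq> 0" for c x
  proof -
    have "infdist (c *\<^sub>C x) Y / cmod c \<le> dist x y" if y: "y \<in> Y" for y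
    proof -
      have "infdist (c *\<^sub>C x) Y \<le> dist (c *\<^sub>C x) (c *\<^sub>C y)" using y Y by (intro infdist_le) auto
      also have "\<dots> = cmod c * dist x y" by (simp add: dist_norm flip: cscale.diff_right)
      finally show ?thesis using \<open>c \<noteq> 0\<close> by (simp add: field_simps)
    qed
    then have "infdist (c *\<^sub>C x) Y / cmod c \<le> infdist x Y"
      unfolding infdist_def[of x] using ne by (auto intro!: cINF_greatest)
    then show ?thesis using \<open>c \<noteq> 0\<close> by (simp add: field_simps)
  qed
  show hom: "infdist (c *\<^sub>C x) Y = cmod c * infdist x Y" for c x
  proof (cases "c = 0")
    case True then show ?thesis using Y by simp
  next
    case False
    have "infdist ((1/c) *\<^sub>C c *\<^sub>C x) Y \<le> cmod (1/c) * infdist (c *\<^sub>C x) Y" using False by (intro le) auto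
    then have "cmod c * infdist x Y \<le> infdist (c *\<^sub>C x) Y" using False by (simp add: field_simps norm_divide)
    then show ?thesis using le[OF False, of x] by simp
  qed
  show "sublinear (\<lambda>x. infdist x Y)"
    unfolding sublinear_def
  proof (intro conjI allI impI)
    fix x y
    have "infdist (x + y) Y - dist y b \<le> dist x a" if "a \<in> Y" "b \<in> Y" for a b
    proof -
      have "infdist (x + y) Y \<le> dist (x + y) (a + b)" using that Y by (intro infdist_le) auto
      also have "\<dots> \<le> dist x a + dist y b" by (rule dist_triangle_add)
      finally show ?thesis by simp
    qed
    then have "infdist (x + y) Y - dist y b \<le> infdist x Y" if "b \<in> Y" for b
      unfolding infdist_def[of x] using ne that by (auto intro!: cINF_greatest)
    then have "infdist (x + y) Y - infdist x Y \<le> dist y b" if "b \<in> Y" for b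
      using that by (simp add: algebra_simps)
    then have "infdist (x + y) Y - infdist x Y \<le> infdist y Y"
      unfolding infdist_def[of y] using ne by (auto intro!: cINF_greatest)
    then show "infdist (x + y) Y \<le> infdist x Y + infdist y Y" by simp
  next
    fix t :: real and x assume "0 \<le> t"
    then show "infdist (t *\<^sub>R x) Y = t * infdist x Y" by (simp add: scaleR_scaleC hom)
  qed
qed

text \<open>The real functional \<open>f\<close> becomes complex linear as
  \<open>f x - i f (i x)\<close>. Multiplying \<open>x\<close> by the unimodular number that makes
  \<open>\<phi> x\<close> real and nonnegative turns the bound on the real part into one on the
  modulus.\<close>

theorem Hahn_Banach_separation:
  fixes Y :: "'a::complex_banach set"
  assumes Y: "0 \<in> Y" "\<And>x y. x \<in> Y \<Longrightarrow> y \<in> Y \<Longrightarrow> x + y \<in> Y" "\<And>c x. x \<in> Y \<Longrightarrow> c *\<^sub>C x \<in> Y"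
  shows "\<exists>\<phi>\<in>dual_space. (\<forall>x. cmod (\<phi> x) \<le> norm x) \<and> (\<forall>y\<in>Y. \<phi> y = 0) \<and> Re (\<phi> z) = infdist z Y"
proof -
  let ?p = "\<lambda>x. infdist x Y"
  note hom = sublinear_infdist(2)[OF Y]
  obtain f where f: "linear f" "\<And>x. f x \<le> ?p x" "f z = ?p z"
    using Hahn_Banach_sublinear[OF sublinear_infdist(1)[OF Y]] by blast
  interpret linear f by fact
  have rot: "f (c *\<^sub>C x) = Re c * f x + Im c * f (\<i> *\<^sub>C x)" for c x
  proof -
    have "c *\<^sub>C x = Re c *\<^sub>R x + Im c *\<^sub>R (\<i> *\<^sub>C x)"
      by (subst complex_eq[of c]) (simp add: scaleR_scaleC cscale_algebra mult.commute)
    then show ?thesis by (simp add: add scale)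
  qed
  define \<phi> where "\<phi> = (\<lambda>x. Complex (f x) (- f (\<i> *\<^sub>C x)))"
  have lin: "\<phi> (x + y) = \<phi> x + \<phi> y" for x y by (simp add: \<phi>_def add cscale_algebra complex_eq_iff)
  have neg: "f (- x) = - f x" for x by (rule neg)
  have mult: "\<phi> (c *\<^sub>C x) = c * \<phi> x" for c x
    using rot[of c x] rot[of "\<i> * c" x] by (simp add: \<phi>_def complex_eq_iff algebra_simps)
  have le: "cmod (\<phi> x) \<le> ?p x" for x
  proof (cases "\<phi> x = 0")
    case False
    let ?c = "cnj (\<phi> x) / cmod (\<phi> x)"
    have c: "cmod ?c = 1" using False by (simp add: norm_divide)
    have "\<phi> (?c *\<^sub>C x) = ?c * \<phi> x" by (rule mult)
    also have "\<dots> = cmod (\<phi> x)" using False complex_norm_square[of "\<phi> x"]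
      by (simp add: power2_eq_square field_simps)
    finally have "f (?c *\<^sub>C x) = cmod (\<phi> x)" by (simp add: \<phi>_def complex_eq_iff)
    then show ?thesis using f(2)[of "?c *\<^sub>C x"] by (simp only: hom c)
  qed (simp add: infdist_nonneg)
  have le': "cmod (\<phi> x) \<le> norm x" for x
    using le[of x] infdist_le[OF Y(1), of x] by (simp add: dist_norm)
  have "\<phi> \<in> dual_space" unfolding dual_space_def using lin mult le' by (auto intro!: exI[of _ 1])
  moreover have "\<phi> y = 0" if "y \<in> Y" for y using le[of y] that by simp
  moreover have "Re (\<phi> z) = infdist z Y" using f(3) by (simp add: \<phi>_def)
  ultimately show ?thesis using le' by (intro bexI[of _ \<phi>]) auto
qed

lemma norming_functional:
  obtains \<phi> where "\<phi> \<in> dual_space" "\<And>x. cmod (\<phi> x) \<le> norm x" "Re (\<phi> z) = norm (z :: 'a::complex_banach)"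
  using Hahn_Banach_separation[of "{0::'a}" z] by (auto simp: infdist_singleton)

lemma norm_le_dual:
  fixes x :: "'a::complex_banach"
  assumes "\<And>\<phi>. \<phi> \<in> dual_space \<Longrightarrow> (\<And>y. cmod (\<phi> y) \<le> norm y) \<Longrightarrow> cmod (\<phi> x) \<le> C"
  shows "norm x \<le> C"
  using norming_functional[of x] assms complex_Re_le_cmod by (metis order_trans)

lemma dual_separates:
  fixes x y :: "'a::complex_banach"
  assumes "\<And>\<phi>. \<phi> \<in> dual_space \<Longrightarrow> \<phi> x = \<phi> y"
  shows "x = y"
proof -
  have "norm (x - y) \<le> 0"
    by (rule norm_le_dual) (simp add: assms dual_spaceD(6))
  then show ?thesis by simp
qed

section \<open>Weak cluster points in reflexive spaces\<close>

lemma compact_PiE_UNIV: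
  fixes S :: "'i \<Rightarrow> 'b::topological_space set"
  assumes "\<And>i. compact (S i)"
  shows "compact (PiE UNIV S)"
  using compactin_PiE[of "\<lambda>_. euclidean" UNIV S] assms
  by (simp add: compactin_euclidean_iff euclidean_product_topology)

text \<open>Banach-Alaoglu in the bidual: the evaluations at \<open>x n\<close> lie in a product of
  discs, which is compact; a cluster point is again linear and bounded in the functional, hence an
  evaluation by reflexivity. Compactness yields a finer filter \<open>G\<close> rather than a
  subsequence.\<close>

lemma reflexive_weak_cluster:
  fixes x :: "nat \<Rightarrow> 'a::complex_banach"
  assumes refl: "reflexive_space TYPE('a)" and bd: "\<And>n. norm (x n) \<le> C"
  obtains y G where "G \<noteq> bot" "G \<le> sequentially"
    "\<And>\<phi>. \<phi> \<in> dual_space \<Longrightarrow> ((\<lambda>n. \<phi> (x n)) \<longlongrightarrow> \<phi> y) G"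
proof -
  \<comment> \<open>Outside the dual space radius and value are 0, so that the product may run over
    all functions.\<close>
  define r where "r = (\<lambda>\<phi> :: 'a \<Rightarrow> complex. if \<phi> \<in> dual_space then \<bar>dual_norm \<phi>\<bar> * C else 0)"
  define e where "e = (\<lambda>n (\<phi> :: 'a \<Rightarrow> complex). if \<phi> \<in> dual_space then \<phi> (x n) else 0)"
  have bd': "cmod (\<phi> (x n)) \<le> \<bar>dual_norm \<phi>\<bar> * C" if "\<phi> \<in> dual_space" for \<phi> n
  proof -
    have "cmod (\<phi> (x n)) \<le> dual_norm \<phi> * norm (x n)" by (rule dual_norm_bound[OF that])
    also have "\<dots> \<le> \<bar>dual_norm \<phi>\<bar> * C" using bd by (intro mult_mono) auto
    finally show ?thesis .
  qed
  define K where "K = PiE UNIV (\<lambda>\<phi>. cball (0::complex) (r \<phi>))"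
  have "compact K" unfolding K_def by (rule compact_PiE_UNIV) simp
  moreover have "filtermap e sequentially \<noteq> bot" by (simp add: filtermap_bot_iff)
  moreover have "eventually (\<lambda>z. z \<in> K) (filtermap e sequentially)"
    using bd' by (auto simp: eventually_filtermap K_def e_def r_def PiE_def intro!: always_eventually)
  ultimately obtain \<Phi> where \<Phi>: "inf (nhds \<Phi>) (filtermap e sequentially) \<noteq> bot"
    unfolding compact_filter by blast
  define G where "G = inf sequentially (filtercomap e (nhds \<Phi>))"
  have "G \<noteq> bot"
  proof
    assume "G = bot"
    then have "inf sequentially (filtercomap e (nhds \<Phi>)) = bot" by (simp add: G_def)
    then obtain P Q where PQ: "eventually P sequentially" "eventually Q (nhds \<Phi>)" "\<forall>n. P n \<and> Q (e n) \<longrightarrow> False"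
      unfolding trivial_limit_def eventually_inf eventually_filtercomap by (metis)
    then have "eventually (\<lambda>z. \<not> Q z) (filtermap e sequentially)"
      unfolding eventually_filtermap by (auto elim: eventually_mono)
    then have "eventually (\<lambda>z. False) (inf (nhds \<Phi>) (filtermap e sequentially))"
      unfolding eventually_inf using PQ(2) by blast
    then show False using \<Phi> by (simp add: trivial_limit_def)
  qed
  have "filterlim e (nhds \<Phi>) G"
    unfolding G_def by (rule filterlim_mono[OF filterlim_filtercomap order_refl]) simp
  then have lim: "((\<lambda>n. e n \<phi>) \<longlongrightarrow> \<Phi> \<phi>) G" for \<phi>
    using continuous_on_tendsto_compose[of UNIV "\<lambda>f. f \<phi>" e \<Phi> G] by (auto intro: continuous_on_product_coordinates)
  then have lim: "((\<lambda>n. \<phi> (x n)) \<longlongrightarrow> \<Phi> \<phi>) G" if "\<phi> \<in> dual_space" for \<phi>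
    using lim[of \<phi>] that by (simp add: e_def)
  have "\<Phi> \<in> bidual_space"
    unfolding bidual_space_def
  proof (intro CollectI conjI ballI allI exI)
    fix \<phi> \<psi> :: "'a \<Rightarrow> complex" assume *: "\<phi> \<in> dual_space" "\<psi> \<in> dual_space"
    then have "(\<lambda>x. \<phi> x + \<psi> x) \<in> dual_space"
      unfolding dual_space_iff by (auto intro: bounded_linear_add simp: algebra_simps)
    from lim[OF this] tendsto_add[OF lim[OF *(1)] lim[OF *(2)]]
    show "\<Phi> (\<lambda>x. \<phi> x + \<psi> x) = \<Phi> \<phi> + \<Phi> \<psi>" using tendsto_unique[OF \<open>G \<noteq> bot\<close>] by blast
  next
    fix \<phi> :: "'a \<Rightarrow> complex" and c assume *: "\<phi> \<in> dual_space"
    then have "(\<lambda>x. c * \<phi> x) \<in> dual_space"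
      unfolding dual_space_iff by (auto intro: bounded_linear_const_mult simp: algebra_simps)
    from lim[OF this] tendsto_mult_left[OF lim[OF *(1)], of c]
    show "\<Phi> (\<lambda>x. c * \<phi> x) = c * \<Phi> \<phi>" using tendsto_unique[OF \<open>G \<noteq> bot\<close>] by blast
  next
    fix \<phi> :: "'a \<Rightarrow> complex" assume *: "\<phi> \<in> dual_space"
    \<comment> \<open>The sign is read off at a nonzero vector; in the zero space the supremum runs
      over the single value 0.\<close>
    have nn: "dual_norm \<phi> \<ge> 0"
    proof (cases "\<exists>z::'a. z \<noteq> 0")
      case True
      then obtain z :: 'a where "z \<noteq> 0" by blast
      then show ?thesis using dual_norm_bound[OF *, of z]
        by (meson norm_ge_zero order_trans zero_le_mult_iff zero_less_norm_iff not_le)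
    next
      case False
      then have "{x::'a. norm x \<le> 1} = {0}" by auto
      then show ?thesis using dual_spaceD(4)[OF *] by (simp add: dual_norm_def)
    qed
    have "cmod (\<Phi> \<phi>) \<le> \<bar>dual_norm \<phi>\<bar> * C"
      by (rule tendsto_upperbound[OF tendsto_norm[OF lim[OF *]]]) (auto simp: bd'[OF *] \<open>G \<noteq> bot\<close>)
    then show "cmod (\<Phi> \<phi>) \<le> C * dual_norm \<phi>" using nn by (simp add: mult.commute)
  qed
  then obtain y where "\<forall>\<phi>\<in>dual_space. \<Phi> \<phi> = \<phi> y" using refl unfolding reflexive_space_def by blast
  then show ?thesis using that[OF \<open>G \<noteq> bot\<close>, of y] lim by (auto simp: G_def)
qed

section \<open>Rotating rays of integration\<close>

lemma integral_cscale:
  fixes f :: "real \<Rightarrow> 'a::complex_banach"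
  shows "f integrable_on S \<Longrightarrow> integral S (\<lambda>x. c *\<^sub>C f x) = c *\<^sub>C integral S f"
  using integral_linear[OF _ cscale.bounded_linear_right, of f S c] by (simp add: o_def)

lemma has_vector_derivative_cis: "(cis has_vector_derivative \<i> * cis t) (at t within S)"
proof -
  have "((\<lambda>t. Complex (cos t) (sin t)) has_vector_derivative Complex (- sin t) (cos t)) (at t within S)"
    unfolding Complex_eq by (rule derivative_eq_intros refl | simp)+
  moreover have "Complex (- sin t) (cos t) = \<i> * cis t" by (simp add: complex_eq_iff)
  moreover have "cis = (\<lambda>t. Complex (cos t) (sin t))" by (auto simp: complex_eq_iff)
  ultimately show ?thesis by simp
qed

lemma continuous_on_cis': "continuous_on S f \<Longrightarrow> continuous_on S (\<lambda>x. cis (f x))"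
  unfolding cis_conv_exp by (intro continuous_intros)

text \<open>For \<open>w = r cis u\<close> both \<open>\<partial>/\<partial>u (cis u F(w))\<close> and \<open>\<partial>/\<partial>r (i r cis u F(w))\<close>
  equal \<open>i cis u (F(w) + w F'(w))\<close>; interchanging the integrations gives Cauchy's theorem for
  annular sectors, for functions with values in a Banach space.\<close>
lemma integral_rotate:
  fixes F :: "complex \<Rightarrow> 'a::complex_banach"
  assumes ab: "a \<le> b" and \<alpha>\<beta>: "\<alpha> \<le> \<beta>"
    and der: "\<And>r u. r \<in> {a..b} \<Longrightarrow> u \<in> {\<alpha>..\<beta>} \<Longrightarrow>
       (F has_derivative (\<lambda>h. h *\<^sub>C F' (of_real r * cis u))) (at (of_real r * cis u))"
    and cont: "continuous_on ((\<lambda>(r, u). of_real r * cis u) ` ({a..b} \<times> {\<alpha>..\<beta>})) F'"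
  shows "integral {a..b} (\<lambda>r. cis \<beta> *\<^sub>C F (of_real r * cis \<beta>)) - integral {a..b} (\<lambda>r. cis \<alpha> *\<^sub>C F (of_real r * cis \<alpha>))
    = integral {\<alpha>..\<beta>} (\<lambda>u. (\<i> * of_real b * cis u) *\<^sub>C F (of_real b * cis u))
      - integral {\<alpha>..\<beta>} (\<lambda>u. (\<i> * of_real a * cis u) *\<^sub>C F (of_real a * cis u))"
proof -
  define w where "w = (\<lambda>r u. complex_of_real r * cis u)"
  let ?W = "(\<lambda>(r, u). of_real r * cis u) ` ({a..b} \<times> {\<alpha>..\<beta>})"
  define H where "H = (\<lambda>r u. (\<i> * cis u) *\<^sub>C (F (w r u) + w r u *\<^sub>C F' (w r u)))"
  have contF: "continuous_on ?W F"
  proof (rule has_derivative_continuous_on)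
    fix z assume "z \<in> ?W"
    then obtain r u where "r \<in> {a..b}" "u \<in> {\<alpha>..\<beta>}" "z = of_real r * cis u" by auto
    then show "(F has_derivative (\<lambda>h. h *\<^sub>C F' z)) (at z within ?W)"
      using has_derivative_at_withinI[OF der] by simp
  qed
  have contw: "continuous_on S (\<lambda>x. w (f x) (g x))" if "continuous_on S f" "continuous_on S g" for S f g
    unfolding w_def by (intro continuous_intros continuous_on_cis' that)
  have inW: "w r u \<in> ?W" if "r \<in> {a..b}" "u \<in> {\<alpha>..\<beta>}" for r u
    using that by (intro image_eqI[of _ _ "(r, u)"]) (auto simp: w_def)
  have contw2: "continuous_on ({a..b} \<times> {\<alpha>..\<beta>}) (\<lambda>z. w (fst z) (snd z))"
    by (intro contw continuous_intros)
  note cF2 = continuous_on_compose2[OF contF contw2] and cF2' = continuous_on_compose2[OF cont contw2]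
  have contH: "continuous_on ({a..b} \<times> {\<alpha>..\<beta>}) (\<lambda>(r, u). H r u)"
    unfolding H_def case_prod_beta
    by (intro continuous_intros continuous_on_cis' contw2 cF2 cF2') (auto intro!: inW)
  have dw_r: "((\<lambda>r. w r u) has_vector_derivative cis u) (at r within S)" for r u S
    unfolding w_def by (rule derivative_eq_intros refl | simp add: of_real_def)+
  have dw_u: "((\<lambda>u. w r u) has_vector_derivative \<i> * w r u) (at u within S)" for r u S
    unfolding w_def using has_vector_derivative_mult_right[OF has_vector_derivative_cis, of "of_real r" u S]
    by (simp add: mult_ac)
  have derw: "(F has_derivative (\<lambda>h. h *\<^sub>C F' (w r u))) (at (w r u))"
    if "r \<in> {a..b}" "u \<in> {\<alpha>..\<beta>}" for r u
    using der[OF that] by (simp add: w_def)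
  have dF_r: "((\<lambda>r. F (w r u)) has_vector_derivative cis u *\<^sub>C F' (w r u)) (at r within {a..b})"
    if "r \<in> {a..b}" "u \<in> {\<alpha>..\<beta>}" for r u
    using has_derivative_compose[OF dw_r[unfolded has_vector_derivative_def] derw[OF that]]
    by (simp add: has_vector_derivative_def scaleR_scaleC scaleR_conv_of_real mult.commute)
  have dF_u: "((\<lambda>u. F (w r u)) has_vector_derivative (\<i> * w r u) *\<^sub>C F' (w r u)) (at u within {\<alpha>..\<beta>})"
    if "r \<in> {a..b}" "u \<in> {\<alpha>..\<beta>}" for r u
    using has_derivative_compose[OF dw_u[unfolded has_vector_derivative_def] derw[OF that]]
    by (simp add: has_vector_derivative_def scaleR_scaleC scaleR_conv_of_real mult.commute)
  have int_u: "integral {\<alpha>..\<beta>} (H r) = cis \<beta> *\<^sub>C F (w r \<beta>) - cis \<alpha> *\<^sub>C F (w r \<alpha>)" if "r \<in> {a..b}" for r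
  proof (intro integral_unique fundamental_theorem_of_calculus \<alpha>\<beta>)
    fix u assume u: "u \<in> {\<alpha>..\<beta>}"
    show "((\<lambda>u. cis u *\<^sub>C F (w r u)) has_vector_derivative H r u) (at u within {\<alpha>..\<beta>})"
      using cscale.has_vector_derivative[OF has_vector_derivative_cis dF_u[OF that u]]
      by (simp add: H_def cscale_algebra mult_ac add.commute)
  qed
  have int_r: "integral {a..b} (\<lambda>r. H r u) = (\<i> * of_real b * cis u) *\<^sub>C F (w b u) - (\<i> * of_real a * cis u) *\<^sub>C F (w a u)"
    if "u \<in> {\<alpha>..\<beta>}" for u
  proof (intro integral_unique fundamental_theorem_of_calculus ab)
    fix r assume r: "r \<in> {a..b}"
    have "((\<lambda>r. \<i> * of_real r * cis u) has_vector_derivative \<i> * cis u) (at r within {a..b})"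
      using has_vector_derivative_mult_right[OF dw_r, of \<i> u r "{a..b}"] by (simp add: w_def mult_ac)
    from cscale.has_vector_derivative[OF this dF_r[OF r that]]
    show "((\<lambda>r. (\<i> * of_real r * cis u) *\<^sub>C F (w r u)) has_vector_derivative H r u) (at r within {a..b})"
      by (simp add: H_def cscale_algebra w_def mult_ac add.commute)
  qed
  have Fr: "continuous_on {a..b} (\<lambda>r. F (w r u))" if "u \<in> {\<alpha>..\<beta>}" for u
    by (rule continuous_on_compose2[OF contF contw]) (use that in \<open>auto intro!: inW continuous_intros\<close>)
  have Fu: "continuous_on {\<alpha>..\<beta>} (\<lambda>u. F (w r u))" if "r \<in> {a..b}" for r
    by (rule continuous_on_compose2[OF contF contw]) (use that in \<open>auto intro!: inW continuous_intros\<close>)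
  have "integral {a..b} (\<lambda>r. integral {\<alpha>..\<beta>} (H r)) = integral {\<alpha>..\<beta>} (\<lambda>u. integral {a..b} (\<lambda>r. H r u))"
    using integral_swap_continuous[of a \<alpha> b \<beta> H] contH by (simp add: cbox_Pair_eq)
  moreover have "integral {a..b} (\<lambda>r. integral {\<alpha>..\<beta>} (H r))
      = integral {a..b} (\<lambda>r. cis \<beta> *\<^sub>C F (w r \<beta>)) - integral {a..b} (\<lambda>r. cis \<alpha> *\<^sub>C F (w r \<alpha>))"
    using \<alpha>\<beta> by (subst integral_diff[symmetric])
      (auto intro!: integral_cong int_u integrable_continuous_interval continuous_intros Fr)
  moreover have "integral {\<alpha>..\<beta>} (\<lambda>u. integral {a..b} (\<lambda>r. H r u))
      = integral {\<alpha>..\<beta>} (\<lambda>u. (\<i> * of_real b * cis u) *\<^sub>C F (w b u))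
        - integral {\<alpha>..\<beta>} (\<lambda>u. (\<i> * of_real a * cis u) *\<^sub>C F (w a u))"
    using ab by (subst integral_diff[symmetric])
      (auto intro!: integral_cong int_r integrable_continuous_interval continuous_intros continuous_on_cis' Fu)
  ultimately show ?thesis by (simp add: w_def)
qed

lemma integral_rotate_bound:
  fixes G :: "real \<Rightarrow> 'a::complex_banach"
  assumes "\<alpha> \<le> \<beta>" "continuous_on {\<alpha>..\<beta>} G" "\<And>u. u \<in> {\<alpha>..\<beta>} \<Longrightarrow> norm (G u - c) \<le> e"
  shows "norm (integral {\<alpha>..\<beta>} G - (\<beta> - \<alpha>) *\<^sub>R c) \<le> e * (\<beta> - \<alpha>)"
proof -
  have "integral {\<alpha>..\<beta>} G - (\<beta> - \<alpha>) *\<^sub>R c = integral {\<alpha>..\<beta>} (\<lambda>u. G u - c)"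
    using assms by (subst integral_diff) (auto intro!: integrable_continuous_interval)
  also have "norm \<dots> \<le> e * (\<beta> - \<alpha>)"
    using assms by (intro integral_bound) (auto intro!: continuous_intros)
  finally show ?thesis .
qed

text \<open>The difference of two rays equals the difference of two arcs. On the outer arc
  \<open>w F(w)\<close> is close to \<open>c\<close>, which produces the term
  \<open>i (\<beta> - \<alpha>) c\<close>; on the inner arc it is small. Rotation through a large
  angle thus replaces a residue computation.\<close>

lemma integral_rotate_approx:
  fixes F :: "complex \<Rightarrow> 'a::complex_banach"
  assumes ab: "a \<le> b" and \<alpha>\<beta>: "\<alpha> \<le> \<beta>"
    and der: "\<And>r u. r \<in> {a..b} \<Longrightarrow> u \<in> {\<alpha>..\<beta>} \<Longrightarrow>
       (F has_derivative (\<lambda>h. h *\<^sub>C F' (of_real r * cis u))) (at (of_real r * cis u))"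
    and cont: "continuous_on ((\<lambda>(r, u). of_real r * cis u) ` ({a..b} \<times> {\<alpha>..\<beta>})) F'"
    and outer: "\<And>u. u \<in> {\<alpha>..\<beta>} \<Longrightarrow> norm ((of_real b * cis u) *\<^sub>C F (of_real b * cis u) - c) \<le> e"
    and inner: "\<And>u. u \<in> {\<alpha>..\<beta>} \<Longrightarrow> norm ((of_real a * cis u) *\<^sub>C F (of_real a * cis u)) \<le> e'"
  shows "norm (integral {a..b} (\<lambda>r. cis \<beta> *\<^sub>C F (of_real r * cis \<beta>)) - integral {a..b} (\<lambda>r. cis \<alpha> *\<^sub>C F (of_real r * cis \<alpha>))
     - (\<i> * of_real (\<beta> - \<alpha>)) *\<^sub>C c) \<le> (e + e') * (\<beta> - \<alpha>)"
proof -
  let ?W = "(\<lambda>(r, u). of_real r * cis u) ` ({a..b} \<times> {\<alpha>..\<beta>})"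
  have contF: "continuous_on ?W F"
  proof (rule has_derivative_continuous_on)
    fix z assume "z \<in> ?W"
    then obtain r u where "r \<in> {a..b}" "u \<in> {\<alpha>..\<beta>}" "z = of_real r * cis u" by auto
    then show "(F has_derivative (\<lambda>h. h *\<^sub>C F' z)) (at z within ?W)"
      using has_derivative_at_withinI[OF der] by simp
  qed
  have c: "continuous_on {\<alpha>..\<beta>} (\<lambda>u. (\<i> * of_real r * cis u) *\<^sub>C F (of_real r * cis u))" if "r \<in> {a..b}" for r
    by (intro continuous_intros continuous_on_cis' continuous_on_compose2[OF contF])
      (use that in \<open>auto intro!: image_eqI[of _ _ "(r, _)"]\<close>)
  have mul: "(\<i> * z) *\<^sub>C x = \<i> *\<^sub>C (z *\<^sub>C x)" for z and x :: 'a by simp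
  have 1: "norm (integral {\<alpha>..\<beta>} (\<lambda>u. (\<i> * of_real b * cis u) *\<^sub>C F (of_real b * cis u)) - (\<beta> - \<alpha>) *\<^sub>R (\<i> *\<^sub>C c)) \<le> e * (\<beta> - \<alpha>)"
  proof (rule integral_rotate_bound[OF \<alpha>\<beta> c])
    fix u assume "u \<in> {\<alpha>..\<beta>}"
    have "(\<i> * of_real b * cis u) *\<^sub>C F (of_real b * cis u) - \<i> *\<^sub>C c = \<i> *\<^sub>C ((of_real b * cis u) *\<^sub>C F (of_real b * cis u) - c)"
      by (simp add: cscale_algebra mult.assoc)
    then show "norm ((\<i> * of_real b * cis u) *\<^sub>C F (of_real b * cis u) - \<i> *\<^sub>C c) \<le> e"
      using outer[OF \<open>u \<in> _\<close>] by (simp only: norm_scaleC) simp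
  qed (use ab in auto)
  have 2: "norm (integral {\<alpha>..\<beta>} (\<lambda>u. (\<i> * of_real a * cis u) *\<^sub>C F (of_real a * cis u)) - (\<beta> - \<alpha>) *\<^sub>R 0) \<le> e' * (\<beta> - \<alpha>)"
  proof (rule integral_rotate_bound[OF \<alpha>\<beta> c])
    fix u assume "u \<in> {\<alpha>..\<beta>}"
    then show "norm ((\<i> * of_real a * cis u) *\<^sub>C F (of_real a * cis u) - 0) \<le> e'"
      using inner by (simp add: norm_mult)
  qed (use ab in auto)
  have 3: "(\<i> * of_real (\<beta> - \<alpha>)) *\<^sub>C c = (\<beta> - \<alpha>) *\<^sub>R (\<i> *\<^sub>C c)" by (simp add: scaleR_scaleC mult.commute)
  define IB where "IB = integral {\<alpha>..\<beta>} (\<lambda>u. (\<i> * of_real b * cis u) *\<^sub>C F (of_real b * cis u))"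
  define IA where "IA = integral {\<alpha>..\<beta>} (\<lambda>u. (\<i> * of_real a * cis u) *\<^sub>C F (of_real a * cis u))"
  have "norm ((IB - IA) - (\<beta> - \<alpha>) *\<^sub>R (\<i> *\<^sub>C c)) = norm ((IB - (\<beta> - \<alpha>) *\<^sub>R (\<i> *\<^sub>C c)) - IA)"
    by (simp add: algebra_simps)
  also have "\<dots> \<le> norm (IB - (\<beta> - \<alpha>) *\<^sub>R (\<i> *\<^sub>C c)) + norm IA" by (rule norm_triangle_ineq4)
  also have "\<dots> \<le> e * (\<beta> - \<alpha>) + e' * (\<beta> - \<alpha>)" using 1 2 by (intro add_mono) (simp_all add: IB_def IA_def)
  finally have "norm ((IB - IA) - (\<beta> - \<alpha>) *\<^sub>R (\<i> *\<^sub>C c)) \<le> e * (\<beta> - \<alpha>) + e' * (\<beta> - \<alpha>)" .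
  moreover have "integral {a..b} (\<lambda>r. cis \<beta> *\<^sub>C F (of_real r * cis \<beta>)) - integral {a..b} (\<lambda>r. cis \<alpha> *\<^sub>C F (of_real r * cis \<alpha>)) = IB - IA"
    unfolding IB_def IA_def by (rule integral_rotate[OF ab \<alpha>\<beta> der cont])
  ultimately show ?thesis by (simp only: 3 distrib_right)
qed

section \<open>Improper integrals of Banach space valued functions\<close>

text \<open>\<open>fcalc\<close> integrates over the open half-line, while contour rotation works on
  compact intervals; the second claim joins them. The constant bound controls the end at 0, the
  bound \<open>C / t\<^sup>2\<close> the end at infinity.\<close>

lemma has_integral_zero_infinity:
  fixes f :: "real \<Rightarrow> 'a::banach"
  assumes cont: "continuous_on {0<..} f" and C: "C \<ge> 0"
    and b0: "\<And>t. 0 < t \<Longrightarrow> norm (f t) \<le> C"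
    and b1: "\<And>t. 0 < t \<Longrightarrow> norm (f t) \<le> C / t\<^sup>2"
  shows "f integrable_on {0<..}"
    "(\<lambda>n. integral {1 / 2^n..2^n} f) \<longlonglongrightarrow> integral {0<..} f"
proof -
  have ci: "f integrable_on {a..b}" if "0 < a" for a b
    using that by (intro integrable_continuous_interval continuous_on_subset[OF cont]) auto
  define g where "g = (\<lambda>t. if t = 0 then 0 else f t)"
  have gi: "(g has_integral integral {a..b} f) {a..b}" if "0 < a" for a b
    using integrable_integral[OF ci[OF that, of b]] by (rule has_integral_eq[rotated]) (use that in \<open>auto simp: g_def\<close>)
  have small: "norm (integral {a..b} f) \<le> C * (b - a)" if "0 < a" "a \<le> b" for a b
    using that by (intro integral_bound continuous_on_subset[OF cont] b0) auto
  have large: "norm (integral {a..b} f) \<le> C / a" if "0 < a" "a \<le> b" for a b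
  proof -
    have "((\<lambda>t. C / t\<^sup>2) has_integral - (C / b) - - (C / a)) {a..b}"
    proof (intro fundamental_theorem_of_calculus)
      fix t assume "t \<in> {a..b}"
      then have "((\<lambda>t. - (C / t)) has_real_derivative C / t\<^sup>2) (at t within {a..b})"
        using that by (auto intro!: derivative_eq_intros simp: power2_eq_square)
      then show "((\<lambda>t. - (C / t)) has_vector_derivative C / t\<^sup>2) (at t within {a..b})"
        by (simp add: has_real_derivative_iff_has_vector_derivative)
    qed (use that in auto)
    note hi = has_integral_integrable[OF this] integral_unique[OF this]
    have b1': "norm (f t) \<le> C / t\<^sup>2" if "t \<in> {a..b}" for t
      using that \<open>0 < a\<close> by (intro b1) auto
    have "norm (integral {a..b} f) \<le> integral {a..b} (\<lambda>t. C / t\<^sup>2)"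
      by (rule integral_norm_bound_integral[OF ci[OF \<open>0 < a\<close>] hi(1) b1'])
    then have "norm (integral {a..b} f) \<le> C / a - C / b" unfolding hi(2) by simp
    moreover have "C / b \<ge> 0" using that C by simp
    ultimately show ?thesis by simp
  qed
  have split: "integral {a..c} f = integral {a..b} f + integral {b..c} f" if "0 < a" "a \<le> b" "b \<le> c" for a b c
    using that by (intro Henstock_Kurzweil_Integration.integral_combine[symmetric] ci) auto
  text \<open>Near 0 the antiderivative \<open>\<lambda>t. integral {t..b} f\<close> is Lipschitz, so it extends continuously to 0.\<close>
  have near: "\<exists>I. (f has_integral I) {0<..b} \<and> (\<forall>a. 0 < a \<and> a \<le> b \<longrightarrow> norm (I - integral {a..b} f) \<le> C * a)" if "0 < b" for b
  proof -
    define G where "G = (\<lambda>t. integral {t..b} f)"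
    have lip: "norm (G s - G t) \<le> C * \<bar>s - t\<bar>" if "s \<in> {0<..b}" "t \<in> {0<..b}" for s t
    proof -
      have *: "norm (G s - G t) \<le> C * (t - s)" if "s \<le> t" "s \<in> {0<..b}" "t \<in> {0<..b}" for s t
        using split[of s t b] small[of s t] that by (auto simp: G_def)
      show ?thesis using *[of s t] *[of t s] that by (cases "s \<le> t") (auto simp: norm_minus_commute)
    qed
    have "C-lipschitz_on {0<..b} G"
      using lip C by (intro lipschitz_onI) (auto simp: dist_norm)
    then have "uniformly_continuous_on {0<..b} G" by (rule lipschitz_on_uniformly_continuous)
    then obtain H where H: "uniformly_continuous_on (closure {0<..b}) H" "\<And>t. t \<in> {0<..b} \<Longrightarrow> G t = H t"
      using uniformly_continuous_on_extension_on_closure by metis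
    have cl: "closure {0<..b} = {0..b}" using \<open>0 < b\<close> by simp
    have contH: "continuous_on {0..b} H" using H(1) unfolding cl by (rule uniformly_continuous_imp_continuous)
    have derH: "((\<lambda>t. - H t) has_vector_derivative g t) (at t)" if t: "t \<in> {0<..<b}" for t
    proof -
      have "((\<lambda>u. integral {u..b} f) has_vector_derivative - f t) (at t within {t/2..b})"
        using t by (intro integral_has_vector_derivative' continuous_on_subset[OF cont]) auto
      then have "(G has_vector_derivative - f t) (at t within {t/2<..<b})"
        unfolding G_def by (rule has_vector_derivative_within_subset) auto
      then have "(G has_vector_derivative - f t) (at t)"
        using t by (subst (asm) at_within_open) auto
      then have "(H has_vector_derivative - f t) (at t)"
        by (rule has_vector_derivative_transform_within_open[of _ _ _ "{0<..<b}"]) (use t H(2) in auto)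
      from has_vector_derivative_minus[OF this] t show ?thesis by (simp add: g_def)
    qed
    have "(g has_integral (- H b - (- H 0))) {0..b}"
      using \<open>0 < b\<close> contH derH by (intro fundamental_theorem_of_calculus_interior) (auto intro: continuous_intros)
    moreover have "H b = 0" using H(2)[of b] \<open>0 < b\<close> by (simp add: G_def)
    ultimately have "(g has_integral H 0) {0..b}" by simp
    then have I: "(f has_integral H 0) {0<..b}"
    proof -
      assume "(g has_integral H 0) {0..b}"
      then have "(g has_integral H 0) {0<..b}"
        by (rule has_integral_spike_set_eq[THEN iffD1, rotated 2]) (auto simp: g_def intro: negligible_subset[OF negligible_sing[of 0]])
      then show ?thesis by (rule has_integral_eq[rotated]) (auto simp: g_def)
    qed
    have "norm (H 0 - G a) \<le> C * a" if "0 < a \<and> a \<le> b" for a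
    proof -
      have "((\<lambda>t. norm (H t - G a)) \<longlongrightarrow> norm (H 0 - G a)) (at 0 within {0<..b})"
        using contH \<open>0 < b\<close>
        by (intro tendsto_intros) (auto simp: continuous_on_def intro: tendsto_within_subset[of H _ 0 "{0..b}"])
      moreover have "eventually (\<lambda>t. norm (H t - G a) \<le> C * a) (at 0 within {0<..b})"
        unfolding eventually_at
      proof (intro exI[of _ a] conjI ballI impI)
        fix t assume t: "t \<in> {0<..b}" "t \<noteq> 0 \<and> dist t 0 < a"
        have "norm (H t - G a) \<le> C * \<bar>t - a\<bar>" using H(2)[of t] lip[of t a] t that by auto
        also have "\<dots> \<le> C * a" using t C by (intro mult_left_mono) auto
        finally show "norm (H t - G a) \<le> C * a" .
      qed (use that in auto)
      moreover have "at 0 within {0<..b} \<noteq> bot" using \<open>0 < b\<close> cl by (simp add: at_within_eq_bot_iff)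
        
      ultimately show ?thesis by (intro tendsto_upperbound)
    qed
    with I show ?thesis by (auto simp: G_def intro!: exI[of _ "H 0"])
  qed
  define I where "I = (\<lambda>b. SOME I. (f has_integral I) {0<..b} \<and> (\<forall>a. 0 < a \<and> a \<le> b \<longrightarrow> norm (I - integral {a..b} f) \<le> C * a))"
  have I: "(f has_integral I b) {0<..b}" "0 < a \<Longrightarrow> a \<le> b \<Longrightarrow> norm (I b - integral {a..b} f) \<le> C * a" if "0 < b" for a b
    using someI_ex[OF near[OF that]] unfolding I_def by auto
  have Idiff: "norm (I c - I b) \<le> C / b" if "0 < b" "b \<le> c" for b c
  proof -
    have "(f has_integral I b + integral {b..c} f) ({0<..b} \<union> {b..c})"
      using that I(1) integrable_integral[OF ci]
      by (intro has_integral_Un) (auto intro: negligible_subset[OF negligible_sing[of b]])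
    moreover have "{0<..b} \<union> {b..c} = {0<..c}" using that by auto
    ultimately have "I c = I b + integral {b..c} f" 
      using has_integral_unique[OF I(1)[of c]] that by simp
    then show ?thesis using large[of b c] that by simp
  qed
  have "Cauchy (\<lambda>n. I (2^n))"
  proof (rule CauchyI')
    fix e :: real assume e: "0 < e"
    obtain M where M: "C / e < 2^M" using real_arch_pow[of 2 "C/e"] by auto
    show "\<exists>M. \<forall>m\<ge>M. \<forall>n>m. dist (I (2 ^ m)) (I (2 ^ n)) < e"
    proof (intro exI[of _ M] allI impI)
      fix m n assume mn: "M \<le> m" "m < n"
      have p: "(2::real)^M \<le> 2^m" "(2::real)^m \<le> 2^n" using mn by (auto intro: power_increasing)
      have "norm (I (2^n) - I (2^m)) \<le> C / 2^m" using p by (intro Idiff) auto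
      also have "\<dots> \<le> C / 2^M" using p C by (intro divide_left_mono) auto
      also have "\<dots> < e" using M e by (simp add: field_simps)
      finally show "dist (I (2 ^ m)) (I (2 ^ n)) < e" by (simp add: dist_norm norm_minus_commute)
    qed
  qed
  then obtain L where L: "(\<lambda>n. I (2^n)) \<longlonglongrightarrow> L" by (metis Cauchy_convergent convergent_def)
  have IL: "norm (I b - L) \<le> C / b" if "0 < b" for b
  proof -
    obtain M where M: "b < 2^M" using real_arch_pow[of 2 b] by auto
    have "norm (I b - I (2^n)) \<le> C / b" if "n \<ge> M" for n
    proof -
      have "(2::real)^M \<le> 2^n" using that by (auto intro: power_increasing)
      then have "b \<le> 2^n" using M by linarith
      then show ?thesis using Idiff[of b "2^n"] \<open>0 < b\<close> by (simp add: norm_minus_commute)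
    qed
    then show ?thesis
      by (intro tendsto_upperbound[OF tendsto_norm[OF tendsto_diff[OF tendsto_const L]]])
         (auto simp: eventually_sequentially)
  qed
  have L': "(f has_integral L) {0<..}"
  proof (rule iffD2[OF has_integral_alt])
    have key: "\<exists>B>0. \<forall>a b. ball 0 B \<subseteq> cbox a b \<longrightarrow> (\<exists>z. ((\<lambda>x. if x \<in> {0<..} then f x else 0) has_integral z) (cbox a b) \<and> norm (z - L) < e)"
      if e: "e > 0" for e
    proof (intro exI[of _ "C / e + 1"] conjI allI impI)
      show "0 < C / e + 1" using C e by (simp add: add_nonneg_pos)
      fix a b :: real assume "ball 0 (C / e + 1) \<subseteq> cbox a b"
      then have ab: "a \<le> 0" "C / e + 1 \<le> b"
        using \<open>0 < C / e + 1\<close> by (auto simp: ball_eq_greaterThanLessThan greaterThanLessThan_subseteq_atLeastAtMost_iff)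
      then have "0 < b" using \<open>0 < C / e + 1\<close> by linarith
      have eq: "{0<..} \<inter> cbox a b = {0<..b}" using ab by auto
      have "((\<lambda>x. if x \<in> {0<..} then f x else 0) has_integral I b) (cbox a b)"
        using I(1)[OF \<open>0 < b\<close>] by (subst has_integral_restrict_Int) (simp only: eq)
      moreover have "C / b < e"
      proof -
        have "C / e < b" using ab by linarith
        then show ?thesis using e \<open>0 < b\<close> by (simp add: field_simps)
      qed
      ultimately show "\<exists>z. ((\<lambda>x. if x \<in> {0<..} then f x else 0) has_integral z) (cbox a b) \<and> norm (z - L) < e"
        using IL[OF \<open>0 < b\<close>] by (intro exI[of _ "I b"]) auto
    qed
    \<comment> \<open>\<open>has_integral_alt\<close> distinguishes boxes from other sets; the
      half-line is unbounded, hence no box.\<close>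
    have nb: "\<not> (\<exists>a b. {0::real<..} = cbox a b)"
    proof
      assume "\<exists>a b. {0::real<..} = cbox a b"
      then have "bounded {0::real<..}" by (metis bounded_cbox)
      then obtain B where B: "\<forall>x\<in>{0::real<..}. norm x \<le> B" unfolding bounded_iff by blast
      have "norm (\<bar>B\<bar> + 1) \<le> B" using B by (rule bspec) auto
      then show False by (simp add: abs_if split: if_splits)
    qed
    show "if \<exists>a b. {0::real<..} = cbox a b then (f has_integral L) {0<..}
      else \<forall>e>0. \<exists>B>0. \<forall>a b. ball 0 B \<subseteq> cbox a b \<longrightarrow> (\<exists>z. ((\<lambda>x. if x \<in> {0<..} then f x else 0) has_integral z) (cbox a b) \<and> norm (z - L) < e)"
      unfolding if_not_P[OF nb] using key by (intro allI impI)
  qed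
  then show "f integrable_on {0<..}" by blast
  show "(\<lambda>n. integral {1 / 2^n..2^n} f) \<longlonglongrightarrow> integral {0<..} f"
  proof -
    have "(\<lambda>n. I (2^n) - integral {1/2^n..2^n} f) \<longlonglongrightarrow> 0"
    proof (rule Lim_null_comparison)
      have "norm (I (2^n) - integral {1/2^n..2^n} f) \<le> C * (1/2^n)" for n
        by (rule I(2)) (auto intro: order_trans[of _ 1])
      then show "\<forall>\<^sub>F n in sequentially. norm (I (2^n) - integral {1/2^n..2^n} f) \<le> C * (1/2)^n"
        by (simp add: power_one_over)
      show "(\<lambda>n. C * (1/2)^n) \<longlonglongrightarrow> 0" by (intro tendsto_mult_right_zero LIMSEQ_realpow_zero) auto
    qed
    from tendsto_diff[OF L this] L' show "(\<lambda>n. integral {1 / 2^n..2^n} f) \<longlonglongrightarrow> integral {0<..} f"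
      by (simp add: integral_unique)
  qed
qed

section \<open>Resolvent families\<close>

text \<open>Complex differentiability for values in a Banach space: the real derivative is complex
  multiplication of one fixed vector.\<close>

definition cderiv :: "(complex \<Rightarrow> 'a::complex_banach) \<Rightarrow> 'a \<Rightarrow> complex \<Rightarrow> bool" where
  "cderiv G G' w \<longleftrightarrow> (G has_derivative (\<lambda>h. h *\<^sub>C G')) (at w)"

lemma cderiv_add: "cderiv F F' w \<Longrightarrow> cderiv G G' w \<Longrightarrow> cderiv (\<lambda>w. F w + G w) (F' + G') w"
  unfolding cderiv_def by (drule (1) has_derivative_add) (simp add: cscale_algebra)

lemma cderiv_diff: "cderiv F F' w \<Longrightarrow> cderiv G G' w \<Longrightarrow> cderiv (\<lambda>w. F w - G w) (F' - G') w"
  unfolding cderiv_def by (drule (1) has_derivative_diff) (simp add: cscale_algebra)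

lemma cderiv_const: "cderiv (\<lambda>w. x) 0 w"
  unfolding cderiv_def by simp

lemma cderiv_scale:
  assumes "(f has_field_derivative f') (at w)" "cderiv G G' w"
  shows "cderiv (\<lambda>w. f w *\<^sub>C G w) (f w *\<^sub>C G' + f' *\<^sub>C G w) w"
  using cscale.FDERIV[OF assms(1)[unfolded has_field_derivative_def] assms(2)[unfolded cderiv_def]]
  unfolding cderiv_def by (simp add: cscale_algebra mult_ac)

lemma cderiv_scale_const: "cderiv G G' w \<Longrightarrow> cderiv (\<lambda>w. c *\<^sub>C G w) (c *\<^sub>C G') w"
  using cderiv_scale[OF DERIV_const, of G G' w c] by simp

lemma cderiv_sum: "(\<And>i. i \<in> I \<Longrightarrow> cderiv (F i) (F' i) w) \<Longrightarrow> cderiv (\<lambda>w. \<Sum>i\<in>I. F i w) (\<Sum>i\<in>I. F' i) w"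
  by (induction I rule: infinite_finite_induct) (auto intro: cderiv_add cderiv_const)

text \<open>The easy half of Banach-Steinhaus: a uniform bound carries the Cauchy property from a
  dense set to all vectors. It extends the constructions below from kernel plus range of
  \<open>g\<close> to the whole space.\<close>

lemma strong_limit:
  fixes L :: "nat \<Rightarrow> 'a::complex_banach \<Rightarrow> 'a"
  assumes L: "\<And>n. bounded_op (L n)" and bd: "\<And>n x. norm (L n x) \<le> C * norm x"
    and D: "closure D = UNIV" and conv: "\<And>x. x \<in> D \<Longrightarrow> convergent (\<lambda>n. L n x)"
  shows "(\<lambda>n. L n x) \<longlonglongrightarrow> lim (\<lambda>n. L n x)"
    "bounded_op (\<lambda>x. lim (\<lambda>n. L n x))" "norm (lim (\<lambda>n. L n x)) \<le> C * norm x"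
proof -
  \<comment> \<open>Made positive so that one can divide by it.\<close>
  define C' where "C' = \<bar>C\<bar> + 1"
  have C': "C' > 0" "norm (L n x) \<le> C' * norm x" for n x
    by (auto simp: C'_def intro!: order_trans[OF bd[of n x]] mult_right_mono)
  have *: "(\<lambda>n. L n x) \<longlonglongrightarrow> lim (\<lambda>n. L n x)" for x
  proof -
    have "Cauchy (\<lambda>n. L n x)"
    proof (rule metric_CauchyI)
      fix e :: real assume e: "e > 0"
      have "x \<in> closure D" using D by simp
      then obtain d where d: "d \<in> D" "dist d x < e / (3 * C')"
        unfolding closure_approachable using e C' by (meson divide_pos_pos mult_pos_pos zero_less_numeral)
      have "Cauchy (\<lambda>n. L n d)" using conv[OF d(1)] by (rule convergent_Cauchy)
      then obtain N where N: "\<And>m n. m \<ge> N \<Longrightarrow> n \<ge> N \<Longrightarrow> dist (L m d) (L n d) < e / 3"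
        using e unfolding Cauchy_def by (meson divide_pos_pos zero_less_numeral)
      have near: "dist (L n x) (L n d) < e / 3" for n
      proof -
        have "dist (L n x) (L n d) = norm (L n (x - d))" by (simp add: dist_norm bounded_opD[OF L])
        also have "\<dots> \<le> C' * dist d x" using C'(2)[of n "x - d"] by (simp add: dist_norm norm_minus_commute)
        also have "\<dots> < e / 3" using d(2) C'(1) by (simp add: field_simps)
        finally show ?thesis .
      qed
      show "\<exists>M. \<forall>m\<ge>M. \<forall>n\<ge>M. dist (L m x) (L n x) < e"
      proof (intro exI[of _ N] allI impI)
        fix m n assume "m \<ge> N" "n \<ge> N"
        then show "dist (L m x) (L n x) < e"
          using near[of m] near[of n] N[of m n] dist_triangle[of "L m x" "L n x" "L m d"]
            dist_triangle[of "L m d" "L n x" "L n d"] by (simp add: dist_commute)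
      qed
    qed
    then show ?thesis by (simp add: Cauchy_convergent_iff convergent_LIMSEQ_iff)
  qed
  show "(\<lambda>n. L n x) \<longlonglongrightarrow> lim (\<lambda>n. L n x)" by fact
  show nb: "norm (lim (\<lambda>n. L n x)) \<le> C * norm x" for x
    by (rule tendsto_upperbound[OF tendsto_norm[OF *]]) (auto simp: bd)
  show "bounded_op (\<lambda>x. lim (\<lambda>n. L n x))"
  proof (rule bounded_opI[OF _ _ nb])
    show "lim (\<lambda>n. L n (x + y)) = lim (\<lambda>n. L n x) + lim (\<lambda>n. L n y)" for x y
      using tendsto_add[OF *[of x] *[of y]] by (intro limI) (simp add: bounded_opD[OF L])
    show "lim (\<lambda>n. L n (c *\<^sub>C x)) = c *\<^sub>C lim (\<lambda>n. L n x)" for c x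
      using cscale.tendsto[OF tendsto_const *[of x], of c] by (intro limI) (simp add: bounded_opD[OF L])
  qed
qed

text \<open>For \<open>0 < \<theta> < pi\<close> this is the complement of the closed sector, with 0
  excluded, written without \<open>Arg\<close> so that openness follows from continuity.\<close>

definition cosector :: "real \<Rightarrow> complex set" where
  "cosector \<theta> = {z. Re z < cmod z * cos \<theta>}"

lemma open_cosector: "open (cosector \<theta>)"
  unfolding cosector_def by (intro open_Collect_less continuous_intros)

text \<open>Stated for resolvents alone; the operator returns in \<open>generator_family\<close>.
  Since \<open>\<theta>0 < pi / 2\<close>, the closed left half-plane without 0 is admissible.
  Density of the domain appears as density of the range of \<open>R (-1)\<close>.\<close>

locale resolvent_family =
  fixes R :: "complex \<Rightarrow> 'a::complex_banach \<Rightarrow> 'a" and \<theta>0 M :: real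
  assumes th0: "0 < \<theta>0" "\<theta>0 < pi / 2"
    and bop: "z \<in> cosector \<theta>0 \<Longrightarrow> bounded_op (R z)"
    and rid: "z \<in> cosector \<theta>0 \<Longrightarrow> w \<in> cosector \<theta>0 \<Longrightarrow> R z x - R w x = (w - z) *\<^sub>C R z (R w x)"
    and bd: "z \<in> cosector \<theta>0 \<Longrightarrow> norm (R z x) \<le> M / cmod z * norm x"
    and M: "0 \<le> M"
    and dense: "closure (range (R (-1))) = UNIV"
begin

abbreviation "S \<equiv> cosector \<theta>0"

lemma cos_pos: "0 < cos \<theta>0" using th0 by (intro cos_gt_zero) auto

lemma S_nz: "z \<in> S \<Longrightarrow> z \<noteq> 0" by (auto simp: cosector_def)

lemma S_scale: "z \<in> S \<Longrightarrow> 0 < t \<Longrightarrow> of_real t * z \<in> S"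
  by (auto simp: cosector_def norm_mult mult.assoc)

lemma S_numeral: "z \<in> S \<Longrightarrow> numeral k * z \<in> S"
  using S_scale[of z "numeral k"] by simp

lemma S_left: "Re z \<le> 0 \<Longrightarrow> z \<noteq> 0 \<Longrightarrow> z \<in> S"
  using cos_pos by (auto simp: cosector_def intro: le_less_trans)

lemma S_imag: "x \<noteq> 0 \<Longrightarrow> \<i> * of_real x \<in> S" "x \<noteq> 0 \<Longrightarrow> - (\<i> * of_real x) \<in> S"
  by (auto intro!: S_left)

lemma S_neg: "0 < t \<Longrightarrow> - of_real t \<in> S" "-1 \<in> S"
  by (auto intro!: S_left)

lemma S_polar: "0 < r \<Longrightarrow> cos u < cos \<theta>0 \<Longrightarrow> of_real r * cis u \<in> S"
  by (auto simp: cosector_def norm_mult)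

lemma R_commute: 
  assumes "z \<in> S" "w \<in> S"
  shows "R z (R w x) = R w (R z x)"
proof (cases "z = w")
  case False
  have "(w - z) *\<^sub>C R z (R w x) = (w - z) *\<^sub>C R w (R z x)"
    using rid[OF assms, of x] rid[OF assms(2,1), of x] by (simp add: cscale_algebra) (metis minus_diff_eq)
  then have "(1 / (w - z)) *\<^sub>C (w - z) *\<^sub>C R z (R w x) = (1 / (w - z)) *\<^sub>C (w - z) *\<^sub>C R w (R z x)" by simp
  then show ?thesis using False by simp
qed simp

lemma R_prod:
  assumes "z \<in> S" "w \<in> S" "z \<noteq> w"
  shows "R z (R w x) = (1 / (w - z)) *\<^sub>C (R z x - R w x)"
  using rid[OF assms(1,2), of x] assms(3) by simp

lemma R_bd: "z \<in> S \<Longrightarrow> norm (R z x) \<le> (1 + M) / cmod z * norm x"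
  by (rule order_trans[OF bd]) (auto intro!: mult_right_mono divide_right_mono)

text \<open>Two applications of the resolvent identity show that the remainder is
  \<open>(w - y)\<^sup>2\<close> times \<open>R y (R w (R w x))\<close>.\<close>

lemma R_deriv:
  assumes w: "w \<in> S"
  shows "cderiv (\<lambda>w. R w x) (- R w (R w x)) w"
proof -
  obtain e where e: "e > 0" "ball w e \<subseteq> S" using open_cosector w by (metis openE)
  \<comment> \<open>Within distance \<open>cmod w / 2\<close> of \<open>w\<close> the modulus of
    \<open>y\<close> is at least \<open>cmod w / 2\<close>, so the bound on \<open>R y\<close> is
    uniform.\<close>
  define e' where "e' = min e (cmod w / 2)"
  have e': "e' > 0" using e S_nz[OF w] by (simp add: e'_def)
  define c where "c = M / (cmod w / 2) * norm (R w (R w x))"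
  have "((\<lambda>w. R w x) has_derivative (\<lambda>h. h *\<^sub>C - R w (R w x))) (at w within UNIV)"
  proof (rule has_derivativeI_sandwich[OF e'])
    show "bounded_linear (\<lambda>h. h *\<^sub>C - R w (R w x))" by (rule cscale.bounded_linear_left)
    show "((\<lambda>y. norm (y - w) * c) \<longlongrightarrow> 0) (at w within UNIV)"
      by (intro tendsto_mult_left_zero tendsto_norm_zero) (simp add: LIM_zero)
    fix y assume y: "y \<noteq> w" "dist y w < e'"
    have yS: "y \<in> S" using y e by (auto simp: e'_def dist_commute)
    have "cmod w \<le> cmod y + dist y w" by (metis dist_commute dist_norm norm_triangle_sub)
    then have yw: "cmod w / 2 \<le> cmod y" using y by (simp add: e'_def)
    have "R y x - R w x - (y - w) *\<^sub>C - R w (R w x) = (w - y) *\<^sub>C (R y (R w x) - R w (R w x))"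
      by (simp add: rid[OF yS w, of x] cscale_algebra)
    also have "\<dots> = (w - y) *\<^sub>C (w - y) *\<^sub>C R y (R w (R w x))" by (simp only: rid[OF yS w, of "R w x"])
    finally have "norm (R y x - R w x - (y - w) *\<^sub>C - R w (R w x)) = cmod (y - w) * cmod (y - w) * norm (R y (R w (R w x)))"
      by (simp add: norm_mult norm_minus_commute)
    also have "\<dots> \<le> cmod (y - w) * cmod (y - w) * c"
    proof (intro mult_left_mono)
      have "norm (R y (R w (R w x))) \<le> M / cmod y * norm (R w (R w x))" by (rule bd[OF yS])
      also have "\<dots> \<le> c" unfolding c_def using yw M S_nz[OF w]
        by (intro mult_right_mono divide_left_mono) (auto intro!: mult_pos_pos simp: S_nz[OF yS])
      finally show "norm (R y (R w (R w x))) \<le> c" .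
    qed auto
    finally show "norm (R y x - R w x - (y - w) *\<^sub>C - R w (R w x)) / norm (y - w) \<le> norm (y - w) * c"
      using y(1) by (simp add: divide_le_eq mult_ac)
  qed
  then show ?thesis unfolding cderiv_def by simp
qed

lemma R_cont: "continuous_on S (\<lambda>w. R w x)"
  using R_deriv unfolding cderiv_def
  by (meson continuous_at_imp_continuous_on has_derivative_continuous)

text \<open>Joint continuity: \<open>f t\<close> is split into \<open>f t0\<close>, where strong
  continuity applies, and a small difference, where the local bound on \<open>R\<close>
  applies.\<close>

lemma R_cont':
  fixes T :: "'b::topological_space set"
  assumes z: "continuous_on T z" and f: "continuous_on T f" and zS: "\<And>t. t \<in> T \<Longrightarrow> z t \<in> S"
  shows "continuous_on T (\<lambda>t. R (z t) (f t))"
  unfolding continuous_on_def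
proof
  fix t0 assume t0: "t0 \<in> T"
  have zl: "(z \<longlongrightarrow> z t0) (at t0 within T)" and fl: "(f \<longlongrightarrow> f t0) (at t0 within T)"
    using z f t0 by (auto simp: continuous_on_def)
  have ev: "eventually (\<lambda>t. z t \<in> S) (at t0 within T)"
    using zS by (auto simp: eventually_at_filter)
  have "((\<lambda>t. R (z t) (f t0)) \<longlongrightarrow> R (z t0) (f t0)) (at t0 within T)"
    using continuous_on_compose2[OF R_cont z, of "f t0"] zS t0 by (auto simp: continuous_on_def)
  moreover have "((\<lambda>t. R (z t) (f t - f t0)) \<longlongrightarrow> 0) (at t0 within T)"
  proof (rule Lim_null_comparison)
    show "eventually (\<lambda>t. norm (R (z t) (f t - f t0)) \<le> M / cmod (z t) * norm (f t - f t0)) (at t0 within T)"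
      using ev by eventually_elim (rule bd)
    have "((\<lambda>t. M / cmod (z t) * norm (f t - f t0)) \<longlongrightarrow> M / cmod (z t0) * norm (f t0 - f t0)) (at t0 within T)"
      using S_nz[OF zS[OF t0]] by (intro tendsto_intros zl fl) auto
    then show "((\<lambda>t. M / cmod (z t) * norm (f t - f t0)) \<longlongrightarrow> 0) (at t0 within T)" by simp
  qed
  ultimately have "((\<lambda>t. R (z t) (f t0) + R (z t) (f t - f t0)) \<longlongrightarrow> R (z t0) (f t0) + 0) (at t0 within T)"
    by (rule tendsto_add)
  moreover have "eventually (\<lambda>t. R (z t) (f t0) + R (z t) (f t - f t0) = R (z t) (f t)) (at t0 within T)"
    using ev by eventually_elim (simp add: bounded_opD(6)[OF bop])
  ultimately show "((\<lambda>t. R (z t) (f t)) \<longlongrightarrow> R (z t0) (f t0)) (at t0 within T)"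
    by (auto dest: Lim_transform_eventually)
qed

text \<open>If \<open>R\<close> is the resolvent of \<open>A\<close>, then \<open>AR w = A R(w)\<close>, \<open>K w v = A R(w) R(v)\<close>,
  \<open>B = (1 + A)\<^sup>-\<^sup>1\<close>, \<open>Bc = A (1 + A)\<^sup>-\<^sup>1\<close> and \<open>g = A (1 + A)\<^sup>-\<^sup>2\<close>.\<close>
definition AR :: "complex \<Rightarrow> 'a \<Rightarrow> 'a" where "AR w x = w *\<^sub>C R w x - x"
definition K :: "complex \<Rightarrow> complex \<Rightarrow> 'a \<Rightarrow> 'a" where "K w v x = AR w (R v x)"
definition B :: "'a \<Rightarrow> 'a" where "B x = - R (-1) x"
definition Bc :: "'a \<Rightarrow> 'a" where "Bc x = x - B x"
definition g :: "'a \<Rightarrow> 'a" where "g x = Bc (B x)"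

text \<open>The commutant of the family. Boundedness is included so that members pass through sums,
  integrals and limits formed from resolvents.\<close>

definition commutes :: "('a \<Rightarrow> 'a) \<Rightarrow> bool" where
  "commutes T \<longleftrightarrow> bounded_op T \<and> (\<forall>z\<in>S. \<forall>x. T (R z x) = R z (T x))"

lemma commutesD: "commutes T \<Longrightarrow> bounded_op T" "commutes T \<Longrightarrow> z \<in> S \<Longrightarrow> T (R z x) = R z (T x)"
  by (auto simp: commutes_def)

lemma
  shows commutes_R: "z \<in> S \<Longrightarrow> commutes (R z)"
    and commutes_id: "commutes (\<lambda>x. x)"
    and commutes_comp: "commutes T \<Longrightarrow> commutes U \<Longrightarrow> commutes (\<lambda>x. T (U x))"
    and commutes_scaleC: "commutes T \<Longrightarrow> commutes (\<lambda>x. c *\<^sub>C T x)"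
    and commutes_add: "commutes T \<Longrightarrow> commutes U \<Longrightarrow> commutes (\<lambda>x. T x + U x)"
    and commutes_diff: "commutes T \<Longrightarrow> commutes U \<Longrightarrow> commutes (\<lambda>x. T x - U x)"
  by (auto simp: commutes_def bop bounded_op_id bounded_op_comp bounded_op_scaleC bounded_op_add
      bounded_op_diff R_commute bounded_opD(1,2,6)[OF bop])

lemma commutes_scaleR: "commutes T \<Longrightarrow> commutes (\<lambda>x. r *\<^sub>R T x)"
  unfolding scaleR_scaleC by (rule commutes_scaleC)

lemma commutes_uminus: "commutes T \<Longrightarrow> commutes (\<lambda>x. - T x)"
  using commutes_scaleC[of T "-1"] by (simp add: cscale_algebra)

lemma commutes_sum: "(\<And>i. i \<in> I \<Longrightarrow> commutes (T i)) \<Longrightarrow> commutes (\<lambda>x. \<Sum>i\<in>I. T i x)"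
proof (induction I rule: infinite_finite_induct)
  case (insert i I)
  then show ?case using commutes_add[of "T i" "\<lambda>x. \<Sum>i\<in>I. T i x"] by simp
qed (simp_all add: commutes_def bounded_opI[of _ 0] bounded_opD(4)[OF bop])

lemma commutes_AR: "w \<in> S \<Longrightarrow> commutes (AR w)"
  unfolding AR_def[abs_def] by (rule commutes_diff[OF commutes_scaleC[OF commutes_R] commutes_id])

lemma commutes_K: "w \<in> S \<Longrightarrow> v \<in> S \<Longrightarrow> commutes (K w v)"
  using commutes_comp[of "AR w" "R v"] by (simp add: K_def[abs_def] commutes_AR commutes_R)

lemma commutes_B: "commutes B"
  unfolding B_def[abs_def] by (rule commutes_uminus[OF commutes_R[OF S_neg(2)]])

lemma commutes_Bc: "commutes Bc"
  unfolding Bc_def[abs_def] by (rule commutes_diff[OF commutes_id commutes_B])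

lemma commutes_g: "commutes g"
  using commutes_comp[OF commutes_Bc commutes_B] by (simp add: g_def[abs_def])

lemma commute_AR: "commutes T \<Longrightarrow> w \<in> S \<Longrightarrow> T (AR w x) = AR w (T x)"
  by (simp add: AR_def bounded_opD commutesD)

lemma commute_K: "commutes T \<Longrightarrow> w \<in> S \<Longrightarrow> v \<in> S \<Longrightarrow> T (K w v x) = K w v (T x)"
  by (simp add: K_def commute_AR commutesD)

lemma commute_B: "commutes T \<Longrightarrow> T (B x) = B (T x)"
  by (simp add: B_def bounded_opD commutesD S_neg)

lemma commute_Bc: "commutes T \<Longrightarrow> T (Bc x) = Bc (T x)"
  by (simp add: Bc_def bounded_opD commute_B commutesD)

lemma commute_g: "commutes T \<Longrightarrow> T (g x) = g (T x)"
  by (simp add: g_def commute_Bc commute_B)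

lemmas B_lin = bounded_opD[OF commutesD(1)[OF commutes_B]]
lemmas Bc_lin = bounded_opD[OF commutesD(1)[OF commutes_Bc]]
lemmas g_lin = bounded_opD[OF commutesD(1)[OF commutes_g]]
lemmas AR_lin = bounded_opD[OF commutesD(1)[OF commutes_AR]]
lemmas R_lin = bounded_opD[OF bop]

lemma g_alt: "g x = B (Bc x)"
  by (simp add: g_def commute_B[OF commutes_Bc])

text \<open>Both sides are \<open>A R(w) (1 + A)^-1\<close>. With the factor \<open>A\<close> at the
  resolvent one has a bounded operator near 0; with \<open>A\<close> at \<open>B\<close> a decaying
  resolvent is left for large \<open>w\<close>.\<close>

lemma AR_B: "w \<in> S \<Longrightarrow> AR w (B x) = R w (Bc x)"
  using rid[of w "-1" x] by (simp add: AR_def Bc_def B_def R_lin S_neg cscale_algebra algebra_simps)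

lemma R_Bc: "w \<in> S \<Longrightarrow> R w (Bc x) = AR w (B x)"
  by (simp add: AR_B)

lemma K_commute: "w \<in> S \<Longrightarrow> v \<in> S \<Longrightarrow> K w v x = K v w x"
  using rid[of w v x] by (simp add: K_def AR_def R_commute[of v w] cscale_algebra algebra_simps)

text \<open>From \<open>A R(w) = w R(w) - 1\<close> and the resolvent identity; on symbols these are
  the partial fractions of \<open>z / ((w - z) (v - z))\<close>.\<close>

lemma K_pf:
  assumes "w \<in> S" "v \<in> S" "w \<noteq> v"
  shows "K w v x = (v / (w - v)) *\<^sub>C R v x - (w / (w - v)) *\<^sub>C R w x"
proof -
  have "K w v x = (w / (v - w)) *\<^sub>C R w x - (w / (v - w)) *\<^sub>C R v x - 1 *\<^sub>C R v x"
    using R_prod[OF assms] by (simp add: K_def AR_def cscale_algebra)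
  also have "\<dots> = (w / (v - w)) *\<^sub>C R w x - (w / (v - w) + 1) *\<^sub>C R v x"
    by (simp only: cscale_algebra) simp
  finally have *: "K w v x = (w / (v - w)) *\<^sub>C R w x - (w / (v - w) + 1) *\<^sub>C R v x" .
  have "w / (v - w) + 1 = - (v / (w - v))" "w / (v - w) = - (w / (w - v))"
    using assms(3) by (auto simp: field_simps)
  then show ?thesis unfolding * by (simp add: cscale_algebra)
qed

lemma norm_B: "norm (B x) \<le> (1 + M) * norm x"
  using R_bd[OF S_neg(2), of x] by (simp add: B_def)

lemma norm_Bc: "norm (Bc x) \<le> (1 + M) * norm x"
proof -
  have "norm (Bc x) \<le> norm x + norm (R (-1) x)" using norm_triangle_ineq4[of x "B x"] by (simp add: Bc_def B_def)
  then show ?thesis using bd[OF S_neg(2), of x] by (simp add: algebra_simps)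
qed

lemma norm_AR: "w \<in> S \<Longrightarrow> norm (AR w x) \<le> (1 + M) * norm x"
proof -
  assume w: "w \<in> S"
  have "norm (AR w x) \<le> cmod w * norm (R w x) + norm x" using norm_triangle_ineq4[of "w *\<^sub>C R w x" x] by (simp add: AR_def)
  also have "cmod w * norm (R w x) \<le> cmod w * (M / cmod w * norm x)" by (intro mult_left_mono bd w) auto
  finally show ?thesis using S_nz[OF w] by (simp add: algebra_simps)
qed

lemma norm_comp:
  assumes "norm y \<le> b * norm x" "norm z \<le> a * norm y" "0 \<le> a"
  shows "norm z \<le> (a * b) * norm x"
proof -
  have "a * norm y \<le> a * (b * norm x)" using assms by (intro mult_left_mono)
  then show ?thesis using assms(2) by (simp add: mult.assoc)
qed

lemma nn: "0 \<le> 1 + M" "0 \<le> (1 + M) ^ k" "0 \<le> (1 + M) / cmod z" using M by auto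

lemma norm_g: "norm (g x) \<le> (1 + M)^2 * norm x"
  using norm_comp[OF norm_B norm_Bc nn(1)] by (simp add: g_def power2_eq_square)

lemma norm_K: "w \<in> S \<Longrightarrow> v \<in> S \<Longrightarrow> norm (K w v x) \<le> (1 + M)^2 / cmod v * norm x"
  using norm_comp[OF R_bd norm_AR nn(1), of v w x] by (simp add: K_def power2_eq_square)

text \<open>One of two regroupings of \<open>A R(w) R(v) A (1 + A)^-2\<close>. With both factors
  \<open>A\<close> away from the resolvents two decaying resolvents remain, good for large
  parameters; with both at the resolvents, as in \<open>K_g_zero\<close>, everything is bounded,
  good near 0.\<close>

lemma K_g_infty:
  assumes "w \<in> S" "v \<in> S"
  shows "K w v (g x) = R w (R v (Bc (Bc x)))"
  by (simp add: K_def g_alt commutesD(2)[OF commutes_B] AR_B assms R_commute[of v w]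
      commute_B[OF commutes_R, OF assms(2)] commute_Bc[OF commutes_R, OF assms(2)])

lemma K_g_zero:
  assumes "w \<in> S" "v \<in> S"
  shows "K w v (g x) = AR w (AR v (B (B x)))"
  by (simp add: K_def g_def R_Bc assms)

lemma norm_K_g_infty:
  assumes "w \<in> S" "v \<in> S"
  shows "norm (K w v (g x)) \<le> (1 + M)^4 / (cmod w * cmod v) * norm x"
  using norm_comp[OF norm_comp[OF norm_comp[OF norm_Bc norm_Bc nn(1)] R_bd[OF assms(2)] nn(3)] R_bd[OF assms(1)] nn(3), of x]
  by (simp add: K_g_infty assms power4_eq_xxxx mult_ac)

lemma norm_K_g_zero:
  assumes "w \<in> S" "v \<in> S"
  shows "norm (K w v (g x)) \<le> (1 + M)^4 * norm x"
  using norm_comp[OF norm_comp[OF norm_comp[OF norm_B norm_B nn(1)] norm_AR[OF assms(2)] nn(1)] norm_AR[OF assms(1)] nn(1), of x]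
  by (simp add: K_g_zero assms power4_eq_xxxx mult_ac)

text \<open>The kernel of \<open>A\<close>, since \<open>(1 + A)^-1 p = p\<close> means
  \<open>A p = 0\<close>.\<close>

definition "Ker = {p. B p = p}"

lemma Ker_R:
  assumes "p \<in> Ker" "w \<in> S"
  shows "w *\<^sub>C R w p = p"
  using AR_B[OF assms(2), of p] assms by (simp add: Ker_def Bc_def AR_def R_lin)

lemma Ker_AR: "p \<in> Ker \<Longrightarrow> w \<in> S \<Longrightarrow> AR w p = 0"
  by (simp add: AR_def Ker_R)

lemma Ker_K: "p \<in> Ker \<Longrightarrow> w \<in> S \<Longrightarrow> v \<in> S \<Longrightarrow> K w v p = 0"
  by (simp add: K_commute[of w v] K_def[of v] )
     (metis AR_lin(4) Ker_AR commute_AR commutes_R R_lin(4))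

lemma Ker_g: "p \<in> Ker \<Longrightarrow> g p = 0"
  by (simp add: g_def Ker_def Bc_def)

end

text \<open>The mean ergodic splitting into kernel and closed range of \<open>A\<close>; the range
  of \<open>Bc\<close> is that of \<open>A\<close>. It can fail in a general Banach space and is
  obtained from reflexivity in \<open>reflexive_split\<close>.\<close>

locale split_resolvent_family = resolvent_family +
  assumes split: "\<exists>p\<in>Ker. x - p \<in> closure (range Bc)"
begin

text \<open>The range of \<open>B\<close> is dense and \<open>Bc\<close> is continuous, so the range
  of \<open>g\<close>, which is \<open>Bc\<close> after \<open>B\<close>, is dense in the range of
  \<open>Bc\<close>.\<close>

lemma dense_g: "closure {p + g y | p y. p \<in> Ker} = UNIV"
proof (intro equalityI subset_UNIV subsetI)
  fix x :: 'a
  obtain p where p: "p \<in> Ker" "x - p \<in> closure (range Bc)" using split by blast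
  have cBc: "continuous_on UNIV Bc" by (intro linear_continuous_on Bc_lin)
  have cB: "closure (range B) = UNIV"
  proof -
    have "B x = R (-1) (- x)" "R (-1) x = B (- x)" for x by (simp_all add: B_def R_lin S_neg)
    then have "range B = range (R (-1))" by (metis (no_types, opaque_lifting) image_cong image_subset_iff rangeI subset_antisym)
    then show ?thesis using dense by simp
  qed
  have "range Bc \<subseteq> closure (range g)"
  proof -
    have "range Bc = Bc ` closure (range B)" using cB by simp
    also have "\<dots> \<subseteq> closure (Bc ` range B)"
      by (rule image_closure_subset) (auto intro: continuous_on_subset[OF cBc] closure_subset[THEN subsetD])
    also have "Bc ` range B = range g" by (auto simp: g_def)
    finally show ?thesis .
  qed
  then have "x - p \<in> closure (range g)" using p(2) by (meson closed_closure closure_minimal subsetD)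
  then have "p + (x - p) \<in> (\<lambda>y. p + y) ` closure (range g)" by blast
  then have "x \<in> closure ((\<lambda>y. p + y) ` range g)" by (simp add: closure_translation)
  moreover have "(\<lambda>y. p + y) ` range g \<subseteq> {p + g y | p y. p \<in> Ker}" using p(1) by auto
  ultimately show "x \<in> closure {p + g y | p y. p \<in> Ker}" by (meson closure_mono subsetD)
qed

text \<open>Applying \<open>g\<close> to the previous density statement removes the kernel part and
  adds one factor \<open>g\<close>. The second factor pays for the decay at infinity in
  \<open>norm_Gf\<close>.\<close>

lemma dense_gg: "closure {p + g (g y) | p y. p \<in> Ker} = UNIV"
proof -
  let ?D = "{p + g (g y) | p y. p \<in> Ker}"
  have cg: "continuous_on UNIV g" by (intro linear_continuous_on g_lin)
  have "p + g y \<in> closure ?D" if p: "p \<in> Ker" for p y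
  proof -
    have "g y \<in> g ` closure {p + g y | p y. p \<in> Ker}" unfolding dense_g by simp
    also have "g ` closure {p + g y | p y. p \<in> Ker} \<subseteq> closure (g ` {p + g y | p y. p \<in> Ker})"
      by (rule image_closure_subset) (auto intro: continuous_on_subset[OF cg] closure_subset[THEN subsetD])
    finally have "g y \<in> closure (g ` {p + g y | p y. p \<in> Ker})" .
    moreover have "g ` {p + g y | p y. p \<in> Ker} \<subseteq> range (\<lambda>y. g (g y))" by (auto simp: g_lin Ker_g)
    ultimately have "g y \<in> closure (range (\<lambda>y. g (g y)))" by (meson closure_mono subsetD)
    then have "p + g y \<in> (\<lambda>z. p + z) ` closure (range (\<lambda>y. g (g y)))" by blast
    then have "p + g y \<in> closure ((\<lambda>z. p + z) ` range (\<lambda>y. g (g y)))" by (simp add: closure_translation)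
    moreover have "(\<lambda>z. p + z) ` range (\<lambda>y. g (g y)) \<subseteq> ?D" using p by auto
    ultimately show ?thesis by (meson closure_mono subsetD)
  qed
  then have "{p + g y | p y. p \<in> Ker} \<subseteq> closure ?D" by auto
  then have "closure {p + g y | p y. p \<in> Ker} \<subseteq> closure ?D" by (simp add: closure_minimal)
  then show ?thesis unfolding dense_g by auto
qed

text \<open>The Abel means \<open>\<epsilon> (\<epsilon> + A)^-1\<close> at
  \<open>\<epsilon> = 1 / (n + 1)\<close>.\<close>

definition Pn :: "nat \<Rightarrow> 'a \<Rightarrow> 'a" where "Pn n x = (1 / real (Suc n)) *\<^sub>R - R (- of_real (1 / real (Suc n))) x"
definition P :: "'a \<Rightarrow> 'a" where "P x = lim (\<lambda>n. Pn n x)"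

lemma Pn_commutes: "commutes (Pn n)"
  unfolding Pn_def[abs_def] by (intro commutes_scaleR commutes_uminus commutes_R S_neg) auto

lemma Pn_norm: "norm (Pn n x) \<le> M * norm x"
proof -
  have c: "cmod (- of_real (1 / real (Suc n))) = 1 / real (Suc n)" by (simp only: norm_minus_cancel norm_of_real) simp
  have "norm (R (- of_real (1 / real (Suc n))) x) \<le> M / cmod (- of_real (1 / real (Suc n))) * norm x"
    by (intro bd S_neg) auto
  then have "norm (R (- of_real (1 / real (Suc n))) x) \<le> M / (1 / real (Suc n)) * norm x" unfolding c .
  then show ?thesis unfolding Pn_def norm_scaleR norm_minus_cancel
    by (simp add: field_simps del: of_real_divide of_nat_Suc)
qed

lemma Pn_Ker: "p \<in> Ker \<Longrightarrow> Pn n p = p"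
  using Ker_R[of p "- of_real (1 / real (Suc n))"] S_neg(1)[of "1 / real (Suc n)"]
  by (simp add: Pn_def scaleR_scaleC cscale_algebra)

text \<open>The factor \<open>A\<close> in \<open>g\<close> turns the resolvent into the uniformly
  bounded \<open>AR\<close>, and the prefactor \<open>1 / (n + 1)\<close> is left over.\<close>

lemma Pn_g: "(\<lambda>n. Pn n (g y)) \<longlonglongrightarrow> 0"
proof (rule Lim_null_comparison)
  show "\<forall>\<^sub>F n in sequentially. norm (Pn n (g y)) \<le> inverse (real (Suc n)) * ((1 + M) * norm (B (B y)))"
  proof (intro always_eventually allI)
    fix n
    have s: "- complex_of_real (1 / real (Suc n)) \<in> S" by (intro S_neg) auto
    have "norm (Pn n (g y)) = inverse (real (Suc n)) * norm (AR (- of_real (1 / real (Suc n))) (B (B y)))"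
      unfolding Pn_def g_def R_Bc[OF s] by (simp add: divide_inverse del: of_nat_Suc of_real_divide)
    also have "\<dots> \<le> inverse (real (Suc n)) * ((1 + M) * norm (B (B y)))" by (intro mult_left_mono norm_AR s) auto
    finally show "norm (Pn n (g y)) \<le> inverse (real (Suc n)) * ((1 + M) * norm (B (B y)))" .
  qed
  show "(\<lambda>n. inverse (real (Suc n)) * ((1 + M) * norm (B (B y)))) \<longlonglongrightarrow> 0"
    by (intro tendsto_mult_left_zero LIMSEQ_inverse_real_of_nat)
qed

lemma P_lim: "(\<lambda>n. Pn n x) \<longlonglongrightarrow> P x" and P_bop: "bounded_op P" and P_norm: "norm (P x) \<le> M * norm x"
proof -
  have conv: "convergent (\<lambda>n. Pn n x)" if x: "x \<in> {p + g y | p y. p \<in> Ker}" for x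
  proof -
    obtain p y where "x = p + g y" "p \<in> Ker" using x by auto
    then have "(\<lambda>n. Pn n x) \<longlonglongrightarrow> p + 0"
      using tendsto_add[OF tendsto_const[of p] Pn_g[of y]]
      by (simp add: bounded_opD[OF commutesD(1)[OF Pn_commutes]] Pn_Ker)
    then show ?thesis by (auto simp: convergent_def)
  qed
  note * = strong_limit[OF commutesD(1)[OF Pn_commutes] Pn_norm dense_g conv]
  show "(\<lambda>n. Pn n x) \<longlonglongrightarrow> P x" unfolding P_def by (rule *(1))
  show "bounded_op P" unfolding P_def[abs_def] by (rule *(2))
  show "norm (P x) \<le> M * norm x" unfolding P_def by (rule *(3))
qed

lemma P_Ker: "p \<in> Ker \<Longrightarrow> P p = p"
  by (simp add: P_def Pn_Ker)

lemma P_g: "P (g y) = 0"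
  unfolding P_def by (rule limI[OF Pn_g])

lemma commute_P: 
  assumes "bounded_op T" "\<And>z x. z \<in> S \<Longrightarrow> T (R z x) = R z (T x)"
  shows "T (P x) = P (T x)"
proof (rule LIMSEQ_unique)
  show "(\<lambda>n. T (Pn n x)) \<longlonglongrightarrow> T (P x)"
    by (rule bounded_linear.tendsto[OF bounded_opD(3)[OF assms(1)] P_lim])
  have "T (Pn n x) = Pn n (T x)" for n
  proof -
    have "- complex_of_real (1 / real (Suc n)) \<in> S" by (intro S_neg) auto
    from assms(2)[OF this] show ?thesis by (simp add: Pn_def bounded_opD[OF assms(1)] del: of_nat_Suc)
  qed
  then show "(\<lambda>n. T (Pn n x)) \<longlonglongrightarrow> P (T x)" using P_lim[of "T x"] by simp
qed

lemma P_commutes: "commutes P"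
  unfolding commutes_def using P_bop commute_P[OF bop R_commute] by auto

lemma P_in_Ker: "P x \<in> Ker"
proof -
  have "closed Ker" unfolding Ker_def
    by (intro closed_Collect_eq continuous_on_id linear_continuous_on B_lin)
  moreover have "P ` closure {p + g y | p y. p \<in> Ker} \<subseteq> Ker"
    by (rule image_closure_subset)
      (auto intro!: linear_continuous_on bounded_opD(3)[OF P_bop] \<open>closed Ker\<close> simp: bounded_opD[OF P_bop] P_Ker P_g)
  ultimately show ?thesis unfolding dense_g by auto
qed

end

section \<open>The dyadic representation of the semigroup\<close>

text \<open>Averaging \<open>(L + \<Sum> \<epsilon> a) (J + \<Sum> \<epsilon> y)\<close> over all
  signs keeps only the diagonal. Bounds on the two signed sums thus control the sum of the products
  \<open>a \<kappa> (y \<kappa>)\<close>, for which the triangle inequality would lose the number of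
  terms.\<close>

lemma sign_average:
  fixes J :: "'a::complex_banach"
  assumes "finite F" "bounded_op L" "\<And>\<kappa>. \<kappa> \<in> F \<Longrightarrow> bounded_op (a \<kappa>)"
    and "\<And>\<epsilon>. (\<forall>\<kappa>. \<epsilon> \<kappa> = 1 \<or> \<epsilon> \<kappa> = (-1::real)) \<Longrightarrow>
       norm (L (J + (\<Sum>\<kappa>\<in>F. \<epsilon> \<kappa> *\<^sub>R y \<kappa>)) + (\<Sum>\<kappa>\<in>F. \<epsilon> \<kappa> *\<^sub>R a \<kappa> (J + (\<Sum>\<kappa>\<in>F. \<epsilon> \<kappa> *\<^sub>R y \<kappa>)))) \<le> c"
  shows "norm (L J + (\<Sum>\<kappa>\<in>F. a \<kappa> (y \<kappa>))) \<le> c"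
  using assms
proof (induction F arbitrary: L J rule: finite_induct)
  case empty
  from empty(3)[of "\<lambda>_. 1"] show ?case by simp
next
  case (insert k F)
  \<comment> \<open>The sign of \<open>k\<close> is fixed and its terms are absorbed into operator
    and vector; averaging over the two values of \<open>s\<close> afterwards removes the mixed
    terms.\<close>
  have *: "norm ((L (J + s *\<^sub>R y k) + s *\<^sub>R a k (J + s *\<^sub>R y k)) + (\<Sum>\<kappa>\<in>F. a \<kappa> (y \<kappa>))) \<le> c"
    if s: "s = 1 \<or> s = (-1::real)" for s
  proof (rule insert.IH[of "\<lambda>x. L x + s *\<^sub>R a k x" "J + s *\<^sub>R y k"])
    show "bounded_op (\<lambda>x. L x + s *\<^sub>R a k x)"
      unfolding scaleR_scaleC using insert.prems by (intro bounded_op_add bounded_op_scaleC) auto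
    fix \<epsilon> :: "'b \<Rightarrow> real" assume \<epsilon>: "\<forall>\<kappa>. \<epsilon> \<kappa> = 1 \<or> \<epsilon> \<kappa> = -1"
    let ?\<epsilon> = "\<epsilon>(k := s)"
    have eq: "(\<Sum>\<kappa>\<in>F. ?\<epsilon> \<kappa> *\<^sub>R z \<kappa>) = (\<Sum>\<kappa>\<in>F. \<epsilon> \<kappa> *\<^sub>R z \<kappa>)" for z :: "'b \<Rightarrow> 'a"
      using insert.hyps by (intro sum.cong) auto
    have "\<forall>\<kappa>. ?\<epsilon> \<kappa> = 1 \<or> ?\<epsilon> \<kappa> = -1" using \<epsilon> s by auto
    from insert.prems(3)[OF this]
    show "norm (L (J + s *\<^sub>R y k + (\<Sum>\<kappa>\<in>F. \<epsilon> \<kappa> *\<^sub>R y \<kappa>)) + s *\<^sub>R a k (J + s *\<^sub>R y k + (\<Sum>\<kappa>\<in>F. \<epsilon> \<kappa> *\<^sub>R y \<kappa>))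
       + (\<Sum>\<kappa>\<in>F. \<epsilon> \<kappa> *\<^sub>R a \<kappa> (J + s *\<^sub>R y k + (\<Sum>\<kappa>\<in>F. \<epsilon> \<kappa> *\<^sub>R y \<kappa>)))) \<le> c"
      using insert.hyps by (simp add: eq add.assoc fun_upd_same del: fun_upd_apply)
  qed (use insert.prems in auto)
  let ?s = "\<Sum>\<kappa>\<in>F. a \<kappa> (y \<kappa>)"
  let ?f = "\<lambda>s::real. (L (J + s *\<^sub>R y k) + s *\<^sub>R a k (J + s *\<^sub>R y k)) + ?s"
  have L: "bounded_op L" and ak: "bounded_op (a k)" using insert.prems by auto
  have "L J + (\<Sum>\<kappa>\<in>insert k F. a \<kappa> (y \<kappa>)) = (1/2) *\<^sub>R (?f 1 + ?f (-1))"
    using insert.hyps by (simp add: bounded_opD[OF L] bounded_opD[OF ak] algebra_simps scaleR_2[symmetric])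
  also have "norm \<dots> \<le> (1/2) * (c + c)"
    using *[of 1] *[of "-1"] norm_triangle_ineq[of "?f 1" "?f (-1)"] by (simp only: norm_scaleR) simp
  finally show ?case by simp
qed

lemma geometric_limit:
  fixes f :: "nat \<Rightarrow> 'a::banach"
  assumes "\<And>n. norm (f (Suc n) - f n) \<le> c * (1/2)^n"
  shows "\<exists>l. f \<longlonglongrightarrow> l \<and> (\<forall>n. norm (f n - l) \<le> 2 * c * (1/2)^n)"
proof -
  have s: "norm (f (n + k) - f n) \<le> c * (1/2)^n * (\<Sum>i<k. (1/2)^i)" for n k
  proof (induction k)
    case (Suc k)
    have "norm (f (n + Suc k) - f n) \<le> norm (f (Suc (n + k)) - f (n + k)) + norm (f (n + k) - f n)"
      using norm_triangle_ineq[of "f (Suc (n + k)) - f (n + k)" "f (n + k) - f n"] by simp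
    also have "\<dots> \<le> c * (1/2)^(n+k) + c * (1/2)^n * (\<Sum>i<k. (1/2)^i)" by (intro add_mono assms Suc)
    finally show ?case by (simp add: algebra_simps power_add)
  qed simp
  have c: "c \<ge> 0" using order_trans[OF norm_ge_zero assms[of 0]] by simp
  have geo: "(\<Sum>i<k. (1/2::real)^i) \<le> 2" for k
  proof -
    have "(\<Sum>i<k. (1/2::real)^i) = 2 - 2 * (1/2)^k" by (induction k) auto
    then show ?thesis by simp
  qed
  have b: "norm (f (n + k) - f n) \<le> 2 * c * (1/2)^n" for n k
  proof -
    have "c * (1/2)^n * (\<Sum>i<k. (1/2)^i) \<le> c * (1/2)^n * 2" using c by (intro mult_left_mono geo) auto
    then show ?thesis using s[of n k] by simp
  qed
  have z: "(\<lambda>n. 2 * c * (1/2)^n) \<longlonglongrightarrow> 0" by (intro tendsto_mult_right_zero LIMSEQ_realpow_zero) auto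
  have "Cauchy f"
  proof (rule CauchyI')
    fix e :: real assume "e > 0"
    then obtain N where N: "2 * c * (1/2)^N < e / 2"
      using z c by (fastforce dest!: LIMSEQ_D[of _ _ "e/2"])
    show "\<exists>M. \<forall>m\<ge>M. \<forall>n>m. dist (f m) (f n) < e"
    proof (intro exI[of _ N] allI impI)
      fix m n assume "N \<le> m" "m < n"
      then obtain k where n: "n = m + k" by (metis less_imp_add_positive)
      have "dist (f m) (f n) \<le> 2 * c * (1/2)^m" using b[of m k] by (simp add: n dist_norm norm_minus_commute)
      also have "\<dots> \<le> 2 * c * (1/2)^N" using c \<open>N \<le> m\<close> by (intro mult_left_mono power_decreasing) auto
      also have "\<dots> < e" using N \<open>e > 0\<close> by simp
      finally show "dist (f m) (f n) < e" .
    qed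
  qed
  then obtain l where l: "f \<longlonglongrightarrow> l" by (auto simp: Cauchy_convergent_iff convergent_def)
  have "norm (f n - l) \<le> 2 * c * (1/2)^n" for n
  proof (rule tendsto_upperbound)
    show "(\<lambda>k. norm (f n - f (k + n))) \<longlonglongrightarrow> norm (f n - l)"
      by (intro tendsto_norm tendsto_diff tendsto_const LIMSEQ_ignore_initial_segment l)
    show "\<forall>\<^sub>F k in sequentially. norm (f n - f (k + n)) \<le> 2 * c * (1/2)^n"
      using b[of n] by (simp add: norm_minus_commute add.commute)
  qed simp
  with l show ?thesis by blast
qed

definition lam :: "bool \<times> int \<Rightarrow> real \<Rightarrow> real" where
  "lam \<kappa> u = (if fst \<kappa> then 1 else -1) * (2 powi snd \<kappa>) * (1 + u)"

text \<open>\<open>12 / pi\<close> is \<open>24 / (2 pi)\<close>: closing the contour on the left,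
  the coefficient \<open>- 1 / 24\<close> of \<open>R(-w)\<close> in \<open>mm_pf\<close> yields
  \<open>2 pi / 24\<close> times the exponential. The factor \<open>- i\<close> makes
  \<open>kc * i\<close> positive.\<close>

definition kc :: complex where "kc = - (12 / pi) * \<i>"

lemma norm_kc: "cmod kc \<le> 4"
  using pi_gt3 by (simp add: kc_def norm_mult norm_divide divide_le_eq)

lemma lam_nz: "0 \<le> u \<Longrightarrow> lam \<kappa> u \<noteq> 0"
  by (auto simp: lam_def)

lemma lam_abs: "0 \<le> u \<Longrightarrow> \<bar>lam \<kappa> u\<bar> = 2 powi snd \<kappa> * (1 + u)"
  by (auto simp: lam_def abs_mult)

lemma lam_ge: "0 \<le> u \<Longrightarrow> 2 powi snd \<kappa> \<le> \<bar>lam \<kappa> u\<bar>"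
  by (simp add: lam_abs)

lemma lam_cont: "continuous_on A (lam \<kappa>)"
  unfolding lam_def by (intro continuous_intros)

text \<open>The upper end is strict because index \<open>k\<close> covers \<open>2^k\<close> to
  \<open>2^(k+1)\<close>; together the intervals fill
  \<open>1/2^n \<le> \<bar>l\<bar> \<le> 2^n\<close>.\<close>

definition Fset :: "nat \<Rightarrow> (bool \<times> int) set" where "Fset n = UNIV \<times> {- int n..<int n}"

lemma finite_Fset: "finite (Fset n)" by (simp add: Fset_def)

context resolvent_family
begin

text \<open>For \<open>\<lambda> = lam \<kappa> u\<close> this makes \<open>Phi \<kappa> u = 2\<^sup>k A R(-i\<lambda>) R(i\<lambda>)\<close> and
  \<open>Psi \<kappa> u = kc \<lambda> A R(2i\<lambda>) R(3i\<lambda>)\<close>; the factor \<open>kc\<close> normalises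
  \<open>\<Sum>\<^sub>\<kappa> \<integral> Psi \<kappa> u (Phi \<kappa> u x) du\<close> to \<open>x\<close> on the closed range of \<open>A\<close>.\<close>
definition K1 :: "real \<Rightarrow> 'a \<Rightarrow> 'a" where "K1 l x = K (- (\<i> * of_real l)) (\<i> * of_real l) x"
definition K2 :: "real \<Rightarrow> 'a \<Rightarrow> 'a" where
  "K2 l x = of_real l *\<^sub>C K (2 * (\<i> * of_real l)) (3 * (\<i> * of_real l)) x"
definition Phi :: "bool \<times> int \<Rightarrow> real \<Rightarrow> 'a \<Rightarrow> 'a" where "Phi \<kappa> u x = (2 powi snd \<kappa>) *\<^sub>R K1 (lam \<kappa> u) x"
definition Psi :: "bool \<times> int \<Rightarrow> real \<Rightarrow> 'a \<Rightarrow> 'a" where "Psi \<kappa> u x = kc *\<^sub>C K2 (lam \<kappa> u) x"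
definition mm :: "real \<Rightarrow> 'a \<Rightarrow> 'a" where "mm l x = kc *\<^sub>C K2 l (K1 l x)"

lemma S_imag2: "l \<noteq> 0 \<Longrightarrow> 2 * (\<i> * of_real l) \<in> S" "l \<noteq> 0 \<Longrightarrow> 3 * (\<i> * of_real l) \<in> S"
  by (intro S_numeral S_imag; simp)+

lemma commutes_K1: "l \<noteq> 0 \<Longrightarrow> commutes (K1 l)"
  unfolding K1_def[abs_def] by (intro commutes_K S_imag)

lemma commutes_K2: "l \<noteq> 0 \<Longrightarrow> commutes (K2 l)"
  unfolding K2_def[abs_def] by (intro commutes_scaleC commutes_K S_imag2)

lemma commutes_Phi: "0 \<le> u \<Longrightarrow> commutes (Phi \<kappa> u)"
  unfolding Phi_def[abs_def] by (intro commutes_scaleR commutes_K1 lam_nz)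

lemma commutes_Psi: "0 \<le> u \<Longrightarrow> commutes (Psi \<kappa> u)"
  unfolding Psi_def[abs_def] by (intro commutes_scaleC commutes_K2 lam_nz)

lemma commutes_mm: "l \<noteq> 0 \<Longrightarrow> commutes (mm l)"
  unfolding mm_def[abs_def] by (rule commutes_scaleC[OF commutes_comp[OF commutes_K2 commutes_K1]])

lemma commute_K1: "commutes T \<Longrightarrow> l \<noteq> 0 \<Longrightarrow> T (K1 l x) = K1 l (T x)"
  by (simp add: K1_def commute_K S_imag)

lemma commute_K2: "commutes T \<Longrightarrow> l \<noteq> 0 \<Longrightarrow> T (K2 l x) = K2 l (T x)"
  by (simp add: K2_def commute_K S_imag2 bounded_opD commutesD)

lemma commute_Phi: "commutes T \<Longrightarrow> 0 \<le> u \<Longrightarrow> T (Phi \<kappa> u x) = Phi \<kappa> u (T x)"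
  by (simp add: Phi_def commute_K1 lam_nz bounded_opD commutesD)

lemma commute_Psi: "commutes T \<Longrightarrow> 0 \<le> u \<Longrightarrow> T (Psi \<kappa> u x) = Psi \<kappa> u (T x)"
  by (simp add: Psi_def commute_K2 lam_nz bounded_opD commutesD)

lemmas K2_lin = bounded_opD[OF commutesD(1)[OF commutes_K2]]
lemmas Phi_lin = bounded_opD[OF commutesD(1)[OF commutes_Phi]]
lemmas Psi_lin = bounded_opD[OF commutesD(1)[OF commutes_Psi]]

lemma K_cont':
  fixes T :: "'b::topological_space set"
  assumes "continuous_on T w" "continuous_on T v" "continuous_on T f"
    "\<And>t. t \<in> T \<Longrightarrow> w t \<in> S" "\<And>t. t \<in> T \<Longrightarrow> v t \<in> S"
  shows "continuous_on T (\<lambda>t. K (w t) (v t) (f t))"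
  unfolding K_def AR_def by (intro continuous_intros R_cont' assms)

lemma K1_cont':
  fixes T :: "'b::topological_space set"
  assumes "continuous_on T l" "continuous_on T f" "\<And>t. t \<in> T \<Longrightarrow> l t \<noteq> 0"
  shows "continuous_on T (\<lambda>t. K1 (l t) (f t))"
  unfolding K1_def by (intro K_cont' continuous_intros assms S_imag)

lemma K2_cont':
  fixes T :: "'b::topological_space set"
  assumes "continuous_on T l" "continuous_on T f" "\<And>t. t \<in> T \<Longrightarrow> l t \<noteq> 0"
  shows "continuous_on T (\<lambda>t. K2 (l t) (f t))"
  unfolding K2_def by (intro K_cont' continuous_intros assms S_imag2)

lemma mm_cont':
  fixes T :: "'b::topological_space set"
  assumes "continuous_on T l" "continuous_on T f" "\<And>t. t \<in> T \<Longrightarrow> l t \<noteq> 0"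
  shows "continuous_on T (\<lambda>t. mm (l t) (f t))"
  unfolding mm_def by (intro K1_cont' K2_cont' continuous_intros assms)

lemma Phi_cont: "A \<subseteq> {0..} \<Longrightarrow> continuous_on A f \<Longrightarrow> continuous_on A (\<lambda>u. Phi \<kappa> u (f u))"
  unfolding Phi_def by (intro continuous_intros K1_cont' lam_cont lam_nz) auto

lemma Psi_cont: "A \<subseteq> {0..} \<Longrightarrow> continuous_on A f \<Longrightarrow> continuous_on A (\<lambda>u. Psi \<kappa> u (f u))"
  unfolding Psi_def by (intro continuous_intros K2_cont' lam_cont lam_nz) auto

lemma norm_K1_g: "l \<noteq> 0 \<Longrightarrow> norm (K1 l (g x)) \<le> (1 + M)^4 * norm x"
  "l \<noteq> 0 \<Longrightarrow> norm (K1 l (g x)) \<le> (1 + M)^4 / l\<^sup>2 * norm x"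
  using norm_K_g_zero[OF S_imag(2,1), of l l x] norm_K_g_infty[OF S_imag(2,1), of l l x]
  by (simp_all add: K1_def norm_mult power2_eq_square abs_mult[symmetric])

lemma norm_K2:
  assumes "l \<noteq> 0" shows "norm (K2 l x) \<le> (1 + M)^2 * norm x"
proof -
  have "norm (K2 l x) = \<bar>l\<bar> * norm (K (2 * (\<i> * of_real l)) (3 * (\<i> * of_real l)) x)" by (simp add: K2_def)
  also have "\<dots> \<le> \<bar>l\<bar> * ((1 + M)^2 / cmod (3 * (\<i> * of_real l)) * norm x)"
    by (intro mult_left_mono norm_K S_imag2 assms) auto
  also have "\<dots> = ((1 + M)^2 * norm x) * (1/3)" using assms by (simp add: norm_mult)
  also have "\<dots> \<le> (1 + M)^2 * norm x" by (intro mult_right_le_one_le) auto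
  finally show ?thesis .
qed

text \<open>Decay at both ends of the dyadic scale: for \<open>k \<ge> 0\<close> the square of
  \<open>lam\<close> is at least \<open>4^k\<close>, for \<open>k < 0\<close> the prefactor alone
  suffices.\<close>

lemma two_powi_bounds:
  assumes "0 \<le> u"
  shows "2 powi snd \<kappa> * min 1 (1 / (lam \<kappa> u)\<^sup>2) \<le> (1/2) ^ nat \<bar>snd \<kappa>\<bar>"
proof (cases "snd \<kappa> \<ge> 0")
  case True
  then have k: "(2::real) powi snd \<kappa> = 2 ^ nat \<bar>snd \<kappa>\<bar>" by (simp add: power_int_def)
  have p: "(2::real) powi snd \<kappa> > 0" by simp
  have "2 powi snd \<kappa> * min 1 (1 / (lam \<kappa> u)\<^sup>2) \<le> 2 powi snd \<kappa> * (1 / (2 powi snd \<kappa>)\<^sup>2)"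
    using lam_ge[OF assms, of \<kappa>] lam_nz[OF assms, of \<kappa>] p
    by (intro mult_left_mono min.coboundedI2 divide_left_mono)
      (auto simp: abs_le_square_iff[symmetric] intro!: mult_pos_pos)
  also have "\<dots> = (1/2) ^ nat \<bar>snd \<kappa>\<bar>" by (simp add: k power2_eq_square power_divide)
  finally show ?thesis .
next
  case False
  then have "(2::real) powi snd \<kappa> = (1/2) ^ nat \<bar>snd \<kappa>\<bar>" by (simp add: power_int_def power_one_over inverse_eq_divide)
  moreover have "2 powi snd \<kappa> * min 1 (1 / (lam \<kappa> u)\<^sup>2) \<le> 2 powi snd \<kappa> * 1"
    by (intro mult_left_mono) auto
  ultimately show ?thesis by simp
qed

lemma norm_Phi_g:
  assumes u: "0 \<le> u"
  shows "norm (Phi \<kappa> u (g x)) \<le> (1 + M)^4 * (1/2) ^ nat \<bar>snd \<kappa>\<bar> * norm x"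
proof -
  let ?b = "(1 + M)^4 * norm x"
  have "norm (K1 (lam \<kappa> u) (g x)) \<le> ?b * min 1 (1 / (lam \<kappa> u)\<^sup>2)"
    using norm_K1_g[OF lam_nz[OF u], of \<kappa> x] by (auto simp: min_def)
  then have "norm (Phi \<kappa> u (g x)) \<le> 2 powi snd \<kappa> * (?b * min 1 (1 / (lam \<kappa> u)\<^sup>2))"
    unfolding Phi_def by (simp add: mult_left_mono)
  also have "\<dots> = ?b * (2 powi snd \<kappa> * min 1 (1 / (lam \<kappa> u)\<^sup>2))" by (simp only: mult_ac)
  also have "\<dots> \<le> ?b * (1/2) ^ nat \<bar>snd \<kappa>\<bar>"
    using M by (intro mult_left_mono two_powi_bounds u) auto
  finally show ?thesis by (simp add: mult_ac)
qed

lemma norm_PsiPhi_g: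
  assumes "0 \<le> u"
  shows "norm (Psi \<kappa> u (Phi \<kappa> u (g x))) \<le> 4 * (1 + M)^6 * (1/2)^(nat \<bar>snd \<kappa>\<bar>) * norm x"
proof -
  let ?l = "lam \<kappa> u" and ?N = "1 + M" and ?k = "snd \<kappa>"
  have l: "?l \<noteq> 0" by (rule lam_nz[OF assms])
  from norm_comp[OF norm_Phi_g[OF assms] norm_K2[OF l] nn(2)]
  have *: "norm (K2 ?l (Phi \<kappa> u (g x))) \<le> ?N\<^sup>2 * (?N^4 * (1/2)^(nat \<bar>?k\<bar>)) * norm x" .
  have "norm (Psi \<kappa> u (Phi \<kappa> u (g x))) \<le> 4 * (?N\<^sup>2 * (?N^4 * (1/2)^(nat \<bar>?k\<bar>)) * norm x)"
    unfolding Psi_def norm_scaleC using norm_kc * by (intro mult_mono) auto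
  also have "?N\<^sup>2 * (?N^4 * (1/2)^(nat \<bar>?k\<bar>)) = ?N^6 * (1/2)^(nat \<bar>?k\<bar>)"
    by (simp add: mult.assoc[symmetric] power_add[symmetric])
  finally show ?thesis by simp
qed

text \<open>The power of 2 placed in \<open>Phi\<close> is the Jacobian of
  \<open>u \<mapsto> lam \<kappa> u\<close> up to sign, so \<open>mm\<close> is the density in the
  frequency variable.\<close>

lemma PsiPhi_mm: "0 \<le> u \<Longrightarrow> Psi \<kappa> u (Phi \<kappa> u x) = (2 powi snd \<kappa>) *\<^sub>R mm (lam \<kappa> u) x"
  by (simp add: Psi_def Phi_def mm_def K2_lin lam_nz scaleR_scaleC mult.commute)

text \<open>The pole at \<open>-i l\<close> is the only one that contributes to \<open>\<integral> exp(i t l) mm l dl\<close>, \<open>t > 0\<close>.\<close>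
lemma mm_pf:
  assumes l: "l \<noteq> 0"
  defines "w \<equiv> \<i> * of_real l"
  shows "mm l x = (kc * \<i>) *\<^sub>C ((1/4) *\<^sub>C R w x - (4/3) *\<^sub>C R (2*w) x + (9/8) *\<^sub>C R (3*w) x - (1/24) *\<^sub>C R (-w) x)"
proof -
  have wS: "w \<in> S" "-w \<in> S" "2*w \<in> S" "3*w \<in> S" using S_imag[OF l] S_imag2[OF l] by (simp_all add: w_def)
  have w0: "w \<noteq> 0" by (rule S_nz[OF wS(1)])
  have K2': "K2 l y = (-\<i> * w) *\<^sub>C (2 *\<^sub>C R (2*w) y - 3 *\<^sub>C R (3*w) y)" for y
    using K_pf[OF wS(3,4), of y] w0 by (simp add: K2_def w_def cscale_algebra)
  have K1': "K1 l y = (-1/2) *\<^sub>C (R w y + R (-w) y)" for y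
    using K_pf[OF wS(2,1), of y] w0 by (simp add: K1_def w_def[symmetric] cscale_algebra)
  have e: "R (2*w) (R w x) = (1/w) *\<^sub>C (R w x - R (2*w) x)"
    "R (2*w) (R (-w) x) = (1/(3*w)) *\<^sub>C (R (-w) x - R (2*w) x)"
    "R (3*w) (R w x) = (1/(2*w)) *\<^sub>C (R w x - R (3*w) x)"
    "R (3*w) (R (-w) x) = (1/(4*w)) *\<^sub>C (R (-w) x - R (3*w) x)"
    using R_prod[OF wS(3,1), of x] R_prod[OF wS(3,2), of x] R_prod[OF wS(4,1), of x] R_prod[OF wS(4,2), of x] w0
    by (simp_all add: cscale_algebra)
  have c4: "a *\<^sub>C R w x + b *\<^sub>C R (2*w) x + c *\<^sub>C R (3*w) x + d *\<^sub>C R (-w) x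
     = a' *\<^sub>C R w x + b' *\<^sub>C R (2*w) x + c' *\<^sub>C R (3*w) x + d' *\<^sub>C R (-w) x"
    if "a = a'" "b = b'" "c = c'" "d = d'" for a b c d a' b' c' d' using that by simp
  have "K2 l (K1 l x) = (\<i> * w / 2) *\<^sub>C (2 *\<^sub>C (R (2*w) (R w x) + R (2*w) (R (-w) x)) - 3 *\<^sub>C (R (3*w) (R w x) + R (3*w) (R (-w) x)))"
    unfolding K1' K2' by (simp add: R_lin wS cscale_algebra)
  also have "\<dots> = \<i> *\<^sub>C ((1/4) *\<^sub>C R w x - (4/3) *\<^sub>C R (2*w) x + (9/8) *\<^sub>C R (3*w) x - (1/24) *\<^sub>C R (-w) x)"
  proof -
    have "(\<i> * w / 2) *\<^sub>C (2 *\<^sub>C (R (2*w) (R w x) + R (2*w) (R (-w) x)) - 3 *\<^sub>C (R (3*w) (R w x) + R (3*w) (R (-w) x)))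
      = (\<i> * w / 2 * (2 / w - 3 / (2 * w))) *\<^sub>C R w x + (\<i> * w / 2 * (- (2 / w) - 2 / (3 * w))) *\<^sub>C R (2*w) x
       + (\<i> * w / 2 * (3 / (2 * w) + 3 / (4 * w))) *\<^sub>C R (3*w) x + (\<i> * w / 2 * (2 / (3 * w) - 3 / (4 * w))) *\<^sub>C R (-w) x"
      unfolding e by (simp only: cscale_algebra scaleC_scaleC distrib_left right_diff_distrib) (simp add: cscale.minus_left)
    also have "\<dots> = (\<i> / 4) *\<^sub>C R w x + (- (\<i> * (4 / 3))) *\<^sub>C R (2*w) x + (\<i> * (9 / 8)) *\<^sub>C R (3*w) x + (- (\<i> / 24)) *\<^sub>C R (-w) x"
      using w0 by (intro c4) (simp_all add: field_simps)
    finally show ?thesis by (simp add: cscale_algebra)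
  qed
  finally show ?thesis by (simp add: mm_def)
qed

end

section \<open>Contour integrals in the left half-plane and the differential equation\<close>

context resolvent_family
begin

text \<open>Here \<open>exp(t w)\<close> is bounded by 1 for \<open>t \<ge> 0\<close>, and
  \<open>R(w)\<close>, \<open>R(2w)\<close>, \<open>R(3w)\<close> are holomorphic up to the
  imaginary axis; only \<open>R(-w)\<close> can meet the spectrum.\<close>

abbreviation "Lset \<equiv> {w :: complex. Re w \<le> 0 \<and> w \<noteq> 0}"

lemma Lset_S: "w \<in> Lset \<Longrightarrow> w \<in> S" by (auto intro: S_left)

lemma Lset_numeral: "w \<in> Lset \<Longrightarrow> numeral k * w \<in> Lset" by (auto simp: mult_nonneg_nonpos)

text \<open>A half turn from \<open>i r\<close> to \<open>- i r\<close> through the left half-plane.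
  As the directions are \<open>i\<close> and \<open>- i\<close>, the difference of the two rays is,
  up to a factor, the integral over the whole imaginary axis; \<open>pi c\<close> is the share of
  the large arc.\<close>

lemma rotate_left:
  fixes F :: "complex \<Rightarrow> 'a"
  assumes ab: "0 < a" "a \<le> b"
    and der: "\<And>w. w \<in> Lset \<Longrightarrow> cderiv F (F' w) w" and cont: "continuous_on Lset F'"
    and outer: "\<And>w. w \<in> Lset \<Longrightarrow> cmod w = b \<Longrightarrow> norm (w *\<^sub>C F w - c) \<le> e"
    and inner: "\<And>w. w \<in> Lset \<Longrightarrow> cmod w = a \<Longrightarrow> norm (w *\<^sub>C F w) \<le> e'"
  shows "norm (integral {a..b} (\<lambda>r. F (\<i> * of_real r) + F (- (\<i> * of_real r))) + pi *\<^sub>R c) \<le> (e + e') * pi"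
proof -
  have L: "of_real r * cis u \<in> Lset" if "0 < r" "u \<in> {pi/2..3*pi/2}" for r u
  proof -
    have "cos u = - sin (u - pi/2)" by (simp add: sin_diff)
    moreover have "0 \<le> sin (u - pi/2)" using that by (intro sin_ge_zero) auto
    ultimately have "cos u \<le> 0" by simp
    then show ?thesis using that by (simp add: mult_nonneg_nonpos)
  qed
  have sub: "(\<lambda>(r, u). of_real r * cis u) ` ({a..b} \<times> {pi/2..3*pi/2}) \<subseteq> Lset"
  proof safe
    fix r u assume "r \<in> {a..b}" "u \<in> {pi/2..3*pi/2}"
    then show "Re (of_real r * cis u) \<le> 0" "of_real r * cis u = 0 \<Longrightarrow> False" using L[of r u] ab by auto
  qed
  have c1: "cis (3*pi/2) = - \<i>" "cis (pi/2) = \<i>"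
  proof -
    have "cos (3*pi/2) = 0" "sin (3*pi/2) = -1"
      using cos_3over2_pi sin_3over2_pi by (simp_all add: mult.commute)
    then show "cis (3*pi/2) = - \<i>" by (simp add: complex_eq_iff)
  qed simp
  have r: "norm (integral {a..b} (\<lambda>r. cis (3*pi/2) *\<^sub>C F (of_real r * cis (3*pi/2)))
      - integral {a..b} (\<lambda>r. cis (pi/2) *\<^sub>C F (of_real r * cis (pi/2)))
      - (\<i> * of_real (3*pi/2 - pi/2)) *\<^sub>C c) \<le> (e + e') * (3*pi/2 - pi/2)"
  proof (rule integral_rotate_approx)
    show "a \<le> b" "pi/2 \<le> 3*pi/2" using ab by auto
    show "(F has_derivative (\<lambda>h. h *\<^sub>C F' (of_real r * cis u))) (at (of_real r * cis u))"
      if "r \<in> {a..b}" "u \<in> {pi/2..3*pi/2}" for r u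
      using der[OF L[of r u]] that ab by (simp add: cderiv_def)
    show "continuous_on ((\<lambda>(r, u). of_real r * cis u) ` ({a..b} \<times> {pi/2..3*pi/2})) F'"
      by (rule continuous_on_subset[OF cont sub])
    show "norm ((of_real b * cis u) *\<^sub>C F (of_real b * cis u) - c) \<le> e" if "u \<in> {pi/2..3*pi/2}" for u
      using outer[OF L[of b u]] that ab by (simp add: norm_mult)
    show "norm ((of_real a * cis u) *\<^sub>C F (of_real a * cis u)) \<le> e'" if "u \<in> {pi/2..3*pi/2}" for u
      using inner[OF L[of a u]] that ab by (simp add: norm_mult)
  qed
  have contF: "continuous_on Lset F"
    using der unfolding cderiv_def by (meson continuous_at_imp_continuous_on has_derivative_continuous)
  have i1: "(\<lambda>r. F (\<i> * of_real r)) integrable_on {a..b}" "(\<lambda>r. F (- (\<i> * of_real r))) integrable_on {a..b}"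
    using ab by (auto intro!: integrable_continuous_interval continuous_on_compose2[OF contF] continuous_intros)
  have "integral {a..b} (\<lambda>r. cis (3*pi/2) *\<^sub>C F (of_real r * cis (3*pi/2)))
      - integral {a..b} (\<lambda>r. cis (pi/2) *\<^sub>C F (of_real r * cis (pi/2)))
      = (- \<i>) *\<^sub>C integral {a..b} (\<lambda>r. F (\<i> * of_real r) + F (- (\<i> * of_real r)))"
    unfolding c1 using i1
    by (simp add: integral_add integral_cscale cscale_algebra mult.commute[of "of_real _" \<i>])
  moreover have "(- \<i>) *\<^sub>C X - (\<i> * of_real (3*pi/2 - pi/2)) *\<^sub>C c = (- \<i>) *\<^sub>C (X + pi *\<^sub>R c)" for X
    by (simp add: cscale_algebra scaleR_scaleC mult.commute)
  ultimately have "norm ((- \<i>) *\<^sub>C (integral {a..b} (\<lambda>r. F (\<i> * of_real r) + F (- (\<i> * of_real r))) + pi *\<^sub>R c))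
      \<le> (e + e') * (3*pi/2 - pi/2)" using r by metis
  then show ?thesis by (simp only: norm_scaleC) simp
qed

lemma R_deriv_scale:
  assumes "w \<in> Lset"
  shows "cderiv (\<lambda>w. R (numeral k * w) x) (numeral k *\<^sub>C - R (numeral k * w) (R (numeral k * w) x)) w"
proof -
  have d: "((\<lambda>w::complex. numeral k * w) has_derivative (\<lambda>h. numeral k * h)) (at w)"
    by (intro has_derivative_mult_right has_derivative_ident)
  show ?thesis
    using has_derivative_compose[OF d R_deriv[OF Lset_S[OF Lset_numeral[OF assms]], unfolded cderiv_def]]
    by (simp add: cderiv_def mult.commute)
qed

lemma R_deriv_L: "w \<in> Lset \<Longrightarrow> cderiv (\<lambda>w. R w x) (- R w (R w x)) w"
  by (rule R_deriv[OF Lset_S])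

lemma R_cont_L:
  "continuous_on Lset (\<lambda>w. R (numeral k * w) (R (numeral k * w) x))"
  "continuous_on Lset (\<lambda>w. R (numeral k * w) x)"
  "continuous_on Lset (\<lambda>w. R w (R w x))"
  "continuous_on Lset (\<lambda>w. R w x)"
  by (intro R_cont' continuous_intros Lset_S Lset_numeral; assumption)+

text \<open>The representation cut off to \<open>1/2^n \<le> \<bar>l\<bar> \<le> 2^n\<close>,
  without the projection onto the kernel.\<close>

definition TN :: "nat \<Rightarrow> real \<Rightarrow> 'a \<Rightarrow> 'a" where
  "TN n t x = (\<Sum>\<kappa>\<in>Fset n. integral {0..1} (\<lambda>u. cis (t * lam \<kappa> u) *\<^sub>C Psi \<kappa> u (Phi \<kappa> u x)))"

text \<open>Opposite frequencies are taken together, so that one integral over positive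
  \<open>r\<close> suffices.\<close>

definition hh :: "real \<Rightarrow> 'a \<Rightarrow> real \<Rightarrow> 'a" where
  "hh t x r = cis (t * r) *\<^sub>C mm r x + cis (- (t * r)) *\<^sub>C mm (- r) x"

lemma PsiPhi_cont: "continuous_on {0..1} (\<lambda>u. cis (t * lam \<kappa> u) *\<^sub>C Psi \<kappa> u (Phi \<kappa> u x))"
  by (intro continuous_intros continuous_on_cis' lam_cont Psi_cont Phi_cont) auto

lemma hh_cont: "A \<subseteq> {0<..} \<Longrightarrow> continuous_on A (hh t x)"
  unfolding hh_def by (intro continuous_intros continuous_on_cis' mm_cont') auto

text \<open>Substitution \<open>r = 2^k (1 + u)\<close>, carried out on an antiderivative of
  \<open>hh\<close>.\<close>

lemma hh_piece:
  "(\<Sum>s\<in>UNIV. integral {0..1} (\<lambda>u. cis (t * lam (s, k) u) *\<^sub>C Psi (s, k) u (Phi (s, k) u x)))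
    = integral {2 powi k..2 powi (k + 1)} (hh t x)"
proof -
  let ?p = "(2::real) powi k"
  have p: "?p > 0" by simp
  have p1: "(2::real) powi (k + 1) = ?p * 2" by (simp add: power_int_add)
  define G where "G = (\<lambda>s. integral {?p..s} (hh t x))"
  have c: "continuous_on {?p..?p*2} (hh t x)" by (intro hh_cont) (auto intro: less_le_trans[OF p])
  have "((\<lambda>u. ?p *\<^sub>R hh t x (?p * (1 + u))) has_integral G (?p * (1 + 1)) - G (?p * (1 + 0))) {0..1}"
  proof (intro fundamental_theorem_of_calculus)
    fix u :: real assume u: "u \<in> {0..1}"
    have 1: "((\<lambda>u. ?p * (1 + u)) has_vector_derivative ?p) (at u within {0..1})"
      by (rule derivative_eq_intros refl | simp)+
    have "?p * (1 + u) \<in> {?p..?p*2}" using u p by auto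
    from integral_has_vector_derivative[OF c this]
    have 2: "(G has_vector_derivative hh t x (?p * (1 + u))) (at (?p * (1 + u)) within {?p..?p*2})"
      unfolding G_def .
    have "(G has_vector_derivative hh t x (?p * (1 + u))) (at (?p * (1 + u)) within (\<lambda>u. ?p * (1 + u)) ` {0..1})"
      using p by (intro has_vector_derivative_within_subset[OF 2]) auto
    from vector_diff_chain_within[OF 1 this]
    show "((\<lambda>u. G (?p * (1 + u))) has_vector_derivative ?p *\<^sub>R hh t x (?p * (1 + u))) (at u within {0..1})"
      by (simp add: o_def)
  qed simp
  from integral_unique[OF this]
  have I: "integral {0..1} (\<lambda>u. ?p *\<^sub>R hh t x (?p * (1 + u))) = integral {?p..?p*2} (hh t x)"
    by (simp add: G_def)
  have "(\<Sum>s\<in>UNIV. integral {0..1} (\<lambda>u. cis (t * lam (s, k) u) *\<^sub>C Psi (s, k) u (Phi (s, k) u x)))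
     = integral {0..1} (\<lambda>u. \<Sum>s\<in>UNIV. cis (t * lam (s, k) u) *\<^sub>C Psi (s, k) u (Phi (s, k) u x))"
    by (intro integral_sum[symmetric]) (auto intro!: integrable_continuous_interval PsiPhi_cont)
  also have "\<dots> = integral {0..1} (\<lambda>u. ?p *\<^sub>R hh t x (?p * (1 + u)))"
    by (intro integral_cong)
      (simp add: UNIV_bool PsiPhi_mm hh_def lam_def scaleR_scaleC cscale_algebra mult_ac add.commute)
  finally show ?thesis unfolding I p1 .
qed

text \<open>The half-open range gains \<open>n\<close> at the top but \<open>- (n + 1)\<close> at
  the bottom.\<close>

lemma Fset_Suc_sum: 
  "(\<Sum>\<kappa>\<in>Fset (Suc n). f \<kappa>) = (\<Sum>\<kappa>\<in>Fset n. f \<kappa>) + ((\<Sum>s\<in>UNIV. f (s, int n)) + (\<Sum>s\<in>UNIV. f (s, - int (Suc n))))"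
  for f :: "bool \<times> int \<Rightarrow> 'b::ab_group_add"
proof -
  have "{- int (Suc n)..<int (Suc n)} = insert (int n) (insert (- int (Suc n)) {- int n..<int n})" by auto
  then have "(\<Sum>k\<in>{- int (Suc n)..<int (Suc n)}. h k) = (\<Sum>k\<in>{- int n..<int n}. h k) + (h (int n) + h (- int (Suc n)))" for h :: "int \<Rightarrow> 'b"
    by (simp add: algebra_simps)
  then have "(\<Sum>s\<in>UNIV. \<Sum>k\<in>{- int (Suc n)..<int (Suc n)}. f (s, k))
    = (\<Sum>s\<in>UNIV. \<Sum>k\<in>{- int n..<int n}. f (s, k)) + ((\<Sum>s\<in>UNIV. f (s, int n)) + (\<Sum>s\<in>UNIV. f (s, - int (Suc n))))"
    by (simp add: sum.distrib)
  then show ?thesis unfolding Fset_def sum.cartesian_product by (simp add: case_prod_beta')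
qed

lemma TN_hh: "TN n t x = integral {1/2^n..2^n} (hh t x)"
proof (induction n)
  case 0 then show ?case by (simp add: TN_def Fset_def)
next
  case (Suc n)
  have i: "hh t x integrable_on {a..b}" if "0 < a" for a b
    using that by (intro integrable_continuous_interval hh_cont) auto
  have p: "(2::real) powi (- int (Suc n)) = 1 / 2^Suc n" "(2::real) powi (- int (Suc n) + 1) = 1 / 2^n"
    "(2::real) powi (int n) = 2^n" "(2::real) powi (int n + 1) = 2^Suc n"
  proof -
    have m: "(2::real) powi (- int m) = 1 / 2^m" for m by (simp add: power_int_minus divide_inverse)
    show "(2::real) powi (- int (Suc n)) = 1 / 2^Suc n" by (rule m)
    have "- int (Suc n) + 1 = - int n" "int n + 1 = int (Suc n)" by simp_all
    then show "(2::real) powi (- int (Suc n) + 1) = 1 / 2^n" "(2::real) powi (int n + 1) = 2^Suc n"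
      by (simp_all only: m power_int_of_nat)
  qed simp
  have "TN (Suc n) t x = integral {1/2^n..2^n} (hh t x) + (integral {2^n..2^Suc n} (hh t x) + integral {1/2^Suc n..1/2^n} (hh t x))"
    unfolding TN_def Fset_Suc_sum using Suc by (simp only: hh_piece p TN_def)
  also have "integral {1/2^n..2^n} (hh t x) + integral {2^n..2^Suc n} (hh t x) = integral {1/2^n..2^Suc n} (hh t x)"
    by (intro Henstock_Kurzweil_Integration.integral_combine i) (auto simp: divide_le_eq simp flip: power_add mult_2)
  then have "integral {1/2^n..2^n} (hh t x) + (integral {2^n..2^Suc n} (hh t x) + integral {1/2^Suc n..1/2^n} (hh t x))
    = integral {1/2^Suc n..1/2^n} (hh t x) + integral {1/2^n..2^Suc n} (hh t x)" by simp
  also have "\<dots> = integral {1/2^Suc n..2^Suc n} (hh t x)"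
  proof (intro Henstock_Kurzweil_Integration.integral_combine i)
    have "(1::real) \<le> 2^Suc n * 2^n" using mult_mono[of 1 "2^Suc n" 1 "(2::real)^n"] by simp
    then show "1 / 2^n \<le> (2::real)^Suc n" by (simp add: divide_le_eq)
  qed (auto simp: field_simps)
  finally show ?case .
qed

lemma TN_comm: 
  assumes T: "bounded_op T" "\<And>z x. z \<in> S \<Longrightarrow> T (R z x) = R z (T x)"
  shows "T (TN n t x) = TN n t (T x)"
proof -
  have c: "commutes T" using T by (auto simp: commutes_def)
  have "T (TN n t x) = (\<Sum>\<kappa>\<in>Fset n. T (integral {0..1} (\<lambda>u. cis (t * lam \<kappa> u) *\<^sub>C Psi \<kappa> u (Phi \<kappa> u x))))"
    unfolding TN_def by (rule bounded_opD(8)[OF T(1)])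
  also have "\<dots> = (\<Sum>\<kappa>\<in>Fset n. integral {0..1} (\<lambda>u. T (cis (t * lam \<kappa> u) *\<^sub>C Psi \<kappa> u (Phi \<kappa> u x))))"
    by (intro sum.cong refl integral_linear[OF integrable_continuous_interval[OF PsiPhi_cont] bounded_opD(3)[OF T(1)], unfolded o_def, symmetric])
  also have "\<dots> = TN n t (T x)"
    unfolding TN_def by (intro sum.cong refl integral_cong) (simp add: bounded_opD[OF T(1)] commute_Psi[OF c] commute_Phi[OF c])
  finally show ?thesis .
qed

lemma TN_incr: "norm (TN (Suc n) t (g x) - TN n t (g x)) \<le> (16 * (1 + M)^6 * norm x) * (1/2)^n"
proof -
  define I where "I = (\<lambda>\<kappa>. integral {0..1} (\<lambda>u. cis (t * lam \<kappa> u) *\<^sub>C Psi \<kappa> u (Phi \<kappa> u (g x))))"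
  have b: "norm (I \<kappa>) \<le> (4 * (1 + M)^6 * norm x) * (1/2)^(nat \<bar>snd \<kappa>\<bar>)" for \<kappa>
  proof -
    have "norm (I \<kappa>) \<le> (4 * (1 + M)^6 * (1/2)^(nat \<bar>snd \<kappa>\<bar>) * norm x) * (1 - 0)"
      unfolding I_def by (rule integral_bound[OF _ PsiPhi_cont]) (simp_all add: norm_PsiPhi_g)
    then show ?thesis by (simp add: mult_ac)
  qed
  have "norm (TN (Suc n) t (g x) - TN n t (g x)) = norm ((I (True, int n) + I (False, int n)) + (I (True, - int (Suc n)) + I (False, - int (Suc n))))"
    unfolding TN_def Fset_Suc_sum I_def by (simp add: UNIV_bool add_ac)
  also have "\<dots> \<le> (norm (I (True, int n)) + norm (I (False, int n))) + (norm (I (True, - int (Suc n))) + norm (I (False, - int (Suc n))))"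
    by (intro norm_triangle_mono order_refl norm_triangle_ineq)
  also have "\<dots> \<le> ((4 * (1 + M)^6 * norm x) * (1/2)^n + (4 * (1 + M)^6 * norm x) * (1/2)^n)
     + ((4 * (1 + M)^6 * norm x) * (1/2)^n + (4 * (1 + M)^6 * norm x) * (1/2)^n)"
  proof -
    have "nat \<bar>- int (Suc n)\<bar> = Suc n" by simp
    then have "(1/2::real)^(nat \<bar>- int (Suc n)\<bar>) \<le> (1/2)^n" by simp
    then have "norm (I (s, - int (Suc n))) \<le> (4 * (1 + M)^6 * norm x) * (1/2)^n" for s
      using M by (intro order_trans[OF b]) (auto intro!: mult_left_mono)
    moreover have "norm (I (s, int n)) \<le> (4 * (1 + M)^6 * norm x) * (1/2)^n" for s using b[of "(s, int n)"] by simp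
    ultimately show ?thesis by (intro add_mono) auto
  qed
  finally show ?thesis by (simp add: algebra_simps)
qed

lemma TN_Ker: "p \<in> Ker \<Longrightarrow> TN n t p = 0"
proof -
  assume p: "p \<in> Ker"
  have "Phi \<kappa> u p = 0" if "0 \<le> u" for \<kappa> u
    using Ker_K[OF p S_imag(2,1)] lam_nz[OF that] by (simp add: Phi_def K1_def)
  then have "TN n t p = (\<Sum>\<kappa>\<in>Fset n. integral {0..1} (\<lambda>u::real. 0))"
    unfolding TN_def by (intro sum.cong integral_cong refl) (simp add: Psi_lin)
  then show ?thesis by simp
qed

definition TT :: "real \<Rightarrow> 'a \<Rightarrow> 'a" where "TT t x = lim (\<lambda>n. TN n t x)"

lemma TT_g: "(\<lambda>n. TN n t (g x)) \<longlonglongrightarrow> TT t (g x)"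
  "norm (TN n t (g x) - TT t (g x)) \<le> 2 * (16 * (1 + M)^6 * norm x) * (1/2)^n"
proof -
  obtain l where l: "(\<lambda>n. TN n t (g x)) \<longlonglongrightarrow> l" "\<And>n. norm (TN n t (g x) - l) \<le> 2 * (16 * (1 + M)^6 * norm x) * (1/2)^n"
    using geometric_limit[of "\<lambda>n. TN n t (g x)", OF TN_incr] by blast
  moreover have "l = TT t (g x)" unfolding TT_def using l(1) by (simp add: limI)
  ultimately show "(\<lambda>n. TN n t (g x)) \<longlonglongrightarrow> TT t (g x)"
    "norm (TN n t (g x) - TT t (g x)) \<le> 2 * (16 * (1 + M)^6 * norm x) * (1/2)^n" by auto
qed

text \<open>This is \<open>A g g = A^3 (1 + A)^-4\<close>, expressed through bounded operators
  only.\<close>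

definition ag :: "'a \<Rightarrow> 'a" where "ag y = g (Bc (Bc y))"

lemma ag_alt: "ag y = Bc (Bc (g y))"
  by (simp add: ag_def commute_g[OF commutes_Bc])

lemma AR_g: "w \<in> S \<Longrightarrow> AR w (g y) = R w (Bc (Bc y))"
  by (simp add: g_alt AR_B)

text \<open>The time derivative of \<open>TN\<close>, taken under the integral of
  \<open>TN_hh\<close>.\<close>

definition VN :: "nat \<Rightarrow> real \<Rightarrow> 'a \<Rightarrow> 'a" where
  "VN n t x = integral {1/2^n..2^n} (\<lambda>r. (\<i> * of_real r * cis (t * r)) *\<^sub>C mm r x - (\<i> * of_real r * cis (- (t * r))) *\<^sub>C mm (- r) x)"

lemma TN_deriv: "((\<lambda>t. TN n t x) has_vector_derivative VN n t x) (at t within U)"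
proof -
  have dcis: "((\<lambda>t. cis (t * c)) has_vector_derivative \<i> * of_real c * cis (t * c)) (at t within U)" for c t U
  proof -
    have "((\<lambda>t. t * c) has_vector_derivative c) (at t within U)" by (rule derivative_eq_intros refl | simp)+
    from vector_diff_chain_within[OF this has_vector_derivative_cis]
    show ?thesis by (simp add: o_def scaleR_conv_of_real mult_ac)
  qed
  have d: "((\<lambda>t. hh t x r) has_vector_derivative (\<i> * of_real r * cis (t * r)) *\<^sub>C mm r x - (\<i> * of_real r * cis (- (t * r))) *\<^sub>C mm (- r) x) (at t within U)"
    for t r U
    using has_vector_derivative_add[OF 
      bounded_linear.has_vector_derivative[OF cscale.bounded_linear_left[of "mm r x"] dcis[of r t U]]
      bounded_linear.has_vector_derivative[OF cscale.bounded_linear_left[of "mm (-r) x"] dcis[of "-r" t U]]]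
    by (simp add: hh_def[abs_def] cscale.minus_left)
  have "((\<lambda>t. integral (cbox (1/2^n) (2^n)) (hh t x)) has_vector_derivative
     integral (cbox (1/2^n) (2^n)) (\<lambda>r. (\<i> * of_real r * cis (t * r)) *\<^sub>C mm r x - (\<i> * of_real r * cis (- (t * r))) *\<^sub>C mm (- r) x)) (at t within UNIV)"
  proof (rule leibniz_rule_vector_derivative[where U = UNIV])
    have "0 < snd z" if "z \<in> UNIV \<times> cbox (1/2^n) (2^n)" for z :: "real \<times> real"
      using that by (auto intro: less_le_trans[of _ "1/2^n"])
    then have "snd z \<noteq> 0" "- snd z \<noteq> 0" if "z \<in> UNIV \<times> cbox (1/2^n) (2^n)" for z :: "real \<times> real"
      using that by fastforce+
    then show "continuous_on (UNIV \<times> cbox (1/2^n) (2^n)) (\<lambda>(t, r). (\<i> * of_real r * cis (t * r)) *\<^sub>C mm r x - (\<i> * of_real r * cis (- (t * r))) *\<^sub>C mm (- r) x)"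
      unfolding case_prod_beta by (intro continuous_intros continuous_on_cis' mm_cont')
    show "hh t x integrable_on cbox (1/2^n) (2^n)" for t
      unfolding cbox_interval by (intro integrable_continuous_interval hh_cont) (auto intro: less_le_trans[of _ "1/2^n"])
  qed (use d in auto)
  then show ?thesis unfolding TN_hh VN_def cbox_interval by (rule has_vector_derivative_within_subset) auto
qed

text \<open>What is left of \<open>(w + A) mm\<close> at \<open>w = i l\<close> after cancellation
  of \<open>R(-w)\<close>, in partial fractions and hence visibly holomorphic on the left
  half-plane.\<close>

definition Gf :: "'a \<Rightarrow> complex \<Rightarrow> 'a" where
  "Gf x w = (\<i> * kc * w) *\<^sub>C ((1/2) *\<^sub>C R w x - 4 *\<^sub>C R (2*w) x + (9/2) *\<^sub>C R (3*w) x)"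

lemma Gf_alt:
  assumes "w \<in> Lset"
  shows "Gf x w = (\<i> * kc * w) *\<^sub>C K (2*w) (3*w) (AR w x)"
proof -
  have wS: "w \<in> S" "2*w \<in> S" "3*w \<in> S" using assms Lset_S Lset_numeral by blast+
  have w0: "w \<noteq> 0" using assms by simp
  have e: "R (2*w) (R w x) = (1/w) *\<^sub>C (R w x - R (2*w) x)"
    "R (3*w) (R w x) = (1/(2*w)) *\<^sub>C (R w x - R (3*w) x)"
    using R_prod[OF wS(2,1), of x] R_prod[OF wS(3,1), of x] w0
    by (simp_all add: cscale_algebra)
  have "K (2*w) (3*w) (AR w x) = 2 *\<^sub>C R (2*w) (AR w x) - 3 *\<^sub>C R (3*w) (AR w x)"
    using K_pf[OF wS(2,3), of "AR w x"] w0 by (simp add: cscale_algebra)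
  also have "\<dots> = 2 *\<^sub>C (w *\<^sub>C R (2*w) (R w x) - R (2*w) x) - 3 *\<^sub>C (w *\<^sub>C R (3*w) (R w x) - R (3*w) x)"
    by (simp add: AR_def R_lin wS)
  also have "\<dots> = (2 - 3/2) *\<^sub>C R w x - (2 + 2) *\<^sub>C R (2*w) x + (3/2 + 3) *\<^sub>C R (3*w) x"
    unfolding e using w0 by (simp only: cscale_algebra scaleC_scaleC) (simp add: cscale_algebra)
  finally show ?thesis by (simp add: Gf_def)
qed

text \<open>Since \<open>(w + A) R(-w) = -1\<close>, adding \<open>A mm\<close> to
  \<open>w mm\<close> removes the only singular factor. \<open>Bc (Bc z)\<close> stands for
  \<open>A g z\<close>.\<close>

lemma Gf_mm:
  assumes l: "l \<noteq> 0"
  shows "(\<i> * of_real l) *\<^sub>C mm l (g z) + mm l (Bc (Bc z)) = Gf (g z) (\<i> * of_real l)"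
proof -
  let ?w = "\<i> * of_real l"
  have wS: "?w \<in> S" "- ?w \<in> S" "2 * ?w \<in> S" "3 * ?w \<in> S" using S_imag[OF l] S_imag2[OF l] by simp_all
  have L: "?w \<in> Lset" using l by simp
  have "K1 l (Bc (Bc z)) = K ?w (- ?w) (Bc (Bc z))" by (simp add: K1_def K_commute wS)
  also have "\<dots> = AR ?w (AR (- ?w) (g z))" by (simp add: K_def AR_g wS)
  also have "\<dots> = (- ?w) *\<^sub>C AR ?w (R (- ?w) (g z)) - AR ?w (g z)" by (simp add: AR_def[of "- ?w"] AR_lin[OF wS(1)])
  also have "AR ?w (R (- ?w) (g z)) = K1 l (g z)" using K_commute[OF wS(2,1), of "g z"] by (simp add: K1_def K_def)
  finally have "K1 l (Bc (Bc z)) = (- ?w) *\<^sub>C K1 l (g z) - AR ?w (g z)" .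
  then have "mm l (Bc (Bc z)) = (- ?w) *\<^sub>C mm l (g z) - kc *\<^sub>C K2 l (AR ?w (g z))"
    by (simp add: mm_def K2_lin l cscale_algebra mult.commute)
  then have "(\<i> * of_real l) *\<^sub>C mm l (g z) + mm l (Bc (Bc z)) = - (kc *\<^sub>C K2 l (AR ?w (g z)))"
    by (simp add: cscale.minus_left)
  also have "\<dots> = Gf (g z) ?w"
  proof -
    have "\<i> * kc * ?w = \<i> * (\<i> * (kc * of_real l))" by (simp only: mult_ac)
    then have "\<i> * kc * ?w = - (kc * of_real l)" by simp
    then show ?thesis unfolding Gf_alt[OF L] K2_def by (simp add: cscale.minus_left)
  qed
  finally show ?thesis .
qed

text \<open>One factor \<open>g\<close> compensates the square of \<open>w\<close> through the two
  resolvents in \<open>K\<close>; the other lets \<open>AR w (g y)\<close> contribute a further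
  \<open>1 / cmod w\<close>. So \<open>w Gf\<close> vanishes at 0 and at infinity.\<close>

lemma norm_Gf:
  assumes w: "w \<in> Lset"
  shows "norm (w *\<^sub>C Gf (g (g y)) w) \<le> 4 * (1 + M)^7 / cmod w * norm y"
    "norm (w *\<^sub>C Gf (g (g y)) w) \<le> 4 * (1 + M)^7 * (cmod w)\<^sup>2 * norm y"
proof -
  have wS: "w \<in> S" "2*w \<in> S" "3*w \<in> S" using w Lset_S Lset_numeral by blast+
  have w0: "cmod w > 0" using w by simp
  have eq: "norm (w *\<^sub>C Gf (g (g y)) w) = cmod kc * ((cmod w)\<^sup>2 * norm (K (2*w) (3*w) (g (AR w (g y)))))"
    unfolding Gf_alt[OF w] commute_AR[OF commutes_g wS(1), symmetric] by (simp add: norm_mult power2_eq_square)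
  have A: "norm (AR w (g y)) \<le> (1 + M)^3 / cmod w * norm y"
    using norm_comp[OF norm_comp[OF norm_Bc norm_Bc nn(1)] R_bd[OF wS(1)] nn(3), of y]
    by (simp add: AR_g[OF wS(1)] power3_eq_cube)
  have B: "norm (AR w (g y)) \<le> (1 + M)^3 * norm y"
    using norm_comp[OF norm_g norm_AR[OF wS(1)] nn(1)] by (simp add: power2_eq_square power3_eq_cube mult.assoc)
  have k: "norm (K (2*w) (3*w) (g z)) \<le> ((1 + M)^4 / (cmod w)\<^sup>2) * norm z" for z
  proof -
    have "norm (K (2*w) (3*w) (g z)) \<le> (1 + M)^4 / (cmod (2*w) * cmod (3*w)) * norm z" by (rule norm_K_g_infty[OF wS(2,3)])
    also have "\<dots> \<le> ((1 + M)^4 / (cmod w)\<^sup>2) * norm z"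
      using w0 M by (intro mult_right_mono divide_left_mono) (auto simp: norm_mult power2_eq_square)
    finally show ?thesis .
  qed
  have "(cmod w)\<^sup>2 * norm (K (2*w) (3*w) (g (AR w (g y)))) \<le> (cmod w)\<^sup>2 * (((1 + M)^4 / (cmod w)\<^sup>2 * ((1 + M)^3 / cmod w)) * norm y)"
    by (intro mult_left_mono norm_comp[OF A k] divide_nonneg_nonneg nn) auto
  also have "\<dots> = (1 + M)^7 / cmod w * norm y" using w0 by (simp add: power_add[symmetric])
  finally show "norm (w *\<^sub>C Gf (g (g y)) w) \<le> 4 * (1 + M)^7 / cmod w * norm y"
    unfolding eq using mult_mono[OF norm_kc, of _ "(1 + M)^7 / cmod w * norm y"] by (simp add: mult.assoc)
  have "(cmod w)\<^sup>2 * norm (K (2*w) (3*w) (g (AR w (g y)))) \<le> (cmod w)\<^sup>2 * (((1 + M)^4 * (1 + M)^3) * norm y)"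
    by (intro mult_left_mono norm_comp[OF B norm_K_g_zero[OF wS(2,3)]] nn) auto
  also have "\<dots> = (1 + M)^7 * (cmod w)\<^sup>2 * norm y" by (simp add: power_add[symmetric])
  finally show "norm (w *\<^sub>C Gf (g (g y)) w) \<le> 4 * (1 + M)^7 * (cmod w)\<^sup>2 * norm y"
    unfolding eq using mult_mono[OF norm_kc, of _ "(1 + M)^7 * (cmod w)\<^sup>2 * norm y"] by (simp add: mult.assoc)
qed

text \<open>The equation \<open>d/dt T = - A T\<close> for the truncations, with a geometric error:
  the integrand is \<open>exp(t w) Gf\<close> on the imaginary axis, and each arc of the half turn
  contributes a multiple of \<open>(1/2)^n\<close>.\<close>

lemma VN_TN:
  assumes t: "0 \<le> t"
  shows "norm (VN n t (g (g y)) + TN n t (ag y)) \<le> 8 * (1 + M)^7 * pi * norm y * (1/2)^n"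
proof -
  let ?x = "g (g y)"
  define D where "D = (\<lambda>w. (1/2) *\<^sub>C (- R w (R w ?x)) - 4 *\<^sub>C (2 *\<^sub>C - R (2*w) (R (2*w) ?x)) + (9/2) *\<^sub>C (3 *\<^sub>C - R (3*w) (R (3*w) ?x)))"
  define Y where "Y = (\<lambda>w. (1/2) *\<^sub>C R w ?x - 4 *\<^sub>C R (2*w) ?x + (9/2) *\<^sub>C R (3*w) ?x)"
  define F where "F = (\<lambda>w. exp (of_real t * w) *\<^sub>C Gf ?x w)"
  define F' where "F' = (\<lambda>w. exp (of_real t * w) *\<^sub>C ((\<i> * kc * w) *\<^sub>C D w + (\<i> * kc) *\<^sub>C Y w) + (of_real t * exp (of_real t * w)) *\<^sub>C ((\<i> * kc * w) *\<^sub>C Y w))"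
  have der: "cderiv F (F' w) w" if w: "w \<in> Lset" for w
  proof -
    have "cderiv Y (D w) w" unfolding Y_def D_def
      by (intro cderiv_add cderiv_diff cderiv_scale_const R_deriv_L R_deriv_scale w)
    moreover have "((\<lambda>w. \<i> * kc * w) has_field_derivative \<i> * kc) (at w)" by (rule derivative_eq_intros refl | simp)+
    moreover have "((\<lambda>w. exp (of_real t * w)) has_field_derivative of_real t * exp (of_real t * w)) (at w)"
      by (rule derivative_eq_intros refl | simp)+
    moreover have "F = (\<lambda>w. exp (of_real t * w) *\<^sub>C ((\<i> * kc * w) *\<^sub>C Y w))" by (simp add: F_def Gf_def Y_def fun_eq_iff)
    ultimately show ?thesis unfolding F'_def using cderiv_scale by blast
  qed
  have cont: "continuous_on Lset F'"
    unfolding F'_def D_def Y_def by (intro continuous_intros R_cont_L)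
  \<comment> \<open>Here the sign of \<open>t\<close> decides: for \<open>t \<ge> 0\<close> the
    contour may be closed on the left.\<close>
  have expb: "cmod (exp (of_real t * w)) \<le> 1" if "w \<in> Lset" for w
    using that t by (simp add: mult_nonneg_nonpos)
  have nF: "norm (w *\<^sub>C F w) \<le> norm (w *\<^sub>C Gf ?x w)" if "w \<in> Lset" for w
  proof -
    have "norm (w *\<^sub>C F w) = cmod (exp (of_real t * w)) * norm (w *\<^sub>C Gf ?x w)" by (simp add: F_def norm_mult)
    also have "\<dots> \<le> 1 * norm (w *\<^sub>C Gf ?x w)" by (intro mult_right_mono expb that) auto
    finally show ?thesis by simp
  qed
  have "norm (integral {1/2^n..2^n} (\<lambda>r. F (\<i> * of_real r) + F (- (\<i> * of_real r))) + pi *\<^sub>R 0)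
      \<le> (4 * (1 + M)^7 * norm y * (1/2)^n + 4 * (1 + M)^7 * norm y * (1/2)^n) * pi"
  proof (rule rotate_left[OF _ _ der cont])
    have "(1::real) \<le> 2^n" by simp
    then show "1/2^n \<le> (2::real)^n" using divide_le_eq_1[of 1 "2^n"] by (smt (verit))
  next
    fix w assume w: "w \<in> Lset" "cmod w = 2^n"
    show "norm (w *\<^sub>C F w - 0) \<le> 4 * (1 + M)^7 * norm y * (1/2)^n"
      using order_trans[OF nF[OF w(1)] norm_Gf(1)[OF w(1), of y]] w(2) by (simp add: power_one_over)
  next
    fix w assume w: "w \<in> Lset" "cmod w = 1/2^n"
    have "(1/2::real)^n * (1/2)^n \<le> (1/2)^n * 1" by (intro mult_left_mono power_le_one) auto
    then have "4 * (1 + M)^7 * norm y * ((1/2)^n * (1/2)^n) \<le> 4 * (1 + M)^7 * norm y * (1/2)^n"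
      using M by (intro mult_left_mono) auto
    then show "norm (w *\<^sub>C F w) \<le> 4 * (1 + M)^7 * norm y * (1/2)^n"
      using nF[OF w(1)] norm_Gf(2)[OF w(1), of y] w(2) by (simp add: power2_eq_square power_one_over mult_ac)
  qed auto
  moreover have "integral {1/2^n..2^n} (\<lambda>r. F (\<i> * of_real r) + F (- (\<i> * of_real r))) = VN n t ?x + TN n t (ag y)"
  proof -
    have pos: "r \<noteq> 0" "0 < r" if "r \<in> {1/2^n..2^n}" for r :: real
      using that by (auto dest: less_le_trans[of 0 "1/2^n" r, rotated])
    have "VN n t ?x + TN n t (ag y) = integral {1/2^n..2^n} (\<lambda>r. (\<i> * of_real r * cis (t * r)) *\<^sub>C mm r ?x - (\<i> * of_real r * cis (- (t * r))) *\<^sub>C mm (- r) ?x + hh t (ag y) r)"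
      unfolding VN_def TN_hh
      by (intro integral_add[symmetric] integrable_continuous_interval hh_cont continuous_intros continuous_on_cis' mm_cont')
        (use pos in auto)
    also have "\<dots> = integral {1/2^n..2^n} (\<lambda>r. F (\<i> * of_real r) + F (- (\<i> * of_real r)))"
    proof (rule integral_cong)
      fix r :: real assume r: "r \<in> {1/2^n..2^n}"
      have r0: "r \<noteq> 0" "- r \<noteq> 0" using pos[OF r] by auto
      have c: "exp (of_real t * (\<i> * of_real r)) = cis (t * r)" "exp (- (of_real t * (\<i> * of_real r))) = cis (- (t * r))"
        by (simp_all add: cis_conv_exp mult_ac)
      have "F (\<i> * of_real r) = cis (t * r) *\<^sub>C ((\<i> * of_real r) *\<^sub>C mm r ?x + mm r (ag y))"
        using Gf_mm[OF r0(1), of "g y"] by (simp only: F_def c ag_alt)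
      moreover have "F (- (\<i> * of_real r)) = cis (- (t * r)) *\<^sub>C ((- (\<i> * of_real r)) *\<^sub>C mm (- r) ?x + mm (- r) (ag y))"
        using Gf_mm[OF r0(2), of "g y"] by (simp only: F_def c ag_alt of_real_minus mult_minus_right)
      ultimately show "(\<i> * of_real r * cis (t * r)) *\<^sub>C mm r ?x - (\<i> * of_real r * cis (- (t * r))) *\<^sub>C mm (- r) ?x + hh t (ag y) r
         = F (\<i> * of_real r) + F (- (\<i> * of_real r))"
        by (simp add: hh_def cscale_algebra mult_ac)
    qed
    finally show ?thesis by simp
  qed
  ultimately show ?thesis by (simp add: algebra_simps)
qed

text \<open>At \<open>t = 0\<close> the reflection of \<open>r\<close> turns \<open>R(-w)\<close>
  into \<open>R(w)\<close>, whose coefficient becomes \<open>1/4 - 1/24 = 5/24\<close>. Then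
  \<open>w F(w)\<close> tends to \<open>5/24 - 2/3 + 3/8 = -1/12\<close> times the vector, so the
  large arc gives \<open>pi / 12\<close>, and \<open>kc * i = 12 / pi\<close> normalises this to the
  identity.\<close>

lemma TN_zero: "norm (TN n 0 (g y) - g y) \<le> 60 * (1 + M)^3 * norm y * (1/2)^n"
proof -
  let ?x = "g y" and ?N = "1 + M"
  define F where "F = (\<lambda>w. (5/24) *\<^sub>C R w ?x - (4/3) *\<^sub>C R (2*w) ?x + (9/8) *\<^sub>C R (3*w) ?x)"
  define F' where "F' = (\<lambda>w. (5/24) *\<^sub>C (- R w (R w ?x)) - (4/3) *\<^sub>C (2 *\<^sub>C - R (2*w) (R (2*w) ?x)) + (9/8) *\<^sub>C (3 *\<^sub>C - R (3*w) (R (3*w) ?x)))"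
  have der: "cderiv F (F' w) w" if w: "w \<in> Lset" for w
    unfolding F_def F'_def by (intro cderiv_add cderiv_diff cderiv_scale_const R_deriv_L R_deriv_scale w)
  have cont: "continuous_on Lset F'" unfolding F'_def by (intro continuous_intros R_cont_L)
  have tri: "norm (a *\<^sub>C p - b *\<^sub>C q + c *\<^sub>C s) \<le> (cmod a + cmod b + cmod c) * m"
    if "norm p \<le> m" "norm q \<le> m" "norm s \<le> m" for a b c m and p q s :: 'a
  proof -
    have "norm (a *\<^sub>C p - b *\<^sub>C q + c *\<^sub>C s) \<le> norm (a *\<^sub>C p) + norm (b *\<^sub>C q) + norm (c *\<^sub>C s)"
      by (meson add_mono_thms_linordered_semiring(3) norm_triangle_ineq norm_triangle_ineq4 order_trans)
    also have "\<dots> \<le> cmod a * m + cmod b * m + cmod c * m"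
      unfolding norm_scaleC using that by (intro add_mono mult_left_mono) auto
    finally show ?thesis by (simp add: algebra_simps)
  qed
  have A1: "norm (AR v ?x) \<le> ?N^3 / cmod v * norm y" if v: "v \<in> S" for v
    using norm_comp[OF norm_comp[OF norm_Bc norm_Bc nn(1)] R_bd[OF v] nn(3), of y] v by (simp add: AR_g power3_eq_cube)
  have A2: "norm (R v ?x) \<le> ?N^3 * norm y" if v: "v \<in> S" for v
    using norm_comp[OF norm_comp[OF norm_B norm_B nn(1)] norm_AR[OF v] nn(1), of y] v by (simp add: g_def R_Bc power3_eq_cube)
  have "norm (integral {1/2^n..2^n} (\<lambda>r. F (\<i> * of_real r) + F (- (\<i> * of_real r))) + pi *\<^sub>R (- (1/12) *\<^sub>R ?x))
      \<le> (2 * ?N^3 * norm y * (1/2)^n + 3 * ?N^3 * norm y * (1/2)^n) * pi"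
  proof (rule rotate_left[OF _ _ der cont])
    have "(1::real) \<le> 2^n" by simp
    then show "1/2^n \<le> (2::real)^n" using divide_le_eq_1[of 1 "2^n"] by (smt (verit))
  next
    fix w assume w: "w \<in> Lset" "cmod w = 2^n"
    have wS: "w \<in> S" "2*w \<in> S" "3*w \<in> S" using w(1) Lset_S Lset_numeral by blast+
    have b: "norm (AR (numeral k * w) ?x) \<le> ?N^3 * norm y * (1/2)^n" if "numeral k * w \<in> S" for k
    proof -
      have cw: "cmod w \<le> cmod (numeral k * w)"
        using mult_right_mono[OF one_le_numeral, of "cmod w" k] by (simp add: norm_mult)
      have "?N^3 / cmod (numeral k * w) * norm y \<le> ?N^3 / cmod w * norm y"
        using w M cw by (intro mult_right_mono divide_left_mono) auto
      also have "?N^3 / cmod w * norm y = ?N^3 * norm y * (1/2)^n" using w(2) by (simp add: power_one_over)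
      finally show ?thesis using A1[OF that] by linarith
    qed
    have "w *\<^sub>C F w - (- (1/12) *\<^sub>R ?x) = (5/24) *\<^sub>C AR w ?x - (2/3) *\<^sub>C AR (2*w) ?x + (3/8) *\<^sub>C AR (3*w) ?x"
    proof -
      have "(- (1/12)) *\<^sub>R ?x = (2/3 - 5/24 - 3/8) *\<^sub>C ?x + (- (1/6)) *\<^sub>C ?x"
        by (simp only: cscale.add_left[symmetric] scaleR_scaleC) (simp add: of_real_divide)
      moreover have "\<dots> = (2/3) *\<^sub>C ?x - (5/24) *\<^sub>C ?x - (3/8) *\<^sub>C ?x - (1/6) *\<^sub>C ?x" by (simp only: cscale_algebra) simp
      ultimately have s: "(- (1/12)) *\<^sub>R ?x = (2/3) *\<^sub>C ?x - (5/24) *\<^sub>C ?x - (3/8) *\<^sub>C ?x - (1/6) *\<^sub>C ?x" by simp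
      have s2: "(- (1/12)) *\<^sub>R ?x = (5/24) *\<^sub>C ?x - (2/3) *\<^sub>C ?x + (3/8) *\<^sub>C ?x"
        by (simp only: cscale.add_left[symmetric] cscale.diff_left[symmetric] scaleR_scaleC) simp
      show ?thesis unfolding s2 by (simp add: F_def AR_def cscale_algebra mult_ac)
    qed
    also have "norm \<dots> \<le> (cmod (5/24) + cmod (2/3) + cmod (3/8)) * (?N^3 * norm y * (1/2)^n)"
      using b[of num.One] b[of "num.Bit0 num.One"] b[of "num.Bit1 num.One"] wS by (intro tri) simp_all
    also have "\<dots> \<le> 2 * (?N^3 * norm y * (1/2)^n)"
      using M by (intro mult_right_mono) (auto simp: norm_divide)
    finally show "norm (w *\<^sub>C F w - (- (1/12) *\<^sub>R ?x)) \<le> 2 * ?N^3 * norm y * (1/2)^n" by simp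
  next
    fix w assume w: "w \<in> Lset" "cmod w = 1/2^n"
    have wS: "w \<in> S" "2*w \<in> S" "3*w \<in> S" using w(1) Lset_S Lset_numeral by blast+
    have "norm (F w) \<le> (cmod (5/24) + cmod (4/3) + cmod (9/8)) * (?N^3 * norm y)"
      unfolding F_def by (intro tri A2 wS)
    also have "\<dots> \<le> 3 * (?N^3 * norm y)" using M by (intro mult_right_mono) (auto simp: norm_divide)
    finally have "cmod w * norm (F w) \<le> cmod w * (3 * (?N^3 * norm y))" by (intro mult_left_mono) auto
    then show "norm (w *\<^sub>C F w) \<le> 3 * ?N^3 * norm y * (1/2)^n" using w(2) by (simp add: power_one_over mult_ac)
  qed auto
  moreover have "TN n 0 ?x = (12/pi) *\<^sub>R integral {1/2^n..2^n} (\<lambda>r. F (\<i> * of_real r) + F (- (\<i> * of_real r)))"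
  proof -
    have pos: "r \<noteq> 0" "0 < r" if "r \<in> {1/2^n..2^n}" for r :: real
      using that by (auto dest: less_le_trans[of 0 "1/2^n" r, rotated])
    have contF: "continuous_on Lset F"
      using der unfolding cderiv_def by (meson continuous_at_imp_continuous_on has_derivative_continuous)
    have int: "(\<lambda>r. F (\<i> * of_real r) + F (- (\<i> * of_real r))) integrable_on {1/2^n..2^n}"
      by (intro integrable_continuous_interval continuous_intros continuous_on_compose2[OF contF]) (use pos in auto)
    have kci: "kc * \<i> = of_real (12/pi)" by (simp add: kc_def complex_eq_iff)
    have "TN n 0 ?x = integral {1/2^n..2^n} (\<lambda>r. (12/pi) *\<^sub>R (F (\<i> * of_real r) + F (- (\<i> * of_real r))))"
      unfolding TN_hh
    proof (rule integral_cong)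
      fix r :: real assume r: "r \<in> {1/2^n..2^n}"
      have r0: "r \<noteq> 0" "- r \<noteq> 0" using pos[OF r] by auto
      have sp: "(5/24) *\<^sub>C z = (1/4) *\<^sub>C z - (1/24) *\<^sub>C z" for z :: 'a by (simp add: cscale.diff_left[symmetric])
      show "hh 0 ?x r = (12/pi) *\<^sub>R (F (\<i> * of_real r) + F (- (\<i> * of_real r)))"
        unfolding hh_def mm_pf[OF r0(1)] mm_pf[OF r0(2)] kci F_def sp
        by (simp only: scaleR_scaleC) (simp add: cscale_algebra)
    qed
    also have "\<dots> = (12/pi) *\<^sub>R integral {1/2^n..2^n} (\<lambda>r. F (\<i> * of_real r) + F (- (\<i> * of_real r)))"
      by (rule integral_cmul)
    finally show ?thesis .
  qed
  moreover have "(12/pi) *\<^sub>R X - ?x = (12/pi) *\<^sub>R (X + pi *\<^sub>R (- (1/12) *\<^sub>R ?x))" for X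
    using pi_gt_zero by (simp add: scaleR_diff_right)
  ultimately have "norm (TN n 0 ?x - ?x) \<le> (12/pi) * ((2 * ?N^3 * norm y * (1/2)^n + 3 * ?N^3 * norm y * (1/2)^n) * pi)"
    by (simp only: norm_scaleR) (simp add: field_simps)
  then show ?thesis by (simp add: mult_ac)
qed

end

section \<open>Identification of the semigroup\<close>

text \<open>Baire's theorem for the closed sets of vectors with orbit bounded by \<open>k\<close>.
  It serves an arbitrary semigroup with the given generator, about which no bound is known
  beforehand.\<close>

lemma uniform_boundedness:
  fixes T :: "nat \<Rightarrow> 'a::banach \<Rightarrow> 'b::real_normed_vector"
  assumes lin: "\<And>n. bounded_linear (T n)" and bdd: "\<And>x. \<exists>c. \<forall>n. norm (T n x) \<le> c"
  shows "\<exists>c. \<forall>n x. norm (T n x) \<le> c * norm x"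
proof -
  define E where "E = (\<lambda>k. {x. \<forall>n. norm (T n x) \<le> real k})"
  have closed: "closed (E k)" for k
    unfolding E_def by (intro closed_Collect_all closed_Collect_le continuous_intros linear_continuous_on lin)
  have cover: "\<Union>(range E) = UNIV"
  proof -
    have "x \<in> \<Union>(range E)" for x
    proof -
      obtain c where c: "\<And>n. norm (T n x) \<le> c" using bdd by blast
      obtain k :: nat where "c \<le> k" using real_arch_simple by blast
      then show ?thesis using c by (auto simp: E_def intro: order_trans)
    qed
    then show ?thesis by blast
  qed
  have "\<exists>k. interior (E k) \<noteq> {}"
  proof (rule ccontr)
    assume "\<not> ?thesis"
    then have "euclidean interior_of \<Union>(range E) = {}"
      using Met_TC.metric_Baire_category_alt[of "range E"] closed complete_UNIV
      by (auto simp: mtopology_is_euclidean mcomplete_iff_complete closed_closedin[symmetric])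
    then show False using cover by simp
  qed
  then obtain k x0 r where r: "r > 0" "ball x0 r \<subseteq> E k" by (metis ex_in_conv mem_interior)
  \<comment> \<open>The vector is scaled to length \<open>r / 2\<close> to stay in the ball; the
    bound \<open>2 k\<close> on the difference of the two images then gives
    \<open>4 k / r\<close>.\<close>
  have "norm (T n x) \<le> (4 * k / r) * norm x" for n x
  proof (cases "x = 0")
    case True then show ?thesis using bounded_linear.linear[OF lin, of n] by (simp add: linear_0)
  next
    case False
    interpret bounded_linear "T n" by (rule lin)
    let ?c = "r / (2 * norm x)"
    have c: "?c > 0" using r False by simp
    have "x0 \<in> E k" "x0 + ?c *\<^sub>R x \<in> E k" using r False by (auto simp: dist_norm subset_iff)
    then have "norm (T n x0) \<le> k" "norm (T n (x0 + ?c *\<^sub>R x)) \<le> k" by (auto simp: E_def)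
    then have "norm (T n (x0 + ?c *\<^sub>R x) - T n x0) \<le> k + k" by (intro norm_triangle_le_diff) simp
    then have "?c * norm (T n x) \<le> 2 * k" using c r by (simp add: add scaleR)
    then show ?thesis using r False by (simp add: field_simps)
  qed
  then show ?thesis by blast
qed

lemma strong_continuity_dense:
  fixes T :: "'b::topological_space \<Rightarrow> 'a::complex_banach \<Rightarrow> 'a"
  assumes T: "\<And>t. t \<in> I \<Longrightarrow> bounded_op (T t)" "\<And>t x. t \<in> I \<Longrightarrow> norm (T t x) \<le> c * norm x"
    and D: "closure D = UNIV" "\<And>x. x \<in> D \<Longrightarrow> continuous_on I (\<lambda>t. T t x)"
  shows "continuous_on I (\<lambda>t. T t x)"
proof -
  have "x \<in> closure D" using D by simp
  then obtain d where d: "\<And>n. d n \<in> D" "d \<longlonglongrightarrow> x" unfolding closure_sequential by blast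
  have "uniform_limit I (\<lambda>n t. T t (d n)) (\<lambda>t. T t x) sequentially"
  proof (rule uniform_limitI)
    fix e :: real assume e: "e > 0"
    have "(\<lambda>n. \<bar>c\<bar> * norm (d n - x)) \<longlonglongrightarrow> \<bar>c\<bar> * norm (x - x)" by (intro tendsto_intros d)
    then have "\<forall>\<^sub>F n in sequentially. \<bar>c\<bar> * norm (d n - x) < e" using e by (auto dest: order_tendstoD(2))
    then show "\<forall>\<^sub>F n in sequentially. \<forall>t\<in>I. dist (T t (d n)) (T t x) < e"
    proof eventually_elim
      case (elim n)
      have "dist (T t (d n)) (T t x) < e" if "t \<in> I" for t
      proof -
        have "dist (T t (d n)) (T t x) = norm (T t (d n - x))" by (simp add: dist_norm bounded_opD[OF T(1)[OF that]])
        also have "\<dots> \<le> c * norm (d n - x)" by (rule T(2)[OF that])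
        also have "\<dots> \<le> \<bar>c\<bar> * norm (d n - x)" by (intro mult_right_mono) auto
        finally show ?thesis using elim by simp
      qed
      then show ?case by blast
    qed
  qed
  then show ?thesis by (rule uniform_limit_theorem[rotated]) (auto simp: D(2) d(1))
qed

lemma tendsto_zero_dense:
  fixes E :: "'b \<Rightarrow> 'a::complex_banach \<Rightarrow> 'a"
  assumes D: "closure D = UNIV" "\<And>d. d \<in> D \<Longrightarrow> ((\<lambda>h. E h d) \<longlongrightarrow> 0) F"
    and ev: "eventually (\<lambda>h. bounded_op (E h) \<and> (\<forall>x. norm (E h x) \<le> c * norm x)) F"
  shows "((\<lambda>h. E h x) \<longlongrightarrow> 0) F"
proof (rule tendstoI)
  fix e :: real assume e: "e > 0"
  define c' where "c' = \<bar>c\<bar> + 1"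
  have c': "c' > 0" "c \<le> c'" by (auto simp: c'_def)
  have "x \<in> closure D" using D by simp
  then obtain d where d: "d \<in> D" "dist d x < e / (2 * c')"
    unfolding closure_approachable using e c' by (meson divide_pos_pos mult_pos_pos zero_less_numeral)
  have "\<forall>\<^sub>F h in F. dist (E h d) 0 < e / 2" using e by (intro tendstoD[OF D(2)[OF d(1)]]) auto
  with ev show "\<forall>\<^sub>F h in F. dist (E h x) 0 < e"
  proof eventually_elim
    case (elim h)
    then have E: "bounded_op (E h)" by simp
    have "E h x = E h d + E h (x - d)" by (simp add: bounded_opD[OF E])
    then have "norm (E h x) \<le> norm (E h d) + norm (E h (x - d))" by (simp only: norm_triangle_ineq)
    also have "norm (E h (x - d)) \<le> c * norm (x - d)" using elim by blast
    also have "\<dots> \<le> c' * norm (x - d)" using c' by (intro mult_right_mono) auto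
    also have "\<dots> < e / 2" using d(2) c' by (simp add: dist_norm norm_minus_commute field_simps)
    finally show ?case using elim by simp
  qed
qed

text \<open>Only the orbit of the single vector \<open>v s0\<close> is assumed differentiable; the
  increment of \<open>v\<close> is handled by the uniform bound and the strong continuity of
  \<open>T\<close>.\<close>

lemma strong_product_derivative:
  fixes T :: "real \<Rightarrow> 'a::complex_banach \<Rightarrow> 'a"
  assumes T: "\<And>s. s \<in> I \<Longrightarrow> bounded_op (T s)" "\<And>s x. s \<in> I \<Longrightarrow> norm (T s x) \<le> c * norm x"
    and cont: "\<And>x. continuous_on I (\<lambda>s. T s x)"
    and v: "(v has_vector_derivative v') (at s0 within I)"
    and d: "((\<lambda>s. T s (v s0)) has_vector_derivative d) (at s0 within I)"
    and s0: "s0 \<in> I"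
  shows "((\<lambda>s. T s (v s)) has_vector_derivative d + T s0 v') (at s0 within I)"
proof -
  have "((\<lambda>s. T s (v s - v s0)) has_derivative (\<lambda>h. h *\<^sub>R T s0 v')) (at s0 within I)"
  proof (rule has_derivativeI_sandwich[of 1])
    show "bounded_linear (\<lambda>h. h *\<^sub>R T s0 v')" by (rule bounded_linear_scaleR_left)
    let ?H = "\<lambda>s. c * (norm (v s - v s0 - (s - s0) *\<^sub>R v') / norm (s - s0)) + norm (T s v' - T s0 v')"
    have 1: "((\<lambda>s. norm (v s - v s0 - (s - s0) *\<^sub>R v') / norm (s - s0)) \<longlongrightarrow> 0) (at s0 within I)"
      using v unfolding has_vector_derivative_def has_derivative_iff_norm by simp
    have 2: "((\<lambda>s. T s v') \<longlongrightarrow> T s0 v') (at s0 within I)" using cont[of v'] s0 by (simp add: continuous_on_def)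
    have "((\<lambda>s. ?H s) \<longlongrightarrow> c * 0 + norm (T s0 v' - T s0 v')) (at s0 within I)" by (intro tendsto_intros 1 2)
    then show "(?H \<longlongrightarrow> 0) (at s0 within I)" by simp
    fix s assume s: "s \<in> I" "s \<noteq> s0"
    note Ts = bounded_opD[OF T(1)[OF s(1)]]
    have "T s (v s - v s0) - T s0 (v s0 - v s0) - (s - s0) *\<^sub>R T s0 v'
      = T s (v s - v s0 - (s - s0) *\<^sub>R v') + (s - s0) *\<^sub>R (T s v' - T s0 v')"
      using bounded_opD(4)[OF T(1)[OF s0]] by (simp add: Ts algebra_simps)
    also have "norm \<dots> \<le> c * norm (v s - v s0 - (s - s0) *\<^sub>R v') + norm (s - s0) * norm (T s v' - T s0 v')"
      by (rule norm_triangle_le) (use T(2)[OF s(1)] in \<open>auto intro: add_mono\<close>)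
    finally show "norm (T s (v s - v s0) - T s0 (v s0 - v s0) - (s - s0) *\<^sub>R T s0 v') / norm (s - s0) \<le> ?H s"
      using s(2) by (simp add: field_simps)
  qed simp
  then have "((\<lambda>s. T s (v s - v s0)) has_vector_derivative T s0 v') (at s0 within I)"
    by (simp add: has_vector_derivative_def)
  from has_vector_derivative_add[OF d this]
  have "((\<lambda>s. T s (v s0) + T s (v s - v s0)) has_vector_derivative d + T s0 v') (at s0 within I)" .
  then show ?thesis
    by (rule has_vector_derivative_transform[OF s0, rotated]) (simp add: bounded_opD[OF T(1)])
qed

text \<open>The two unconditional bounds are what the H-infinity calculus has to deliver; with the
  splitting they carry the whole construction.\<close>

locale dilatable = split_resolvent_family +
  fixes C :: real
  assumes C: "0 \<le> C"
    and Phi_sum: "finite F \<Longrightarrow> (\<And>\<kappa>. cmod (\<zeta> \<kappa>) \<le> 1) \<Longrightarrow> u \<in> {0..1} \<Longrightarrow> norm (\<Sum>\<kappa>\<in>F. \<zeta> \<kappa> *\<^sub>C Phi \<kappa> u x) \<le> C * norm x"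
    and Psi_sum: "finite F \<Longrightarrow> (\<And>\<kappa>. cmod (\<zeta> \<kappa>) \<le> 1) \<Longrightarrow> u \<in> {0..1} \<Longrightarrow> norm (\<Sum>\<kappa>\<in>F. \<zeta> \<kappa> *\<^sub>C Psi \<kappa> u x) \<le> C * norm x"
begin

text \<open>The same signs are put on both series, and \<open>sign_average\<close> with
  \<open>L = 0\<close>, \<open>J = 0\<close> leaves the diagonal products. The phases
  \<open>cis (t * lam \<kappa> u)\<close> are absorbed into the vectors, so the bound is uniform in
  \<open>t\<close>.\<close>

lemma PsiPhi_sum:
  assumes "finite F" "u \<in> {0..1}"
  shows "norm (\<Sum>\<kappa>\<in>F. cis (t * lam \<kappa> u) *\<^sub>C Psi \<kappa> u (Phi \<kappa> u x)) \<le> C\<^sup>2 * norm x"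
proof -
  let ?y = "\<lambda>\<kappa>. cis (t * lam \<kappa> u) *\<^sub>C Phi \<kappa> u x"
  have u: "0 \<le> u" using assms by simp
  have "norm ((\<lambda>x. 0) (0::'a) + (\<Sum>\<kappa>\<in>F. Psi \<kappa> u (?y \<kappa>))) \<le> C\<^sup>2 * norm x"
  proof (rule sign_average[OF assms(1), where L = "\<lambda>x. 0" and J = 0 and a = "\<lambda>\<kappa>. Psi \<kappa> u" and y = ?y])
    show "bounded_op (\<lambda>x::'a. 0::'a)" by (rule bounded_opI[of _ 0]) auto
    show "bounded_op (Psi \<kappa> u)" for \<kappa> by (rule commutesD(1)[OF commutes_Psi[OF u]])
    fix \<epsilon> :: "bool \<times> int \<Rightarrow> real" assume e: "\<forall>\<kappa>. \<epsilon> \<kappa> = 1 \<or> \<epsilon> \<kappa> = -1"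
    then have e1: "\<bar>\<epsilon> \<kappa>\<bar> = 1" for \<kappa> by (metis abs_1 abs_minus_cancel)
    let ?z = "0 + (\<Sum>\<kappa>\<in>F. \<epsilon> \<kappa> *\<^sub>R ?y \<kappa>)"
    have z: "norm ?z \<le> C * norm x"
      using Phi_sum[OF assms(1) _ assms(2), of "\<lambda>\<kappa>. of_real (\<epsilon> \<kappa>) * cis (t * lam \<kappa> u)" x] e1
      by (simp add: scaleR_scaleC norm_mult)
    have "norm (0 + (\<Sum>\<kappa>\<in>F. \<epsilon> \<kappa> *\<^sub>R Psi \<kappa> u ?z)) \<le> C * norm ?z"
      using Psi_sum[OF assms(1) _ assms(2), of "\<lambda>\<kappa>. of_real (\<epsilon> \<kappa>)" ?z] e1
      by (simp add: scaleR_scaleC)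
    also have "\<dots> \<le> C * (C * norm x)" using z C by (rule mult_left_mono)
    finally show "norm (0 + (\<Sum>\<kappa>\<in>F. \<epsilon> \<kappa> *\<^sub>R Psi \<kappa> u ?z)) \<le> C\<^sup>2 * norm x" by (simp add: power2_eq_square)
  qed
  then show ?thesis by (simp add: Psi_lin u)
qed

lemma TN_alt: "TN n t x = integral {0..1} (\<lambda>u. \<Sum>\<kappa>\<in>Fset n. cis (t * lam \<kappa> u) *\<^sub>C Psi \<kappa> u (Phi \<kappa> u x))"
  unfolding TN_def
  by (intro integral_sum[symmetric] finite_Fset integrable_continuous_interval PsiPhi_cont)

lemma TN_norm: "norm (TN n t x) \<le> C\<^sup>2 * norm x"
proof -
  have "norm (TN n t x) \<le> C\<^sup>2 * norm x * (1 - 0)"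
    unfolding TN_alt by (intro integral_bound continuous_on_sum PsiPhi_cont PsiPhi_sum finite_Fset) auto
  then show ?thesis by simp
qed

lemma TN_bop: "bounded_op (TN n t)"
proof (rule bounded_opI[OF _ _ TN_norm])
  have c: "continuous_on {0..1} (\<lambda>u. \<Sum>\<kappa>\<in>Fset n. cis (t * lam \<kappa> u) *\<^sub>C Psi \<kappa> u (Phi \<kappa> u x))" for x
    by (intro continuous_on_sum PsiPhi_cont)
  fix x y :: 'a and a :: complex
  show "TN n t (x + y) = TN n t x + TN n t y"
    unfolding TN_alt integral_add[OF integrable_continuous_interval[OF c] integrable_continuous_interval[OF c], symmetric]
    by (intro integral_cong) (simp add: Phi_lin Psi_lin cscale.add_right sum.distrib)
  show "TN n t (a *\<^sub>C x) = a *\<^sub>C TN n t x"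
    unfolding TN_alt integral_cscale[OF integrable_continuous_interval[OF c], symmetric]
    by (intro integral_cong) (simp add: Phi_lin Psi_lin cscale.sum_right mult.commute)
qed

lemma TN_lim: "(\<lambda>n. TN n t x) \<longlonglongrightarrow> TT t x" and TT_bop: "bounded_op (TT t)" and TT_norm: "norm (TT t x) \<le> C\<^sup>2 * norm x"
proof -
  have conv: "convergent (\<lambda>n. TN n t x)" if x: "x \<in> {p + g y | p y. p \<in> Ker}" for x
  proof -
    obtain p y where "x = p + g y" "p \<in> Ker" using x by auto
    then show ?thesis using TT_g(1)[of t y] by (auto simp: bounded_opD[OF TN_bop] TN_Ker convergent_def)
  qed
  note * = strong_limit[OF TN_bop TN_norm dense_g conv]
  show "(\<lambda>n. TN n t x) \<longlonglongrightarrow> TT t x" unfolding TT_def by (rule *(1))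
  show "bounded_op (TT t)" unfolding TT_def[abs_def] by (rule *(2))
  show "norm (TT t x) \<le> C\<^sup>2 * norm x" unfolding TT_def by (rule *(3))
qed

definition T :: "real \<Rightarrow> 'a \<Rightarrow> 'a" where "T t x = P x + TT t x"

lemma T_bop: "bounded_op (T t)"
  unfolding T_def[abs_def] by (intro bounded_op_add P_bop TT_bop)

lemma T_norm: "norm (T t x) \<le> (M + C\<^sup>2) * norm x"
  unfolding T_def using norm_triangle_mono[OF P_norm TT_norm, of x t x] by (simp add: algebra_simps)

lemmas T_lin = bounded_opD[OF T_bop]

lemma commute_T:
  assumes "bounded_op U" "\<And>z x. z \<in> S \<Longrightarrow> U (R z x) = R z (U x)"
  shows "U (T t x) = T t (U x)"
proof -
  have "(\<lambda>n. U (TN n t x)) \<longlonglongrightarrow> U (TT t x)"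
    by (rule bounded_linear.tendsto[OF bounded_opD(3)[OF assms(1)] TN_lim])
  then have "(\<lambda>n. TN n t (U x)) \<longlonglongrightarrow> U (TT t x)" by (simp only: TN_comm[OF assms])
  then have "U (TT t x) = TT t (U x)" by (rule LIMSEQ_unique[OF _ TN_lim])
  then show ?thesis by (simp add: T_def bounded_opD[OF assms(1)] commute_P[OF assms])
qed

lemma T_commutes: "commutes (T t)"
  unfolding commutes_def using T_bop commute_T[OF bop R_commute] by auto

lemma T_Ker: "p \<in> Ker \<Longrightarrow> T t p = p"
  by (simp add: T_def P_Ker TT_def TN_Ker)

lemma T_g: "T t (g y) = TT t (g y)"
  by (simp add: T_def P_g)

lemma T_zero: "T 0 x = x"
proof -
  have g0: "T 0 (g y) = g y" for y
  proof -
    have "(\<lambda>n. TN n 0 (g y) - g y) \<longlonglongrightarrow> 0"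
    proof (rule Lim_null_comparison)
      show "\<forall>\<^sub>F n in sequentially. norm (TN n 0 (g y) - g y) \<le> 60 * (1 + M)^3 * norm y * (1/2)^n"
        by (simp add: TN_zero)
      show "(\<lambda>n. 60 * (1 + M)^3 * norm y * (1/2)^n) \<longlonglongrightarrow> 0" by (intro tendsto_mult_right_zero LIMSEQ_realpow_zero) auto
    qed
    then have "(\<lambda>n. TN n 0 (g y)) \<longlonglongrightarrow> g y" by (simp add: LIM_zero_iff)
    then show ?thesis unfolding T_g by (rule LIMSEQ_unique[OF TN_lim])
  qed
  have "closed {x. T 0 x = x}" by (intro closed_Collect_eq continuous_on_id linear_continuous_on T_lin)
  moreover have "{p + g y | p y. p \<in> Ker} \<subseteq> {x. T 0 x = x}" by (auto simp: T_lin T_Ker g0)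
  ultimately have "closure {p + g y | p y. p \<in> Ker} \<subseteq> {x. T 0 x = x}" by (rule closure_minimal[rotated])
  then show ?thesis unfolding dense_g by blast
qed

text \<open>The derivatives \<open>VN\<close> converge uniformly for \<open>t \<ge> 0\<close>: the
  error in the equation and the truncation error both decay geometrically, with constants
  independent of \<open>t\<close>.\<close>

lemma T_deriv:
  assumes "t \<in> {0..}"
  shows "((\<lambda>t. T t (g (g y))) has_vector_derivative - T t (ag y)) (at t within {0..})"
proof -
  let ?c = "8 * (1 + M)^7 * pi * norm y + 2 * (16 * (1 + M)^6 * norm (Bc (Bc y)))"
  have b: "norm (VN n t (g (g y)) - - T t (ag y)) \<le> ?c * (1/2)^n" if "0 \<le> t" for t n
  proof -
    have "VN n t (g (g y)) - - T t (ag y) = (VN n t (g (g y)) + TN n t (ag y)) - (TN n t (ag y) - TT t (ag y))"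
      by (simp add: ag_def T_g)
    also have "norm \<dots> \<le> 8 * (1 + M)^7 * pi * norm y * (1/2)^n + 2 * (16 * (1 + M)^6 * norm (Bc (Bc y))) * (1/2)^n"
      using TT_g(2)[of n t "Bc (Bc y)"] VN_TN[OF that, of n y]
      by (intro order_trans[OF norm_triangle_ineq4 add_mono]) (simp_all add: ag_def)
    finally show ?thesis by (simp add: algebra_simps)
  qed
  have "\<exists>f. \<forall>t\<in>{0..}. (\<lambda>n. TN n t (g (g y))) \<longlonglongrightarrow> f t \<and> (f has_derivative (\<lambda>h. h *\<^sub>R - T t (ag y))) (at t within {0..})"
  proof (rule has_derivative_sequence)
    show "((\<lambda>t. TN n t (g (g y))) has_derivative (\<lambda>h. h *\<^sub>R VN n t (g (g y)))) (at t within {0..})" for n t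
      using TN_deriv by (simp add: has_vector_derivative_def)
    show "(0::real) \<in> {0..}" "(\<lambda>n. TN n 0 (g (g y))) \<longlonglongrightarrow> TT 0 (g (g y))" by (simp_all add: TN_lim)
    fix e :: real assume e: "e > 0"
    have "(\<lambda>n. ?c * (1/2)^n) \<longlonglongrightarrow> 0" by (intro tendsto_mult_right_zero LIMSEQ_realpow_zero) auto
    then have "\<forall>\<^sub>F n in sequentially. ?c * (1/2)^n < e" using e by (rule order_tendstoD(2))
    then show "\<forall>\<^sub>F n in sequentially. \<forall>t\<in>{0..}. \<forall>h. norm (h *\<^sub>R VN n t (g (g y)) - h *\<^sub>R - T t (ag y)) \<le> e * norm h"
    proof eventually_elim
      case (elim n)
      show ?case
      proof (intro ballI allI)
        fix t h :: real assume "t \<in> {0..}"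
        then have "norm (VN n t (g (g y)) - - T t (ag y)) \<le> e" using b[of t n] elim by simp
        then have "\<bar>h\<bar> * norm (VN n t (g (g y)) - - T t (ag y)) \<le> \<bar>h\<bar> * e" by (intro mult_left_mono) auto
        then show "norm (h *\<^sub>R VN n t (g (g y)) - h *\<^sub>R - T t (ag y)) \<le> e * norm h"
          by (simp only: scaleR_diff_right[symmetric] norm_scaleR) (simp add: mult.commute)
      qed
    qed
  qed simp
  then obtain f where f: "\<And>t. t \<in> {0..} \<Longrightarrow> (\<lambda>n. TN n t (g (g y))) \<longlonglongrightarrow> f t"
    "\<And>t. t \<in> {0..} \<Longrightarrow> (f has_derivative (\<lambda>h. h *\<^sub>R - T t (ag y))) (at t within {0..})" by blast
  have "f t = T t (g (g y))" if "t \<in> {0..}" for t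
    unfolding T_g by (rule LIMSEQ_unique[OF f(1)[OF that] TN_lim])
  then show ?thesis
    using f(2)[OF assms] assms unfolding has_vector_derivative_def[symmetric]
    by (intro has_vector_derivative_transform[of t "{0..}" "\<lambda>t. T t (g (g y))" f]) auto
qed

lemma T_cont: "continuous_on {0..} (\<lambda>t. T t x)"
proof (rule strong_continuity_dense[OF T_bop T_norm dense_gg])
  fix x assume "x \<in> {p + g (g y) | p y. p \<in> Ker}"
  then obtain p y where x: "x = p + g (g y)" "p \<in> Ker" by auto
  have "continuous_on {0..} (\<lambda>t. T t (g (g y)))"
    by (rule continuous_on_vector_derivative[OF T_deriv])
  then show "continuous_on {0..} (\<lambda>t. T t x)" by (simp add: x T_lin T_Ker continuous_on_add)
qed

text \<open>\<open>s \<mapsto> T (t - s) (V s x)\<close> has derivative 0 for \<open>x\<close> in the range of \<open>g\<^sup>2\<close>.\<close>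
lemma T_unique:
  assumes V: "\<And>s. 0 \<le> s \<Longrightarrow> commutes (V s)"
    and dV: "\<And>s y. 0 \<le> s \<Longrightarrow> ((\<lambda>s. V s (g (g y))) has_vector_derivative - V s (ag y)) (at s within {0..})"
    and pV: "\<And>s p. 0 \<le> s \<Longrightarrow> p \<in> Ker \<Longrightarrow> V s p = V 0 p"
    and t: "0 \<le> t"
  shows "V t x = T t (V 0 x)"
proof -
  have Vg: "V s (g z) = g (V s z)" if "0 \<le> s" for s z using commute_g[OF V[OF that]] by simp
  have gg: "V t (g (g y)) = T t (V 0 (g (g y)))" for y
  proof -
    have "((\<lambda>s. T (t - s) (V s (g (g y)))) has_vector_derivative 0) (at s within {0..t})" if s: "s \<in> {0..t}" for s
    proof -
      have s0: "0 \<le> s" using s by simp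
      have "((\<lambda>s. T (t - s) (g (g (V s0 y)))) has_vector_derivative T (t - s0) (ag (V s0 y))) (at s0 within {0..t})"
        if "s0 \<in> {0..t}" for s0
      proof -
        have 1: "((\<lambda>s. t - s) has_vector_derivative -1) (at s0 within {0..t})"
          by (rule derivative_eq_intros refl | simp)+
        have "((\<lambda>s. T s (g (g (V s0 y)))) has_vector_derivative - T (t - s0) (ag (V s0 y))) (at (t - s0) within (\<lambda>s. t - s) ` {0..t})"
          by (rule has_vector_derivative_within_subset[OF T_deriv]) (use that in auto)
        from vector_diff_chain_within[OF 1 this] show ?thesis by (simp add: o_def)
      qed
      from this[OF s] have d: "((\<lambda>r. T (t - r) (V s (g (g y)))) has_vector_derivative T (t - s) (ag (V s y))) (at s within {0..t})"
        by (simp add: Vg s0)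
      have "((\<lambda>s. T (t - s) (V s (g (g y)))) has_vector_derivative T (t - s) (ag (V s y)) + T (t - s) (- V s (ag y))) (at s within {0..t})"
      proof (rule strong_product_derivative[where T = "\<lambda>s. T (t - s)" and v = "\<lambda>s. V s (g (g y))", OF T_bop T_norm _ _ d s])
        show "continuous_on {0..t} (\<lambda>s. T (t - s) x)" for x
          by (rule continuous_on_compose2[OF T_cont]) (auto intro!: continuous_intros)
        show "((\<lambda>s. V s (g (g y))) has_vector_derivative - V s (ag y)) (at s within {0..t})"
          by (rule has_vector_derivative_within_subset[OF dV[OF s0]]) auto
      qed
      moreover have "V s (ag y) = ag (V s y)"
        by (simp add: ag_def Vg s0 commute_Bc[OF V[OF s0]])
      ultimately show ?thesis by (simp add: T_lin)
    qed
    then obtain k where k: "\<And>s. s \<in> {0..t} \<Longrightarrow> T (t - s) (V s (g (g y))) = k"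
      using has_vector_derivative_zero_constant[of "{0..t}" "\<lambda>s. T (t - s) (V s (g (g y)))"] by (metis convex_real_interval(5))
    from k[of 0] k[of t] t show ?thesis by (simp add: T_zero)
  qed
  have "closed {x. V t x = T t (V 0 x)}"
    by (intro closed_Collect_eq linear_continuous_on bounded_opD(3) bounded_op_comp[OF T_bop] commutesD(1) V t order_refl)
  moreover have "{p + g (g y) | p y. p \<in> Ker} \<subseteq> {x. V t x = T t (V 0 x)}"
  proof -
    have "T t (V 0 p) = V 0 p" if "p \<in> Ker" for p
    proof -
      have "V 0 p \<in> Ker" using that commute_B[OF V[of 0], of p] by (simp add: Ker_def)
      then show ?thesis by (rule T_Ker)
    qed
    then show ?thesis
      using bounded_opD(1)[OF commutesD(1)[OF V[OF t]]] bounded_opD(1)[OF commutesD(1)[OF V[of 0]]]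
      by (auto simp: gg T_lin pV[OF t])
  qed
  ultimately have "closure {p + g (g y) | p y. p \<in> Ker} \<subseteq> {x. V t x = T t (V 0 x)}" by (rule closure_minimal[rotated])
  then show ?thesis unfolding dense_gg by blast
qed

text \<open>Uniqueness applied to the shifted family \<open>s \<mapsto> T (s + t)\<close>, whose
  initial operator is \<open>T t\<close>.\<close>

lemma T_add:
  assumes "0 \<le> s" "0 \<le> t"
  shows "T (s + t) x = T s (T t x)"
proof -
  have "T (s + t) x = T s (T (0 + t) x)"
  proof (rule T_unique[where V = "\<lambda>s. T (s + t)"])
    fix r :: real and y assume r: "0 \<le> r"
    have 1: "((\<lambda>s. s + t) has_vector_derivative 1) (at r within {0..})"
      by (rule derivative_eq_intros refl | simp)+
    have "((\<lambda>s. T s (g (g y))) has_vector_derivative - T (r + t) (ag y)) (at (r + t) within (\<lambda>s. s + t) ` {0..})"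
      by (rule has_vector_derivative_within_subset[OF T_deriv]) (use r assms in auto)
    from vector_diff_chain_within[OF 1 this]
    show "((\<lambda>s. T (s + t) (g (g y))) has_vector_derivative - T (r + t) (ag y)) (at r within {0..})"
      by (simp add: o_def)
  qed (auto simp: T_commutes T_Ker assms)
  then show ?thesis by simp
qed

lemma T_C0: "C0_semigroup T"
  unfolding C0_semigroup_def
proof (intro conjI allI impI)
  show "T 0 = id" by (auto simp: T_zero)
  show "T (s + t) = T s \<circ> T t" if "0 \<le> s" "0 \<le> t" for s t using T_add[OF that] by auto
  fix x
  have "((\<lambda>t. T t x) \<longlongrightarrow> T 0 x) (at 0 within {0..})" using T_cont by (simp add: continuous_on_def)
  then show "((\<lambda>t. T t x) \<longlongrightarrow> x) (at_right 0)"
    unfolding T_zero by (rule tendsto_within_subset) auto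
qed (rule T_bop)

text \<open>\<open>B y\<close> runs through the domain of \<open>A\<close>, and
  \<open>Bc y = A B y\<close>. On kernel plus range of \<open>g g\<close> the claim is
  \<open>T_deriv\<close> at 0; density does the rest once the difference quotients on the range of
  \<open>B\<close> are bounded uniformly in \<open>h\<close>.\<close>

lemma T_generator: "((\<lambda>h. (1/h) *\<^sub>R (T h (B y) - B y)) \<longlongrightarrow> - Bc y) (at_right 0)"
proof -
  let ?c = "M + C\<^sup>2"
  have c0: "0 \<le> ?c" using M by simp
  \<comment> \<open>Integrating the derivative gives the bound on the dense set; both sides are
    continuous in \<open>z\<close>.\<close>
  have int: "norm (T h (B z) - B z) \<le> h * (?c * norm (Bc z))" if h: "0 < h" for h z
  proof -
    have d: "norm (T h (B z) - B z) \<le> h * (?c * norm (Bc z))" if "z = p + g (g y)" "p \<in> Ker" for z p y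
    proof -
      have Bz: "B z = p + g (g (B y))" using that by (simp add: B_lin commute_B[OF commutes_g] Ker_def)
      have Bcz: "Bc z = ag (B y)" using that
        by (simp add: Bc_lin Ker_def Bc_def[of p] ag_alt commute_Bc[OF commutes_g] g_def[of "g y"] g_def[of y] commute_B[OF commutes_Bc] commute_B[OF commutes_g])
      have "((\<lambda>t. - T t (ag (B y))) has_integral T h (g (g (B y))) - T 0 (g (g (B y)))) {0..h}"
        using h by (intro fundamental_theorem_of_calculus has_vector_derivative_within_subset[OF T_deriv]) auto
      from integral_unique[OF this] have "T h (B z) - B z = integral {0..h} (\<lambda>t. - T t (ag (B y)))"
        unfolding Bz by (simp add: T_lin T_Ker that(2) T_zero)
      also have "norm \<dots> \<le> (?c * norm (Bc z)) * (h - 0)"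
        using h T_norm by (intro integral_bound continuous_intros continuous_on_subset[OF T_cont]) (auto simp: Bcz)
      finally show ?thesis by (simp add: mult.commute)
    qed
    have "closed {z. norm (T h (B z) - B z) \<le> h * (?c * norm (Bc z))}"
      by (intro closed_Collect_le continuous_intros linear_continuous_on Bc_lin B_lin bounded_linear_compose[OF T_lin(3) B_lin(3)])
    moreover have "{p + g (g y) | p y. p \<in> Ker} \<subseteq> {z. norm (T h (B z) - B z) \<le> h * (?c * norm (Bc z))}"
      using d by blast
    ultimately have "closure {p + g (g y) | p y. p \<in> Ker} \<subseteq> {z. norm (T h (B z) - B z) \<le> h * (?c * norm (Bc z))}"
      by (rule closure_minimal[rotated])
    then show ?thesis unfolding dense_gg by blast
  qed
  define E where "E = (\<lambda>h y. (1/h) *\<^sub>R (T h (B y) - B y) + Bc y)"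
  have "((\<lambda>h. E h y) \<longlongrightarrow> 0) (at_right 0)"
  proof (rule tendsto_zero_dense[OF dense_gg])
    show "\<forall>\<^sub>F h in at_right 0. bounded_op (E h) \<and> (\<forall>x. norm (E h x) \<le> ((?c + 1) * (1 + M)) * norm x)"
      unfolding eventually_at_filter
    proof (intro always_eventually allI impI conjI)
      fix h :: real and x assume h: "h \<noteq> 0" "h \<in> {0<..}"
      show "bounded_op (E h)"
        unfolding E_def scaleR_scaleC
        by (intro bounded_op_add bounded_op_scaleC bounded_op_diff bounded_op_comp[OF T_bop] commutesD(1) commutes_B commutes_Bc)
      have "norm (E h x) \<le> (1/h) * norm (T h (B x) - B x) + norm (Bc x)"
        unfolding E_def using h norm_triangle_ineq[of "(1/h) *\<^sub>R (T h (B x) - B x)" "Bc x"] by simp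
      also have "\<dots> \<le> (1/h) * (h * (?c * norm (Bc x))) + norm (Bc x)"
        using h by (intro add_mono mult_left_mono int) auto
      also have "\<dots> = (?c + 1) * norm (Bc x)" using h by (simp add: algebra_simps)
      also have "\<dots> \<le> (?c + 1) * ((1 + M) * norm x)" using c0 by (intro mult_left_mono norm_Bc) auto
      finally show "norm (E h x) \<le> ((?c + 1) * (1 + M)) * norm x" by (simp add: mult.assoc)
    qed
  next
    fix z assume "z \<in> {p + g (g y) | p y. p \<in> Ker}"
    then obtain p y where z: "z = p + g (g y)" "p \<in> Ker" by auto
    have Bz: "B z = p + g (g (B y))" using z by (simp add: B_lin commute_B[OF commutes_g] Ker_def)
    have Bcz: "Bc z = ag (B y)" using z
      by (simp add: Bc_lin Ker_def Bc_def[of p] ag_alt commute_Bc[OF commutes_g] g_def[of "g y"] g_def[of y] commute_B[OF commutes_Bc] commute_B[OF commutes_g])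
    have "((\<lambda>t. T t (g (g (B y)))) has_vector_derivative - T 0 (ag (B y))) (at 0 within {0..})" by (rule T_deriv) simp
    then have "((\<lambda>t. T t (g (g (B y)))) has_vector_derivative - Bc z) (at 0 within {0<..})"
      unfolding T_zero Bcz by (rule has_vector_derivative_within_subset) auto
    then have "((\<lambda>h. norm (T h (g (g (B y))) - g (g (B y)) - h *\<^sub>R - Bc z) / norm h) \<longlongrightarrow> 0) (at_right 0)"
      unfolding has_vector_derivative_def has_derivative_iff_norm by (simp add: T_zero)
    then have "((\<lambda>h. norm (E h z)) \<longlongrightarrow> 0) (at_right 0)"
    proof (rule Lim_transform_eventually)
      show "\<forall>\<^sub>F h in at_right 0. norm (T h (g (g (B y))) - g (g (B y)) - h *\<^sub>R - Bc z) / norm h = norm (E h z)"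
        unfolding eventually_at_filter
      proof (intro always_eventually allI impI)
        fix h :: real assume h: "h \<noteq> 0" "h \<in> {0<..}"
        have "E h z = (1/h) *\<^sub>R (T h (g (g (B y))) - g (g (B y)) - h *\<^sub>R - Bc z)"
          unfolding E_def Bz using h by (simp add: T_lin T_Ker z(2) scaleR_add_right)
        then show "norm (T h (g (g (B y))) - g (g (B y)) - h *\<^sub>R - Bc z) / norm h = norm (E h z)"
          by (simp only: norm_scaleR) simp
      qed
    qed
    then show "((\<lambda>h. E h z) \<longlongrightarrow> 0) (at_right 0)" by (rule tendsto_norm_zero_cancel)
  qed
  from tendsto_diff[OF this tendsto_const[of "Bc y"]] show ?thesis by (simp add: E_def)
qed

end

section \<open>Arbitrary semigroups with the same generator\<close>

lemma C0_semigroup_at_0: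
  assumes V: "C0_semigroup V"
  shows "((\<lambda>t. V t x) \<longlongrightarrow> x) (at 0 within {0..})" "V 0 x = x"
proof -
  show 0: "V 0 x = x" using V by (simp add: C0_semigroup_def)
  have "((\<lambda>t. V t x) \<longlongrightarrow> x) (at 0 within {0<..})" using V by (simp add: C0_semigroup_def)
  moreover have "at 0 within {0::real<..} = at 0 within {0..}"
    unfolding at_within_def by (rule arg_cong2[of _ _ _ _ inf]) auto
  ultimately show "((\<lambda>t. V t x) \<longlongrightarrow> x) (at 0 within {0..})" by simp
qed

text \<open>If no interval at 0 worked, there would be times \<open>h n\<close> tending to 0 with
  norms above \<open>n\<close>, against uniform boundedness along a strongly convergent sequence.
  The bound near 0 is then propagated in steps of length \<open>\<delta>\<close>.\<close>

lemma C0_semigroup_bounded: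
  fixes V :: "real \<Rightarrow> 'a::complex_banach \<Rightarrow> 'a"
  assumes V: "C0_semigroup V"
  shows "\<exists>c. \<forall>s\<in>{0..t}. \<forall>x. norm (V s x) \<le> c * norm x"
proof -
  have bop: "bounded_op (V s)" if "0 \<le> s" for s using V that by (simp add: C0_semigroup_def)
  have "\<exists>\<delta> c. 0 < \<delta> \<and> (\<forall>s\<in>{0..\<delta>}. \<forall>x. norm (V s x) \<le> c * norm x)"
  proof (rule ccontr)
    assume neg: "\<not> ?thesis"
    have "\<exists>s\<in>{0..inverse (real (Suc n))}. \<exists>x. \<not> norm (V s x) \<le> real n * norm x" for n
      using neg[simplified, rule_format, of "inverse (real (Suc n))" "real n"] by auto
    then obtain h where h: "\<And>n. h n \<in> {0..inverse (real (Suc n))}" "\<And>n. \<exists>x. \<not> norm (V (h n) x) \<le> real n * norm x"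
      by metis
    have h0: "h \<longlonglongrightarrow> 0"
      by (rule tendsto_sandwich[OF _ _ tendsto_const LIMSEQ_inverse_real_of_nat]) (use h(1) in auto)
    have "\<exists>c. \<forall>n. norm (V (h n) x) \<le> c" for x
    proof -
      have "(\<lambda>n. V (h n) x) \<longlonglongrightarrow> x"
      proof (rule tendstoI)
        fix e :: real assume e: "e > 0"
        have "eventually (\<lambda>t. dist (V t x) x < e) (at 0 within {0..})"
          using C0_semigroup_at_0(1)[OF V] e by (rule tendstoD)
        then obtain d where d: "d > 0" "\<And>t. t \<in> {0..} \<Longrightarrow> t \<noteq> 0 \<Longrightarrow> dist t 0 < d \<Longrightarrow> dist (V t x) x < e"
          unfolding eventually_at by auto
        have "\<forall>\<^sub>F n in sequentially. dist (h n) 0 < d" using h0 d(1) by (rule tendstoD)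
        then show "\<forall>\<^sub>F n in sequentially. dist (V (h n) x) x < e"
        proof eventually_elim
          case (elim n)
          show ?case
          proof (cases "h n = 0")
            case True then show ?thesis using C0_semigroup_at_0(2)[OF V] e by simp
          next
            case False then show ?thesis using d(2)[of "h n"] h(1)[of n] elim by auto
          qed
        qed
      qed
      then have "Bseq (\<lambda>n. V (h n) x)" by (intro convergent_imp_Bseq) (auto simp: convergent_def)
      then show ?thesis by (auto simp: Bseq_def)
    qed
    then obtain c where c: "\<And>n x. norm (V (h n) x) \<le> c * norm x"
      using uniform_boundedness[of "\<lambda>n. V (h n)"] bounded_opD(3)[OF bop] h(1) by (metis atLeastAtMost_iff)
    obtain n :: nat where n: "c \<le> n" using real_arch_simple by blast
    obtain x where "\<not> norm (V (h n) x) \<le> real n * norm x" using h(2) by blast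
    moreover have "c * norm x \<le> real n * norm x" using n by (intro mult_right_mono) auto
    ultimately show False using c[of n x] by simp
  qed
  then obtain \<delta> c where \<delta>: "0 < \<delta>" "\<And>s x. s \<in> {0..\<delta>} \<Longrightarrow> norm (V s x) \<le> c * norm x" by blast
  define c' where "c' = \<bar>c\<bar> + 1"
  have c': "1 \<le> c'" "c \<le> c'" by (auto simp: c'_def)
  have b: "norm (V s x) \<le> c' ^ Suc k * norm x" if "s \<in> {0..real k * \<delta>}" for k s x
    using that
  proof (induction k arbitrary: s)
    case 0
    then show ?case using C0_semigroup_at_0(2)[OF V, of x] mult_right_mono[OF c'(1), of "norm x"] by simp
  next
    case (Suc k)
    show ?case
    proof (cases "s \<le> \<delta>")
      case True
      then have "norm (V s x) \<le> c * norm x" using Suc \<delta> by auto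
      also have "c \<le> c' ^ Suc (Suc k)" using c' self_le_power[of c' "Suc (Suc k)"] by linarith
      finally show ?thesis by (simp add: mult_right_mono order_trans)
    next
      case False
      then have s: "s - \<delta> \<in> {0..real k * \<delta>}" using Suc(2) by (auto simp: algebra_simps)
      have "V s x = V \<delta> (V (s - \<delta>) x)"
      proof -
        have "V (r + q) = V r \<circ> V q" if "0 \<le> r" "0 \<le> q" for r q using V that by (simp add: C0_semigroup_def)
        from this[of \<delta> "s - \<delta>"] have "V (\<delta> + (s - \<delta>)) = V \<delta> \<circ> V (s - \<delta>)" using s \<delta>(1) by auto
        then show ?thesis by simp
      qed
      also have "norm \<dots> \<le> c * norm (V (s - \<delta>) x)" using \<delta> by (intro \<delta>(2)) auto
      also have "\<dots> \<le> c' * (c' ^ Suc k * norm x)" using c' Suc.IH[OF s] by (intro mult_mono) auto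
      finally show ?thesis by (simp add: mult.assoc)
    qed
  qed
  obtain k :: nat where "t / \<delta> \<le> k" using real_arch_simple by blast
  then have "{0..t} \<subseteq> {0..real k * \<delta>}" using \<delta>(1) by (auto simp: field_simps)
  then show ?thesis using b[of _ k] by blast
qed

text \<open>Here the operator returns: \<open>R\<close> consists of its resolvents, so the range of
  \<open>B\<close> is its domain.\<close>

locale generator_family = dilatable +
  fixes A :: "'a uop"
  assumes linA: "linear_uop A" and res: "z \<in> S \<Longrightarrow> is_resolvent z A (R z)"
begin

lemma A_B: "B w \<in> fst A" "snd A (B w) = Bc w"
proof -
  have "B w = R (-1) (- w)" by (simp add: B_def R_lin S_neg)
  moreover have "R (-1) (- w) \<in> fst A" "(-1) *\<^sub>C R (-1) (- w) - snd A (R (-1) (- w)) = - w"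
    using res[OF S_neg(2)] by (auto simp: is_resolvent_def)
  ultimately show "B w \<in> fst A" "snd A (B w) = Bc w"
    by (auto simp: Bc_def cscale_algebra algebra_simps)
qed

lemma B_A: "x \<in> fst A \<Longrightarrow> B (x + snd A x) = x"
proof -
  assume "x \<in> fst A"
  then have "R (-1) ((-1) *\<^sub>C x - snd A x) = x" using res[OF S_neg(2)] by (auto simp: is_resolvent_def)
  moreover have "(-1) *\<^sub>C x - snd A x = - (x + snd A x)" by (simp add: cscale_algebra)
  ultimately show ?thesis by (simp add: B_def R_lin S_neg)
qed

text \<open>Conversely, if the difference quotients at \<open>x\<close> tend to \<open>y\<close>,
  applying \<open>B\<close> gives \<open>B y = - Bc x\<close>, so \<open>x = B (x - y)\<close> lies
  in the domain: the generator is no larger than \<open>- A\<close>.\<close>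

lemma T_neg_generator: "neg_generator A T"
proof -
  have fwd: "((\<lambda>h. (1/h) *\<^sub>R (T h x - x)) \<longlongrightarrow> - snd A x) (at_right 0)" if x: "x \<in> fst A" for x
    using T_generator[of "x + snd A x"] B_A[OF x] A_B(2)[of "x + snd A x"] by simp
  have bwd: "x \<in> fst A" if lim: "((\<lambda>h. (1/h) *\<^sub>R (T h x - x)) \<longlongrightarrow> y) (at_right 0)" for x y
  proof -
    have "((\<lambda>h. B ((1/h) *\<^sub>R (T h x - x))) \<longlongrightarrow> B y) (at_right 0)"
      by (rule bounded_linear.tendsto[OF B_lin(3) lim])
    then have "((\<lambda>h. (1/h) *\<^sub>R (T h (B x) - B x)) \<longlongrightarrow> B y) (at_right 0)"
      by (simp add: B_lin commute_B[OF T_commutes])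
    then have "B y = - Bc x" using T_generator[of x] by (intro tendsto_unique[of "at_right 0"]) auto
    then have "x = B (x - y)" by (simp add: B_lin Bc_def)
    then show ?thesis using A_B(1)[of "x - y"] by simp
  qed
  show ?thesis unfolding neg_generator_def using fwd bwd by blast
qed

text \<open>\<open>V\<close> is brought under \<open>T_unique\<close>: it preserves the domain and
  commutes with \<open>A\<close>, hence with the resolvents; it solves the equation on the domain;
  and it is constant on the kernel.\<close>

lemma semigroup_generator_unique:
  assumes V: "C0_semigroup V" and gen: "neg_generator A V" and t: "0 \<le> t"
  shows "V t x = T t x"
proof -
  have bop: "bounded_op (V s)" if "0 \<le> s" for s using V that by (simp add: C0_semigroup_def)
  have add: "V (s + r) x = V s (V r x)" if "0 \<le> s" "0 \<le> r" for s r x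
    using V that unfolding C0_semigroup_def by (metis comp_apply)
  have lim: "((\<lambda>h. (1/h) *\<^sub>R (V h x - x)) \<longlongrightarrow> - snd A x) (at_right 0)" if "x \<in> fst A" for x
    using gen that by (auto simp: neg_generator_def)
  have inv: "V s x \<in> fst A \<and> snd A (V s x) = V s (snd A x)" if s: "0 \<le> s" and x: "x \<in> fst A" for s x
  proof -
    have "((\<lambda>h. V s ((1/h) *\<^sub>R (V h x - x))) \<longlongrightarrow> V s (- snd A x)) (at_right 0)"
      by (rule bounded_linear.tendsto[OF bounded_opD(3)[OF bop[OF s]] lim[OF x]])
    moreover have "\<forall>\<^sub>F h in at_right 0. V s ((1/h) *\<^sub>R (V h x - x)) = (1/h) *\<^sub>R (V h (V s x) - V s x)"
      unfolding eventually_at_filter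
    proof (intro always_eventually allI impI)
      fix h :: real assume "h \<in> {0<..}"
      then have "V s (V h x) = V h (V s x)" using add[of s h x] add[of h s x] s by (simp add: add.commute)
      then show "V s ((1/h) *\<^sub>R (V h x - x)) = (1/h) *\<^sub>R (V h (V s x) - V s x)"
        by (simp add: bounded_opD[OF bop[OF s]])
    qed
    ultimately have l: "((\<lambda>h. (1/h) *\<^sub>R (V h (V s x) - V s x)) \<longlongrightarrow> - V s (snd A x)) (at_right 0)"
      by (simp add: bounded_opD[OF bop[OF s]] Lim_transform_eventually)
    then have "V s x \<in> fst A" using gen by (auto simp: neg_generator_def)
    moreover have "- snd A (V s x) = - V s (snd A x)"
      using lim[OF calculation] l by (intro tendsto_unique[of "at_right 0"]) auto
    ultimately show ?thesis by simp
  qed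
  have comm: "commutes (V s)" if s: "0 \<le> s" for s
    unfolding commutes_def
  proof (intro conjI ballI allI bop s)
    fix z x assume z: "z \<in> S"
    note r = res[OF z, unfolded is_resolvent_def]
    have w: "R z x \<in> fst A" "z *\<^sub>C R z x - snd A (R z x) = x" using r by auto
    have "V s x = z *\<^sub>C V s (R z x) - snd A (V s (R z x))"
      using inv[OF s w(1)] w(2) by (metis bounded_opD(2,6)[OF bop[OF s]])
    then show "V s (R z x) = R z (V s x)" using r inv[OF s w(1)] by metis
  qed
  \<comment> \<open>Only the right derivative at 0 is given. With \<open>m = min r s\<close> and
    \<open>h = \<bar>r - s\<bar>\<close> both signs of \<open>r - s\<close> reduce to
    \<open>V m (V h x - x)\<close>, and local boundedness controls \<open>V m\<close>.\<close>
  have deriv: "((\<lambda>s. V s x) has_vector_derivative - V s (snd A x)) (at s within {0..})"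
    if s: "0 \<le> s" and x: "x \<in> fst A" for s x
  proof -
    obtain c where c: "\<And>r x. r \<in> {0..s + 1} \<Longrightarrow> norm (V r x) \<le> c * norm x"
      using C0_semigroup_bounded[OF V, of "s + 1"] by blast
    let ?a = "snd A x"
    define H where "H = (\<lambda>r. c * norm ((1/\<bar>r - s\<bar>) *\<^sub>R (V \<bar>r - s\<bar> x - x) + ?a) + c * norm (V \<bar>r - s\<bar> ?a - ?a))"
    have fl: "filterlim (\<lambda>r. \<bar>r - s\<bar>) (at_right 0) (at s within {0..})"
      unfolding filterlim_at
    proof (intro conjI)
      have "((\<lambda>r. \<bar>r - s\<bar>) \<longlongrightarrow> \<bar>s - s\<bar>) (at s within {0..})" by (intro tendsto_intros)
      then show "((\<lambda>r. \<bar>r - s\<bar>) \<longlongrightarrow> 0) (at s within {0..})" by simp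
    qed (auto simp: eventually_at_filter)
    have "((\<lambda>h. V h ?a) \<longlongrightarrow> ?a) (at_right 0)" using V by (simp add: C0_semigroup_def)
    then have l2: "((\<lambda>h. c * norm ((1/h) *\<^sub>R (V h x - x) + ?a) + c * norm (V h ?a - ?a)) \<longlongrightarrow> c * norm (- ?a + ?a) + c * norm (?a - ?a)) (at_right 0)"
      by (intro tendsto_intros lim x)
    have Hl: "(H \<longlongrightarrow> 0) (at s within {0..})"
      using filterlim_compose[OF l2 fl] by (simp add: H_def)
    have "((\<lambda>s. V s x) has_derivative (\<lambda>h. h *\<^sub>R - V s ?a)) (at s within {0..})"
    proof (rule has_derivativeI_sandwich[of 1, OF _ _ _ Hl])
      show "bounded_linear (\<lambda>h. h *\<^sub>R - V s ?a)" by (rule bounded_linear_scaleR_left)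
      fix r assume r: "r \<in> {0..}" "r \<noteq> s" "dist r s < 1"
      define m where "m = min r s"
      define h where "h = \<bar>r - s\<bar>"
      have mh: "0 \<le> m" "0 < h" "m \<in> {0..s+1}" "0 \<le> s - m" using r s by (auto simp: m_def h_def dist_real_def)
      note Vm = bounded_opD[OF bop[OF mh(1)]]
      have "norm (V r x - V s x - (r - s) *\<^sub>R - V s ?a) = norm (V m (V h x - x) + h *\<^sub>R V s ?a)"
      proof (cases "s \<le> r")
        case True
        then have "m = s" "h = r - s" by (auto simp: m_def h_def)
        moreover from this have "V r x = V m (V h x)" using add[of m h x] mh by simp
        ultimately show ?thesis using Vm by simp
      next
        case False
        then have "m = r" "h = s - r" by (auto simp: m_def h_def)
        moreover from this have "V s x = V m (V h x)" using add[of m h x] mh by simp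
        ultimately have "V m (V h x - x) = V s x - V r x" "r - s = - h" using Vm(6)[of "V h x" x] by simp_all
        then have "V r x - V s x - (r - s) *\<^sub>R - V s ?a = - (V m (V h x - x) + h *\<^sub>R V s ?a)" by simp
        then show ?thesis by (simp only: norm_minus_cancel)
      qed
      also have "V m (V h x - x) + h *\<^sub>R V s ?a = V m (V h x - x + h *\<^sub>R ?a) + h *\<^sub>R (V s ?a - V m ?a)"
        by (simp add: Vm algebra_simps)
      also have "norm \<dots> \<le> h * (c * norm ((1/h) *\<^sub>R (V h x - x) + ?a)) + h * (c * norm (V h ?a - ?a))"
      proof (rule norm_triangle_le[OF add_mono])
        have "V h x - x + h *\<^sub>R ?a = h *\<^sub>R ((1/h) *\<^sub>R (V h x - x) + ?a)" using mh by (simp add: scaleR_add_right)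
        then have "norm (V m (V h x - x + h *\<^sub>R ?a)) = h * norm (V m ((1/h) *\<^sub>R (V h x - x) + ?a))" using mh by (simp add: Vm(7))
        also have "\<dots> \<le> h * (c * norm ((1/h) *\<^sub>R (V h x - x) + ?a))" using mh by (intro mult_left_mono c) auto
        finally show "norm (V m (V h x - x + h *\<^sub>R ?a)) \<le> h * (c * norm ((1/h) *\<^sub>R (V h x - x) + ?a))" .
        have c0: "0 \<le> c * norm (V h ?a - ?a)" using c[of m "V h ?a - ?a"] mh norm_ge_zero by (meson order_trans)
        have "norm (V s ?a - V m ?a) \<le> c * norm (V h ?a - ?a)"
        proof (cases "s \<le> r")
          case True then show ?thesis using c0 by (simp add: m_def)
        next
          case False
          then have "V s ?a = V m (V h ?a)" using add[of m h ?a] mh by (simp add: m_def h_def)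
          then show ?thesis using c[OF mh(3), of "V h ?a - ?a"] by (simp add: Vm)
        qed
        then show "norm (h *\<^sub>R (V s ?a - V m ?a)) \<le> h * (c * norm (V h ?a - ?a))" using mh by (simp add: mult_left_mono)
      qed
      finally show "norm (V r x - V s x - (r - s) *\<^sub>R - V s ?a) / norm (r - s) \<le> H r"
        using mh unfolding H_def h_def[symmetric] real_norm_def by (simp add: field_simps)
    qed simp
    then show ?thesis by (simp add: has_vector_derivative_def)
  qed
  have "V t x = T t (V 0 x)"
  proof (rule T_unique[OF comm _ _ t])
    fix s :: real and y assume s: "0 \<le> s"
    have "g (g y) = B (Bc (g y))" by (rule g_alt)
    then show "((\<lambda>s. V s (g (g y))) has_vector_derivative - V s (ag y)) (at s within {0..})"
      using deriv[OF s A_B(1)[of "Bc (g y)"]] A_B(2)[of "Bc (g y)"] by (simp add: ag_alt)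
  next
    fix s :: real and p assume s: "0 \<le> s" and p: "p \<in> Ker"
    have "p \<in> fst A" "snd A p = 0" using A_B[of p] p by (auto simp: Ker_def Bc_def)
    then have "((\<lambda>s. V s p) has_vector_derivative 0) (at r within {0..})" if "r \<in> {0..}" for r
      using deriv[of r p] that by (simp add: bounded_opD[OF bop])
    then obtain k where "\<And>r. r \<in> {0..} \<Longrightarrow> V r p = k"
      using has_vector_derivative_zero_constant[of "{0..}" "\<lambda>s. V s p"] by (metis convex_real_interval(1))
    then show "V s p = V 0 p" using s by simp
  qed
  then show ?thesis using C0_semigroup_at_0(2)[OF V] by simp
qed

text \<open>\<open>semigroup\<close> is a choice among the semigroups with generator
  \<open>- A\<close>: \<open>T\<close> shows that one exists, and uniqueness identifies the chosen
  one.\<close>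

theorem semigroup_eq_T: "0 \<le> t \<Longrightarrow> semigroup A t x = T t x"
proof -
  assume t: "0 \<le> t"
  have "C0_semigroup (semigroup A) \<and> neg_generator A (semigroup A)"
    unfolding semigroup_def by (rule someI[of _ T]) (use T_C0 T_neg_generator in blast)
  then show ?thesis using semigroup_generator_unique t by blast
qed

end

section \<open>The holomorphic functional calculus of rational functions\<close>

text \<open>In a sector of sine \<open>s\<close> the cross term \<open>2 b Im z\<close> takes at
  most the fraction \<open>s\<close> of \<open>(cmod z)\<^sup>2 + b\<^sup>2\<close>; the distance
  from \<open>z\<close> to \<open>i b\<close> is thus comparable to both moduli.\<close>

lemma norm_diff_imag:
  assumes "\<bar>Im z\<bar> \<le> s * cmod z" "0 \<le> s" "s < 1"
  shows "(1 - s) * ((cmod z)\<^sup>2 + b\<^sup>2) \<le> (cmod (z - \<i> * of_real b))\<^sup>2"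
proof -
  have "b * Im z \<le> \<bar>b\<bar> * \<bar>Im z\<bar>" by (metis abs_ge_self abs_mult)
  also have "\<dots> \<le> \<bar>b\<bar> * (s * cmod z)" using assms by (intro mult_left_mono) auto
  finally have 1: "2 * (b * Im z) \<le> s * (2 * \<bar>b\<bar> * cmod z)" by (simp add: mult_ac)
  have "2 * \<bar>b\<bar> * cmod z \<le> (cmod z)\<^sup>2 + b\<^sup>2" using sum_squares_bound[of "\<bar>b\<bar>" "cmod z"] by (simp add: add.commute)
  then have "s * (2 * \<bar>b\<bar> * cmod z) \<le> s * ((cmod z)\<^sup>2 + b\<^sup>2)" using assms by (intro mult_left_mono)
  with 1 have 2: "2 * (b * Im z) \<le> s * ((cmod z)\<^sup>2 + b\<^sup>2)" by linarith
  have "(cmod (z - \<i> * of_real b))\<^sup>2 = (cmod z)\<^sup>2 + b\<^sup>2 - 2 * (b * Im z)"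
    unfolding cmod_power2 by (simp add: power2_eq_square algebra_simps)
  with 2 show ?thesis by (simp add: algebra_simps)
qed

lemma norm_diff_imag':
  assumes "\<bar>Im z\<bar> \<le> s * cmod z" "0 \<le> s" "s < 1"
  shows "sqrt (1 - s) * cmod z \<le> cmod (z - \<i> * of_real b)" "sqrt (1 - s) * \<bar>b\<bar> \<le> cmod (z - \<i> * of_real b)"
proof -
  have "(1 - s) * (cmod z)\<^sup>2 \<le> (cmod (z - \<i> * of_real b))\<^sup>2" "(1 - s) * b\<^sup>2 \<le> (cmod (z - \<i> * of_real b))\<^sup>2"
  proof -
    have "0 \<le> (1 - s) * b\<^sup>2" "0 \<le> (1 - s) * (cmod z)\<^sup>2" using assms by simp_all
    then show "(1 - s) * (cmod z)\<^sup>2 \<le> (cmod (z - \<i> * of_real b))\<^sup>2" "(1 - s) * b\<^sup>2 \<le> (cmod (z - \<i> * of_real b))\<^sup>2"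
      using norm_diff_imag[OF assms, of b] unfolding distrib_left by linarith+
  qed
  then have "sqrt ((1 - s) * (cmod z)\<^sup>2) \<le> cmod (z - \<i> * of_real b)" "sqrt ((1 - s) * b\<^sup>2) \<le> cmod (z - \<i> * of_real b)"
    by (simp_all add: real_le_lsqrt)
  then show "sqrt (1 - s) * cmod z \<le> cmod (z - \<i> * of_real b)" "sqrt (1 - s) * \<bar>b\<bar> \<le> cmod (z - \<i> * of_real b)"
    by (simp_all add: real_sqrt_mult)
qed

text \<open>The symbol of a sum of operators \<open>c K (i p) (i q)\<close>. For nonzero
  \<open>p\<close>, \<open>q\<close> it decays to first order at 0 and at infinity.\<close>

definition rat :: "'k set \<Rightarrow> ('k \<Rightarrow> complex) \<Rightarrow> ('k \<Rightarrow> real) \<Rightarrow> ('k \<Rightarrow> real) \<Rightarrow> complex \<Rightarrow> complex" where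
  "rat F c p q z = (\<Sum>\<kappa>\<in>F. c \<kappa> * (z / ((z - \<i> * of_real (p \<kappa>)) * (z - \<i> * of_real (q \<kappa>)))))"

lemma rat_bound:
  assumes "finite F" "\<And>\<kappa>. p \<kappa> \<noteq> 0" "\<And>\<kappa>. q \<kappa> \<noteq> 0" "0 \<le> s" "s < 1"
  shows "\<exists>c0\<ge>0. \<forall>z. z \<noteq> 0 \<longrightarrow> \<bar>Im z\<bar> \<le> s * cmod z \<longrightarrow> cmod (rat F c p q z) \<le> c0 * cmod z \<and> cmod (rat F c p q z) \<le> c0 / cmod z"
proof -
  define A where "A = (\<Sum>\<kappa>\<in>F. cmod (c \<kappa>) / ((1 - s) * \<bar>p \<kappa>\<bar> * \<bar>q \<kappa>\<bar>))"
  define B where "B = (\<Sum>\<kappa>\<in>F. cmod (c \<kappa>) / (1 - s))"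
  have AB: "0 \<le> A" "0 \<le> B" using assms(5) by (auto simp: A_def B_def intro!: sum_nonneg divide_nonneg_nonneg mult_nonneg_nonneg)
  have "cmod (rat F c p q z) \<le> A * cmod z \<and> cmod (rat F c p q z) \<le> B / cmod z" if z: "z \<noteq> 0" "\<bar>Im z\<bar> \<le> s * cmod z" for z
  proof -
    define t where "t = sqrt (1 - s)"
    have t: "t > 0" "t * t = 1 - s" using assms(5) by (auto simp: t_def)
    note n = norm_diff_imag'[OF z(2) assms(4,5), folded t_def]
    have a: "cmod (c \<kappa> * (z / ((z - \<i> * of_real (p \<kappa>)) * (z - \<i> * of_real (q \<kappa>))))) \<le> cmod (c \<kappa>) * (cmod z / ((t * x) * (t * y)))"
      if "t * x \<le> cmod (z - \<i> * of_real (p \<kappa>))" "t * y \<le> cmod (z - \<i> * of_real (q \<kappa>))" "0 < x" "0 < y" for \<kappa> x y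
    proof -
      have "(t * x) * (t * y) \<le> cmod (z - \<i> * of_real (p \<kappa>)) * cmod (z - \<i> * of_real (q \<kappa>))"
        using that t by (intro mult_mono) auto
      moreover have "0 < (t * x) * (t * y)" using that t by simp
      ultimately show ?thesis unfolding norm_mult norm_divide by (intro mult_left_mono frac_le order_refl) auto
    qed
    have "cmod (rat F c p q z) \<le> (\<Sum>\<kappa>\<in>F. cmod (c \<kappa>) * (cmod z / ((t * \<bar>p \<kappa>\<bar>) * (t * \<bar>q \<kappa>\<bar>))))"
      unfolding rat_def by (intro sum_norm_le a n) (use assms in auto)
    also have "\<dots> = A * cmod z" unfolding A_def sum_distrib_right
      by (intro sum.cong refl) (simp add: t(2)[symmetric] mult_ac)
    finally have 1: "cmod (rat F c p q z) \<le> A * cmod z" .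
    have "cmod (rat F c p q z) \<le> (\<Sum>\<kappa>\<in>F. cmod (c \<kappa>) * (cmod z / ((t * cmod z) * (t * cmod z))))"
      unfolding rat_def by (intro sum_norm_le a n) (use z in auto)
    also have "\<dots> = B / cmod z" unfolding B_def sum_divide_distrib
      by (intro sum.cong refl) (use z t in \<open>simp add: t(2)[symmetric] mult_ac\<close>)
    finally show ?thesis using 1 by simp
  qed
  then have "cmod (rat F c p q z) \<le> (A + B) * cmod z \<and> cmod (rat F c p q z) \<le> (A + B) / cmod z"
    if "z \<noteq> 0" "\<bar>Im z\<bar> \<le> s * cmod z" for z
  proof -
    have "A * cmod z \<le> (A + B) * cmod z" "B / cmod z \<le> (A + B) / cmod z"
      using AB by (auto intro: mult_right_mono divide_right_mono)
    then show ?thesis using \<open>\<And>z. z \<noteq> 0 \<Longrightarrow> \<bar>Im z\<bar> \<le> s * cmod z \<Longrightarrow> _\<close>[OF that] by linarith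
  qed
  then show ?thesis using AB by (intro exI[of _ "A + B"]) auto
qed

context resolvent_family
begin

text \<open>The integrand is a pole part \<open>Fs\<close> plus \<open>R z y\<close>, where
  \<open>2 pi i y\<close> is the claimed value. \<open>Fs\<close> is rotated through the sector, by
  the angle \<open>2 \<nu>\<close>, and \<open>R z y\<close> through its complement, by
  \<open>2 pi - 2 \<nu>\<close>. At infinity they behave like \<open>- y / z\<close> and
  \<open>y / z\<close>, so the two arcs add up to \<open>2 pi i y\<close>.\<close>

lemma rat_integral:
  fixes x :: 'a
  assumes F: "finite F" and p: "\<And>\<kappa>. p \<kappa> \<noteq> 0" and q: "\<And>\<kappa>. q \<kappa> \<noteq> 0" and pq: "\<And>\<kappa>. p \<kappa> \<noteq> q \<kappa>"
    and nu: "\<theta>0 < \<nu>" "\<nu> < pi / 2"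
  shows "integral {0<..} (\<lambda>t::real. (cis (-\<nu>) * rat F c p q (t * cis (-\<nu>))) *\<^sub>C R (t * cis (-\<nu>)) x)
      - integral {0<..} (\<lambda>t::real. (cis \<nu> * rat F c p q (t * cis \<nu>)) *\<^sub>C R (t * cis \<nu>) x)
    = (2 * pi * \<i>) *\<^sub>C (\<Sum>\<kappa>\<in>F. c \<kappa> *\<^sub>C K (\<i> * of_real (p \<kappa>)) (\<i> * of_real (q \<kappa>)) x)"
proof -
  define a b where "a = (\<lambda>\<kappa>. \<i> * complex_of_real (p \<kappa>))" and "b = (\<lambda>\<kappa>. \<i> * complex_of_real (q \<kappa>))"
  have abS: "a \<kappa> \<in> S" "b \<kappa> \<in> S" for \<kappa> using S_imag p q by (auto simp: a_def b_def)
  have ab: "a \<kappa> \<noteq> b \<kappa>" for \<kappa> using pq by (simp add: a_def b_def)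
  define y where "y = (\<Sum>\<kappa>\<in>F. c \<kappa> *\<^sub>C K (a \<kappa>) (b \<kappa>) x)"
  define s where "s = sin \<nu>"
  have nu0: "0 < \<nu>" using nu th0 by linarith
  have s01: "0 \<le> s" "s < 1"
  proof -
    show "0 \<le> s" unfolding s_def using nu nu0 by (intro sin_ge_zero) auto
    have "sin \<nu> < sin (pi/2)" using nu nu0 by (intro sin_monotone_2pi) auto
    then show "s < 1" by (simp add: s_def)
  qed
  have sec: "\<bar>Im (of_real r * cis u)\<bar> \<le> s * cmod (of_real r * cis u)" if "0 < r" "u \<in> {-\<nu>..\<nu>}" for r u
  proof -
    have "\<bar>sin u\<bar> \<le> sin \<nu>"
    proof (cases "0 \<le> u")
      case True
      then have "0 \<le> sin u" "sin u \<le> sin \<nu>" using that nu by (auto intro!: sin_ge_zero sin_monotone_2pi_le)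
      then show ?thesis by simp
    next
      case False
      then have "0 \<le> sin (-u)" "sin (-u) \<le> sin \<nu>" using that nu by (intro sin_ge_zero sin_monotone_2pi_le; simp)+
      then show ?thesis by simp
    qed
    then show ?thesis using that by (simp add: s_def norm_mult abs_mult)
  qed
  have out: "of_real r * cis u \<in> S" if "0 < r" "u \<in> {\<nu>..2*pi-\<nu>}" for r u
  proof (rule S_polar[OF that(1)])
    have "cos u \<le> cos \<nu>"
    proof (cases "u \<le> pi")
      case True then show ?thesis using that nu nu0 by (intro cos_monotone_0_pi_le) auto
    next
      case False
      then have "cos (2*pi - u) \<le> cos \<nu>" using that nu nu0 by (intro cos_monotone_0_pi_le) auto
      then show ?thesis by (simp add: cos_diff)
    qed
    also have "\<dots> < cos \<theta>0" using nu th0 by (intro cos_monotone_0_pi) auto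
    finally show "cos u < cos \<theta>0" .
  qed
  \<comment> \<open>The boundary rays are joined through the sector by the angles from
    \<open>-\<nu>\<close> to \<open>\<nu>\<close>, and through its complement by those from
    \<open>\<nu>\<close> to \<open>2 pi - \<nu>\<close>.\<close>
  have cisnu: "cis (2*pi - \<nu>) = cis (-\<nu>)" by (simp add: complex_eq_iff cos_diff sin_diff)
  have rayS: "of_real r * cis \<nu> \<in> S" "of_real r * cis (-\<nu>) \<in> S" if "0 < r" for r
  proof -
    have "\<nu> \<le> pi" using nu pi_gt_zero by linarith
    then show "of_real r * cis \<nu> \<in> S" "of_real r * cis (-\<nu>) \<in> S"
      using out[OF that, of \<nu>] out[OF that, of "2*pi-\<nu>"] unfolding cisnu by auto
  qed
  have nz: "z - a \<kappa> \<noteq> 0" "z - b \<kappa> \<noteq> 0" if "z \<noteq> 0" "\<bar>Im z\<bar> \<le> s * cmod z" for z \<kappa>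
  proof -
    have pos: "0 < sqrt (1 - s) * cmod z" using s01 that by simp
    show "z - a \<kappa> \<noteq> 0" "z - b \<kappa> \<noteq> 0"
      using less_le_trans[OF pos norm_diff_imag'(1)[OF that(2) s01, of "p \<kappa>"]]
        less_le_trans[OF pos norm_diff_imag'(1)[OF that(2) s01, of "q \<kappa>"]] by (auto simp: a_def b_def)
  qed
  define Fs where "Fs = (\<lambda>z. \<Sum>\<kappa>\<in>F. c \<kappa> *\<^sub>C (((a \<kappa> / (a \<kappa> - b \<kappa>)) / (z - a \<kappa>)) *\<^sub>C R (a \<kappa>) x - ((b \<kappa> / (a \<kappa> - b \<kappa>)) / (z - b \<kappa>)) *\<^sub>C R (b \<kappa>) x))"
  define Fs' where "Fs' = (\<lambda>z. \<Sum>\<kappa>\<in>F. c \<kappa> *\<^sub>C ((- (a \<kappa> / (a \<kappa> - b \<kappa>)) / (z - a \<kappa>)\<^sup>2) *\<^sub>C R (a \<kappa>) x - (- (b \<kappa> / (a \<kappa> - b \<kappa>)) / (z - b \<kappa>)\<^sup>2) *\<^sub>C R (b \<kappa>) x))"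
  text \<open>By the resolvent identity the pole part of the integrand splits off; the two parts are
    rotated into opposite directions.\<close>
  have split: "rat F c p q z *\<^sub>C R z x = Fs z + R z y" if z: "z \<in> S" "z \<noteq> 0" "\<bar>Im z\<bar> \<le> s * cmod z" for z
  proof -
    have "(z / ((z - a \<kappa>) * (z - b \<kappa>))) *\<^sub>C R z x
      = ((a \<kappa> / (a \<kappa> - b \<kappa>)) / (z - a \<kappa>)) *\<^sub>C R (a \<kappa>) x - ((b \<kappa> / (a \<kappa> - b \<kappa>)) / (z - b \<kappa>)) *\<^sub>C R (b \<kappa>) x + R z (K (a \<kappa>) (b \<kappa>) x)" for \<kappa>
    proof -
      note n = nz[OF z(2,3), of \<kappa>]
      let ?d = "a \<kappa> - b \<kappa>"
      have d: "?d \<noteq> 0" using ab by simp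
      have n': "z \<noteq> a \<kappa>" "z \<noteq> b \<kappa>" using n by auto
      have ra: "R z (R (a \<kappa>) x) = (1 / (a \<kappa> - z)) *\<^sub>C (R z x - R (a \<kappa>) x)" by (rule R_prod[OF z(1) abS(1) n'(1)])
      have rb: "R z (R (b \<kappa>) x) = (1 / (b \<kappa> - z)) *\<^sub>C (R z x - R (b \<kappa>) x)" by (rule R_prod[OF z(1) abS(2) n'(2)])
      have "R z (K (a \<kappa>) (b \<kappa>) x) = (b \<kappa> / ?d) *\<^sub>C R z (R (b \<kappa>) x) - (a \<kappa> / ?d) *\<^sub>C R z (R (a \<kappa>) x)"
        by (simp add: K_pf[OF abS ab] R_lin[OF z(1)])
      also have "\<dots> = (b \<kappa> / ?d / (b \<kappa> - z) - a \<kappa> / ?d / (a \<kappa> - z)) *\<^sub>C R z x - (b \<kappa> / ?d / (b \<kappa> - z)) *\<^sub>C R (b \<kappa>) x + (a \<kappa> / ?d / (a \<kappa> - z)) *\<^sub>C R (a \<kappa>) x"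
        unfolding ra rb by (simp add: cscale_algebra)
      also have "b \<kappa> / ?d / (b \<kappa> - z) - a \<kappa> / ?d / (a \<kappa> - z) = z / ((z - a \<kappa>) * (z - b \<kappa>))"
        using n d by (simp add: divide_simps) (simp add: algebra_simps)
      also have "a \<kappa> / ?d / (a \<kappa> - z) = - (a \<kappa> / ?d / (z - a \<kappa>))" by (metis minus_diff_eq minus_divide_right)
      also have "b \<kappa> / ?d / (b \<kappa> - z) = - (b \<kappa> / ?d / (z - b \<kappa>))" by (metis minus_diff_eq minus_divide_right)
      finally show ?thesis by (simp add: cscale.minus_left)
    qed
    then have "(\<Sum>\<kappa>\<in>F. c \<kappa> *\<^sub>C ((z / ((z - a \<kappa>) * (z - b \<kappa>))) *\<^sub>C R z x)) = Fs z + (\<Sum>\<kappa>\<in>F. c \<kappa> *\<^sub>C R z (K (a \<kappa>) (b \<kappa>) x))"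
      unfolding Fs_def by (simp add: cscale.add_right sum.distrib)
    then show ?thesis
      by (simp add: rat_def cscale.sum_left y_def R_lin[OF z(1)] a_def b_def)
  qed
  obtain c0 where c0: "0 \<le> c0" "\<And>z. z \<noteq> 0 \<Longrightarrow> \<bar>Im z\<bar> \<le> s * cmod z \<Longrightarrow> cmod (rat F c p q z) \<le> c0 * cmod z"
    "\<And>z. z \<noteq> 0 \<Longrightarrow> \<bar>Im z\<bar> \<le> s * cmod z \<Longrightarrow> cmod (rat F c p q z) \<le> c0 / cmod z"
    using rat_bound[where c=c and F=F and p=p and q=q, OF F p q s01] by blast
  have derFs: "cderiv Fs (Fs' z) z" if z: "z \<noteq> 0" "\<bar>Im z\<bar> \<le> s * cmod z" for z
  proof -
    have "((\<lambda>z. k / (z - w)) has_field_derivative (- k / (z - w)\<^sup>2)) (at z)" if "z - w \<noteq> 0" for k w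
      using that by (auto intro!: derivative_eq_intros simp: power2_eq_square)
    from cderiv_scale[OF this cderiv_const]
    have d: "cderiv (\<lambda>z. (k / (z - w)) *\<^sub>C v) ((- k / (z - w)\<^sup>2) *\<^sub>C v) z" if "z - w \<noteq> 0" for k w v using that by simp
    show ?thesis unfolding Fs_def Fs'_def
      by (intro cderiv_sum cderiv_scale_const cderiv_diff d nz z)
  qed
  have contFs': "continuous_on {z. z \<noteq> 0 \<and> \<bar>Im z\<bar> \<le> s * cmod z} Fs'"
    unfolding Fs'_def by (intro continuous_intros) (use nz in auto)
  have contFs: "continuous_on {z. z \<noteq> 0 \<and> \<bar>Im z\<bar> \<le> s * cmod z} Fs"
    using derFs unfolding cderiv_def by (metis (mono_tags, lifting) continuous_at_imp_continuous_on has_derivative_continuous mem_Collect_eq)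
  define t where "t = sqrt (1 - s)"
  have t0: "t > 0" using s01 by (simp add: t_def)
  note nb = norm_diff_imag'[OF _ s01, folded t_def]
  \<comment> \<open>\<open>Ca\<close> bounds \<open>Fs\<close> on the inner arc and
    \<open>Cb\<close> measures the approach of \<open>z Fs\<close> to \<open>- y\<close> on the
    outer one; \<open>Ce\<close> and \<open>Cd\<close> do the same for \<open>R z y\<close>.\<close>
  define Ca where "Ca = (\<Sum>\<kappa>\<in>F. cmod (c \<kappa>) * ((cmod (a \<kappa> / (a \<kappa> - b \<kappa>)) / (t * \<bar>p \<kappa>\<bar>)) * norm (R (a \<kappa>) x) + (cmod (b \<kappa> / (a \<kappa> - b \<kappa>)) / (t * \<bar>q \<kappa>\<bar>)) * norm (R (b \<kappa>) x)))"
  have FsB: "norm (Fs z) \<le> Ca" if z: "z \<noteq> 0" "\<bar>Im z\<bar> \<le> s * cmod z" for z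
    unfolding Fs_def Ca_def norm_scaleC
  proof (intro sum_norm_le)
    fix \<kappa>
    have "norm (((a \<kappa> / (a \<kappa> - b \<kappa>)) / (z - a \<kappa>)) *\<^sub>C R (a \<kappa>) x - ((b \<kappa> / (a \<kappa> - b \<kappa>)) / (z - b \<kappa>)) *\<^sub>C R (b \<kappa>) x)
      \<le> (cmod (a \<kappa> / (a \<kappa> - b \<kappa>)) / cmod (z - a \<kappa>)) * norm (R (a \<kappa>) x) + (cmod (b \<kappa> / (a \<kappa> - b \<kappa>)) / cmod (z - b \<kappa>)) * norm (R (b \<kappa>) x)"
      using norm_triangle_ineq4[of "((a \<kappa> / (a \<kappa> - b \<kappa>)) / (z - a \<kappa>)) *\<^sub>C R (a \<kappa>) x" "((b \<kappa> / (a \<kappa> - b \<kappa>)) / (z - b \<kappa>)) *\<^sub>C R (b \<kappa>) x"]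
      by (simp only: norm_scaleC norm_divide)
    also have "\<dots> \<le> (cmod (a \<kappa> / (a \<kappa> - b \<kappa>)) / (t * \<bar>p \<kappa>\<bar>)) * norm (R (a \<kappa>) x) + (cmod (b \<kappa> / (a \<kappa> - b \<kappa>)) / (t * \<bar>q \<kappa>\<bar>)) * norm (R (b \<kappa>) x)"
      using nb(2)[OF z(2)] t0 p q nz[OF z] unfolding a_def b_def
      by (intro add_mono mult_right_mono divide_left_mono mult_pos_pos) (auto simp: a_def b_def)
    finally show "norm (c \<kappa> *\<^sub>C (((a \<kappa> / (a \<kappa> - b \<kappa>)) / (z - a \<kappa>)) *\<^sub>C R (a \<kappa>) x - ((b \<kappa> / (a \<kappa> - b \<kappa>)) / (z - b \<kappa>)) *\<^sub>C R (b \<kappa>) x))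
      \<le> cmod (c \<kappa>) * ((cmod (a \<kappa> / (a \<kappa> - b \<kappa>)) / (t * \<bar>p \<kappa>\<bar>)) * norm (R (a \<kappa>) x) + (cmod (b \<kappa> / (a \<kappa> - b \<kappa>)) / (t * \<bar>q \<kappa>\<bar>)) * norm (R (b \<kappa>) x))"
      unfolding norm_scaleC by (intro mult_left_mono) auto
  qed
  have Ca0: "0 \<le> Ca" using t0 by (auto simp: Ca_def intro!: sum_nonneg mult_nonneg_nonneg add_nonneg_nonneg divide_nonneg_nonneg)
  define Cb where "Cb = (\<Sum>\<kappa>\<in>F. cmod (c \<kappa>) * ((cmod (a \<kappa> / (a \<kappa> - b \<kappa>)) * cmod (a \<kappa>) / t) * norm (R (a \<kappa>) x) + (cmod (b \<kappa> / (a \<kappa> - b \<kappa>)) * cmod (b \<kappa>) / t) * norm (R (b \<kappa>) x)))"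
  have FsI: "norm (z *\<^sub>C Fs z - - y) \<le> Cb / cmod z" if z: "z \<noteq> 0" "\<bar>Im z\<bar> \<le> s * cmod z" for z
  proof -
    have 1: "z *\<^sub>C (((a \<kappa> / (a \<kappa> - b \<kappa>)) / (z - a \<kappa>)) *\<^sub>C R (a \<kappa>) x - ((b \<kappa> / (a \<kappa> - b \<kappa>)) / (z - b \<kappa>)) *\<^sub>C R (b \<kappa>) x) + K (a \<kappa>) (b \<kappa>) x
      = ((a \<kappa> / (a \<kappa> - b \<kappa>)) * a \<kappa> / (z - a \<kappa>)) *\<^sub>C R (a \<kappa>) x - ((b \<kappa> / (a \<kappa> - b \<kappa>)) * b \<kappa> / (z - b \<kappa>)) *\<^sub>C R (b \<kappa>) x" for \<kappa>
    proof -
      have e: "z * (k / (z - w)) = k * w / (z - w) + k" if "z - w \<noteq> 0" for k w :: complex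
        using that by (simp add: field_simps)
      have e': "z *\<^sub>C ((k / (z - w)) *\<^sub>C v) = (k * w / (z - w)) *\<^sub>C v + k *\<^sub>C v" if "z - w \<noteq> 0" for k w and v :: 'a
        by (simp only: scaleC_scaleC e[OF that] cscale.add_left)
      show ?thesis unfolding cscale.diff_right e'[OF nz(1)[OF z]] e'[OF nz(2)[OF z]] K_pf[OF abS ab]
        by simp
    qed
    define D where "D = (\<lambda>\<kappa>. ((a \<kappa> / (a \<kappa> - b \<kappa>)) * a \<kappa> / (z - a \<kappa>)) *\<^sub>C R (a \<kappa>) x - ((b \<kappa> / (a \<kappa> - b \<kappa>)) * b \<kappa> / (z - b \<kappa>)) *\<^sub>C R (b \<kappa>) x)"
    define E where "E = (\<lambda>\<kappa>. (cmod (a \<kappa> / (a \<kappa> - b \<kappa>)) * cmod (a \<kappa>) / t) * norm (R (a \<kappa>) x) + (cmod (b \<kappa> / (a \<kappa> - b \<kappa>)) * cmod (b \<kappa>) / t) * norm (R (b \<kappa>) x))"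
    have DE: "norm (D \<kappa>) \<le> E \<kappa> / cmod z" for \<kappa>
    proof -
      have "norm (D \<kappa>) \<le> (cmod (a \<kappa> / (a \<kappa> - b \<kappa>)) * cmod (a \<kappa>) / cmod (z - a \<kappa>)) * norm (R (a \<kappa>) x) + (cmod (b \<kappa> / (a \<kappa> - b \<kappa>)) * cmod (b \<kappa>) / cmod (z - b \<kappa>)) * norm (R (b \<kappa>) x)"
        using norm_triangle_ineq4[of "((a \<kappa> / (a \<kappa> - b \<kappa>)) * a \<kappa> / (z - a \<kappa>)) *\<^sub>C R (a \<kappa>) x" "((b \<kappa> / (a \<kappa> - b \<kappa>)) * b \<kappa> / (z - b \<kappa>)) *\<^sub>C R (b \<kappa>) x"]
        by (simp only: D_def norm_scaleC norm_divide norm_mult)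
      also have "\<dots> \<le> (cmod (a \<kappa> / (a \<kappa> - b \<kappa>)) * cmod (a \<kappa>) / (t * cmod z)) * norm (R (a \<kappa>) x) + (cmod (b \<kappa> / (a \<kappa> - b \<kappa>)) * cmod (b \<kappa>) / (t * cmod z)) * norm (R (b \<kappa>) x)"
        using nb(1)[OF z(2)] t0 z nz[OF z] unfolding a_def b_def
        by (intro add_mono mult_right_mono divide_left_mono mult_pos_pos) (auto simp: a_def b_def)
      also have "\<dots> = E \<kappa> / cmod z"
        by (simp add: E_def add_divide_distrib)
      finally show ?thesis .
    qed
    have eq: "z *\<^sub>C Fs z - - y = (\<Sum>\<kappa>\<in>F. c \<kappa> *\<^sub>C D \<kappa>)"
    proof -
      have "z *\<^sub>C Fs z - - y = (\<Sum>\<kappa>\<in>F. c \<kappa> *\<^sub>C (z *\<^sub>C (((a \<kappa> / (a \<kappa> - b \<kappa>)) / (z - a \<kappa>)) *\<^sub>C R (a \<kappa>) x - ((b \<kappa> / (a \<kappa> - b \<kappa>)) / (z - b \<kappa>)) *\<^sub>C R (b \<kappa>) x) + K (a \<kappa>) (b \<kappa>) x))"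
        unfolding Fs_def y_def cscale.sum_right diff_minus_eq_add sum.distrib[symmetric]
        by (intro sum.cong refl) (simp add: cscale.add_right cscale.diff_right mult.commute mult.left_commute)
      then show ?thesis by (simp only: 1 D_def)
    qed
    have "norm (\<Sum>\<kappa>\<in>F. c \<kappa> *\<^sub>C D \<kappa>) \<le> (\<Sum>\<kappa>\<in>F. cmod (c \<kappa>) * (E \<kappa> / cmod z))"
      by (intro sum_norm_le) (simp only: norm_scaleC mult_left_mono[OF DE norm_ge_zero])
    also have "\<dots> = Cb / cmod z" unfolding Cb_def sum_divide_distrib by (intro sum.cong refl) (simp add: E_def)
    finally show ?thesis unfolding eq .
  qed
  have Cb0: "0 \<le> Cb" using t0 by (auto simp: Cb_def intro!: sum_nonneg mult_nonneg_nonneg add_nonneg_nonneg divide_nonneg_nonneg)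
  define Cd where "Cd = (\<Sum>\<kappa>\<in>F. cmod (c \<kappa>) * ((1 + M) * ((1 + M) * ((1 + M) * norm x))))"
  \<comment> \<open>The factors \<open>A\<close> are redistributed: \<open>A R(z)\<close> applied to
    \<open>A R(a) R(b)\<close> equals \<open>A R(a) A R(b) R(z)\<close>, which decays like
    \<open>1 / cmod z\<close>.\<close>
  have RI: "norm (z *\<^sub>C R z y - y) \<le> Cd / cmod z" if z: "z \<in> S" for z
  proof -
    have "z *\<^sub>C R z y - y = (\<Sum>\<kappa>\<in>F. c \<kappa> *\<^sub>C AR (a \<kappa>) (AR (b \<kappa>) (R z x)))"
    proof -
      have "z *\<^sub>C R z y - y = AR z y" by (simp add: AR_def)
      also have "\<dots> = (\<Sum>\<kappa>\<in>F. c \<kappa> *\<^sub>C AR z (K (a \<kappa>) (b \<kappa>) x))" by (simp add: y_def AR_lin[OF z])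
      also have "\<dots> = (\<Sum>\<kappa>\<in>F. c \<kappa> *\<^sub>C AR (a \<kappa>) (AR (b \<kappa>) (R z x)))"
      proof (intro sum.cong refl arg_cong2[where f = scaleC])
        fix \<kappa>
        have "AR z (K (a \<kappa>) (b \<kappa>) x) = AR (a \<kappa>) (K z (b \<kappa>) x)"
          unfolding K_def by (rule commute_AR[OF commutes_AR[OF z] abS(1)])
        then show "AR z (K (a \<kappa>) (b \<kappa>) x) = AR (a \<kappa>) (AR (b \<kappa>) (R z x))"
          using K_commute[OF z abS(2)[of \<kappa>], of x, unfolded K_def] by (simp only: K_def)
      qed
      finally show ?thesis .
    qed
    also have "norm \<dots> \<le> (\<Sum>\<kappa>\<in>F. (cmod (c \<kappa>) * ((1 + M) * ((1 + M) * ((1 + M) * norm x)))) / cmod z)"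
    proof (intro sum_norm_le)
      fix \<kappa>
      have "norm (AR (a \<kappa>) (AR (b \<kappa>) (R z x))) \<le> (1 + M) * ((1 + M) * ((1 + M) / cmod z * norm x))"
        by (intro order_trans[OF norm_AR[OF abS(1)]] order_trans[OF norm_AR[OF abS(2)]] mult_left_mono R_bd z nn)
      from mult_left_mono[OF this norm_ge_zero[of "c \<kappa>"]]
      show "norm (c \<kappa> *\<^sub>C AR (a \<kappa>) (AR (b \<kappa>) (R z x))) \<le> (cmod (c \<kappa>) * ((1 + M) * ((1 + M) * ((1 + M) * norm x)))) / cmod z"
        by (simp add: mult_ac)
    qed
    also have "\<dots> = Cd / cmod z" by (simp only: Cd_def sum_divide_distrib)
    finally show ?thesis .
  qed
  have Cd0: "0 \<le> Cd" using M by (auto simp: Cd_def intro!: sum_nonneg mult_nonneg_nonneg)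
  define Ce where "Ce = (\<Sum>\<kappa>\<in>F. cmod (c \<kappa>) * ((1 + M) * norm (R (a \<kappa>) (R (b \<kappa>) x))))"
  have R0: "norm (R z y) \<le> Ce" if z: "z \<in> S" for z
  proof -
    have "R z y = (\<Sum>\<kappa>\<in>F. c \<kappa> *\<^sub>C AR z (R (a \<kappa>) (R (b \<kappa>) x)))"
    proof -
      have "R z (K (a \<kappa>) (b \<kappa>) x) = AR z (R (a \<kappa>) (R (b \<kappa>) x))" for \<kappa>
      proof -
        have "R z (AR (a \<kappa>) v) = AR (a \<kappa>) (R z v)" for v by (rule commute_AR[OF commutes_R[OF z] abS(1)])
        then show ?thesis using K_commute[OF abS(1)[of \<kappa>] z, of "R (b \<kappa>) x"] by (simp add: K_def)
      qed
      then show ?thesis by (simp add: y_def R_lin[OF z])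
    qed
    also have "norm \<dots> \<le> Ce" unfolding Ce_def
      by (intro sum_norm_le) (auto simp: intro!: mult_left_mono norm_AR z)
    finally show ?thesis .
  qed
  have Ce0: "0 \<le> Ce" using M by (auto simp: Ce_def intro!: sum_nonneg mult_nonneg_nonneg)
  define G where "G = (\<lambda>v (r::real). (cis v * rat F c p q (r * cis v)) *\<^sub>C R (r * cis v) x)"
  have ray: "v \<in> {-\<nu>..\<nu>} \<and> (\<forall>r>0. of_real r * cis v \<in> S)" if "v = \<nu> \<or> v = -\<nu>" for v
    using that rayS nu0 by auto
  have raysec: "of_real r * cis v \<noteq> 0" "\<bar>Im (of_real r * cis v)\<bar> \<le> s * cmod (of_real r * cis v)" if "v = \<nu> \<or> v = -\<nu>" "0 < r" for v r
    using sec[OF that(2)] ray[OF that(1)] that by auto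
  have Gsplit: "G v r = cis v *\<^sub>C Fs (of_real r * cis v) + cis v *\<^sub>C R (of_real r * cis v) y" if "v = \<nu> \<or> v = -\<nu>" "0 < r" for v r
    using split[OF _ raysec[OF that]] ray[OF that(1)] that(2) by (simp add: G_def cscale.add_right flip: scaleC_scaleC)
  have cz: "continuous_on A (\<lambda>r. of_real r * cis v)" for v A by (intro continuous_intros)
  have c1: "continuous_on {0<..} (\<lambda>r. cis v *\<^sub>C Fs (of_real r * cis v))" "continuous_on {0<..} (\<lambda>r. cis v *\<^sub>C R (of_real r * cis v) y)"
    if v: "v = \<nu> \<or> v = -\<nu>" for v
  proof -
    show "continuous_on {0<..} (\<lambda>r. cis v *\<^sub>C Fs (of_real r * cis v))"
      by (intro continuous_intros continuous_on_compose2[OF contFs cz]) (use raysec[OF v] in auto)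
    show "continuous_on {0<..} (\<lambda>r. cis v *\<^sub>C R (of_real r * cis v) y)"
      by (intro continuous_intros R_cont' cz) (use ray[OF v] in auto)
  qed
  have lim: "(\<lambda>n. integral {1/2^n..2^n} (G v)) \<longlonglongrightarrow> integral {0<..} (G v)" if v: "v = \<nu> \<or> v = -\<nu>" for v
  proof (rule has_integral_zero_infinity(2)[where C = "c0 * (M * norm x)"])
    show "continuous_on {0<..} (G v)"
      using continuous_on_add[OF c1[OF v]] by (rule continuous_on_eq) (simp add: Gsplit[OF v])
    show "0 \<le> c0 * (M * norm x)" using c0 M by simp
    fix r :: real assume r: "0 < r"
    have nG: "norm (G v r) = cmod (rat F c p q (r * cis v)) * norm (R (r * cis v) x)" by (simp add: G_def norm_mult)
    have Rr: "norm (R (of_real r * cis v) x) \<le> M / r * norm x" using bd[of "of_real r * cis v" x] ray[OF v] r by (simp add: norm_mult)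
    have "norm (G v r) \<le> (c0 * r) * (M / r * norm x)"
      unfolding nG using c0(1) c0(2)[OF raysec[OF v r]] r Rr by (intro mult_mono) (auto simp: norm_mult)
    then show "norm (G v r) \<le> c0 * (M * norm x)" using r by simp
    have "norm (G v r) \<le> (c0 / r) * (M / r * norm x)"
      unfolding nG using c0(1) c0(3)[OF raysec[OF v r]] r Rr by (intro mult_mono) (auto simp: norm_mult)
    then show "norm (G v r) \<le> c0 * (M * norm x) / r\<^sup>2" by (simp add: power2_eq_square)
  qed
  have trunc: "norm ((integral {1/2^n..2^n} (G (-\<nu>)) - integral {1/2^n..2^n} (G \<nu>)) - (2 * pi * \<i>) *\<^sub>C y)
     \<le> ((Cb + Ca) * (2 * \<nu>) + (Cd + Ce) * (2*pi - 2*\<nu>)) * (1/2)^n" for n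
  proof -
    let ?l = "1/2^n :: real" and ?h = "2^n :: real"
    have "(1::real) \<le> 2^n" by simp
    then have lh: "0 < ?l" "?l \<le> ?h" using divide_le_eq_1[of 1 "2^n::real"] by (simp, smt (verit))
    have pos: "0 < r" if "r \<in> {?l..?h}" for r
      by (rule less_le_trans[OF lh(1)]) (use that in auto)
    have int: "(\<lambda>r. cis v *\<^sub>C Fs (of_real r * cis v)) integrable_on {?l..?h}" "(\<lambda>r. cis v *\<^sub>C R (of_real r * cis v) y) integrable_on {?l..?h}"
      if v: "v = \<nu> \<or> v = -\<nu>" for v
      by (intro integrable_continuous_interval continuous_on_subset[OF c1(1)[OF v]] continuous_on_subset[OF c1(2)[OF v]]; use pos in blast)+
    have GI: "integral {?l..?h} (G v) = integral {?l..?h} (\<lambda>r. cis v *\<^sub>C Fs (of_real r * cis v)) + integral {?l..?h} (\<lambda>r. cis v *\<^sub>C R (of_real r * cis v) y)"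
      if v: "v = \<nu> \<or> v = -\<nu>" for v
    proof -
      have "integral {?l..?h} (G v) = integral {?l..?h} (\<lambda>r. cis v *\<^sub>C Fs (of_real r * cis v) + cis v *\<^sub>C R (of_real r * cis v) y)"
        by (intro integral_cong Gsplit[OF v] pos)
      then show ?thesis using integral_add[OF int[OF v]] by simp
    qed
    have sub1: "(\<lambda>(r, u). of_real r * cis u) ` ({?l..?h} \<times> {-\<nu>..\<nu>}) \<subseteq> {z. z \<noteq> 0 \<and> \<bar>Im z\<bar> \<le> s * cmod z}"
    proof safe
      fix r u assume "r \<in> {?l..?h}" "u \<in> {-\<nu>..\<nu>}"
      then show "\<bar>Im (of_real r * cis u)\<bar> \<le> s * cmod (of_real r * cis u)" "of_real r * cis u = 0 \<Longrightarrow> False"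
        using sec[of r u] pos[of r] by auto
    qed
    have 1: "norm (integral {?l..?h} (\<lambda>r. cis \<nu> *\<^sub>C Fs (of_real r * cis \<nu>)) - integral {?l..?h} (\<lambda>r. cis (-\<nu>) *\<^sub>C Fs (of_real r * cis (-\<nu>)))
      - (\<i> * of_real (\<nu> - (-\<nu>))) *\<^sub>C (- y)) \<le> (Cb * (1/2)^n + Ca * (1/2)^n) * (\<nu> - (-\<nu>))"
    proof (rule integral_rotate_approx[OF lh(2)])
      show "-\<nu> \<le> \<nu>" using nu0 by simp
      fix u assume u: "u \<in> {-\<nu>..\<nu>}"
      show "(Fs has_derivative (\<lambda>h. h *\<^sub>C Fs' (of_real r * cis u))) (at (of_real r * cis u))" if "r \<in> {?l..?h}" for r
      proof -
        have "0 < r" by (rule pos[OF that])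
        then show ?thesis using derFs[OF _ sec[OF _ u]] by (simp add: cderiv_def)
      qed
      show "norm ((of_real ?h * cis u) *\<^sub>C Fs (of_real ?h * cis u) - - y) \<le> Cb * (1/2)^n"
      proof -
        have "norm ((of_real ?h * cis u) *\<^sub>C Fs (of_real ?h * cis u) - - y) \<le> Cb / cmod (of_real ?h * cis u)"
          by (rule FsI[OF _ sec[OF _ u]]) simp_all
        also have "cmod (of_real ?h * cis u) = ?h" by (simp add: norm_mult norm_power)
        finally show ?thesis by (simp add: power_one_over)
      qed
      have "norm ((of_real ?l * cis u) *\<^sub>C Fs (of_real ?l * cis u)) = ?l * norm (Fs (of_real ?l * cis u))"
        by (simp add: norm_mult norm_power norm_divide)
      also have "\<dots> \<le> ?l * Ca" using lh(1) by (intro mult_left_mono FsB sec u) auto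
      finally show "norm ((of_real ?l * cis u) *\<^sub>C Fs (of_real ?l * cis u)) \<le> Ca * (1/2)^n" by (simp add: power_one_over)
    next
      show "continuous_on ((\<lambda>(r, u). of_real r * cis u) ` ({?l..?h} \<times> {-\<nu>..\<nu>})) Fs'"
        by (rule continuous_on_subset[OF contFs' sub1])
    qed
    have sub2: "(\<lambda>(r, u). of_real r * cis u) ` ({?l..?h} \<times> {\<nu>..2*pi-\<nu>}) \<subseteq> S"
    proof safe
      fix r u assume "r \<in> {?l..?h}" "u \<in> {\<nu>..2*pi-\<nu>}"
      then show "of_real r * cis u \<in> S" using out[of r u] pos[of r] by auto
    qed
    have 2: "norm (integral {?l..?h} (\<lambda>r. cis (2*pi-\<nu>) *\<^sub>C R (of_real r * cis (2*pi-\<nu>)) y) - integral {?l..?h} (\<lambda>r. cis \<nu> *\<^sub>C R (of_real r * cis \<nu>) y)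
      - (\<i> * of_real (2*pi-\<nu> - \<nu>)) *\<^sub>C y) \<le> (Cd * (1/2)^n + Ce * (1/2)^n) * (2*pi-\<nu> - \<nu>)"
    proof (rule integral_rotate_approx[OF lh(2), where F = "\<lambda>w. R w y" and F' = "\<lambda>w. - R w (R w y)"])
      show "\<nu> \<le> 2*pi-\<nu>" using nu pi_gt_zero by linarith
      fix u assume u: "u \<in> {\<nu>..2*pi-\<nu>}"
      show "((\<lambda>w. R w y) has_derivative (\<lambda>h. h *\<^sub>C - R (of_real r * cis u) (R (of_real r * cis u) y))) (at (of_real r * cis u))" if "r \<in> {?l..?h}" for r
      proof -
        have "0 < r" by (rule pos[OF that])
        then show ?thesis using R_deriv[OF out[OF _ u]] by (simp add: cderiv_def)
      qed
      show "norm ((of_real ?h * cis u) *\<^sub>C R (of_real ?h * cis u) y - y) \<le> Cd * (1/2)^n"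
      proof -
        have "norm ((of_real ?h * cis u) *\<^sub>C R (of_real ?h * cis u) y - y) \<le> Cd / cmod (of_real ?h * cis u)"
          by (rule RI[OF out[OF _ u]]) simp
        also have "cmod (of_real ?h * cis u) = ?h" by (simp add: norm_mult norm_power)
        finally show ?thesis by (simp add: power_one_over)
      qed
      have "norm ((of_real ?l * cis u) *\<^sub>C R (of_real ?l * cis u) y) = ?l * norm (R (of_real ?l * cis u) y)"
        by (simp add: norm_mult norm_power norm_divide)
      also have "\<dots> \<le> ?l * Ce" using lh(1) by (intro mult_left_mono R0 out u) auto
      finally show "norm ((of_real ?l * cis u) *\<^sub>C R (of_real ?l * cis u) y) \<le> Ce * (1/2)^n" by (simp add: power_one_over)
    next
      show "continuous_on ((\<lambda>(r, u). of_real r * cis u) ` ({?l..?h} \<times> {\<nu>..2*pi-\<nu>})) (\<lambda>w. - R w (R w y))"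
        by (intro continuous_on_minus R_cont' continuous_on_id) (use sub2 in auto)
    qed
    define F1 F2 R1 R2 where "F1 = integral {?l..?h} (\<lambda>r. cis \<nu> *\<^sub>C Fs (of_real r * cis \<nu>))"
      and "F2 = integral {?l..?h} (\<lambda>r. cis (-\<nu>) *\<^sub>C Fs (of_real r * cis (-\<nu>)))"
      and "R1 = integral {?l..?h} (\<lambda>r. cis \<nu> *\<^sub>C R (of_real r * cis \<nu>) y)"
      and "R2 = integral {?l..?h} (\<lambda>r. cis (-\<nu>) *\<^sub>C R (of_real r * cis (-\<nu>)) y)"
    have "(2 * pi * \<i>) *\<^sub>C y = - ((\<i> * of_real (\<nu> - (-\<nu>))) *\<^sub>C (- y)) + (\<i> * of_real (2*pi-\<nu> - \<nu>)) *\<^sub>C y"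
      by (simp only: cscale.minus_right minus_minus cscale.add_left[symmetric]) (simp add: algebra_simps)
    then have "(integral {?l..?h} (G (-\<nu>)) - integral {?l..?h} (G \<nu>)) - (2 * pi * \<i>) *\<^sub>C y
      = (R2 - R1 - (\<i> * of_real (2*pi-\<nu> - \<nu>)) *\<^sub>C y) - (F1 - F2 - (\<i> * of_real (\<nu> - (-\<nu>))) *\<^sub>C (- y))"
      using GI[of \<nu>] GI[of "-\<nu>"] unfolding F1_def F2_def R1_def R2_def by simp
    also have "norm \<dots> \<le> (Cd * (1/2)^n + Ce * (1/2)^n) * (2*pi-\<nu> - \<nu>) + (Cb * (1/2)^n + Ca * (1/2)^n) * (\<nu> - (-\<nu>))"
      using 1 2 unfolding cisnu F1_def F2_def R1_def R2_def by (intro order_trans[OF norm_triangle_ineq4 add_mono])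
    finally show ?thesis by (simp add: algebra_simps)
  qed
  have "(\<lambda>n. (integral {1/2^n..2^n} (G (-\<nu>)) - integral {1/2^n..2^n} (G \<nu>)) - (2 * pi * \<i>) *\<^sub>C y) \<longlonglongrightarrow> 0"
  proof (rule Lim_null_comparison)
    show "\<forall>\<^sub>F n in sequentially. norm ((integral {1/2^n..2^n} (G (-\<nu>)) - integral {1/2^n..2^n} (G \<nu>)) - (2 * pi * \<i>) *\<^sub>C y)
       \<le> ((Cb + Ca) * (2 * \<nu>) + (Cd + Ce) * (2*pi - 2*\<nu>)) * (1/2)^n"
      by (intro always_eventually allI trunc)
    show "(\<lambda>n. ((Cb + Ca) * (2 * \<nu>) + (Cd + Ce) * (2*pi - 2*\<nu>)) * (1/2)^n) \<longlonglongrightarrow> 0"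
      by (intro tendsto_mult_right_zero LIMSEQ_realpow_zero) auto
  qed
  moreover have "(\<lambda>n. (integral {1/2^n..2^n} (G (-\<nu>)) - integral {1/2^n..2^n} (G \<nu>)) - (2 * pi * \<i>) *\<^sub>C y)
     \<longlonglongrightarrow> (integral {0<..} (G (-\<nu>)) - integral {0<..} (G \<nu>)) - (2 * pi * \<i>) *\<^sub>C y"
    by (intro tendsto_intros lim) auto
  ultimately have "(integral {0<..} (G (-\<nu>)) - integral {0<..} (G \<nu>)) - (2 * pi * \<i>) *\<^sub>C y = 0"
    by (rule LIMSEQ_unique[rotated])
  then show ?thesis by (simp add: G_def y_def a_def b_def)
qed

end

section \<open>Uniform bounds for dyadic rational sums on a sector\<close>

lemma dyadic_sum:
  assumes "finite F" "0 < \<rho>"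
  shows "(\<Sum>k\<in>F. (2::real) powi k * \<rho> / (\<rho>\<^sup>2 + (2 powi k)\<^sup>2)) \<le> 8"
proof -
  \<comment> \<open>The dyadic level of \<open>\<rho>\<close>. Each term is at most 2 times a
    geometric factor in the distance to \<open>k0\<close>; the levels above and below sum to at most
    2 each, whence 8 independently of \<open>\<rho>\<close>.\<close>
  define k0 where "k0 = \<lfloor>log 2 \<rho>\<rfloor>"
  have pw: "(2::real) powi k = 2 powr of_int k" for k by (simp add: powr_real_of_int')
  have k0: "2 powi k0 \<le> \<rho>" "\<rho> \<le> 2 * 2 powi k0"
  proof -
    have "2 powr of_int k0 \<le> 2 powr (log 2 \<rho>)" unfolding k0_def by (intro powr_mono) auto
    then show "2 powi k0 \<le> \<rho>" using assms by (simp add: pw)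
    have "2 powr (log 2 \<rho>) \<le> 2 powr (of_int k0 + 1)" unfolding k0_def by (intro powr_mono) linarith+
    then show "\<rho> \<le> 2 * 2 powi k0" using assms by (simp add: pw powr_add)
  qed
  have tb: "2 powi k * \<rho> / (\<rho>\<^sup>2 + (2 powi k)\<^sup>2) \<le> 2 * (1/2)^(nat \<bar>k - k0\<bar>)" for k
  proof -
    let ?p = "(2::real) powi k"
    have p: "0 < ?p" by simp
    show ?thesis
    proof (cases "k0 \<le> k")
      case True
      have e: "?p = 2 powi k0 * 2 ^ nat (k - k0)"
      proof -
        have "?p = 2 powi (k0 + int (nat (k - k0)))" using True by simp
        also have "\<dots> = 2 powi k0 * 2 powi int (nat (k - k0))" by (subst power_int_add) auto
        finally show ?thesis by (simp only: power_int_of_nat)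
      qed
      have "?p * \<rho> / (\<rho>\<^sup>2 + ?p\<^sup>2) \<le> ?p * \<rho> / ?p\<^sup>2" using assms p by (intro divide_left_mono) (auto intro!: mult_pos_pos add_pos_pos)
      also have "\<dots> = \<rho> / ?p" using p by (simp add: power2_eq_square)
      also have "\<dots> \<le> 2 * 2 powi k0 / ?p" using k0 p by (intro divide_right_mono) auto
      also have "\<dots> = 2 * (1/2)^(nat \<bar>k - k0\<bar>)" using True by (simp add: e power_one_over)
      finally show ?thesis .
    next
      case False
      have e: "2 powi k0 = ?p * 2 ^ nat (k0 - k)"
      proof -
        have "(2::real) powi k0 = 2 powi (k + int (nat (k0 - k)))" using False by simp
        also have "\<dots> = ?p * 2 powi int (nat (k0 - k))" by (subst power_int_add) auto
        finally show ?thesis by (simp only: power_int_of_nat)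
      qed
      have "?p * \<rho> / (\<rho>\<^sup>2 + ?p\<^sup>2) \<le> ?p * \<rho> / \<rho>\<^sup>2" using assms p by (intro divide_left_mono) (auto intro!: mult_pos_pos add_pos_pos)
      also have "\<dots> = ?p / \<rho>" using assms by (simp add: power2_eq_square)
      also have "\<dots> \<le> ?p / 2 powi k0" using k0 p assms by (intro divide_left_mono) auto
      also have "\<dots> = (1/2)^(nat \<bar>k - k0\<bar>)" using False p by (simp add: e power_one_over)
      also have "\<dots> \<le> 2 * (1/2)^(nat \<bar>k - k0\<bar>)" by simp
      finally show ?thesis .
    qed
  qed
  have geo: "(\<Sum>n\<in>A. (1/2::real)^n) \<le> 2" if fA: "finite A" for A :: "nat set"
  proof -
    obtain N where "A \<subseteq> {..<N}" using fA by (metis finite_nat_iff_bounded)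
    then have "(\<Sum>n\<in>A. (1/2::real)^n) \<le> (\<Sum>n<N. (1/2::real)^n)" by (intro sum_mono2) auto
    also have "\<dots> = 2 - 2 * (1/2)^N" by (induction N) auto
    finally show ?thesis by (smt (verit) zero_le_power zero_le_divide_1_iff)
  qed
  have half: "(\<Sum>k\<in>G. (1/2::real)^(nat \<bar>k - k0\<bar>)) \<le> 2" if "finite G" "inj_on (\<lambda>k. nat \<bar>k - k0\<bar>) G" for G
    using geo[of "(\<lambda>k. nat \<bar>k - k0\<bar>) ` G"] that by (simp add: sum.reindex o_def)
  have "(\<Sum>k\<in>F. (1/2::real)^(nat \<bar>k - k0\<bar>)) = (\<Sum>k\<in>{k\<in>F. k0 \<le> k}. (1/2::real)^(nat \<bar>k - k0\<bar>)) + (\<Sum>k\<in>{k\<in>F. \<not> k0 \<le> k}. (1/2::real)^(nat \<bar>k - k0\<bar>))"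
    using assms(1) by (subst sum.union_disjoint[symmetric]) (auto intro!: sum.cong)
  also have "\<dots> \<le> 2 + 2" using assms(1) by (intro add_mono half) (auto simp: inj_on_def)
  finally have "(\<Sum>k\<in>F. 2 * (1/2::real)^(nat \<bar>k - k0\<bar>)) \<le> 8" by (simp add: sum_distrib_left[symmetric])
  moreover have "(\<Sum>k\<in>F. (2::real) powi k * \<rho> / (\<rho>\<^sup>2 + (2 powi k)\<^sup>2)) \<le> (\<Sum>k\<in>F. 2 * (1/2::real)^(nat \<bar>k - k0\<bar>))"
    by (intro sum_mono tb)
  ultimately show ?thesis by linarith
qed

text \<open>The triangle inequality uses only the moduli of the coefficients, so unimodular factors
  cost nothing. The 16 is twice the 8 of \<open>dyadic_sum\<close>, for the two signs of the
  frequency.\<close>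

lemma rat_dyadic_bound:
  fixes F :: "(bool \<times> int) set"
  assumes F: "finite F" and z: "z \<noteq> 0" "\<bar>Im z\<bar> \<le> s * cmod z" and s: "0 \<le> s" "s < 1"
    and c: "\<And>\<kappa>. cmod (c \<kappa>) \<le> \<gamma> * 2 powi snd \<kappa>" and \<gamma>: "0 \<le> \<gamma>"
    and p: "\<And>\<kappa>. 2 powi snd \<kappa> \<le> \<bar>p \<kappa>\<bar>" and q: "\<And>\<kappa>. 2 powi snd \<kappa> \<le> \<bar>q \<kappa>\<bar>"
  shows "cmod (rat F c p q z) \<le> 16 * \<gamma> / (1 - s)"
proof -
  let ?w = "\<lambda>k. (2::real) powi k * cmod z / ((cmod z)\<^sup>2 + (2 powi k)\<^sup>2)"
  have s': "0 < 1 - s" using s by simp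
  have "cmod (rat F c p q z) \<le> (\<Sum>\<kappa>\<in>F. \<gamma> / (1 - s) * ?w (snd \<kappa>))"
    unfolding rat_def
  proof (intro sum_norm_le)
    fix \<kappa> :: "bool \<times> int"
    let ?k = "(2::real) powi snd \<kappa>" and ?N = "(cmod z)\<^sup>2 + (2 powi snd \<kappa>)\<^sup>2"
    have Npos: "0 < ?N" using z by (simp add: add_pos_nonneg)
    have low: "sqrt ((1 - s) * ?N) \<le> cmod (z - \<i> * of_real b)" if "?k \<le> \<bar>b\<bar>" for b
    proof -
      have "?k\<^sup>2 \<le> b\<^sup>2" using that by (simp add: abs_le_square_iff[symmetric])
      then have "(1 - s) * ?N \<le> (1 - s) * ((cmod z)\<^sup>2 + b\<^sup>2)" using s' by (intro mult_left_mono) auto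
      then have "(1 - s) * ?N \<le> (cmod (z - \<i> * of_real b))\<^sup>2" using norm_diff_imag[OF z(2) s, of b] by linarith
      then show ?thesis by (simp add: real_le_lsqrt)
    qed
    have "sqrt ((1 - s) * ?N) * sqrt ((1 - s) * ?N) \<le> cmod (z - \<i> * of_real (p \<kappa>)) * cmod (z - \<i> * of_real (q \<kappa>))"
      using Npos s' by (intro mult_mono low p q) auto
    then have d: "(1 - s) * ?N \<le> cmod (z - \<i> * of_real (p \<kappa>)) * cmod (z - \<i> * of_real (q \<kappa>))"
      using Npos s' by simp
    have "cmod (c \<kappa> * (z / ((z - \<i> * of_real (p \<kappa>)) * (z - \<i> * of_real (q \<kappa>))))) \<le> (\<gamma> * ?k) * (cmod z / ((1 - s) * ?N))"
      unfolding norm_mult norm_divide using \<gamma> Npos s' by (intro mult_mono[OF c frac_le[OF _ order_refl _ d]]) auto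
    then show "cmod (c \<kappa> * (z / ((z - \<i> * of_real (p \<kappa>)) * (z - \<i> * of_real (q \<kappa>))))) \<le> \<gamma> / (1 - s) * ?w (snd \<kappa>)"
      by simp
  qed
  also have "\<dots> = \<gamma> / (1 - s) * (\<Sum>\<kappa>\<in>F. ?w (snd \<kappa>))" by (simp only: sum_distrib_left)
  finally have 1: "cmod (rat F c p q z) \<le> \<gamma> / (1 - s) * (\<Sum>\<kappa>\<in>F. ?w (snd \<kappa>))" .
  have "(\<Sum>\<kappa>\<in>F. ?w (snd \<kappa>)) \<le> (\<Sum>\<kappa>\<in>(UNIV :: bool set) \<times> snd ` F. ?w (snd \<kappa>))"
    using F by (intro sum_mono2) (auto simp: image_iff intro!: divide_nonneg_nonneg mult_nonneg_nonneg, force)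
  also have "\<dots> = (\<Sum>b\<in>(UNIV :: bool set). \<Sum>k\<in>snd ` F. ?w k)" by (simp only: sum.cartesian_product case_prod_beta')
  also have "\<dots> \<le> (\<Sum>b\<in>(UNIV :: bool set). 8)" using F z by (intro sum_mono dyadic_sum) auto
  finally have "(\<Sum>\<kappa>\<in>F. ?w (snd \<kappa>)) \<le> 16" by simp
  then have "\<gamma> / (1 - s) * (\<Sum>\<kappa>\<in>F. ?w (snd \<kappa>)) \<le> \<gamma> / (1 - s) * 16" using \<gamma> s' by (intro mult_left_mono) auto
  then show ?thesis using 1 by (simp add: mult.commute)
qed

lemma closure_sector:
  assumes "0 < \<phi>" "\<phi> < pi"
  shows "closure (sector \<phi>) \<subseteq> {z. cmod z * cos \<phi> \<le> Re z}"
proof (rule closure_minimal)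
  show "sector \<phi> \<subseteq> {z. cmod z * cos \<phi> \<le> Re z}"
  proof
    fix z assume z: "z \<in> sector \<phi>"
    then have nz: "z \<noteq> 0" "\<bar>Arg z\<bar> < \<phi>" by (auto simp: sector_def)
    have "cos \<phi> \<le> cos \<bar>Arg z\<bar>" using nz assms by (intro cos_monotone_0_pi_le) auto
    then have "cos \<phi> \<le> Re z / cmod z" using nz by (simp add: cos_Arg)
    then show "z \<in> {z. cmod z * cos \<phi> \<le> Re z}" using nz by (simp add: field_simps)
  qed
  show "closed {z. cmod z * cos \<phi> \<le> Re z}" by (intro closed_Collect_le continuous_intros)
qed

lemma sector_Im:
  assumes "z \<in> sector \<phi>" "\<phi> < pi / 2"
  shows "\<bar>Im z\<bar> \<le> sin \<phi> * cmod z" "0 < Re z"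
proof -
  have z: "z \<noteq> 0" "\<bar>Arg z\<bar> < \<phi>" using assms by (auto simp: sector_def)
  have "Im z = cmod z * sin (Arg z)" "Re z = cmod z * cos (Arg z)"
    using rcis_cmod_Arg[of z] by (metis Im_rcis, metis Re_rcis)
  moreover have "\<bar>sin (Arg z)\<bar> \<le> sin \<phi>"
  proof -
    have "sin \<bar>Arg z\<bar> \<le> sin \<phi>" using z assms(2) by (intro sin_monotone_2pi_le) auto
    moreover have "0 \<le> sin \<bar>Arg z\<bar>" using z assms(2) by (intro sin_ge_zero) auto
    ultimately show ?thesis by (cases "0 \<le> Arg z") auto
  qed
  moreover have "0 < cos (Arg z)" using z assms(2) by (intro cos_gt_zero_pi) auto
  ultimately show "\<bar>Im z\<bar> \<le> sin \<phi> * cmod z" "0 < Re z"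
    using z by (simp_all add: abs_mult mult.commute mult_left_mono)
qed

lemma rat_H0:
  assumes F: "finite F" and p: "\<And>\<kappa>. p \<kappa> \<noteq> 0" and q: "\<And>\<kappa>. q \<kappa> \<noteq> 0" and th: "0 < \<theta>" "\<theta> < pi / 2"
  shows "rat F c p q \<in> H0_infty \<theta>"
proof -
  have s: "0 \<le> sin \<theta>" "sin \<theta> < 1"
  proof -
    show "0 \<le> sin \<theta>" using th by (intro sin_ge_zero) auto
    have "sin \<theta> < sin (pi/2)" using th by (intro sin_monotone_2pi) auto
    then show "sin \<theta> < 1" by simp
  qed
  obtain c0 where c0: "0 \<le> c0" "\<And>z. z \<noteq> 0 \<Longrightarrow> \<bar>Im z\<bar> \<le> sin \<theta> * cmod z \<Longrightarrow> cmod (rat F c p q z) \<le> c0 * cmod z"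
    "\<And>z. z \<noteq> 0 \<Longrightarrow> \<bar>Im z\<bar> \<le> sin \<theta> * cmod z \<Longrightarrow> cmod (rat F c p q z) \<le> c0 / cmod z"
    using rat_bound[where c=c and F=F and p=p and q=q, OF F p q s] by blast
  have z0: "z \<noteq> 0" if "z \<in> sector \<theta>" for z using that by (simp add: sector_def)
  have hol: "rat F c p q holomorphic_on sector \<theta>"
    unfolding rat_def[abs_def]
  proof (intro holomorphic_intros)
    fix z \<kappa> assume "z \<in> sector \<theta>"
    then have "0 < Re z" using sector_Im(2) th by blast
    then have "z - \<i> * of_real b \<noteq> 0" for b by (metis Re_i_times Im_complex_of_real less_irrefl neg_equal_zero right_minus_eq)
    then show "(z - \<i> * of_real (p \<kappa>)) * (z - \<i> * of_real (q \<kappa>)) \<noteq> 0" by simp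
  qed
  \<comment> \<open>The decay exponent demanded by \<open>H0_infty\<close> is taken to be 1.\<close>
  have dec: "cmod (rat F c p q z) \<le> (2 * (c0 + 1)) * norm z powr 1 / (1 + norm z powr (2 * 1))" if "z \<in> sector \<theta>" for z
  proof -
    note b = c0(2,3)[OF z0[OF that] sector_Im(1)[OF that th(2)]]
    have pos: "0 < cmod z" using z0[OF that] by simp
    have "cmod (rat F c p q z) * (1 + (cmod z)\<^sup>2) = cmod (rat F c p q z) + cmod (rat F c p q z) * (cmod z)\<^sup>2" by (simp add: algebra_simps)
    also have "\<dots> \<le> c0 * cmod z + c0 / cmod z * (cmod z)\<^sup>2" using b by (intro add_mono mult_right_mono) auto
    also have "\<dots> \<le> (2 * (c0 + 1)) * cmod z" using pos by (simp add: power2_eq_square algebra_simps)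
    finally have "cmod (rat F c p q z) \<le> (2 * (c0 + 1)) * cmod z / (1 + (cmod z)\<^sup>2)"
      using pos by (simp add: pos_le_divide_eq add_pos_nonneg)
    then show ?thesis using pos by (simp add: powr_numeral)
  qed
  have "bounded (rat F c p q ` sector \<theta>)"
  proof -
    have "cmod (rat F c p q z) \<le> c0" if "z \<in> sector \<theta>" for z
    proof -
      note b = c0(2,3)[OF z0[OF that] sector_Im(1)[OF that th(2)]]
      have pos: "0 < cmod z" using z0[OF that] by simp
      show ?thesis
      proof (cases "cmod z \<le> 1")
        case True
        then show ?thesis using b(1) mult_left_mono[OF True c0(1)] by simp
      next
        case False
        then have "c0 / cmod z \<le> c0" using c0(1) pos by (simp add: divide_le_eq mult_le_cancel_left1)
        then show ?thesis using b(2) by simp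
      qed
    qed
    then show ?thesis by (auto simp: bounded_iff)
  qed
  then show ?thesis
    unfolding H0_infty_def using hol dec c0(1)
    by (intro CollectI conjI exI[of _ "2 * (c0 + 1)"] exI[of _ 1]) auto
qed

context resolvent_family
begin

lemma fcalc_rat:
  assumes A: "\<And>z. z \<in> S \<Longrightarrow> R z = resolvent z A"
    and F: "finite F" and p: "\<And>\<kappa>. p \<kappa> \<noteq> 0" and q: "\<And>\<kappa>. q \<kappa> \<noteq> 0" and pq: "\<And>\<kappa>. p \<kappa> \<noteq> q \<kappa>"
    and nu: "\<theta>0 < \<nu>" "\<nu> < pi / 2"
  shows "fcalc A \<nu> (rat F c p q) x = (\<Sum>\<kappa>\<in>F. c \<kappa> *\<^sub>C K (\<i> * of_real (p \<kappa>)) (\<i> * of_real (q \<kappa>)) x)"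
proof -
  have cosnu: "cos \<nu> < cos \<theta>0" using nu th0 by (intro cos_monotone_0_pi) auto
  have ray: "of_real t * cis \<nu> \<in> S" "of_real t * cis (-\<nu>) \<in> S" if "t \<in> {0<..}" for t
    using that cosnu by (intro S_polar; simp)+
  have "integral {0<..} (\<lambda>t::real. (cis v * rat F c p q (t * cis v)) *\<^sub>C resolvent (t * cis v) A x)
    = integral {0<..} (\<lambda>t::real. (cis v * rat F c p q (t * cis v)) *\<^sub>C R (t * cis v) x)" if "v = \<nu> \<or> v = -\<nu>" for v
    using that ray A by (intro integral_cong) auto
  from this[of \<nu>] this[of "-\<nu>"]
  have "fcalc A \<nu> (rat F c p q) x = (1 / (2 * pi * \<i>)) *\<^sub>C ((2 * pi * \<i>) *\<^sub>C (\<Sum>\<kappa>\<in>F. c \<kappa> *\<^sub>C K (\<i> * of_real (p \<kappa>)) (\<i> * of_real (q \<kappa>)) x))"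
    unfolding fcalc_def using rat_integral[where p=p and q=q and x=x, OF F p q pq nu, of c] by simp
  also have "\<dots> = (\<Sum>\<kappa>\<in>F. c \<kappa> *\<^sub>C K (\<i> * of_real (p \<kappa>)) (\<i> * of_real (q \<kappa>)) x)"
    unfolding scaleC_scaleC by simp
  finally show ?thesis .
qed

text \<open>The operator sum is \<open>f(A)\<close> for \<open>f = rat F c p q\<close>, hence
  bounded by the supremum of \<open>f\<close> on the sector, which \<open>rat_dyadic_bound\<close>
  makes independent of \<open>F\<close> and of the phases.\<close>

lemma Hinfty_K_sum:
  fixes F :: "(bool \<times> int) set"
  assumes A: "\<And>z. z \<in> S \<Longrightarrow> R z = resolvent z A"
    and H: "\<And>f x. f \<in> H0_infty \<theta> \<Longrightarrow> norm (fcalc A \<nu> f x) \<le> H * (SUP z\<in>sector \<theta>. cmod (f z)) * norm x" and H0: "0 \<le> H"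
    and F: "finite F" and p: "\<And>\<kappa>. 2 powi snd \<kappa> \<le> \<bar>p \<kappa>\<bar>" and q: "\<And>\<kappa>. 2 powi snd \<kappa> \<le> \<bar>q \<kappa>\<bar>" and pq: "\<And>\<kappa>. p \<kappa> \<noteq> q \<kappa>"
    and c: "\<And>\<kappa>. cmod (c \<kappa>) \<le> \<gamma> * 2 powi snd \<kappa>" and \<gamma>: "0 \<le> \<gamma>"
    and nu: "\<theta>0 < \<nu>" "\<nu> < pi / 2" and th: "0 < \<theta>" "\<theta> < pi / 2"
  shows "norm (\<Sum>\<kappa>\<in>F. c \<kappa> *\<^sub>C K (\<i> * of_real (p \<kappa>)) (\<i> * of_real (q \<kappa>)) x) \<le> H * (16 * \<gamma> / (1 - sin \<theta>)) * norm x"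
proof -
  have pos: "(0::real) < 2 powi k" for k :: int by simp
  have p0: "p \<kappa> \<noteq> 0" and q0: "q \<kappa> \<noteq> 0" for \<kappa> using less_le_trans[OF pos p[of \<kappa>]] less_le_trans[OF pos q[of \<kappa>]] by auto
  have s: "0 \<le> sin \<theta>" "sin \<theta> < 1"
  proof -
    show "0 \<le> sin \<theta>" using th by (intro sin_ge_zero) auto
    have "sin \<theta> < sin (pi/2)" using th by (intro sin_monotone_2pi) auto
    then show "sin \<theta> < 1" by simp
  qed
  have "(1::complex) \<in> sector \<theta>" using th by (simp add: sector_def)
  then have "(SUP z\<in>sector \<theta>. cmod (rat F c p q z)) \<le> 16 * \<gamma> / (1 - sin \<theta>)"
  proof (intro cSUP_least)
    fix z assume z: "z \<in> sector \<theta>"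
    then show "cmod (rat F c p q z) \<le> 16 * \<gamma> / (1 - sin \<theta>)"
      by (intro rat_dyadic_bound[OF F _ sector_Im(1)[OF z th(2)] s c \<gamma> p q]) (simp add: sector_def)
  qed auto
  then have "H * (SUP z\<in>sector \<theta>. cmod (rat F c p q z)) * norm x \<le> H * (16 * \<gamma> / (1 - sin \<theta>)) * norm x"
    using H0 by (intro mult_right_mono mult_left_mono) auto
  moreover have "fcalc A \<nu> (rat F c p q) x = (\<Sum>\<kappa>\<in>F. c \<kappa> *\<^sub>C K (\<i> * of_real (p \<kappa>)) (\<i> * of_real (q \<kappa>)) x)"
    by (rule fcalc_rat[OF A F p0 q0 pq nu])
  ultimately show ?thesis
    using H[where x = x, OF rat_H0[where c = c and p = p and q = q, OF F p0 q0 th]] by simp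
qed

end

text \<open>In a reflexive space the Abel means \<open>\<epsilon> (\<epsilon> + A)\<^sup>-\<^sup>1 x\<close> have a weak cluster point; it lies in
  the kernel and differs from \<open>x\<close> by an element of the closed range.\<close>
lemma (in resolvent_family) reflexive_split:
  assumes refl: "reflexive_space TYPE('a)"
  shows "split_resolvent_family R \<theta>0 M"
proof
  fix x
  define e where "e = (\<lambda>n. 1 / real (Suc n))"
  define xn where "xn = (\<lambda>n. - (e n *\<^sub>R R (- of_real (e n)) x))"
  have e: "0 < e n" for n by (simp add: e_def)
  have eS: "- of_real (e n) \<in> S" for n using e by (intro S_neg)
  have "norm (xn n) \<le> M * norm x" for n
  proof -
    have "norm (xn n) = e n * norm (R (- of_real (e n)) x)" using e[of n] by (simp add: xn_def)
    also have "\<dots> \<le> e n * (M / e n * norm x)"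
      using bd[OF eS, of n x] e[of n] by (intro mult_left_mono) auto
    finally show ?thesis using e[of n] by simp
  qed
  then obtain y G where G: "G \<noteq> bot" "G \<le> sequentially" and y: "\<And>\<phi>. \<phi> \<in> dual_space \<Longrightarrow> ((\<lambda>n. \<phi> (xn n)) \<longlongrightarrow> \<phi> y) G"
    using reflexive_weak_cluster[OF refl] by metis
  have diff: "x - xn n = - AR (- of_real (e n)) x" for n
    by (simp add: xn_def AR_def scaleR_scaleC cscale.minus_left)
  have Bcxn: "Bc (xn n) = e n *\<^sub>R B (- AR (- of_real (e n)) x)" for n
  proof -
    have "R (- of_real (e n)) (Bc x) = AR (- of_real (e n)) (B x)" by (rule R_Bc[OF eS])
    also have "\<dots> = B (AR (- of_real (e n)) x)" by (simp add: commute_AR[OF commutes_B eS])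
    finally have f: "R (- of_real (e n)) (Bc x) = B (AR (- of_real (e n)) x)" .
    have "Bc (xn n) = - (e n *\<^sub>R R (- of_real (e n)) (Bc x))"
      by (simp add: xn_def Bc_lin(5,7) commute_Bc[OF commutes_R[OF eS], symmetric])
    then show ?thesis by (simp only: f B_lin(5)) simp
  qed
  have "Bc y = 0"
  proof (rule dual_separates)
    fix \<phi> :: "'a \<Rightarrow> complex" assume \<phi>: "\<phi> \<in> dual_space"
    have "((\<lambda>n. \<phi> (Bc (xn n))) \<longlongrightarrow> \<phi> (Bc y)) G"
      using y[OF dual_space_comp[OF \<phi> commutesD(1)[OF commutes_Bc]]] .
    moreover have "(\<lambda>n. Bc (xn n)) \<longlonglongrightarrow> 0"
    proof (rule Lim_null_comparison)
      show "\<forall>\<^sub>F n in sequentially. norm (Bc (xn n)) \<le> inverse (real (Suc n)) * ((1 + M) * ((1 + M) * norm x))"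
      proof (intro always_eventually allI)
        fix n
        have "norm (Bc (xn n)) = e n * norm (B (- AR (- of_real (e n)) x))" using e[of n] by (simp add: Bcxn)
        also have "\<dots> \<le> e n * ((1 + M) * ((1 + M) * norm x))"
          using e[of n] norm_AR[OF eS[of n], of x] nn(1)
          by (intro mult_left_mono order_trans[OF norm_B]) auto
        finally show "norm (Bc (xn n)) \<le> inverse (real (Suc n)) * ((1 + M) * ((1 + M) * norm x))" by (simp add: e_def divide_inverse)
      qed
      show "(\<lambda>n. inverse (real (Suc n)) * ((1 + M) * ((1 + M) * norm x))) \<longlonglongrightarrow> 0"
        by (intro tendsto_mult_left_zero LIMSEQ_inverse_real_of_nat)
    qed
    then have "(\<lambda>n. \<phi> (Bc (xn n))) \<longlonglongrightarrow> \<phi> 0"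
      by (rule bounded_linear.tendsto[OF dual_spaceD(3)[OF \<phi>]])
    then have "((\<lambda>n. \<phi> (Bc (xn n))) \<longlongrightarrow> \<phi> 0) G" using G(2) by (rule tendsto_mono[rotated])
    ultimately show "\<phi> (Bc y) = \<phi> 0" using G(1) tendsto_unique by blast
  qed
  then have "y \<in> Ker" by (simp add: Ker_def Bc_def)
  moreover have "x - y \<in> closure (range Bc)"
  proof (rule ccontr)
    assume neg: "x - y \<notin> closure (range Bc)"
    have sub: "0 \<in> range Bc" "u \<in> range Bc \<Longrightarrow> v \<in> range Bc \<Longrightarrow> u + v \<in> range Bc" "u \<in> range Bc \<Longrightarrow> c *\<^sub>C u \<in> range Bc" for u v c
    proof -
      show "0 \<in> range Bc" using Bc_lin(4) by (metis rangeI)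
      show "u \<in> range Bc \<Longrightarrow> v \<in> range Bc \<Longrightarrow> u + v \<in> range Bc" by (auto simp flip: Bc_lin(1))
      show "u \<in> range Bc \<Longrightarrow> c *\<^sub>C u \<in> range Bc" by (auto simp flip: Bc_lin(2))
    qed
    \<comment> \<open>Closed subspaces are weakly closed: the functional is 0 at each
      \<open>x - xn n\<close>, hence at \<open>x - y\<close>, where its real part equals the
      distance to the range.\<close>
    obtain \<phi> where \<phi>: "\<phi> \<in> dual_space" "\<And>u. u \<in> range Bc \<Longrightarrow> \<phi> u = 0" "Re (\<phi> (x - y)) = infdist (x - y) (range Bc)"
      using Hahn_Banach_separation[OF sub] by blast
    have "\<phi> (x - xn n) = 0" for n
    proof -
      \<comment> \<open>The preimage is found by writing \<open>A R\<close> as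
        \<open>A (1 + A)^-1\<close> applied to \<open>(1 + A) R\<close>.\<close>
      have "x - xn n = Bc (- AR (- of_real (e n)) x - R (- of_real (e n)) x)"
      proof -
        let ?r = "R (- of_real (e n))"
        have 1: "Bc (?r x) = AR (- of_real (e n)) (B x)" by (simp add: commute_Bc[OF commutes_R[OF eS], symmetric] R_Bc[OF eS])
        have "Bc (- AR (- of_real (e n)) x) = - AR (- of_real (e n)) x + AR (- of_real (e n)) (B x)"
          unfolding Bc_def by (simp add: B_lin(5) commute_AR[OF commutes_B eS])
        then show ?thesis by (simp add: diff Bc_lin(6) 1)
      qed
      then show ?thesis using \<phi>(2) by (metis rangeI)
    qed
    then have "\<phi> (xn n) = \<phi> x" for n by (simp add: dual_spaceD[OF \<phi>(1)])
    then have "((\<lambda>n. \<phi> x) \<longlongrightarrow> \<phi> y) G" using y[OF \<phi>(1)] by simp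
    then have "\<phi> y = \<phi> x" using G(1) by (simp add: tendsto_const_iff)
    then have "infdist (x - y) (range Bc) = 0" using \<phi>(3) by (simp add: dual_spaceD[OF \<phi>(1)])
    then show False using neg in_closure_iff_infdist_zero[of "range Bc" "x - y"] by auto
  qed
  ultimately show "\<exists>p\<in>Ker. x - p \<in> closure (range Bc)" by blast
qed

theorem Hinfty_generator_family:
  fixes A :: "'a::complex_banach uop"
  assumes refl: "reflexive_space TYPE('a)" and th: "0 < \<theta>" "\<theta> < pi / 2" and H: "has_Hinfty_calculus A \<theta>"
  shows "\<exists>\<theta>0 M C. generator_family (\<lambda>z. resolvent z A) \<theta>0 M C A \<and>
    (\<forall>z\<in>cosector \<theta>0. in_resolvent_set z A)"
proof -
  obtain \<omega> Kc where om: "\<omega> < \<theta>" "sectorial \<omega> A" and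
    Kc: "\<And>f a \<nu> x. f \<in> H0_infty \<theta> \<Longrightarrow> \<omega> < \<nu> \<Longrightarrow> \<nu> < \<theta> \<Longrightarrow>
      norm (fcalc A \<nu> f x + a *\<^sub>C x) \<le> Kc * (SUP z\<in>sector \<theta>. cmod (f z + a)) * norm x"
    using H unfolding has_Hinfty_calculus_def by blast
  \<comment> \<open>Midpoints with \<open>\<omega> < \<theta>0 < \<nu> < \<theta>\<close>: the
    resolvents are bounded outside \<open>\<theta>0\<close>, the contour has angle
    \<open>\<nu>\<close>, and the symbols are tested on the sector of angle
    \<open>\<theta>\<close>.\<close>
  define \<theta>0 where "\<theta>0 = (\<omega> + \<theta>) / 2"
  define \<nu> where "\<nu> = (\<theta>0 + \<theta>) / 2"
  have om0: "0 < \<omega>" using om(2) by (simp add: sectorial_def)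
  have t0: "\<omega> < \<theta>0" "\<theta>0 < \<theta>" "0 < \<theta>0" "\<theta>0 < pi / 2" "\<theta>0 < pi" "\<theta>0 < \<nu>" "\<nu> < \<theta>" "\<omega> < \<nu>" "\<nu> < pi / 2"
    using om(1) om0 th by (auto simp: \<theta>0_def \<nu>_def field_simps)
  obtain C0 where C0: "\<And>z x. z \<notin> closure (sector \<theta>0) \<Longrightarrow> norm (z *\<^sub>C resolvent z A x) \<le> C0 * norm x"
    using om(2) t0 unfolding sectorial_def by meson
  have notin: "z \<notin> closure (sector \<theta>0)" "z \<notin> closure (sector \<omega>)" if z: "z \<in> cosector \<theta>0" for z
  proof -
    have "cos \<theta>0 \<le> cos \<omega>" using t0 om0 by (intro cos_monotone_0_pi_le) auto
    then have "cmod z * cos \<theta>0 \<le> cmod z * cos \<omega>" by (intro mult_left_mono) auto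
    then show "z \<notin> closure (sector \<theta>0)" "z \<notin> closure (sector \<omega>)"
      using closure_sector[of \<theta>0] closure_sector[of \<omega>] t0 om0 z unfolding cosector_def by auto
  qed
  have inres: "in_resolvent_set z A" if "z \<in> cosector \<theta>0" for z
    using notin(2)[OF that] om(2) unfolding sectorial_def uop_spectrum_def by blast
  have res: "is_resolvent z A (resolvent z A)" if "z \<in> cosector \<theta>0" for z
    using inres[OF that] unfolding in_resolvent_set_def resolvent_def by (rule someI_ex)
  let ?M = "\<bar>C0\<bar>"
  have rf: "resolvent_family (\<lambda>z. resolvent z A) \<theta>0 ?M"
  proof
    show "0 < \<theta>0" "\<theta>0 < pi / 2" "0 \<le> ?M" using t0 by auto
    fix z x assume z: "z \<in> cosector \<theta>0"
    show "bounded_op (resolvent z A)" using res[OF z] by (simp add: is_resolvent_def)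
    have "z \<noteq> 0" using z by (auto simp: cosector_def)
    have "cmod z * norm (resolvent z A x) \<le> C0 * norm x" using C0[OF notin(1)[OF z], of x] by simp
    also have "\<dots> \<le> ?M * norm x" by (intro mult_right_mono) auto
    finally show "norm (resolvent z A x) \<le> ?M / cmod z * norm x" using \<open>z \<noteq> 0\<close> by (simp add: field_simps)
    fix w assume w: "w \<in> cosector \<theta>0"
    let ?y = "resolvent w A x"
    have y: "?y \<in> fst A" "w *\<^sub>C ?y - snd A ?y = x" using res[OF w] by (auto simp: is_resolvent_def)
    have x: "x = (z *\<^sub>C ?y - snd A ?y) + (w - z) *\<^sub>C ?y" by (subst y(2)[symmetric]) (simp add: cscale_algebra)
    have "resolvent z A x = resolvent z A (z *\<^sub>C ?y - snd A ?y) + resolvent z A ((w - z) *\<^sub>C ?y)"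
      using \<open>bounded_op (resolvent z A)\<close> by (subst x) (rule bounded_opD(1))
    also have "resolvent z A (z *\<^sub>C ?y - snd A ?y) = ?y" using res[OF z] y(1) by (simp add: is_resolvent_def)
    also have "resolvent z A ((w - z) *\<^sub>C ?y) = (w - z) *\<^sub>C resolvent z A ?y" using \<open>bounded_op (resolvent z A)\<close> by (rule bounded_opD(2))
    finally show "resolvent z A x - resolvent w A x = (w - z) *\<^sub>C resolvent z A (resolvent w A x)" by simp
  next
    have c: "cos \<theta>0 > 0" using t0 by (intro cos_gt_zero) auto
    have "-1 \<in> cosector \<theta>0" using c by (simp add: cosector_def)
    then have "resolvent (-1) A ((-1) *\<^sub>C x - snd A x) = x" if "x \<in> fst A" for x
      using res[of "-1"] that by (simp add: is_resolvent_def)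
    then have "fst A \<subseteq> range (resolvent (-1) A)" by (metis rangeI subsetI)
    then have "closure (fst A) \<subseteq> closure (range (resolvent (-1) A))" by (rule closure_mono)
    then show "closure (range (resolvent (-1) A)) = UNIV"
      using om(2) by (auto simp: sectorial_def densely_defined_def)
  qed
  interpret resolvent_family "\<lambda>z. resolvent z A" \<theta>0 ?M by (rule rf)
  interpret split_resolvent_family "\<lambda>z. resolvent z A" \<theta>0 ?M by (rule reflexive_split[OF refl])
  \<comment> \<open>The calculus with \<open>a = 0\<close>. Passing to the absolute value of the
    constant is sound because the supremum is nonnegative.\<close>
  have HK: "norm (fcalc A \<nu> f x) \<le> \<bar>Kc\<bar> * (SUP z\<in>sector \<theta>. cmod (f z)) * norm x" if f: "f \<in> H0_infty \<theta>" for f x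
  proof -
    have "(1::complex) \<in> sector \<theta>" using th by (simp add: sector_def)
    moreover have "bdd_above ((\<lambda>z. cmod (f z)) ` sector \<theta>)"
    proof -
      obtain b where "\<forall>w\<in>f ` sector \<theta>. cmod w \<le> b" using f unfolding H0_infty_def bounded_iff by blast
      then show ?thesis by (intro bdd_aboveI2[of _ _ b]) auto
    qed
    ultimately have "cmod (f 1) \<le> (SUP z\<in>sector \<theta>. cmod (f z))" by (rule cSUP_upper)
    then have "0 \<le> (SUP z\<in>sector \<theta>. cmod (f z))" using norm_ge_zero[of "f 1"] by linarith
    then have "Kc * (SUP z\<in>sector \<theta>. cmod (f z)) * norm x \<le> \<bar>Kc\<bar> * (SUP z\<in>sector \<theta>. cmod (f z)) * norm x"
      by (intro mult_right_mono) auto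
    then show ?thesis using Kc[OF f, of \<nu> x 0] t0 by simp
  qed
  \<comment> \<open>16 comes from \<open>rat_dyadic_bound\<close>; 8 bounds the coefficients
    relative to \<open>2^k\<close>, by \<open>cmod kc \<le> 4\<close> and
    \<open>\<bar>lam \<kappa> u\<bar> \<le> 2 * 2^k\<close> for \<open>Psi\<close>, with room to
    spare for \<open>Phi\<close>.\<close>
  define C where "C = \<bar>Kc\<bar> * (16 * 8 / (1 - sin \<theta>))"
  have sin1: "sin \<theta> < 1"
  proof -
    have "sin \<theta> < sin (pi/2)" using th by (intro sin_monotone_2pi) auto
    then show ?thesis by simp
  qed
  have K: "norm (\<Sum>\<kappa>\<in>F. c \<kappa> *\<^sub>C K (\<i> * of_real (p \<kappa>)) (\<i> * of_real (q \<kappa>)) x) \<le> C * norm x"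
    if "finite F" "\<And>\<kappa>. 2 powi snd \<kappa> \<le> \<bar>p \<kappa>\<bar>" "\<And>\<kappa>. 2 powi snd \<kappa> \<le> \<bar>q \<kappa>\<bar>" "\<And>\<kappa>. p \<kappa> \<noteq> q \<kappa>"
     "\<And>\<kappa>. cmod (c \<kappa>) \<le> 8 * 2 powi snd \<kappa>" for F :: "(bool \<times> int) set" and c p q x
    using Hinfty_K_sum[OF HOL.refl HK abs_ge_zero that _ t0(6,9) th] by (simp add: C_def)
  have dil: "dilatable (\<lambda>z. resolvent z A) \<theta>0 ?M C"
  proof
    show "0 \<le> C" using sin1 by (simp add: C_def)
    fix F :: "(bool \<times> int) set" and \<zeta> :: "bool \<times> int \<Rightarrow> complex" and u :: real and x
    assume F: "finite F" and \<zeta>: "\<And>\<kappa>. cmod (\<zeta> \<kappa>) \<le> 1" and u: "u \<in> {0..1}"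
    have l: "2 powi snd \<kappa> \<le> \<bar>lam \<kappa> u\<bar>" "\<bar>lam \<kappa> u\<bar> \<le> 2 * 2 powi snd \<kappa>" "lam \<kappa> u \<noteq> 0" for \<kappa>
      using u by (auto simp: lam_ge lam_abs lam_nz)
    have "norm (\<Sum>\<kappa>\<in>F. (\<zeta> \<kappa> * of_real (2 powi snd \<kappa>)) *\<^sub>C K (\<i> * of_real (- lam \<kappa> u)) (\<i> * of_real (lam \<kappa> u)) x) \<le> C * norm x"
    proof (rule K[OF F])
      fix \<kappa>
      have "cmod (\<zeta> \<kappa> * of_real (2 powi snd \<kappa>)) = cmod (\<zeta> \<kappa>) * 2 powi snd \<kappa>" by (simp add: norm_mult norm_power_int)
      also have "\<dots> \<le> 8 * 2 powi snd \<kappa>" using \<zeta>[of \<kappa>] by (intro mult_right_mono) auto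
      finally show "cmod (\<zeta> \<kappa> * of_real (2 powi snd \<kappa>)) \<le> 8 * 2 powi snd \<kappa>" .
    qed (use l in auto)
    then show "norm (\<Sum>\<kappa>\<in>F. \<zeta> \<kappa> *\<^sub>C Phi \<kappa> u x) \<le> C * norm x"
      by (simp add: Phi_def K1_def scaleR_scaleC)
    have "norm (\<Sum>\<kappa>\<in>F. (\<zeta> \<kappa> * (kc * of_real (lam \<kappa> u))) *\<^sub>C K (\<i> * of_real (2 * lam \<kappa> u)) (\<i> * of_real (3 * lam \<kappa> u)) x) \<le> C * norm x"
    proof (rule K[OF F])
      fix \<kappa>
      have "cmod (\<zeta> \<kappa> * (kc * of_real (lam \<kappa> u))) \<le> 1 * (4 * (2 * 2 powi snd \<kappa>))"
        unfolding norm_mult norm_of_real by (intro mult_mono \<zeta> norm_kc l) auto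
      then show "cmod (\<zeta> \<kappa> * (kc * of_real (lam \<kappa> u))) \<le> 8 * 2 powi snd \<kappa>" by simp
      show "2 powi snd \<kappa> \<le> \<bar>2 * lam \<kappa> u\<bar>" "2 powi snd \<kappa> \<le> \<bar>3 * lam \<kappa> u\<bar>" using l[of \<kappa>] by (simp_all add: abs_mult)
      show "2 * lam \<kappa> u \<noteq> 3 * lam \<kappa> u" using l(3) by simp
    qed
    then show "norm (\<Sum>\<kappa>\<in>F. \<zeta> \<kappa> *\<^sub>C Psi \<kappa> u x) \<le> C * norm x"
      by (simp add: Psi_def K2_def mult.assoc mult.left_commute[of \<i>])
  qed
  have "generator_family (\<lambda>z. resolvent z A) \<theta>0 ?M C A"
    using dil res om(2) unfolding generator_family_def generator_family_axioms_def sectorial_def by auto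
  then show ?thesis using inres by blast
qed

section \<open>Measurable functions with separable range\<close>

text \<open>Strong measurability in Pettis's form, Borel with separable range, without exceptional
  null sets. Pointwise limits and substitution into operator fields stay inside it;
  \<open>strongly_measurable_SM\<close> links it to the almost everywhere notion.\<close>

definition SM :: "'w measure \<Rightarrow> ('w \<Rightarrow> 'a::metric_space) \<Rightarrow> bool" where
  "SM M f \<longleftrightarrow> f \<in> borel_measurable M \<and> (\<exists>D. countable D \<and> f ` space M \<subseteq> closure D)"

definition CV :: "'w measure \<Rightarrow> ('w \<Rightarrow> 'a) \<Rightarrow> bool" where
  "CV M f \<longleftrightarrow> countable (f ` space M) \<and> (\<forall>y. f -` {y} \<inter> space M \<in> sets M)"

lemma SM_measurable: "SM M f \<Longrightarrow> f \<in> borel_measurable M"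
  by (simp add: SM_def)

lemma SM_const: "SM M (\<lambda>_. c)"
  unfolding SM_def by (intro conjI exI[of _ "{c}"]) auto

lemma SM_limit:
  assumes f: "\<And>n::nat. SM M (f n)" and lim: "\<And>\<omega>. \<omega> \<in> space M \<Longrightarrow> (\<lambda>n. f n \<omega>) \<longlonglongrightarrow> g \<omega>"
  shows "SM M g"
proof -
  obtain D where D: "\<And>n. countable (D n)" "\<And>n. f n ` space M \<subseteq> closure (D n)"
    using f unfolding SM_def by metis
  have "g ` space M \<subseteq> closure (\<Union>n. D n)"
  proof
    fix y assume "y \<in> g ` space M"
    then obtain \<omega> where w: "\<omega> \<in> space M" "y = g \<omega>" by blast
    have "f n \<omega> \<in> closure (\<Union>n. D n)" for n
    proof -
      have "f n \<omega> \<in> closure (D n)" using D(2) w by blast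
      also have "closure (D n) \<subseteq> closure (\<Union>n. D n)" by (intro closure_mono) auto
      finally show ?thesis .
    qed
    then show "y \<in> closure (\<Union>n. D n)"
      unfolding w(2) using lim[OF w(1)] by (rule closed_sequentially[OF closed_closure])
  qed
  moreover have "countable (\<Union>n. D n)" using D(1) by auto
  moreover have "g \<in> borel_measurable M"
    by (rule borel_measurable_LIMSEQ_metric[OF SM_measurable[OF f] lim])
  ultimately show ?thesis unfolding SM_def by blast
qed

lemma SM_glue:
  fixes h :: "'c \<Rightarrow> 'w \<Rightarrow> 'b::metric_space"
  assumes g: "CV M g" and h: "\<And>y. SM M (h y)"
  shows "SM M (\<lambda>\<omega>. h (g \<omega>) \<omega>)"
proof -
  obtain D where D: "\<And>y. countable (D y)" "\<And>y. h y ` space M \<subseteq> closure (D y)"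
    using h unfolding SM_def by metis
  let ?Y = "g ` space M"
  have Y: "countable ?Y" using g by (simp add: CV_def)
  have "(\<lambda>\<omega>. h (g \<omega>) \<omega>) ` space M \<subseteq> closure (\<Union>y\<in>?Y. D y)"
  proof safe
    fix \<omega> assume w: "\<omega> \<in> space M"
    then have "h (g \<omega>) \<omega> \<in> closure (D (g \<omega>))" using D(2) by blast
    also have "closure (D (g \<omega>)) \<subseteq> closure (\<Union>y\<in>?Y. D y)" using w by (intro closure_mono) auto
    finally show "h (g \<omega>) \<omega> \<in> closure (\<Union>y\<in>?Y. D y)" .
  qed
  moreover have "countable (\<Union>y\<in>?Y. D y)" by (rule countable_UN[OF Y D(1)])
  moreover have "(\<lambda>\<omega>. h (g \<omega>) \<omega>) \<in> borel_measurable M"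
  proof (rule measurableI)
    fix B assume B: "B \<in> sets (borel :: 'b measure)"
    have "(\<lambda>\<omega>. h (g \<omega>) \<omega>) -` B \<inter> space M = (\<Union>y\<in>?Y. (h y -` B \<inter> space M) \<inter> (g -` {y} \<inter> space M))" by auto
    also have "\<dots> \<in> sets M"
      using Y g B SM_measurable[OF h] by (intro sets.countable_UN' sets.Int) (auto simp: CV_def intro: measurable_sets)
    finally show "(\<lambda>\<omega>. h (g \<omega>) \<omega>) -` B \<inter> space M \<in> sets M" .
  qed simp
  ultimately show ?thesis unfolding SM_def by blast
qed

lemma measurable_dist_const:
  "f \<in> borel_measurable M \<Longrightarrow> (\<lambda>\<omega>. dist (d :: 'a::metric_space) (f \<omega>)) \<in> borel_measurable M"
  by (rule measurable_compose[of f M borel]) (auto intro!: borel_measurable_continuous_onI continuous_intros)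

lemma CV_countable_compose:
  fixes i :: "'w \<Rightarrow> nat"
  assumes "i \<in> measurable M (count_space UNIV)"
  shows "CV M (\<lambda>\<omega>. d (i \<omega>))"
  unfolding CV_def
proof (intro conjI allI)
  have "(\<lambda>\<omega>. d (i \<omega>)) ` space M \<subseteq> range d" by auto
  then show "countable ((\<lambda>\<omega>. d (i \<omega>)) ` space M)" by (rule countable_subset) auto
  fix y
  have "(\<lambda>\<omega>. d (i \<omega>)) -` {y} \<inter> space M = i -` {j. d j = y} \<inter> space M" by auto
  also have "\<dots> \<in> sets M" using assms by (rule measurable_sets) auto
  finally show "(\<lambda>\<omega>. d (i \<omega>)) -` {y} \<inter> space M \<in> sets M" .
qed

lemma SM_approx:
  assumes f: "SM M f" and e: "0 < e"
  shows "\<exists>g. CV M g \<and> (\<forall>\<omega>\<in>space M. dist (g \<omega>) (f \<omega>) < e)"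
proof (cases "space M = {}")
  case True
  then show ?thesis by (intro exI[of _ f]) (auto simp: CV_def)
next
  case False
  obtain D where D: "countable D" "f ` space M \<subseteq> closure D" using f by (auto simp: SM_def)
  have "D \<noteq> {}" using False D by auto
  define d where "d = from_nat_into D"
  have rd: "range d = D" using D \<open>D \<noteq> {}\<close> by (simp add: d_def range_from_nat_into)
  define i where "i = (\<lambda>\<omega>. LEAST i. dist (d i) (f \<omega>) < e)"
  note [measurable] = measurable_dist_const[OF SM_measurable[OF f]]
  have "i \<in> measurable M (count_space UNIV)" unfolding i_def by measurable
  moreover have "dist (d (i \<omega>)) (f \<omega>) < e" if "\<omega> \<in> space M" for \<omega>
  proof -
    have "f \<omega> \<in> closure D" using D that by auto
    then obtain y where "y \<in> D" "dist y (f \<omega>) < e" using e by (auto simp: closure_approachable)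
    then obtain j where "dist (d j) (f \<omega>) < e" using rd by blast
    then show ?thesis unfolding i_def by (rule LeastI)
  qed
  ultimately show ?thesis by (intro exI[of _ "\<lambda>\<omega>. d (i \<omega>)"]) (auto intro: CV_countable_compose)
qed

text \<open>\<open>f\<close> is approximated uniformly by countably valued functions: on each of
  countably many pieces the second argument is constant, and continuity in it passes to the limit.
  So \<open>F\<close> need only be measurable vector by vector.\<close>

lemma SM_compose:
  fixes f :: "'w \<Rightarrow> 'a::metric_space" and F :: "'w \<Rightarrow> 'a \<Rightarrow> 'b::metric_space"
  assumes F: "\<And>d. SM M (\<lambda>\<omega>. F \<omega> d)" and cont: "\<And>\<omega>. \<omega> \<in> space M \<Longrightarrow> continuous_on UNIV (F \<omega>)" and f: "SM M f"
  shows "SM M (\<lambda>\<omega>. F \<omega> (f \<omega>))"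
proof -
  have "\<forall>n. \<exists>g. CV M g \<and> (\<forall>\<omega>\<in>space M. dist (g \<omega>) (f \<omega>) < inverse (real (Suc n)))"
    by (intro allI SM_approx f) simp
  then obtain g where g: "\<And>n. CV M (g n)" "\<And>n \<omega>. \<omega> \<in> space M \<Longrightarrow> dist (g n \<omega>) (f \<omega>) < inverse (real (Suc n))"
    by metis
  show ?thesis
  proof (rule SM_limit)
    show "SM M (\<lambda>\<omega>. F \<omega> (g n \<omega>))" for n by (rule SM_glue[OF g(1) F])
    fix \<omega> assume w: "\<omega> \<in> space M"
    have "(\<lambda>n. g n \<omega>) \<longlonglongrightarrow> f \<omega>"
    proof (rule metric_tendsto_imp_tendsto[OF LIMSEQ_inverse_real_of_nat])
      show "\<forall>\<^sub>F n in sequentially. dist (g n \<omega>) (f \<omega>) \<le> dist (inverse (real (Suc n))) 0"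
        using g(2)[OF w] by (intro always_eventually allI) (auto simp: dist_real_def less_imp_le simp del: of_nat_Suc)
    qed
    then show "(\<lambda>n. F \<omega> (g n \<omega>)) \<longlonglongrightarrow> F \<omega> (f \<omega>)"
      using continuous_on_tendsto_compose[OF cont[OF w]] by auto
  qed
qed

lemma SM_continuous: "continuous_on UNIV h \<Longrightarrow> SM M f \<Longrightarrow> SM M (\<lambda>\<omega>. h (f \<omega>))"
  by (rule SM_compose[where F = "\<lambda>_. h"]) (auto intro: SM_const)

lemma SM_second_countable:
  fixes f :: "'w \<Rightarrow> 'b::{metric_space, second_countable_topology}"
  assumes "f \<in> borel_measurable M"
  shows "SM M f"
proof -
  obtain D :: "'b set" where D: "countable D" "\<And>X. open X \<Longrightarrow> X \<noteq> {} \<Longrightarrow> \<exists>d\<in>D. d \<in> X"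
    using countable_dense_setE by blast
  have "closure D = UNIV"
  proof -
    have "x \<in> closure D" for x
      unfolding closure_approachable
    proof (intro allI impI)
      fix e :: real assume "0 < e"
      then obtain d where "d \<in> D" "d \<in> ball x e" using D(2)[of "ball x e"] by auto
      then show "\<exists>y\<in>D. dist y x < e" by (auto simp: dist_commute)
    qed
    then show ?thesis by blast
  qed
  then show ?thesis using assms D(1) by (auto simp: SM_def intro!: exI[of _ D])
qed

lemma SM_add: "SM M f \<Longrightarrow> SM M g \<Longrightarrow> SM M (\<lambda>\<omega>. f \<omega> + g \<omega> :: 'a::real_normed_vector)"
  by (rule SM_compose[where F = "\<lambda>\<omega> d. f \<omega> + d"]) (auto intro!: SM_continuous[where h = "\<lambda>x. x + _"] continuous_intros)

lemma SM_sum: "(\<And>i. i \<in> I \<Longrightarrow> SM M (f i)) \<Longrightarrow> SM M (\<lambda>\<omega>. \<Sum>i\<in>I. f i \<omega> :: 'a::real_normed_vector)"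
  by (induction I rule: infinite_finite_induct) (auto intro: SM_const SM_add)

lemma SM_scaleC:
  assumes "c \<in> borel_measurable M" "SM M f"
  shows "SM M (\<lambda>\<omega>. c \<omega> *\<^sub>C f \<omega>)"
  by (rule SM_compose[where F = "\<lambda>\<omega> d. c \<omega> *\<^sub>C d", OF _ _ assms(2)])
    (auto intro!: SM_continuous[OF _ SM_second_countable[OF assms(1)]] continuous_intros)

lemma SM_diff: "SM M f \<Longrightarrow> SM M g \<Longrightarrow> SM M (\<lambda>\<omega>. f \<omega> - g \<omega> :: 'a::real_normed_vector)"
  using SM_add[of M f "\<lambda>\<omega>. - g \<omega>"] SM_continuous[OF continuous_on_minus[OF continuous_on_id], of M g] by simp

text \<open>\<open>s n\<close> picks a point nearest to \<open>f\<close> among the first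
  \<open>n + 1\<close> terms of a sequence whose closure contains the range.\<close>

lemma SM_simple_approx:
  fixes f :: "'w \<Rightarrow> 'a::real_normed_vector"
  assumes f: "SM M f"
  shows "\<exists>s :: nat \<Rightarrow> 'w \<Rightarrow> 'a. (\<forall>n. finite (s n ` space M) \<and> (\<forall>y. s n -` {y} \<inter> space M \<in> sets M))
    \<and> (\<forall>\<omega>\<in>space M. (\<lambda>n. s n \<omega>) \<longlonglongrightarrow> f \<omega>) \<and> (\<forall>n. \<forall>\<omega>\<in>space M. norm (s n \<omega> - f \<omega>) \<le> norm (f \<omega>))"
proof -
  obtain D where D: "countable D" "f ` space M \<subseteq> closure D" using f by (auto simp: SM_def)
  \<comment> \<open>The sequence starts with 0, which is thus always a competitor; this gives the
    domination by \<open>norm (f \<omega>)\<close>.\<close>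
  define d where "d = (\<lambda>i. case i of 0 \<Rightarrow> 0 | Suc j \<Rightarrow> from_nat_into (insert 0 D) j)"
  have rd: "insert 0 D \<subseteq> range d"
  proof
    fix y assume "y \<in> insert 0 D"
    then obtain j where "y = from_nat_into (insert 0 D) j"
      using D(1) by (metis countable_insert from_nat_into_surj)
    then have "y = d (Suc j)" by (simp add: d_def)
    then show "y \<in> range d" by blast
  qed
  define i where "i = (\<lambda>n \<omega>. LEAST i. i \<le> n \<and> (\<forall>j\<in>{..n}. dist (d i) (f \<omega>) \<le> dist (d j) (f \<omega>)))"
  note [measurable] = measurable_dist_const[OF SM_measurable[OF f]]
  have im: "i n \<in> measurable M (count_space UNIV)" for n unfolding i_def by measurable
  have ip: "i n \<omega> \<le> n" "\<And>j. j \<le> n \<Longrightarrow> dist (d (i n \<omega>)) (f \<omega>) \<le> dist (d j) (f \<omega>)" for n \<omega>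
  proof -
    have "\<exists>i. is_arg_min (\<lambda>i. dist (d i) (f \<omega>)) (\<lambda>i. i \<in> {..n}) i"
      by (rule ex_is_arg_min_if_finite) auto
    then obtain k where "k \<le> n \<and> (\<forall>j\<in>{..n}. dist (d k) (f \<omega>) \<le> dist (d j) (f \<omega>))"
      by (auto simp: is_arg_min_linorder)
    then have "i n \<omega> \<le> n \<and> (\<forall>j\<in>{..n}. dist (d (i n \<omega>)) (f \<omega>) \<le> dist (d j) (f \<omega>))"
      unfolding i_def by (rule LeastI)
    then show "i n \<omega> \<le> n" "\<And>j. j \<le> n \<Longrightarrow> dist (d (i n \<omega>)) (f \<omega>) \<le> dist (d j) (f \<omega>)" by auto
  qed
  show ?thesis
  proof (intro exI[of _ "\<lambda>n \<omega>. d (i n \<omega>)"] conjI allI ballI)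
    fix n
    have "(\<lambda>\<omega>. d (i n \<omega>)) ` space M \<subseteq> d ` {..n}" using ip(1) by auto
    then show "finite ((\<lambda>\<omega>. d (i n \<omega>)) ` space M)" by (rule finite_subset) auto
    show "(\<lambda>\<omega>. d (i n \<omega>)) -` {y} \<inter> space M \<in> sets M" for y
      using CV_countable_compose[OF im, of d n] by (auto simp: CV_def)
    fix \<omega> assume "\<omega> \<in> space M"
    show "norm (d (i n \<omega>) - f \<omega>) \<le> norm (f \<omega>)"
      using ip(2)[of 0 n \<omega>] by (simp add: d_def dist_norm)
  next
    fix \<omega> assume w: "\<omega> \<in> space M"
    show "(\<lambda>n. d (i n \<omega>)) \<longlonglongrightarrow> f \<omega>"
    proof (rule metric_LIMSEQ_I)
      fix e :: real assume "0 < e"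
      moreover have "f \<omega> \<in> closure D" using D w by auto
      ultimately obtain y where "y \<in> D" "dist y (f \<omega>) < e" by (auto simp: closure_approachable)
      then obtain j where j: "dist (d j) (f \<omega>) < e" using rd by blast
      show "\<exists>no. \<forall>n\<ge>no. dist (d (i n \<omega>)) (f \<omega>) < e"
        using j ip(2)[of j _ \<omega>] by (intro exI[of _ j]) (auto intro: le_less_trans)
    qed
  qed
qed

lemma SM_strongly_measurable: "SM M f \<Longrightarrow> strongly_measurable M f"
  unfolding strongly_measurable_def by (drule SM_simple_approx) (elim ex_forward conjE, intro conjI AE_I2, blast+)

text \<open>The function is set to 0 on a null set outside which the simple functions
  converge.\<close>

lemma strongly_measurable_SM:
  fixes f :: "'w \<Rightarrow> 'a::real_normed_vector"
  assumes "strongly_measurable M f"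
  obtains f' where "SM M f'" "AE \<omega> in M. f \<omega> = f' \<omega>"
proof -
  obtain s where s: "\<And>n. finite (s n ` space M)" "\<And>n y. s n -` {y} \<inter> space M \<in> sets M"
    and lim: "AE x in M. (\<lambda>n. s n x) \<longlonglongrightarrow> f x"
    using assms unfolding strongly_measurable_def by blast
  obtain N where N: "{x \<in> space M. \<not> (\<lambda>n. s n x) \<longlonglongrightarrow> f x} \<subseteq> N" "emeasure M N = 0" "N \<in> sets M"
    using lim by (rule AE_E)
  have "SM M (\<lambda>\<omega>. if \<omega> \<in> N then 0 else f \<omega>)"
  proof (rule SM_limit)
    show "SM M (\<lambda>\<omega>. if \<omega> \<in> N then 0 else s n \<omega>)" for n
    proof -
      have b: "CV M (\<lambda>\<omega>. \<omega> \<in> N)"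
      proof -
        have "(\<lambda>\<omega>. \<omega> \<in> N) -` {y} \<inter> space M \<in> sets M" for y
        proof (cases y)
          case True
          then have "(\<lambda>\<omega>. \<omega> \<in> N) -` {y} \<inter> space M = N \<inter> space M" by auto
          then show ?thesis using N(3) by auto
        next
          case False
          then have "(\<lambda>\<omega>. \<omega> \<in> N) -` {y} \<inter> space M = space M - N" by auto
          then show ?thesis using N(3) by auto
        qed
        then show ?thesis by (auto simp: CV_def)
      qed
      have "CV M (s n)" using s by (auto simp: CV_def countable_finite)
      then have "SM M (s n)" using SM_glue[of M "s n" "\<lambda>y \<omega>. y"] SM_const by auto
      then have "SM M (\<lambda>\<omega>. if c then 0 else s n \<omega>)" for c by (cases c) (simp_all add: SM_const)
      then show ?thesis by (rule SM_glue[OF b, of "\<lambda>c \<omega>. if c then 0 else s n \<omega>"])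
    qed
    show "(\<lambda>n. if \<omega> \<in> N then 0 else s n \<omega>) \<longlonglongrightarrow> (if \<omega> \<in> N then 0 else f \<omega>)" if "\<omega> \<in> space M" for \<omega>
      using N(1) that by auto
  qed
  moreover have "AE \<omega> in M. f \<omega> = (if \<omega> \<in> N then 0 else f \<omega>)"
  proof (rule AE_I)
    show "{\<omega> \<in> space M. f \<omega> \<noteq> (if \<omega> \<in> N then 0 else f \<omega>)} \<subseteq> N" by auto
  qed (use N in auto)
  ultimately show ?thesis by (rule that)
qed

section \<open>Measure preserving flows on \<open>L\<^sup>p\<close>\<close>

lemma Lp_SM:
  assumes "f \<in> Lp M p"
  obtains f' where "SM M f'" "AE \<omega> in M. f \<omega> = f' \<omega>" "(\<integral>\<^sup>+x. ennreal (norm (f' x) powr p) \<partial>M) < \<infinity>"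
    "Lp_norm M p f = Lp_norm M p f'"
proof -
  obtain f' where f': "SM M f'" "AE \<omega> in M. f \<omega> = f' \<omega>"
    using assms strongly_measurable_SM unfolding Lp_def by blast
  have "(\<integral>\<^sup>+x. ennreal (norm (f x) powr p) \<partial>M) = (\<integral>\<^sup>+x. ennreal (norm (f' x) powr p) \<partial>M)"
    by (rule nn_integral_cong_AE) (use f'(2) in \<open>eventually_elim, simp\<close>)
  then show ?thesis using that[of f'] f' assms by (simp add: Lp_def Lp_norm_def)
qed

lemma Lp_norm_cong_AE: "AE \<omega> in M. f \<omega> = g \<omega> \<Longrightarrow> Lp_norm M p f = Lp_norm M p g"
  unfolding Lp_norm_def
  by (rule arg_cong[where f = "\<lambda>u. enn2real u powr (1/p)"], rule nn_integral_cong_AE) auto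

lemma measurable_norm_powr:
  assumes "SM M f" shows "(\<lambda>\<omega>. ennreal (norm (f \<omega>) powr p)) \<in> borel_measurable M"
proof -
  have [measurable]: "(\<lambda>\<omega>. norm (f \<omega>)) \<in> borel_measurable M"
    by (rule SM_measurable[OF SM_continuous[OF _ assms]]) (intro continuous_intros)
  show ?thesis by measurable
qed

lemma SM_preserving:
  assumes "\<tau> \<in> measurable M M" "SM M f"
  shows "SM M (\<lambda>\<omega>. f (\<tau> \<omega>))"
  using assms measurable_space[OF assms(1)] unfolding SM_def
  by (auto intro: measurable_compose[of \<tau>] dest!: image_subset_iff[THEN iffD1])

lemma AE_preserving:
  assumes "\<tau> \<in> measurable M M" "distr M M \<tau> = M" "AE \<omega> in M. P \<omega>"
  shows "AE \<omega> in M. P (\<tau> \<omega>)"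
  by (rule AE_distrD[OF assms(1)]) (subst assms(2), rule assms(3))

lemma nn_integral_preserving:
  assumes "\<tau> \<in> measurable M M" "distr M M \<tau> = M" "h \<in> borel_measurable M"
  shows "(\<integral>\<^sup>+x. h (\<tau> x) \<partial>M) = (\<integral>\<^sup>+x. h x \<partial>M)"
  using nn_integral_distr[OF assms(1), of h] assms(2,3) by simp

text \<open>Substitution respects classes because preimages of null sets are null; the norm is
  computed on an everywhere measurable representative.\<close>

lemma Lp_preserving:
  assumes t: "\<tau> \<in> measurable M M" "distr M M \<tau> = M" and f: "f \<in> Lp M p"
  shows "(\<lambda>\<omega>. f (\<tau> \<omega>)) \<in> Lp M p" "Lp_norm M p (\<lambda>\<omega>. f (\<tau> \<omega>)) = Lp_norm M p f"
proof -
  obtain f' where f': "SM M f'" "AE \<omega> in M. f \<omega> = f' \<omega>" "(\<integral>\<^sup>+x. ennreal (norm (f' x) powr p) \<partial>M) < \<infinity>"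
    "Lp_norm M p f = Lp_norm M p f'" using f by (rule Lp_SM)
  have ae: "AE \<omega> in M. f (\<tau> \<omega>) = f' (\<tau> \<omega>)" by (rule AE_preserving[OF t f'(2)])
  have eq: "(\<integral>\<^sup>+x. ennreal (norm (f' (\<tau> x)) powr p) \<partial>M) = (\<integral>\<^sup>+x. ennreal (norm (f' x) powr p) \<partial>M)"
    by (rule nn_integral_preserving[OF t measurable_norm_powr[OF f'(1)]])
  have "(\<integral>\<^sup>+x. ennreal (norm (f (\<tau> x)) powr p) \<partial>M) = (\<integral>\<^sup>+x. ennreal (norm (f' (\<tau> x)) powr p) \<partial>M)"
    by (rule nn_integral_cong_AE) (use ae in \<open>eventually_elim, simp\<close>)
  moreover have "strongly_measurable M (\<lambda>\<omega>. f (\<tau> \<omega>))"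
  proof -
    obtain s where s: "\<And>n. finite (s n ` space M)" "\<And>n y. s n -` {y} \<inter> space M \<in> sets M"
      and lim: "AE x in M. (\<lambda>n. s n x) \<longlonglongrightarrow> f' x"
      using SM_strongly_measurable[OF f'(1)] unfolding strongly_measurable_def by blast
    have "finite ((\<lambda>\<omega>. s n (\<tau> \<omega>)) ` space M)" for n
      by (rule finite_subset[OF _ s(1)[of n]]) (use measurable_space[OF t(1)] in auto)
    moreover have "(\<lambda>\<omega>. s n (\<tau> \<omega>)) -` {y} \<inter> space M \<in> sets M" for n y
    proof -
      have "(\<lambda>\<omega>. s n (\<tau> \<omega>)) -` {y} \<inter> space M = \<tau> -` (s n -` {y} \<inter> space M) \<inter> space M"
        using measurable_space[OF t(1)] by auto
      then show ?thesis using measurable_sets[OF t(1) s(2)] by simp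
    qed
    moreover have "AE x in M. (\<lambda>n. s n (\<tau> x)) \<longlonglongrightarrow> f (\<tau> x)"
      using AE_preserving[OF t lim] ae by eventually_elim simp
    ultimately show ?thesis
      unfolding strongly_measurable_def by (intro exI[of _ "\<lambda>n \<omega>. s n (\<tau> \<omega>)"] conjI allI)
  qed
  ultimately show "(\<lambda>\<omega>. f (\<tau> \<omega>)) \<in> Lp M p" using f'(3) eq by (simp add: Lp_def)
  have "Lp_norm M p (\<lambda>\<omega>. f (\<tau> \<omega>)) = Lp_norm M p (\<lambda>\<omega>. f' (\<tau> \<omega>))" by (rule Lp_norm_cong_AE[OF ae])
  also have "\<dots> = Lp_norm M p f'" unfolding Lp_norm_def eq ..
  finally show "Lp_norm M p (\<lambda>\<omega>. f (\<tau> \<omega>)) = Lp_norm M p f" using f'(4) by simp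
qed

lemma powr_add3:
  fixes a b c :: real
  assumes "0 \<le> a" "0 \<le> b" "0 \<le> c" "0 \<le> p"
  shows "(a + b + c) powr p \<le> 3 powr p * (a powr p + b powr p + c powr p)"
proof -
  let ?m = "max a (max b c)"
  have "(a + b + c) powr p \<le> (3 * ?m) powr p" using assms by (intro powr_mono2) auto
  also have "\<dots> = 3 powr p * ?m powr p" using assms using assms by (subst powr_mult) auto
  also have "\<dots> \<le> 3 powr p * (a powr p + b powr p + c powr p)"
    by (intro mult_left_mono) (auto simp: max_def)
  finally show ?thesis .
qed

text \<open>A simple function changes under the flow only on the symmetric differences in
  \<open>sym\<close>, whose measure tends to 0. General functions follow by approximation, since the
  flow preserves the approximation error.\<close>

lemma flow_Lp_continuous_0:
  fixes f :: "'w \<Rightarrow> 'a::real_normed_vector"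
  assumes M: "prob_space M" and t: "\<And>t. \<tau> t \<in> measurable M M" "\<And>t. distr M M (\<tau> t) = M"
    and sym: "\<And>A. A \<in> sets M \<Longrightarrow> ((\<lambda>t. emeasure M {\<omega> \<in> space M. (\<tau> t \<omega> \<in> A) \<noteq> (\<omega> \<in> A)}) \<longlongrightarrow> 0) (at (0::real))"
    and p: "0 < p" and f: "SM M f" "(\<integral>\<^sup>+x. ennreal (norm (f x) powr p) \<partial>M) < \<infinity>"
  shows "((\<lambda>t. \<integral>\<^sup>+x. ennreal (norm (f (\<tau> t x) - f x) powr p) \<partial>M) \<longlongrightarrow> 0) (at 0)"
proof -
  interpret prob_space M by (rule M)
  obtain s where s: "\<And>n. finite (s n ` space M)" "\<And>n y. s n -` {y} \<inter> space M \<in> sets M"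
    "\<And>\<omega>. \<omega> \<in> space M \<Longrightarrow> (\<lambda>n. s n \<omega>) \<longlonglongrightarrow> f \<omega>" "\<And>n \<omega>. \<omega> \<in> space M \<Longrightarrow> norm (s n \<omega> - f \<omega>) \<le> norm (f \<omega>)"
    using SM_simple_approx[OF f(1)] by metis
  have sSM: "SM M (s n)" for n
    using SM_glue[of M "s n" "\<lambda>y \<omega>. y"] SM_const s by (auto simp: CV_def countable_finite)
  have approx: "(\<lambda>n. \<integral>\<^sup>+x. ennreal (norm (s n x - f x) powr p) \<partial>M) \<longlonglongrightarrow> (\<integral>\<^sup>+x. 0 \<partial>M)"
  proof (rule nn_integral_dominated_convergence[where w = "\<lambda>x. ennreal (norm (f x) powr p)"])
    show "(\<lambda>x. ennreal (norm (s n x - f x) powr p)) \<in> borel_measurable M" for n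
      by (rule measurable_norm_powr[OF SM_diff[OF sSM f(1)]])
    show "(\<lambda>x. ennreal (norm (f x) powr p)) \<in> borel_measurable M" by (rule measurable_norm_powr[OF f(1)])
    show "AE x in M. ennreal (norm (s n x - f x) powr p) \<le> ennreal (norm (f x) powr p)" for n
      using s(4) p by (intro AE_I2 ennreal_leI powr_mono2) auto
    show "AE x in M. (\<lambda>n. ennreal (norm (s n x - f x) powr p)) \<longlonglongrightarrow> 0"
    proof (intro AE_I2)
      fix x assume "x \<in> space M"
      then have "(\<lambda>n. norm (s n x - f x)) \<longlonglongrightarrow> 0" using s(3) by (simp add: LIM_zero tendsto_norm_zero)
      then have "(\<lambda>n. norm (s n x - f x) powr p) \<longlonglongrightarrow> 0"
        by (rule tendsto_zero_powrI) (use p in auto)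
      then show "(\<lambda>n. ennreal (norm (s n x - f x) powr p)) \<longlonglongrightarrow> 0" by (rule tendsto_ennrealI[where x = 0, simplified])
    qed
  qed (use f(2) in auto)
  have simple: "((\<lambda>t. \<integral>\<^sup>+x. ennreal (norm (s n (\<tau> t x) - s n x) powr p) \<partial>M) \<longlongrightarrow> 0) (at 0)" for n
  proof -
    let ?Y = "s n ` space M"
    obtain b where b: "\<And>y. y \<in> ?Y \<Longrightarrow> norm y \<le> b" using finite_imp_bounded[OF s(1)[of n]] by (auto simp: bounded_iff)
    define A where "A = (\<lambda>y t. {\<omega> \<in> space M. (\<tau> t \<omega> \<in> s n -` {y} \<inter> space M) \<noteq> (\<omega> \<in> s n -` {y} \<inter> space M)})"
    have Am: "A y t \<in> sets M" for y t
    proof -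
      note [measurable] = s(2)[of n y] t(1)[of t]
      show ?thesis unfolding A_def by measurable
    qed
    have le: "(\<integral>\<^sup>+x. ennreal (norm (s n (\<tau> t x) - s n x) powr p) \<partial>M) \<le> ennreal ((2 * \<bar>b\<bar>) powr p) * (\<Sum>y\<in>?Y. emeasure M (A y t))" for t
    proof -
      have "(\<integral>\<^sup>+x. ennreal (norm (s n (\<tau> t x) - s n x) powr p) \<partial>M) \<le> (\<integral>\<^sup>+x. ennreal ((2 * \<bar>b\<bar>) powr p) * (\<Sum>y\<in>?Y. indicator (A y t) x) \<partial>M)"
      proof (rule nn_integral_mono)
        fix x assume x: "x \<in> space M"
        have tx: "\<tau> t x \<in> space M" using measurable_space[OF t(1) x] .
        show "ennreal (norm (s n (\<tau> t x) - s n x) powr p) \<le> ennreal ((2 * \<bar>b\<bar>) powr p) * (\<Sum>y\<in>?Y. indicator (A y t) x)"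
        proof (cases "s n (\<tau> t x) = s n x")
          case True then show ?thesis using p by simp
        next
          case False
          then have "x \<in> A (s n x) t" using x tx by (auto simp: A_def)
          then have "1 \<le> (\<Sum>y\<in>?Y. indicator (A y t) x :: ennreal)"
            using member_le_sum[of "s n x" ?Y "\<lambda>y. indicator (A y t) x :: ennreal"] x s(1) by auto
          have "norm (s n (\<tau> t x) - s n x) \<le> \<bar>b\<bar> + \<bar>b\<bar>"
            using b[of "s n x"] b[of "s n (\<tau> t x)"] x tx by (intro order_trans[OF norm_triangle_ineq4] add_mono) (auto intro: order_trans)
          then have "ennreal (norm (s n (\<tau> t x) - s n x) powr p) \<le> ennreal ((2 * \<bar>b\<bar>) powr p) * 1"
            using p by (simp add: powr_mono2)
          also have "\<dots> \<le> ennreal ((2 * \<bar>b\<bar>) powr p) * (\<Sum>y\<in>?Y. indicator (A y t) x)"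
            by (intro mult_left_mono) (use \<open>1 \<le> _\<close> in auto)
          finally show ?thesis .
        qed
      qed
      also have "\<dots> = ennreal ((2 * \<bar>b\<bar>) powr p) * (\<Sum>y\<in>?Y. emeasure M (A y t))"
        using Am by (simp add: nn_integral_cmult nn_integral_sum)
      finally show ?thesis .
    qed
    have "((\<lambda>t. ennreal ((2 * \<bar>b\<bar>) powr p) * (\<Sum>y\<in>?Y. emeasure M (A y t))) \<longlongrightarrow> ennreal ((2 * \<bar>b\<bar>) powr p) * (\<Sum>y\<in>?Y. 0)) (at 0)"
      unfolding A_def by (intro ennreal_tendsto_cmult tendsto_sum sym s(2)) auto
    then have lim: "((\<lambda>t. ennreal ((2 * \<bar>b\<bar>) powr p) * (\<Sum>y\<in>?Y. emeasure M (A y t))) \<longlongrightarrow> 0) (at 0)" by simp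
    show ?thesis by (rule tendsto_sandwich[OF _ _ tendsto_const lim]) (simp_all add: le)
  qed
  let ?c = "ennreal (3 powr p)"
  \<comment> \<open>Three terms; measure preservation makes the first equal to the third, hence the
    factor 2.\<close>
  have split: "(\<integral>\<^sup>+x. ennreal (norm (f (\<tau> t x) - f x) powr p) \<partial>M)
     \<le> ?c * (2 * (\<integral>\<^sup>+x. ennreal (norm (s n x - f x) powr p) \<partial>M) + (\<integral>\<^sup>+x. ennreal (norm (s n (\<tau> t x) - s n x) powr p) \<partial>M))" for t n
  proof -
    let ?d = "\<lambda>x. ennreal (norm (s n x - f x) powr p)"
    have dm: "?d \<in> borel_measurable M" by (rule measurable_norm_powr[OF SM_diff[OF sSM f(1)]])
    have em: "(\<lambda>x. ennreal (norm (s n (\<tau> t x) - s n x) powr p)) \<in> borel_measurable M"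
      by (rule measurable_norm_powr[OF SM_diff[OF SM_preserving[OF t(1) sSM] sSM]])
    have "(\<integral>\<^sup>+x. ennreal (norm (f (\<tau> t x) - f x) powr p) \<partial>M)
      \<le> (\<integral>\<^sup>+x. ?c * (?d (\<tau> t x) + ennreal (norm (s n (\<tau> t x) - s n x) powr p) + ?d x) \<partial>M)"
    proof (rule nn_integral_mono)
      fix x
      have "norm (f (\<tau> t x) - f x) \<le> norm (s n (\<tau> t x) - f (\<tau> t x)) + norm (s n (\<tau> t x) - s n x) + norm (s n x - f x)"
      proof -
        have "f (\<tau> t x) - f x = - (s n (\<tau> t x) - f (\<tau> t x)) + (s n (\<tau> t x) - s n x) + (s n x - f x)" by simp
        then show ?thesis by (metis norm_minus_cancel norm_triangle_mono norm_triangle_ineq order_refl)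
      qed
      then have "norm (f (\<tau> t x) - f x) powr p \<le> (norm (s n (\<tau> t x) - f (\<tau> t x)) + norm (s n (\<tau> t x) - s n x) + norm (s n x - f x)) powr p"
        using p by (intro powr_mono2) auto
      also have "\<dots> \<le> 3 powr p * (norm (s n (\<tau> t x) - f (\<tau> t x)) powr p + norm (s n (\<tau> t x) - s n x) powr p + norm (s n x - f x) powr p)"
        using p by (intro powr_add3) auto
      finally show "ennreal (norm (f (\<tau> t x) - f x) powr p) \<le> ?c * (?d (\<tau> t x) + ennreal (norm (s n (\<tau> t x) - s n x) powr p) + ?d x)"
        by (simp add: ennreal_leI flip: ennreal_mult ennreal_plus)
    qed
    also have "\<dots> = ?c * ((\<integral>\<^sup>+x. ?d (\<tau> t x) \<partial>M) + (\<integral>\<^sup>+x. ennreal (norm (s n (\<tau> t x) - s n x) powr p) \<partial>M) + (\<integral>\<^sup>+x. ?d x \<partial>M))"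
      using dm em measurable_compose[OF t(1) dm] by (simp add: nn_integral_cmult nn_integral_add)
    also have "(\<integral>\<^sup>+x. ?d (\<tau> t x) \<partial>M) = (\<integral>\<^sup>+x. ?d x \<partial>M)" by (rule nn_integral_preserving[OF t dm])
    finally show ?thesis by (simp add: mult_2 add_ac)
  qed
  show ?thesis
  proof (rule order_tendstoI)
    fix e :: ennreal assume e: "0 < e"
    have "(\<lambda>n. ?c * (2 * (\<integral>\<^sup>+x. ennreal (norm (s n x - f x) powr p) \<partial>M) + 0)) \<longlonglongrightarrow> ?c * (2 * (\<integral>\<^sup>+x. 0 \<partial>M) + 0)"
      by (intro ennreal_tendsto_cmult tendsto_add approx tendsto_const) auto
    then have "\<forall>\<^sub>F n in sequentially. ?c * (2 * (\<integral>\<^sup>+x. ennreal (norm (s n x - f x) powr p) \<partial>M) + 0) < e"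
      using e by (intro order_tendstoD(2)) auto
    then obtain n where n: "?c * (2 * (\<integral>\<^sup>+x. ennreal (norm (s n x - f x) powr p) \<partial>M) + 0) < e"
      by (auto simp: eventually_sequentially)
    have "((\<lambda>t. ?c * (2 * (\<integral>\<^sup>+x. ennreal (norm (s n x - f x) powr p) \<partial>M) + (\<integral>\<^sup>+x. ennreal (norm (s n (\<tau> t x) - s n x) powr p) \<partial>M)))
       \<longlongrightarrow> ?c * (2 * (\<integral>\<^sup>+x. ennreal (norm (s n x - f x) powr p) \<partial>M) + 0)) (at 0)"
      by (intro ennreal_tendsto_cmult tendsto_add simple tendsto_const) auto
    then have "\<forall>\<^sub>F t in at 0. ?c * (2 * (\<integral>\<^sup>+x. ennreal (norm (s n x - f x) powr p) \<partial>M) + (\<integral>\<^sup>+x. ennreal (norm (s n (\<tau> t x) - s n x) powr p) \<partial>M)) < e"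
      using n by (rule order_tendstoD(2))
    then show "\<forall>\<^sub>F t in at 0. (\<integral>\<^sup>+x. ennreal (norm (f (\<tau> t x) - f x) powr p) \<partial>M) < e"
      by eventually_elim (rule le_less_trans[OF split])
  qed auto
qed

lemma flow_isometric_group:
  assumes M: "prob_space M" and t: "\<And>t. \<tau> t \<in> measurable M M" "\<And>t. distr M M (\<tau> t) = M"
    and sym: "\<And>A. A \<in> sets M \<Longrightarrow> ((\<lambda>t. emeasure M {\<omega> \<in> space M. (\<tau> t \<omega> \<in> A) \<noteq> (\<omega> \<in> A)}) \<longlongrightarrow> 0) (at (0::real))"
    and p: "0 < p" and grp: "\<And>s t \<omega>. \<tau> (s + t) \<omega> = \<tau> s (\<tau> t \<omega>)" and zero: "AE \<omega> in M. \<tau> 0 \<omega> = \<omega>"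
  shows "isometric_C0_group M p (\<lambda>t (f :: 'w \<Rightarrow> 'a::complex_banach) \<omega>. f (\<tau> t \<omega>))"
  unfolding isometric_C0_group_def
proof (intro conjI allI ballI)
  fix t
  show "Lp_bounded_op M p (\<lambda>(f :: 'w \<Rightarrow> 'a) \<omega>. f (\<tau> t \<omega>))"
    unfolding Lp_bounded_op_def
  proof (intro conjI ballI impI allI exI[of _ 1])
    show "AE x in M. f (\<tau> t x) = g (\<tau> t x)" if "AE x in M. f x = g x" for f g :: "'w \<Rightarrow> 'a"
      by (rule AE_preserving[OF t that])
  qed (simp_all add: Lp_preserving[OF t])
  show "Lp_norm M p (\<lambda>\<omega>. f (\<tau> t \<omega>)) = Lp_norm M p f" if "f \<in> Lp M p" for f :: "'w \<Rightarrow> 'a"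
    by (rule Lp_preserving(2)[OF t that])
next
  fix f :: "'w \<Rightarrow> 'a" assume "f \<in> Lp M p"
  show "AE x in M. f (\<tau> 0 x) = f x" using zero by eventually_elim simp
  show "AE x in M. f (\<tau> (s + t) x) = f (\<tau> t (\<tau> s x))" for s t by (simp add: add.commute[of s] grp)
next
  fix f :: "'w \<Rightarrow> 'a" and t0 assume f: "f \<in> Lp M p"
  obtain f' where f': "SM M f'" "AE \<omega> in M. f \<omega> = f' \<omega>" "(\<integral>\<^sup>+x. ennreal (norm (f' x) powr p) \<partial>M) < \<infinity>"
    using f by (rule Lp_SM)
  have "((\<lambda>t. \<integral>\<^sup>+x. ennreal (norm (f' (\<tau> t x) - f' x) powr p) \<partial>M) \<longlongrightarrow> 0) (at 0)"
    by (rule flow_Lp_continuous_0[OF M t sym p f'(1,3)])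
  then have "((\<lambda>t. \<integral>\<^sup>+x. ennreal (norm (f' (\<tau> (t - t0) x) - f' x) powr p) \<partial>M) \<longlongrightarrow> 0) (at t0)"
    by (subst LIM_offset_zero_iff[of t0]) (simp_all add: at_infinity_def)
  then have "((\<lambda>t. enn2real (\<integral>\<^sup>+x. ennreal (norm (f' (\<tau> (t - t0) x) - f' x) powr p) \<partial>M)) \<longlongrightarrow> 0) (at t0)"
    by (intro tendsto_enn2real[where l = 0]) simp_all
  then have "((\<lambda>t. Lp_norm M p (\<lambda>x. f' (\<tau> (t - t0) x) - f' x)) \<longlongrightarrow> 0) (at t0)"
    unfolding Lp_norm_def by (intro tendsto_zero_powrI[where b = "1/p"]) (use p in auto)
  \<comment> \<open>Continuity at \<open>t0\<close> is continuity at 0 transported by the measure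
    preserving map \<open>\<tau> t0\<close>.\<close>
  moreover have "Lp_norm M p (\<lambda>x. f' (\<tau> (t - t0) x) - f' x) = Lp_norm M p (\<lambda>x. f (\<tau> t x) - f (\<tau> t0 x))" for t
  proof -
    have "Lp_norm M p (\<lambda>x. f (\<tau> t x) - f (\<tau> t0 x)) = Lp_norm M p (\<lambda>x. f' (\<tau> t x) - f' (\<tau> t0 x))"
    proof (rule Lp_norm_cong_AE)
      show "AE x in M. f (\<tau> t x) - f (\<tau> t0 x) = f' (\<tau> t x) - f' (\<tau> t0 x)"
        using AE_preserving[OF t f'(2), of t] AE_preserving[OF t f'(2), of t0] by eventually_elim simp
    qed
    also have "\<dots> = Lp_norm M p (\<lambda>x. f' (\<tau> (t - t0) (\<tau> t0 x)) - f' (\<tau> t0 x))" by (simp flip: grp)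
    also have "\<dots> = Lp_norm M p (\<lambda>x. f' (\<tau> (t - t0) x) - f' x)"
      unfolding Lp_norm_def
      by (subst nn_integral_preserving[OF t(1,2), of "\<lambda>x. ennreal (norm (f' (\<tau> (t - t0) x) - f' x) powr p)" t0])
        (rule measurable_norm_powr[OF SM_diff[OF SM_preserving[OF t(1) f'(1)] f'(1)]], simp)
    finally show ?thesis by simp
  qed
  ultimately show "((\<lambda>t. Lp_norm M p (\<lambda>x. f (\<tau> t x) - f (\<tau> t0 x))) \<longlongrightarrow> 0) (at t0)" by simp
qed

section \<open>Skew rotations of the infinite product of unit intervals\<close>

text \<open>Carried by the unit interval but living on the whole line, so that \<open>Om\<close> is
  a measure on all real sequences.\<close>

definition U01 :: "real measure" where "U01 = uniform_measure lborel {0..1}"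

definition Om :: "(nat \<Rightarrow> real) measure" where "Om = PiM UNIV (\<lambda>_. U01)"

lemma prob_space_U01: "prob_space U01"
  unfolding U01_def by (rule prob_space_uniform_measure) auto

lemma sets_U01 [measurable_cong]: "sets U01 = sets borel"
  by (simp add: U01_def)

lemma space_U01 [simp]: "space U01 = UNIV"
  by (simp add: U01_def)

lemma sets_Om [measurable_cong]: "sets Om = sets (PiM UNIV (\<lambda>_. borel))"
  unfolding Om_def by (intro sets_PiM_cong) (auto simp: sets_U01)

lemma space_Om [simp]: "space Om = UNIV"
  by (simp add: Om_def space_PiM)

interpretation U01: prob_space U01 by (rule prob_space_U01)

interpretation Om_prod: product_prob_space "\<lambda>_. U01" "UNIV :: nat set"
  by unfold_locales

interpretation Om: prob_space Om
  unfolding Om_def by (rule prob_space_PiM) (rule prob_space_U01)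

interpretation U01_Om: pair_sigma_finite U01 Om
  by unfold_locales

lemma nn_integral_U01:
  assumes "f \<in> borel_measurable borel"
  shows "(\<integral>\<^sup>+y. f y \<partial>U01) = (\<integral>\<^sup>+y. f y * indicator {0..<1} y \<partial>lborel)"
proof -
  have "(\<integral>\<^sup>+y. f y \<partial>U01) = (\<integral>\<^sup>+y. f y * indicator {0..1} y \<partial>lborel)"
    unfolding U01_def using assms by (subst nn_integral_uniform_measure) (auto simp: divide_ennreal_def)
  also have "\<dots> = (\<integral>\<^sup>+y. f y * indicator {0..<1} y \<partial>lborel)"
    by (intro nn_integral_cong_AE eventually_mono[OF AE_lborel_singleton[of 1]]) (auto split: split_indicator)
  finally show ?thesis .
qed

lemma measurable_frac [measurable]: "frac \<in> borel_measurable (borel :: real measure)"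
  unfolding frac_def by measurable

text \<open>By periodicity the shifted interval \<open>{c'..<1+c'}\<close> may be cut at 1 and its
  upper piece moved back by 1.\<close>

lemma U01_rotate:
  fixes h :: "real \<Rightarrow> ennreal"
  assumes h: "h \<in> borel_measurable borel"
  shows "(\<integral>\<^sup>+y. h (frac (y + c)) \<partial>U01) = (\<integral>\<^sup>+y. h y \<partial>U01)"
proof -
  define c' where "c' = frac c"
  have c': "0 \<le> c'" "c' < 1" by (auto simp: c'_def frac_ge_0 frac_lt_1)
  define G where "G = (\<lambda>y. h (frac y))"
  note [measurable] = h
  have [measurable]: "G \<in> borel_measurable borel" unfolding G_def by measurable
  have per: "G (1 + y) = G y" for y by (simp add: G_def frac_def)
  have Gc: "h (frac (y + c)) = G (c' + y)" for y
    unfolding G_def c'_def by (simp add: add.commute)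
  have "(\<integral>\<^sup>+y. h (frac (y + c)) \<partial>U01) = (\<integral>\<^sup>+y. G (c' + y) * indicator {0..<1} y \<partial>lborel)"
    unfolding Gc by (rule nn_integral_U01) measurable
  also have "\<dots> = (\<integral>\<^sup>+y. G (c' + 1 * y) * indicator {c'..<1+c'} (c' + 1 * y) \<partial>lborel)"
    by (intro nn_integral_cong) (auto split: split_indicator)
  also have "\<dots> = (\<integral>\<^sup>+y. G y * indicator {c'..<1+c'} y \<partial>lborel)"
    by (subst nn_integral_real_affine[where c = 1 and t = c']) auto
  also have "\<dots> = (\<integral>\<^sup>+y. G y * indicator {c'..<1} y + G y * indicator {1..<1+c'} y \<partial>lborel)"
    using c' by (intro nn_integral_cong) (auto split: split_indicator)
  also have "\<dots> = (\<integral>\<^sup>+y. G y * indicator {c'..<1} y \<partial>lborel) + (\<integral>\<^sup>+y. G y * indicator {1..<1+c'} y \<partial>lborel)"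
    by (rule nn_integral_add) auto
  also have "(\<integral>\<^sup>+y. G y * indicator {1..<1+c'} y \<partial>lborel) = (\<integral>\<^sup>+y. G (1 + 1 * y) * indicator {1..<1+c'} (1 + 1 * y) \<partial>lborel)"
    by (subst nn_integral_real_affine[where c = 1 and t = 1]) auto
  also have "\<dots> = (\<integral>\<^sup>+y. G y * indicator {0..<c'} y \<partial>lborel)"
    by (intro nn_integral_cong) (auto simp: per split: split_indicator)
  also have "(\<integral>\<^sup>+y. G y * indicator {c'..<1} y \<partial>lborel) + (\<integral>\<^sup>+y. G y * indicator {0..<c'} y \<partial>lborel)
     = (\<integral>\<^sup>+y. G y * indicator {c'..<1} y + G y * indicator {0..<c'} y \<partial>lborel)"
    by (rule nn_integral_add[symmetric]) auto
  also have "\<dots> = (\<integral>\<^sup>+y. h y * indicator {0..<1} y \<partial>lborel)"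
    using c' by (intro nn_integral_cong) (auto simp: G_def frac_eq[THEN iffD2] split: split_indicator)
  also have "\<dots> = (\<integral>\<^sup>+y. h y \<partial>U01)" by (rule nn_integral_U01[OF h, symmetric])
  finally show ?thesis .
qed

lemma measurable_Om_component [measurable]: "(\<lambda>w. w n) \<in> borel_measurable Om"
  by (simp add: measurable_cong_sets[OF sets_Om HOL.refl])

lemma measurable_into_Om:
  assumes "\<And>n. (\<lambda>w. f w n) \<in> borel_measurable N"
  shows "f \<in> measurable N Om"
  unfolding measurable_cong_sets[OF HOL.refl sets_Om]
  by (rule measurable_PiM_single'[where f = "\<lambda>n w. f w n"]) (use assms in auto)

lemma measurable_upd_pair: "(\<lambda>(y, w). w(n := y)) \<in> measurable (U01 \<Otimes>\<^sub>M Om) Om"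
proof (rule measurable_into_Om)
  fix m
  show "(\<lambda>x. (case x of (y, w) \<Rightarrow> w(n := y)) m) \<in> borel_measurable (U01 \<Otimes>\<^sub>M Om)"
    by (cases "m = n") (auto simp: case_prod_beta)
qed

lemma measurable_upd: "(\<lambda>y. w(n := y)) \<in> measurable borel Om"
proof (rule measurable_into_Om)
  show "(\<lambda>y. (w(n := y)) m) \<in> borel_measurable borel" for m by (cases "m = n") auto
qed

text \<open>Replacing one coordinate by an independent copy does not change the law;
  \<open>Om_nn_integral\<close> and \<open>Om_integral\<close> turn this into Fubini for a single
  coordinate.\<close>

lemma Om_resample: "distr (U01 \<Otimes>\<^sub>M Om) Om (\<lambda>(y, w). w(n := y)) = Om"
  using distr_pair_PiM_eq_PiM[of UNIV "\<lambda>_. U01" n] prob_space_U01 by (simp add: Om_def)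

lemma Om_nn_integral:
  assumes "h \<in> borel_measurable Om"
  shows "(\<integral>\<^sup>+w. h w \<partial>Om) = (\<integral>\<^sup>+w. \<integral>\<^sup>+y. h (w(n := y)) \<partial>U01 \<partial>Om)"
proof -
  have m: "(\<lambda>(y, w). h (w(n := y))) \<in> borel_measurable (U01 \<Otimes>\<^sub>M Om)"
    using measurable_compose[OF measurable_upd_pair assms] by (simp add: case_prod_beta)
  have "(\<integral>\<^sup>+w. h w \<partial>Om) = (\<integral>\<^sup>+w. h w \<partial>(distr (U01 \<Otimes>\<^sub>M Om) Om (\<lambda>(y, w). w(n := y))))"
    by (simp only: Om_resample)
  also have "\<dots> = (\<integral>\<^sup>+x. h (case x of (y, w) \<Rightarrow> w(n := y)) \<partial>(U01 \<Otimes>\<^sub>M Om))"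
    by (rule nn_integral_distr[OF measurable_upd_pair]) (simp add: assms)
  also have "\<dots> = (\<integral>\<^sup>+w. \<integral>\<^sup>+y. h (w(n := y)) \<partial>U01 \<partial>Om)"
    using U01_Om.nn_integral_snd[OF m] by (simp add: case_prod_unfold)
  finally show ?thesis .
qed

lemma Om_integral:
  fixes h :: "(nat \<Rightarrow> real) \<Rightarrow> complex"
  assumes h: "h \<in> borel_measurable Om" and b: "\<And>w. cmod (h w) \<le> b"
  shows "(\<integral>w. h w \<partial>Om) = (\<integral>w. \<integral>y. h (w(n := y)) \<partial>U01 \<partial>Om)"
proof -
  interpret UO: prob_space "U01 \<Otimes>\<^sub>M Om"
    by (rule prob_space_pair) (rule prob_space_U01, rule Om.prob_space_axioms)
  have m: "(\<lambda>(y, w). h (w(n := y))) \<in> borel_measurable (U01 \<Otimes>\<^sub>M Om)"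
    using measurable_compose[OF measurable_upd_pair h] by (simp add: case_prod_beta)
  have i: "integrable (U01 \<Otimes>\<^sub>M Om) (\<lambda>(y, w). h (w(n := y)))"
    by (rule UO.integrable_const_bound[OF _ m, of b]) (auto simp: b)
  have "(\<integral>w. h w \<partial>Om) = (\<integral>w. h w \<partial>(distr (U01 \<Otimes>\<^sub>M Om) Om (\<lambda>(y, w). w(n := y))))"
    by (simp only: Om_resample)
  also have "\<dots> = (\<integral>x. h (case x of (y, w) \<Rightarrow> w(n := y)) \<partial>(U01 \<Otimes>\<^sub>M Om))"
    by (rule integral_distr[OF measurable_upd_pair h])
  also have "\<dots> = (\<integral>w. \<integral>y. h (w(n := y)) \<partial>U01 \<partial>Om)"
    using U01_Om.integral_snd[OF i] by (simp add: case_prod_unfold)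
  finally show ?thesis .
qed

text \<open>A skew product: the coordinates in \<open>K\<close> rotate on the circle with speeds
  read off from coordinate \<open>s\<close>. For \<open>s\<close> outside \<open>K\<close> these
  speeds are constant along orbits, which gives the group law.\<close>

definition flow :: "nat \<Rightarrow> nat set \<Rightarrow> (nat \<Rightarrow> real \<Rightarrow> real) \<Rightarrow> real \<Rightarrow> (nat \<Rightarrow> real) \<Rightarrow> nat \<Rightarrow> real" where
  "flow s K c t w n = (if n \<in> K then frac (w n + t * c n (w s)) else w n)"

lemma flow_measurable:
  assumes c: "\<And>n. c n \<in> borel_measurable borel"
  shows "flow s K c t \<in> measurable Om Om"
proof (rule measurable_into_Om)
  fix n
  note [measurable] = c[of n]
  show "(\<lambda>w. flow s K c t w n) \<in> borel_measurable Om"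
    unfolding flow_def by (cases "n \<in> K") simp_all
qed

lemma flow_add: "s \<notin> K \<Longrightarrow> flow s K c (t + t') w = flow s K c t (flow s K c t' w)"
  by (auto simp: flow_def fun_eq_iff algebra_simps)

lemma flow_commute:
  assumes "s \<notin> K'" "s' \<notin> K" "K \<inter> K' = {}"
  shows "flow s K c t (flow s' K' c t' w) = flow s' K' c t' (flow s K c t w)"
  using assms by (auto simp: flow_def fun_eq_iff)

text \<open>Given all other coordinates, a moved coordinate undergoes a fixed rotation; the
  coordinates are peeled off one by one.\<close>

lemma flow_nn_integral:
  assumes c: "\<And>n. c n \<in> borel_measurable borel" and "finite K" "s \<notin> K" "h \<in> borel_measurable Om"
  shows "(\<integral>\<^sup>+w. h (flow s K c t w) \<partial>Om) = (\<integral>\<^sup>+w. h w \<partial>Om)"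
  using assms(2-4)
proof (induction K arbitrary: h)
  case empty
  have "flow s {} c t w = w" for w by (simp add: flow_def fun_eq_iff)
  then show ?case by simp
next
  case (insert n K)
  have eq: "flow s (insert n K) c t w = flow s K c t (flow s {n} c t w)" for w
    using insert.hyps insert.prems by (auto simp: flow_def fun_eq_iff)
  let ?h = "\<lambda>w. h (flow s K c t w)"
  have hm: "?h \<in> borel_measurable Om" by (rule measurable_compose[OF flow_measurable[OF c] insert.prems(2)])
  have "(\<integral>\<^sup>+w. ?h (flow s {n} c t w) \<partial>Om) = (\<integral>\<^sup>+w. \<integral>\<^sup>+y. ?h (flow s {n} c t (w(n := y))) \<partial>U01 \<partial>Om)"
    by (rule Om_nn_integral) (rule measurable_compose[OF flow_measurable[OF c] hm])
  also have "\<dots> = (\<integral>\<^sup>+w. \<integral>\<^sup>+y. ?h (w(n := frac (y + t * c n (w s)))) \<partial>U01 \<partial>Om)"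
  proof -
    have "flow s {n} c t (w(n := y)) = w(n := frac (y + t * c n (w s)))" for w y
      using insert.prems by (auto simp: flow_def fun_eq_iff)
    then show ?thesis by simp
  qed
  also have "\<dots> = (\<integral>\<^sup>+w. \<integral>\<^sup>+y. ?h (w(n := y)) \<partial>U01 \<partial>Om)"
    by (intro nn_integral_cong U01_rotate measurable_compose[OF measurable_upd hm])
  also have "\<dots> = (\<integral>\<^sup>+w. ?h w \<partial>Om)" by (rule Om_nn_integral[OF hm, symmetric])
  also have "\<dots> = (\<integral>\<^sup>+w. h w \<partial>Om)" using insert by auto
  finally show ?case by (simp only: eq)
qed

text \<open>A cylinder set sees finitely many coordinates \<open>J\<close>, so \<open>K\<close> may
  be cut down to \<open>K \<inter> J\<close>.\<close>

lemma flow_distr: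
  assumes c: "\<And>n. c n \<in> borel_measurable borel" and s: "s \<notin> K"
  shows "distr Om Om (flow s K c t) = Om"
proof -
  have "distr Om Om (flow s K c t) = PiM UNIV (\<lambda>_. U01)"
  proof (rule Om_prod.PiM_eq)
    fix J :: "nat set" and F :: "nat \<Rightarrow> real set"
    assume J: "finite J" "\<And>j. j \<in> J \<Longrightarrow> F j \<in> sets U01"
    define X where "X = prod_emb UNIV (\<lambda>_. U01) J (\<Pi>\<^sub>E j\<in>J. F j)"
    have X: "X = {w. \<forall>j\<in>J. w j \<in> F j}" by (auto simp: X_def prod_emb_def restrict_PiE_iff)
    have Xm: "X \<in> sets Om" unfolding X_def Om_def using J by (intro sets_PiM_I) auto
    have "emeasure (distr Om Om (flow s K c t)) X = (\<integral>\<^sup>+w. indicator X w \<partial>distr Om Om (flow s K c t))"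
      using Xm by simp
    also have "\<dots> = (\<integral>\<^sup>+w. indicator X (flow s K c t w) \<partial>Om)"
      by (rule nn_integral_distr[OF flow_measurable[OF c]]) (use Xm in simp)
    also have "\<dots> = (\<integral>\<^sup>+w. indicator X (flow s (K \<inter> J) c t w) \<partial>Om)"
      by (intro nn_integral_cong) (auto simp: X flow_def split: split_indicator)
    also have "\<dots> = (\<integral>\<^sup>+w. indicator X w \<partial>Om)"
      by (rule flow_nn_integral[OF c]) (use J s Xm in auto)
    also have "\<dots> = emeasure Om X" using Xm by simp
    also have "\<dots> = (\<Prod>j\<in>J. emeasure U01 (F j))"
      unfolding X_def Om_def using J by (intro Om_prod.emeasure_PiM_emb) auto
    finally show "emeasure (distr Om Om (flow s K c t)) (prod_emb UNIV (\<lambda>_. U01) J (\<Pi>\<^sub>E j\<in>J. F j)) = (\<Prod>j\<in>J. emeasure U01 (F j))"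
      by (simp add: X_def)
  qed (simp add: Om_def)
  then show ?thesis by (simp add: Om_def)
qed

lemma AE_Om_component: "AE y in U01. P y \<Longrightarrow> AE w in Om. P (w n)"
  unfolding Om_def by (rule Om_prod.AE_component) auto

lemma AE_U01:
  assumes "AE y in lborel. 0 \<le> y \<and> y \<le> 1 \<longrightarrow> P y" shows "AE y in U01. P y"
  unfolding U01_def by (rule AE_uniform_measureI) (use assms in auto)

text \<open>\<open>frac\<close> is the identity only on \<open>{0..<1}\<close>, so the claim holds
  almost everywhere and not everywhere.\<close>

lemma flow_zero: "AE w in Om. flow s K c 0 w = w"
proof -
  have "AE w in Om. 0 \<le> w n \<and> w n < 1" for n
  proof (rule AE_Om_component, rule AE_U01)
    show "AE y in lborel. 0 \<le> y \<and> y \<le> 1 \<longrightarrow> 0 \<le> y \<and> y < (1::real)"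
      using AE_lborel_singleton[of 1] by eventually_elim auto
  qed
  then have "AE w in Om. \<forall>n. 0 \<le> w n \<and> w n < 1" by (simp add: AE_all_countable)
  then show ?thesis by eventually_elim (auto simp: flow_def fun_eq_iff frac_eq)
qed

text \<open>Almost surely the coordinate differs from \<open>a\<close> and from the end points 0 and
  1; for small times it then neither wraps around nor crosses \<open>a\<close>.\<close>

lemma flow_continuous_halfspace:
  assumes c: "\<And>n. c n \<in> borel_measurable borel"
  shows "((\<lambda>t. emeasure Om {w. (flow s K c t w n \<le> a) \<noteq> (w n \<le> a)}) \<longlongrightarrow> 0) (at 0)"
proof (cases "n \<in> K")
  case False
  then show ?thesis by (simp add: flow_def)
next
  case True
  note [measurable] = c[of n]
  have m: "{w. (flow s K c t w n \<le> a) \<noteq> (w n \<le> a)} \<in> sets Om" for t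
  proof -
    have "{w \<in> space Om. (frac (w n + t * c n (w s)) \<le> a) \<noteq> (w n \<le> a)} \<in> sets Om" by measurable
    then show ?thesis using True by (simp add: flow_def)
  qed
  have ae: "AE w in Om. 0 < w n \<and> w n < 1 \<and> w n \<noteq> a"
  proof (rule AE_Om_component, rule AE_U01)
    show "AE y in lborel. 0 \<le> y \<and> y \<le> 1 \<longrightarrow> 0 < y \<and> y < (1::real) \<and> y \<noteq> a"
      using AE_lborel_singleton[of 1] AE_lborel_singleton[of 0] AE_lborel_singleton[of a] by eventually_elim auto
  qed
  show ?thesis
    unfolding tendsto_at_iff_sequentially comp_def
  proof (intro allI impI)
    fix X :: "nat \<Rightarrow> real" assume X: "X \<longlonglongrightarrow> 0"
    let ?A = "\<lambda>i. {w. (flow s K c (X i) w n \<le> a) \<noteq> (w n \<le> a)}"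
    have "(\<lambda>i. \<integral>\<^sup>+w. indicator (?A i) w \<partial>Om) \<longlonglongrightarrow> (\<integral>\<^sup>+w. 0 \<partial>Om)"
    proof (rule nn_integral_dominated_convergence[where w = "\<lambda>_. 1"])
      show "AE w in Om. (\<lambda>i. indicator (?A i) w :: ennreal) \<longlonglongrightarrow> 0"
        using ae
      proof eventually_elim
        case (elim w)
        have lim: "(\<lambda>i. w n + X i * c n (w s)) \<longlonglongrightarrow> w n + 0 * c n (w s)"
          by (intro tendsto_intros X)
        let ?U = "{0<..<1} \<inter> (if w n < a then {..<a} else {a<..})"
        have "open ?U" "w n + 0 * c n (w s) \<in> ?U" using elim by auto
        then have "\<forall>\<^sub>F i in sequentially. w n + X i * c n (w s) \<in> ?U" by (rule topological_tendstoD[OF lim])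
        then have "\<forall>\<^sub>F i in sequentially. indicator (?A i) w = (0 :: ennreal)"
        proof eventually_elim
          case (elim i)
          then have "frac (w n + X i * c n (w s)) = w n + X i * c n (w s)" by (auto simp: frac_eq)
          then show ?case using elim True \<open>0 < w n \<and> w n < 1 \<and> w n \<noteq> a\<close>
            by (auto simp: flow_def indicator_def split: if_splits)
        qed
        then show ?case by (rule tendsto_eventually)
      qed
      show "(\<lambda>w. indicator (?A i) w :: ennreal) \<in> borel_measurable Om" for i using m by simp
    qed (auto simp: Om.emeasure_space_1[unfolded space_Om] split: split_indicator)
    then show "(\<lambda>i. emeasure Om (?A i)) \<longlonglongrightarrow> 0" using m by simp
  qed
qed

text \<open>The sets moved continuously in measure at time 0. They form a sigma-algebra, which
  reduces strong continuity of the groups to half-lines in one coordinate.\<close>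

definition contset :: "(real \<Rightarrow> (nat \<Rightarrow> real) \<Rightarrow> nat \<Rightarrow> real) \<Rightarrow> (nat \<Rightarrow> real) set \<Rightarrow> bool" where
  "contset \<tau> A \<longleftrightarrow> A \<in> sets Om \<and> ((\<lambda>t. emeasure Om {w. (\<tau> t w \<in> A) \<noteq> (w \<in> A)}) \<longlongrightarrow> 0) (at 0)"

lemma contset_Compl: "contset \<tau> A \<Longrightarrow> contset \<tau> (UNIV - A)"
  using sets.compl_sets[of A Om] by (simp add: contset_def eq_commute)

text \<open>The tail of the union has small measure, and so has its preimage because the flow
  preserves the measure; hence the factor 2. Finitely many sets remain.\<close>

lemma contset_UN:
  assumes t: "\<And>t. \<tau> t \<in> measurable Om Om" "\<And>t. distr Om Om (\<tau> t) = Om" and A: "\<And>i::nat. contset \<tau> (A i)"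
  shows "contset \<tau> (\<Union>i. A i)"
proof -
  have Am: "A i \<in> sets Om" for i using A by (simp add: contset_def)
  let ?D = "\<lambda>A t. {w. (\<tau> t w \<in> A) \<noteq> (w \<in> A)}"
  have Dm: "?D B t \<in> sets Om" if "B \<in> sets Om" for B t
  proof -
    have "?D B t = {w \<in> space Om. (\<tau> t w \<in> B) \<noteq> (w \<in> B)}" by simp
    also have "\<dots> \<in> sets Om" using t(1)[of t] that by measurable
    finally show ?thesis .
  qed
  define tl where "tl = (\<lambda>N. (\<Union>i. A i) - (\<Union>i<N. A i))"
  have tlm: "tl N \<in> sets Om" for N unfolding tl_def using Am by auto
  have "(\<lambda>N. emeasure Om (tl N)) \<longlonglongrightarrow> emeasure Om (\<Inter>N. tl N)"
    using tlm by (intro Lim_emeasure_decseq) (auto simp: decseq_def tl_def)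
  also have "(\<Inter>N. tl N) = {}" by (auto simp: tl_def)
  finally have tl0: "(\<lambda>N. emeasure Om (tl N)) \<longlonglongrightarrow> 0" by simp
  have le: "emeasure Om (?D (\<Union>i. A i) t) \<le> (\<Sum>i<N. emeasure Om (?D (A i) t)) + 2 * emeasure Om (tl N)" for t N
  proof -
    have pre: "emeasure Om (\<tau> t -` tl N) = emeasure Om (tl N)"
      using emeasure_distr[OF t(1) tlm, of t N] t(2)[of t] by simp
    have prem: "\<tau> t -` tl N \<in> sets Om" using measurable_sets[OF t(1) tlm, of t N] by simp
    have "?D (\<Union>i. A i) t \<subseteq> (\<Union>i<N. ?D (A i) t) \<union> (tl N \<union> \<tau> t -` tl N)"
      by (auto simp: tl_def)
    then have "emeasure Om (?D (\<Union>i. A i) t) \<le> emeasure Om ((\<Union>i<N. ?D (A i) t) \<union> (tl N \<union> \<tau> t -` tl N))"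
      by (rule emeasure_mono) (use Dm[OF Am] tlm prem in auto)
    also have "\<dots> \<le> emeasure Om (\<Union>i<N. ?D (A i) t) + emeasure Om (tl N \<union> \<tau> t -` tl N)"
      by (rule emeasure_subadditive) (use Dm[OF Am] tlm prem in auto)
    also have "\<dots> \<le> (\<Sum>i<N. emeasure Om (?D (A i) t)) + (emeasure Om (tl N) + emeasure Om (\<tau> t -` tl N))"
      by (intro add_mono emeasure_subadditive emeasure_subadditive_finite) (use Dm[OF Am] tlm prem in auto)
    finally show ?thesis by (simp add: pre mult_2)
  qed
  have "((\<lambda>t. emeasure Om (?D (\<Union>i. A i) t)) \<longlongrightarrow> 0) (at 0)"
  proof (rule order_tendstoI)
    fix e :: ennreal assume e: "0 < e"
    have "(\<lambda>N. 0 + 2 * emeasure Om (tl N)) \<longlonglongrightarrow> 0 + 2 * 0"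
      by (intro tendsto_add tendsto_const ennreal_tendsto_cmult tl0) simp
    then have "\<forall>\<^sub>F N in sequentially. 0 + 2 * emeasure Om (tl N) < e"
      by (rule order_tendstoD(2)) (use e in simp)
    then obtain N where N: "0 + 2 * emeasure Om (tl N) < e" by (auto simp: eventually_sequentially)
    have "((\<lambda>t. (\<Sum>i<N. emeasure Om (?D (A i) t)) + 2 * emeasure Om (tl N)) \<longlongrightarrow> (\<Sum>i<N. 0) + 2 * emeasure Om (tl N)) (at 0)"
      by (intro tendsto_add tendsto_sum tendsto_const) (use A in \<open>simp add: contset_def\<close>)
    then have "\<forall>\<^sub>F t in at 0. (\<Sum>i<N. emeasure Om (?D (A i) t)) + 2 * emeasure Om (tl N) < e"
      by (rule order_tendstoD(2)) (use N in simp)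
    then show "\<forall>\<^sub>F t in at 0. emeasure Om (?D (\<Union>i. A i) t) < e"
      by eventually_elim (rule le_less_trans[OF le])
  qed simp
  then show ?thesis using Am by (auto simp: contset_def)
qed

text \<open>Half-lines generate the Borel sets of one coordinate, and the resulting cylinders
  generate the product sigma-algebra: two inductions over generated sigma-algebras.\<close>

lemma flow_contset:
  assumes c: "\<And>n. c n \<in> borel_measurable borel" and s: "s \<notin> K" and A: "A \<in> sets Om"
  shows "contset (flow s K c) A"
proof -
  let ?\<tau> = "flow s K c"
  have UN: "contset ?\<tau> (\<Union>i. A i)" if "\<And>i::nat. contset ?\<tau> (A i)" for A
    by (rule contset_UN[OF flow_measurable[OF c] flow_distr[OF c s] that])
  have empty: "contset ?\<tau> {}" by (simp add: contset_def)
  have cyl: "contset ?\<tau> {w. w n \<in> B}" if "B \<in> sets borel" for n B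
  proof -
    have "B \<in> sigma_sets UNIV (range (\<lambda>a::real. {..a}))"
      using that unfolding borel_eq_atMost by simp
    then show ?thesis
    proof induction
      case (Basic B)
      then obtain a where a: "B = {..a}" by blast
      have "{w \<in> space Om. w n \<le> a} \<in> sets Om" by measurable
      then show ?case using flow_continuous_halfspace[where c = c and s = s and K = K and n = n and a = a, OF c] by (simp add: contset_def a)
    next
      case Empty
      then show ?case using empty by simp
    next
      case (Compl B)
      have "{w. w n \<in> UNIV - B} = UNIV - {w. w n \<in> B}" by auto
      then show ?case using contset_Compl[OF Compl.IH] by simp
    next
      case (Union B)
      have "{w. w n \<in> (\<Union>i. B i)} = (\<Union>i. {w. w n \<in> B i})" by auto
      then show ?case using UN[OF Union.IH] by simp
    qed
  qed
  have "A \<in> sigma_sets UNIV {{f. f i \<in> B} | i B. B \<in> sets (borel :: real measure)}"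
    using A unfolding sets_Om sets_PiM_single by simp
  then show ?thesis
  proof induction
    case (Basic B)
    then show ?case using cyl by blast
  next
    case Empty
    then show ?case by (rule empty)
  next
    case (Compl B)
    then show ?case by (intro contset_Compl)
  next
    case (Union B)
    then show ?case by (intro UN)
  qed
qed

lemma flow_group:
  assumes c: "\<And>n. c n \<in> borel_measurable borel" and s: "s \<notin> K" and p: "0 < p"
  shows "isometric_C0_group Om p (\<lambda>t (f :: _ \<Rightarrow> 'a::complex_banach) w. f (flow s K c t w))"
  by (rule flow_isometric_group[OF Om.prob_space_axioms flow_measurable[OF c] flow_distr[OF c s] _ p])
    (use flow_contset[OF c s] flow_zero flow_add[OF s] in \<open>auto simp: contset_def\<close>)

section \<open>Random series\<close>

text \<open>\<open>Om\<close> lives on all real sequences, while the series bounds are assumed for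
  \<open>u\<close> in the unit interval. Clipping changes nothing almost everywhere and makes the
  bounds hold at every point.\<close>

definition clip :: "real \<Rightarrow> real" where "clip v = min 1 (max 0 v)"

lemma clip_range: "clip v \<in> {0..1}" "0 \<le> clip v" "clip v \<le> 1"
  by (auto simp: clip_def)

lemma clip_id: "v \<in> {0..1} \<Longrightarrow> clip v = v"
  by (auto simp: clip_def)

lemma continuous_on_clip:
  assumes "continuous_on {0..1} f" shows "continuous_on UNIV (\<lambda>v. f (clip v))"
  by (rule continuous_on_compose2[OF assms])
    (auto simp: clip_range clip_def intro!: continuous_intros continuous_on_min continuous_on_max)

definition ph :: "real \<Rightarrow> complex" where "ph y = cis (2 * pi * y)"

lemma norm_ph [simp]: "cmod (ph y) = 1"
  by (simp add: ph_def)

lemma ph_add: "ph (x + y) = ph x * ph y"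
  by (simp add: ph_def cis_mult algebra_simps)

lemma ph_diff: "ph (x - y) = cnj (ph y) * ph x"
  by (simp add: ph_def cis_mult cis_cnj algebra_simps)

lemma ph_frac: "ph (frac x) = ph x"
proof -
  have "cis (2 * pi * of_int \<lfloor>x\<rfloor>) = 1" by (intro cis_multiple_2pi) simp
  then have "ph (of_int \<lfloor>x\<rfloor>) = 1" by (simp add: ph_def)
  moreover have "ph x = ph (frac x + of_int \<lfloor>x\<rfloor>)" by (simp add: frac_def)
  ultimately show ?thesis by (simp add: ph_add)
qed

lemma ph_continuous: "continuous_on A ph"
  unfolding ph_def by (intro continuous_on_cis' continuous_intros)

lemma ph_measurable [measurable]: "ph \<in> borel_measurable borel"
  by (intro borel_measurable_continuous_onI ph_continuous)

lemma integral_U01: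
  fixes f :: "real \<Rightarrow> complex"
  assumes f: "continuous_on UNIV f"
  shows "(\<integral>y. f y \<partial>U01) = integral {0..1} f"
proof -
  have [measurable]: "f \<in> borel_measurable borel" by (intro borel_measurable_continuous_onI f)
  have "U01 = density lborel (\<lambda>y. ennreal (indicator {0..1} y))"
    unfolding U01_def uniform_measure_def by (intro density_cong) (auto simp: divide_ennreal_def split: split_indicator)
  then have "(\<integral>y. f y \<partial>U01) = (\<integral>y. f y \<partial>density lborel (\<lambda>y. ennreal (indicator {0..1} y)))" by (rule arg_cong)
  also have "\<dots> = set_lebesgue_integral lborel {0..1} f"
    unfolding set_lebesgue_integral_def by (rule integral_density) auto
  also have "\<dots> = integral {0..1} f"
    by (intro set_borel_integral_eq_integral(2) borel_integrable_atLeastAtMost' continuous_on_subset[OF f]) auto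
  finally show ?thesis .
qed

lemma integral_ph: "(\<integral>y. ph y \<partial>U01) = 0"
proof -
  have "((\<lambda>y. ph y / (2 * pi * \<i>)) has_vector_derivative ph y) (at y within {0..1})" for y
  proof -
    have "((cis \<circ> (\<lambda>y. 2 * pi * y)) has_vector_derivative (2 * pi) *\<^sub>R (\<i> * cis (2 * pi * y))) (at y within {0..1})"
      by (intro vector_diff_chain_within has_vector_derivative_cis) (auto intro!: derivative_eq_intros)
    from has_vector_derivative_mult_right[OF this, of "1 / (2 * pi * \<i>)"] show ?thesis
      by (simp add: ph_def comp_def scaleR_conv_of_real)
  qed
  then have "(ph has_integral ph 1 / (2 * pi * \<i>) - ph 0 / (2 * pi * \<i>)) {0..1}"
    by (intro fundamental_theorem_of_calculus) auto
  moreover have "ph 1 = ph 0" using ph_frac[of 1] by simp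
  ultimately have "integral {0..1} ph = 0" by (simp add: integral_unique)
  then show ?thesis using integral_U01[OF ph_continuous] by simp
qed

context dilatable
begin

text \<open>\<open>8 = 4 * 2\<close>, from \<open>cmod kc \<le> 4\<close> and
  \<open>\<bar>lam \<kappa> u\<bar> \<le> 2 * 2^k\<close>; the two powers of decay that
  \<open>g\<close> provides outweigh the factor \<open>lam\<close>.\<close>

lemma norm_Psi_g:
  assumes u: "u \<in> {0..1}"
  shows "norm (Psi \<kappa> u (g x)) \<le> (8 * (1 + M)^4 * norm x) * (1/2) ^ nat \<bar>snd \<kappa>\<bar>"
proof -
  let ?b = "(1 + M)^4 * norm x" and ?l = "lam \<kappa> u" and ?z = "2 * (\<i> * of_real (lam \<kappa> u)) :: complex"
    and ?v = "3 * (\<i> * of_real (lam \<kappa> u)) :: complex"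
  have l: "?l \<noteq> 0" and u0: "0 \<le> u" using lam_nz u by auto
  have b0: "0 \<le> ?b" using M by simp
  have "norm (K ?z ?v (g x)) \<le> ?b * min 1 (1 / ?l\<^sup>2)"
  proof -
    have "norm (K ?z ?v (g x)) \<le> ?b" using norm_K_g_zero[OF S_imag2[OF l]] .
    moreover have "norm (K ?z ?v (g x)) \<le> ?b / (cmod ?z * cmod ?v)"
      using norm_K_g_infty[OF S_imag2[OF l], of x] by simp
    moreover have "?b / (cmod ?z * cmod ?v) \<le> ?b / ?l\<^sup>2"
    proof -
      have "cmod ?z * cmod ?v = 6 * ?l\<^sup>2" by (simp add: norm_mult power2_eq_square abs_mult[symmetric])
      moreover have "0 < ?l\<^sup>2" using l by simp
      ultimately show ?thesis using b0 by (auto intro!: divide_left_mono)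
    qed
    ultimately show ?thesis by (auto simp: min_def)
  qed
  then have "norm (Psi \<kappa> u (g x)) \<le> 4 * (\<bar>?l\<bar> * (?b * min 1 (1 / ?l\<^sup>2)))"
    unfolding Psi_def K2_def norm_scaleC using norm_kc by (intro mult_mono) (auto intro: mult_left_mono)
  also have "\<dots> \<le> 4 * ((2 * 2 powi snd \<kappa>) * (?b * min 1 (1 / ?l\<^sup>2)))"
  proof -
    have "\<bar>?l\<bar> \<le> 2 powi snd \<kappa> * 2" unfolding lam_abs[OF u0] using u by (intro mult_left_mono) auto
    then show ?thesis using b0 by (intro mult_left_mono mult_right_mono) auto
  qed
  also have "\<dots> = (8 * ?b) * (2 powi snd \<kappa> * min 1 (1 / ?l\<^sup>2))" by (simp add: mult_ac)
  also have "\<dots> \<le> (8 * ?b) * (1/2) ^ nat \<bar>snd \<kappa>\<bar>"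
    using b0 by (intro mult_left_mono two_powi_bounds u0) auto
  finally show ?thesis by (simp add: mult.assoc)
qed

lemma Phi_Ker: "p \<in> Ker \<Longrightarrow> 0 \<le> u \<Longrightarrow> Phi \<kappa> u p = 0"
  using Ker_K[of p, OF _ S_imag(2,1)] lam_nz[of u \<kappa>] by (simp add: Phi_def K1_def)

lemma Psi_Ker: "p \<in> Ker \<Longrightarrow> 0 \<le> u \<Longrightarrow> Psi \<kappa> u p = 0"
  using Ker_K[of p, OF _ S_imag2] lam_nz[of u \<kappa>] by (simp add: Psi_def K2_def)

end

text \<open>\<open>SN\<close> and its limit \<open>SL\<close> below are \<open>P + \<Sum> \<zeta>\<^sub>\<kappa> \<Theta>\<^sub>\<kappa>(u)\<close>, where the
  coordinate \<open>s\<close> holds \<open>u\<close> and the coordinate \<open>a \<kappa>\<close> holds the phase of \<open>\<zeta>\<^sub>\<kappa>\<close>.\<close>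
locale random_series = dilatable +
  fixes \<Theta> :: "bool \<times> int \<Rightarrow> real \<Rightarrow> 'a \<Rightarrow> 'a" and e :: "real \<Rightarrow> complex" and s :: nat and a :: "bool \<times> int \<Rightarrow> nat"
  assumes Theta_sum: "finite F \<Longrightarrow> (\<And>\<kappa>. cmod (\<zeta> \<kappa>) \<le> 1) \<Longrightarrow> u \<in> {0..1} \<Longrightarrow> norm (\<Sum>\<kappa>\<in>F. \<zeta> \<kappa> *\<^sub>C \<Theta> \<kappa> u x) \<le> C * norm x"
    and commutes_Theta: "0 \<le> u \<Longrightarrow> commutes (\<Theta> \<kappa> u)"
    and commute_Theta: "commutes U \<Longrightarrow> 0 \<le> u \<Longrightarrow> U (\<Theta> \<kappa> u x) = \<Theta> \<kappa> u (U x)"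
    and Theta_cont: "continuous_on {0..1} (\<lambda>u. \<Theta> \<kappa> u x)"
    and Theta_g: "u \<in> {0..1} \<Longrightarrow> norm (\<Theta> \<kappa> u (g x)) \<le> (8 * (1 + M)^4 * norm x) * (1/2) ^ nat \<bar>snd \<kappa>\<bar>"
    and Theta_Ker: "p \<in> Ker \<Longrightarrow> 0 \<le> u \<Longrightarrow> \<Theta> \<kappa> u p = 0"
    and e_measurable: "e \<in> borel_measurable borel" and e_norm: "cmod (e y) = 1"
begin

definition SN :: "nat \<Rightarrow> (nat \<Rightarrow> real) \<Rightarrow> 'a \<Rightarrow> 'a" where
  "SN n w x = P x + (\<Sum>\<kappa>\<in>Fset n. e (w (a \<kappa>)) *\<^sub>C \<Theta> \<kappa> (clip (w s)) x)"

definition SL :: "(nat \<Rightarrow> real) \<Rightarrow> 'a \<Rightarrow> 'a" where "SL w x = lim (\<lambda>n. SN n w x)"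

lemma SN_commutes: "commutes (SN n w)"
proof -
  have "commutes (\<lambda>x. \<Sum>\<kappa>\<in>Fset n. e (w (a \<kappa>)) *\<^sub>C \<Theta> \<kappa> (clip (w s)) x)"
    by (rule commutes_sum, rule commutes_scaleC, rule commutes_Theta, rule clip_range)
  with P_commutes show ?thesis unfolding SN_def[abs_def] commutes_def
    by (auto intro: bounded_op_add simp: R_lin)
qed

lemmas SN_bop = commutesD(1)[OF SN_commutes]

lemma SN_norm: "norm (SN n w x) \<le> (M + C) * norm x"
proof -
  have "norm (\<Sum>\<kappa>\<in>Fset n. e (w (a \<kappa>)) *\<^sub>C \<Theta> \<kappa> (clip (w s)) x) \<le> C * norm x"
    by (rule Theta_sum[OF finite_Fset _ clip_range(1)]) (simp add: e_norm)
  from norm_triangle_mono[OF P_norm this] show ?thesis by (simp add: SN_def algebra_simps)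
qed

lemma SN_convergent: "convergent (\<lambda>n. SN n w (g x))"
proof -
  define I where "I = (\<lambda>\<kappa>. e (w (a \<kappa>)) *\<^sub>C \<Theta> \<kappa> (clip (w s)) (g x))"
  let ?c = "8 * (1 + M)^4 * norm x"
  have b: "norm (I \<kappa>) \<le> ?c * (1/2) ^ nat \<bar>snd \<kappa>\<bar>" for \<kappa>
    using Theta_g[OF clip_range(1), of \<kappa> "w s" x] by (simp add: I_def norm_scaleC e_norm)
  have "norm (SN (Suc n) w (g x) - SN n w (g x)) \<le> (4 * ?c) * (1/2)^n" for n
  proof -
    have "norm (SN (Suc n) w (g x) - SN n w (g x))
       = norm ((I (True, int n) + I (False, int n)) + (I (True, - int (Suc n)) + I (False, - int (Suc n))))"
      unfolding SN_def Fset_Suc_sum I_def by (simp add: UNIV_bool add_ac)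
    also have "\<dots> \<le> (norm (I (True, int n)) + norm (I (False, int n))) + (norm (I (True, - int (Suc n))) + norm (I (False, - int (Suc n))))"
      by (intro norm_triangle_mono order_refl norm_triangle_ineq)
    also have "\<dots> \<le> (?c * (1/2)^n + ?c * (1/2)^n) + (?c * (1/2)^n + ?c * (1/2)^n)"
    proof -
      have "nat \<bar>- int (Suc n)\<bar> = Suc n" by simp
      then have "(1/2::real)^(nat \<bar>- int (Suc n)\<bar>) \<le> (1/2)^n" by simp
      then have "norm (I (s, - int (Suc n))) \<le> ?c * (1/2)^n" for s
        using M by (intro order_trans[OF b]) (auto intro!: mult_left_mono)
      moreover have "norm (I (s, int n)) \<le> ?c * (1/2)^n" for s using b[of "(s, int n)"] by simp
      ultimately show ?thesis by (intro add_mono) auto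
    qed
    finally show ?thesis by (simp add: algebra_simps)
  qed
  from geometric_limit[OF this] show ?thesis unfolding convergent_def by blast
qed

text \<open>The series converges at every \<open>w\<close>, not just almost surely: the bound holds
  for each choice of phases, and on the range of \<open>g\<close> the terms decay
  geometrically.\<close>

lemma SN_lim: "(\<lambda>n. SN n w x) \<longlonglongrightarrow> SL w x" and SL_bop: "bounded_op (SL w)"
  and SL_norm: "norm (SL w x) \<le> (M + C) * norm x"
proof -
  have conv: "convergent (\<lambda>n. SN n w x)" if x: "x \<in> {p + g y | p y. p \<in> Ker}" for x
  proof -
    obtain p y where p: "x = p + g y" "p \<in> Ker" using x by auto
    have "SN n w p = p" for n
      using p(2) by (simp add: SN_def P_Ker Theta_Ker clip_range)
    then have "SN n w x = p + SN n w (g y)" for n by (simp add: p(1) bounded_opD[OF SN_bop])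
    then show ?thesis using convergent_add[OF convergent_const SN_convergent[of w y]] by simp
  qed
  note * = strong_limit[OF SN_bop SN_norm dense_g conv]
  show "(\<lambda>n. SN n w x) \<longlonglongrightarrow> SL w x" unfolding SL_def by (rule *(1))
  show "bounded_op (SL w)" unfolding SL_def[abs_def] by (rule *(2))
  show "norm (SL w x) \<le> (M + C) * norm x" unfolding SL_def by (rule *(3))
qed

lemma Theta_SM: "SM Om (\<lambda>w. \<Theta> \<kappa> (clip (w s)) x)"
  by (rule SM_continuous[OF continuous_on_clip[OF Theta_cont] SM_second_countable[OF measurable_Om_component]])

lemma e_component: "(\<lambda>w. e (w n)) \<in> borel_measurable Om"
  by (rule measurable_compose[OF measurable_Om_component e_measurable])

lemma SN_SM: "SM Om (\<lambda>w. SN n w x)"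
  unfolding SN_def by (intro SM_add SM_const SM_sum SM_scaleC Theta_SM e_component)

lemma SL_SM: "SM Om (\<lambda>w. SL w x)"
  by (rule SM_limit[OF SN_SM SN_lim])

lemma SL_cong: "(\<And>n. n \<in> insert s (range a) \<Longrightarrow> w n = w' n) \<Longrightarrow> SL w = SL w'"
  by (simp add: SL_def[abs_def] SN_def)

lemma SL_commute:
  assumes U: "commutes U"
  shows "U (SL w x) = SL w (U x)"
proof -
  note Ul = bounded_opD[OF commutesD(1)[OF U]]
  have "U (SN n w x) = SN n w (U x)" for n
    by (simp add: SN_def Ul commute_P[OF commutesD[OF U]] commute_Theta[OF U] clip_range)
  then have "(\<lambda>n. SN n w (U x)) \<longlonglongrightarrow> U (SL w x)"
    using bounded_linear.tendsto[OF Ul(3) SN_lim, of w x] by simp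
  then show ?thesis by (rule LIMSEQ_unique[OF _ SN_lim])
qed

end

text \<open>The circle coordinates have period 1, hence the division of the frequency by
  \<open>2 * pi\<close>.\<close>

locale dilation_block = dilatable +
  fixes s :: nat and a :: "bool \<times> int \<Rightarrow> nat" and c :: "nat \<Rightarrow> real \<Rightarrow> real"
  assumes inj_a: "inj a" and s_a: "s \<notin> range a"
    and c_measurable: "c n \<in> borel_measurable borel" and c_a: "c (a \<kappa>) v = lam \<kappa> (clip v) / (2 * pi)"
begin

sublocale J: random_series R \<theta>0 M C Phi ph s a
proof
  show "norm (Phi \<kappa> u (g x)) \<le> (8 * (1 + M)^4 * norm x) * (1/2) ^ nat \<bar>snd \<kappa>\<bar>" if "u \<in> {0..1}" for \<kappa> u x
  proof -
    let ?y = "(1 + M)^4 * (1/2) ^ nat \<bar>snd \<kappa>\<bar> * norm x"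
    have "norm (Phi \<kappa> u (g x)) \<le> ?y" using that by (intro norm_Phi_g) simp
    also have "\<dots> \<le> 8 * ?y" using M by simp
    finally show ?thesis by (simp add: mult_ac)
  qed
qed (auto intro: Phi_sum commutes_Phi commute_Phi Phi_cont[where f = "\<lambda>_. _"] Phi_Ker)

sublocale Q: random_series R \<theta>0 M C Psi "\<lambda>y. cnj (ph y)" s a
  by unfold_locales
    (auto intro: Psi_sum commutes_Psi commute_Psi Psi_cont[where f = "\<lambda>_. _"] norm_Psi_g Psi_Ker
      borel_measurable_continuous_onI continuous_on_cnj ph_continuous)

abbreviation "\<tau> \<equiv> flow s (range a) c"

lemma flow_s: "\<tau> t w s = w s"
  using s_a by (simp add: flow_def)

text \<open>\<open>ph\<close> has period 1, so the \<open>frac\<close> of the flow disappears and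
  the motion becomes multiplication by \<open>exp(i t lam)\<close>.\<close>

lemma ph_flow: "ph (\<tau> t w (a \<kappa>)) = ph (w (a \<kappa>)) * cis (t * lam \<kappa> (clip (w s)))"
  by (simp add: flow_def ph_frac ph_add c_a) (simp add: ph_def)

text \<open>The mixed terms with \<open>P\<close> vanish: \<open>Psi\<close> kills the kernel, and
  \<open>P\<close> commutes with \<open>Phi\<close>, which kills the kernel too.\<close>

lemma QN_JN:
  "Q.SN n w (J.SN n (\<tau> t w) y) = P y + (\<Sum>\<kappa>\<in>Fset n. \<Sum>\<kappa>'\<in>Fset n.
     ph (w (a \<kappa>') - w (a \<kappa>)) *\<^sub>C (cis (t * lam \<kappa>' (clip (w s))) *\<^sub>C Psi \<kappa> (clip (w s)) (Phi \<kappa>' (clip (w s)) y)))"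
proof -
  let ?u = "clip (w s)"
  have u: "0 \<le> ?u" by (rule clip_range)
  have PP: "P (Phi \<kappa> ?u y) = 0" for \<kappa>
    using commute_Phi[OF P_commutes u, of \<kappa> y] Phi_Ker[OF P_in_Ker u] by simp
  show ?thesis
    unfolding Q.SN_def J.SN_def flow_s ph_flow ph_diff
    by (simp add: bounded_opD[OF P_bop] Psi_lin u P_Ker P_in_Ker PP Psi_Ker cscale.sum_right mult_ac)
qed

end

text \<open>A random functional. In a product of blocks it will consist of the other blocks followed
  by a fixed functional, so the expectation lemmas ask that it not depend on the coordinates of the
  current block.\<close>

definition functional_field :: "((nat \<Rightarrow> real) \<Rightarrow> 'a::complex_banach \<Rightarrow> complex) \<Rightarrow> real \<Rightarrow> bool" where
  "functional_field L b \<longleftrightarrow> (\<forall>w. L w \<in> dual_space) \<and> (\<forall>w x. cmod (L w x) \<le> b * norm x) \<and> (\<forall>x. SM Om (\<lambda>w. L w x))"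

lemma functional_fieldD:
  assumes "functional_field L b"
  shows "L w \<in> dual_space" "cmod (L w x) \<le> b * norm x" "SM Om (\<lambda>w. L w x)"
  using assms by (auto simp: functional_field_def)

lemma functional_field_measurable:
  assumes L: "functional_field L b" and f: "SM Om f"
  shows "(\<lambda>w. L w (f w)) \<in> borel_measurable Om"
proof (rule SM_measurable, rule SM_compose[OF _ _ f])
  show "SM Om (\<lambda>w. L w d)" for d using functional_fieldD(3)[OF L] .
  show "continuous_on UNIV (L w)" for w
    by (rule linear_continuous_on) (rule dual_spaceD(3)[OF functional_fieldD(1)[OF L]])
qed

lemma functional_field_integrable:
  assumes L: "functional_field L b" and f: "SM Om f" and fb: "\<And>w. norm (f w) \<le> r" and b: "0 \<le> b"
  shows "integrable Om (\<lambda>w. L w (f w))" "cmod (L w (f w)) \<le> b * r"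
proof -
  show bd: "cmod (L w (f w)) \<le> b * r" for w
    using functional_fieldD(2)[OF L, of w "f w"] mult_left_mono[OF fb b] by (rule order_trans)
  show "integrable Om (\<lambda>w. L w (f w))"
    by (rule Om.integrable_const_bound[OF _ functional_field_measurable[OF L f]]) (use bd in auto)
qed

context dilation_block
begin

lemma PsiPhi_SM: "SM Om (\<lambda>w. cis (t * lam \<kappa>' (clip (w s))) *\<^sub>C Psi \<kappa> (clip (w s)) (Phi \<kappa>' (clip (w s)) y))"
proof -
  have "continuous_on {0..1} (\<lambda>u. cis (t * lam \<kappa>' u) *\<^sub>C Psi \<kappa> u (Phi \<kappa>' u y))"
    by (intro cscale.continuous_on continuous_on_cis' continuous_intros lam_cont Psi_cont Phi_cont) auto
  from SM_continuous[OF continuous_on_clip[OF this] SM_second_countable[OF measurable_Om_component]]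
  show ?thesis .
qed

lemma PsiPhi_norm:
  assumes u: "u \<in> {0..1}" shows "norm (cis r *\<^sub>C Psi \<kappa> u (Phi \<kappa>' u y)) \<le> C * (C * norm y)"
proof -
  have "norm (Phi \<kappa>' u y) \<le> C * norm y" using Phi_sum[of "{\<kappa>'}" "\<lambda>_. 1", OF _ _ u] by simp
  then have "C * norm (Phi \<kappa>' u y) \<le> C * (C * norm y)" using C by (rule mult_left_mono)
  moreover have "norm (Psi \<kappa> u (Phi \<kappa>' u y)) \<le> C * norm (Phi \<kappa>' u y)" using Psi_sum[of "{\<kappa>}" "\<lambda>_. 1", OF _ _ u] by simp
  ultimately show ?thesis by (simp add: norm_scaleC)
qed

text \<open>The phase at \<open>a \<kappa>'\<close> is integrated first: nothing else under the
  integral depends on that coordinate, and its mean is 0.\<close>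

lemma expectation_off_diagonal:
  assumes L: "functional_field L b" "0 \<le> b" and ind: "\<And>w n v. n \<in> insert s (range a) \<Longrightarrow> L (w(n := v)) = L w"
    and ne: "\<kappa> \<noteq> \<kappa>'"
  shows "(\<integral>w. L w (ph (w (a \<kappa>') - w (a \<kappa>)) *\<^sub>C (cis (t * lam \<kappa>' (clip (w s))) *\<^sub>C Psi \<kappa> (clip (w s)) (Phi \<kappa>' (clip (w s)) y))) \<partial>Om) = 0"
    (is "(\<integral>w. ?h w \<partial>Om) = 0")
proof -
  let ?z = "\<lambda>w. cis (t * lam \<kappa>' (clip (w s))) *\<^sub>C Psi \<kappa> (clip (w s)) (Phi \<kappa>' (clip (w s)) y)"
  have sm: "SM Om (\<lambda>w. ph (w (a \<kappa>') - w (a \<kappa>)) *\<^sub>C ?z w)"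
    by (intro SM_scaleC PsiPhi_SM) measurable
  have bd: "norm (ph (w (a \<kappa>') - w (a \<kappa>)) *\<^sub>C ?z w) \<le> C * (C * norm y)" for w
    using PsiPhi_norm[OF clip_range(1)] by (simp add: norm_scaleC norm_mult)
  have ne': "a \<kappa> \<noteq> a \<kappa>'" "s \<noteq> a \<kappa>'" using ne inj_a s_a by (auto dest: injD)
  have "(\<integral>w. ?h w \<partial>Om) = (\<integral>w. \<integral>v. ?h (w(a \<kappa>' := v)) \<partial>U01 \<partial>Om)"
    by (rule Om_integral[OF functional_field_measurable[OF L(1) sm] functional_field_integrable(2)[OF L(1) sm bd L(2)]])
  also have "\<dots> = (\<integral>w. \<integral>v. ph v * (cnj (ph (w (a \<kappa>))) * L w (?z w)) \<partial>U01 \<partial>Om)"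
    using ne' by (simp add: ind dual_spaceD(2)[OF functional_fieldD(1)[OF L(1)]] ph_diff mult_ac)
  also have "\<dots> = 0" by (simp add: integral_ph)
  finally show ?thesis .
qed

text \<open>The phases have cancelled, so within the block only coordinate \<open>s\<close> is left
  to integrate, and the functional passes through that integral.\<close>

lemma expectation_diagonal:
  assumes L: "functional_field L b" "0 \<le> b" and ind: "\<And>w n v. n \<in> insert s (range a) \<Longrightarrow> L (w(n := v)) = L w"
  shows "(\<integral>w. L w (cis (t * lam \<kappa> (clip (w s))) *\<^sub>C Psi \<kappa> (clip (w s)) (Phi \<kappa> (clip (w s)) y)) \<partial>Om)
    = (\<integral>w. L w (integral {0..1} (\<lambda>u. cis (t * lam \<kappa> u) *\<^sub>C Psi \<kappa> u (Phi \<kappa> u y))) \<partial>Om)"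
    (is "(\<integral>w. ?h w \<partial>Om) = _")
proof -
  let ?z = "\<lambda>u. cis (t * lam \<kappa> u) *\<^sub>C Psi \<kappa> u (Phi \<kappa> u y)"
  have c: "continuous_on {0..1} ?z" by (rule PsiPhi_cont)
  have "(\<integral>w. ?h w \<partial>Om) = (\<integral>w. \<integral>v. ?h (w(s := v)) \<partial>U01 \<partial>Om)"
    by (rule Om_integral[OF functional_field_measurable[OF L(1) PsiPhi_SM]
      functional_field_integrable(2)[OF L(1) PsiPhi_SM PsiPhi_norm[OF clip_range(1)] L(2)]])
  also have "\<dots> = (\<integral>w. \<integral>v. L w (?z (clip v)) \<partial>U01 \<partial>Om)"
    by (simp add: ind)
  also have "\<dots> = (\<integral>w. L w (integral {0..1} ?z) \<partial>Om)"
  proof (intro Bochner_Integration.integral_cong HOL.refl)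
    fix w
    have bl: "bounded_linear (L w)" by (rule dual_spaceD(3)[OF functional_fieldD(1)[OF L(1)]])
    have "continuous_on UNIV (\<lambda>v. L w (?z (clip v)))"
      by (rule bounded_linear.continuous_on[OF bl continuous_on_clip[OF c]])
    then have "(\<integral>v. L w (?z (clip v)) \<partial>U01) = integral {0..1} (\<lambda>v. L w (?z (clip v)))" by (rule integral_U01)
    also have "\<dots> = integral {0..1} (L w \<circ> ?z)" by (intro integral_cong) (simp add: clip_id)
    also have "\<dots> = L w (integral {0..1} ?z)"
      by (rule integral_linear[OF integrable_continuous_interval[OF c] bl])
    finally show "(\<integral>v. L w (?z (clip v)) \<partial>U01) = L w (integral {0..1} ?z)" .
  qed
  finally show ?thesis .
qed

lemma expectation_TN:
  assumes L: "functional_field L b" "0 \<le> b" and ind: "\<And>w n v. n \<in> insert s (range a) \<Longrightarrow> L (w(n := v)) = L w"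
  shows "(\<integral>w. L w (Q.SN n w (J.SN n (\<tau> t w) y)) \<partial>Om) = (\<integral>w. L w (P y + TN n t y) \<partial>Om)"
proof -
  note Ll = dual_spaceD[OF functional_fieldD(1)[OF L(1)]]
  let ?z = "\<lambda>\<kappa> \<kappa>' w. cis (t * lam \<kappa>' (clip (w s))) *\<^sub>C Psi \<kappa> (clip (w s)) (Phi \<kappa>' (clip (w s)) y)"
  let ?x = "\<lambda>\<kappa> \<kappa>' w. ph (w (a \<kappa>') - w (a \<kappa>)) *\<^sub>C ?z \<kappa> \<kappa>' w"
  let ?i = "\<lambda>\<kappa>. integral {0..1} (\<lambda>u. cis (t * lam \<kappa> u) *\<^sub>C Psi \<kappa> u (Phi \<kappa> u y))"
  have const: "integrable Om (\<lambda>w. L w x)" for x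
    by (rule functional_field_integrable(1)[OF L(1) SM_const _ L(2)]) (rule order_refl)
  have int: "integrable Om (\<lambda>w. L w (?x \<kappa> \<kappa>' w))" for \<kappa> \<kappa>'
  proof (rule functional_field_integrable(1)[OF L(1) _ _ L(2)])
    show "SM Om (?x \<kappa> \<kappa>')" by (intro SM_scaleC PsiPhi_SM) measurable
    show "norm (?x \<kappa> \<kappa>' w) \<le> C * (C * norm y)" for w
      using PsiPhi_norm[OF clip_range(1)] by (simp add: norm_scaleC norm_mult)
  qed
  have diag: "(\<integral>w. L w (?x \<kappa> \<kappa>' w) \<partial>Om) = (if \<kappa>' = \<kappa> then (\<integral>w. L w (?i \<kappa>) \<partial>Om) else 0)" for \<kappa> \<kappa>'
  proof (cases "\<kappa>' = \<kappa>")
    case True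
    have "ph 0 = 1" by (simp add: ph_def)
    then show ?thesis using True expectation_diagonal[OF L ind, of t \<kappa> y] by simp
  next
    case False
    then show ?thesis using expectation_off_diagonal[OF L ind, of \<kappa> \<kappa>' t y] by auto
  qed
  have "(\<integral>w. L w (Q.SN n w (J.SN n (\<tau> t w) y)) \<partial>Om)
    = (\<integral>w. L w (P y) + (\<Sum>\<kappa>\<in>Fset n. \<Sum>\<kappa>'\<in>Fset n. L w (?x \<kappa> \<kappa>' w)) \<partial>Om)"
    unfolding QN_JN by (simp only: Ll)
  also have "\<dots> = (\<integral>w. L w (P y) \<partial>Om) + (\<Sum>\<kappa>\<in>Fset n. \<Sum>\<kappa>'\<in>Fset n. (\<integral>w. L w (?x \<kappa> \<kappa>' w) \<partial>Om))"
  proof -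
    have int': "integrable Om (\<lambda>w. \<Sum>\<kappa>'\<in>Fset n. L w (?x \<kappa> \<kappa>' w))" for \<kappa>
      by (rule Bochner_Integration.integrable_sum) (rule int)
    have "(\<integral>w. (\<Sum>\<kappa>'\<in>Fset n. L w (?x \<kappa> \<kappa>' w)) \<partial>Om) = (\<Sum>\<kappa>'\<in>Fset n. (\<integral>w. L w (?x \<kappa> \<kappa>' w) \<partial>Om))" for \<kappa>
      by (rule Bochner_Integration.integral_sum) (rule int)
    moreover have "(\<integral>w. (\<Sum>\<kappa>\<in>Fset n. \<Sum>\<kappa>'\<in>Fset n. L w (?x \<kappa> \<kappa>' w)) \<partial>Om) = (\<Sum>\<kappa>\<in>Fset n. (\<integral>w. (\<Sum>\<kappa>'\<in>Fset n. L w (?x \<kappa> \<kappa>' w)) \<partial>Om))"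
      by (rule Bochner_Integration.integral_sum) (rule int')
    moreover have "integrable Om (\<lambda>w. \<Sum>\<kappa>\<in>Fset n. \<Sum>\<kappa>'\<in>Fset n. L w (?x \<kappa> \<kappa>' w))"
      by (rule Bochner_Integration.integrable_sum) (rule int')
    ultimately show ?thesis by (simp only: Bochner_Integration.integral_add[OF const])
  qed
  also have "\<dots> = (\<integral>w. L w (P y) \<partial>Om) + (\<Sum>\<kappa>\<in>Fset n. (\<integral>w. L w (?i \<kappa>) \<partial>Om))"
    unfolding diag by (simp add: finite_Fset)
  also have "\<dots> = (\<integral>w. L w (P y) + (\<Sum>\<kappa>\<in>Fset n. L w (?i \<kappa>)) \<partial>Om)"
    by (subst Bochner_Integration.integral_add) (simp_all add: const)
  also have "\<dots> = (\<integral>w. L w (P y + TN n t y) \<partial>Om)" unfolding TN_def by (simp only: Ll)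
  finally show ?thesis .
qed

text \<open>Dominated convergence in the truncation. Both series are cut at the same
  \<open>n\<close>; the uniform bound on \<open>Q.SN\<close> makes the product of the two strongly
  convergent sequences converge.\<close>

lemma expectation_T:
  assumes L: "functional_field L b" "0 \<le> b" and ind: "\<And>w n v. n \<in> insert s (range a) \<Longrightarrow> L (w(n := v)) = L w"
  shows "(\<integral>w. L w (Q.SL w (J.SL (\<tau> t w) y)) \<partial>Om) = (\<integral>w. L w (T t y) \<partial>Om)"
proof -
  note bl = dual_spaceD(3)[OF functional_fieldD(1)[OF L(1)]]
  have MC: "0 \<le> M + C" using M C by simp
  have "(\<lambda>n. Q.SN n w (J.SN n (\<tau> t w) y)) \<longlonglongrightarrow> Q.SL w (J.SL (\<tau> t w) y)" for w
  proof -
    let ?z = "J.SL (\<tau> t w) y"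
    have "(\<lambda>n. Q.SN n w (J.SN n (\<tau> t w) y - ?z)) \<longlonglongrightarrow> 0"
    proof (rule Lim_null_comparison)
      show "\<forall>\<^sub>F n in sequentially. norm (Q.SN n w (J.SN n (\<tau> t w) y - ?z)) \<le> (M + C) * norm (J.SN n (\<tau> t w) y - ?z)"
        by (intro always_eventually allI Q.SN_norm)
      show "(\<lambda>n. (M + C) * norm (J.SN n (\<tau> t w) y - ?z)) \<longlonglongrightarrow> 0"
        by (intro tendsto_mult_right_zero tendsto_norm_zero LIM_zero J.SN_lim)
    qed
    from tendsto_add[OF this Q.SN_lim[of w ?z]] show ?thesis
      by (simp add: bounded_opD[OF Q.SN_bop])
  qed
  then have lim: "(\<lambda>n. L w (Q.SN n w (J.SN n (\<tau> t w) y))) \<longlonglongrightarrow> L w (Q.SL w (J.SL (\<tau> t w) y))" for w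
    by (rule bounded_linear.tendsto[OF bl])
  have J\<tau>: "SM Om (\<lambda>w. J.SN n (\<tau> t w) y)" for n
    by (rule SM_preserving[OF flow_measurable[OF c_measurable] J.SN_SM])
  have sm: "SM Om (\<lambda>w. Q.SN n w (J.SN n (\<tau> t w) y))" for n
    by (rule SM_compose[OF Q.SN_SM linear_continuous_on[OF bounded_opD(3)[OF Q.SN_bop]] J\<tau>])
  have bd: "norm (Q.SN n w (J.SN n (\<tau> t w) y)) \<le> (M + C) * ((M + C) * norm y)" for n w
    by (rule order_trans[OF Q.SN_norm mult_left_mono[OF J.SN_norm MC]])
  have mT: "(\<lambda>w. L w (T t y)) \<in> borel_measurable Om" by (rule functional_field_measurable[OF L(1) SM_const])
  have "(\<lambda>n. \<integral>w. L w (Q.SN n w (J.SN n (\<tau> t w) y)) \<partial>Om) \<longlonglongrightarrow> (\<integral>w. L w (Q.SL w (J.SL (\<tau> t w) y)) \<partial>Om)"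
  proof (rule integral_dominated_convergence[where w = "\<lambda>_. b * ((M + C) * ((M + C) * norm y))"])
    show m: "(\<lambda>w. L w (Q.SN n w (J.SN n (\<tau> t w) y))) \<in> borel_measurable Om" for n
      by (rule functional_field_measurable[OF L(1) sm])
    show "(\<lambda>w. L w (Q.SL w (J.SL (\<tau> t w) y))) \<in> borel_measurable Om"
      by (rule borel_measurable_LIMSEQ_metric[OF m lim])
    show "AE w in Om. norm (L w (Q.SN n w (J.SN n (\<tau> t w) y))) \<le> b * ((M + C) * ((M + C) * norm y))" for n
      by (intro AE_I2 functional_field_integrable(2)[OF L(1) sm bd L(2)])
  qed (use lim in auto)
  moreover have "(\<lambda>n. \<integral>w. L w (P y + TN n t y) \<partial>Om) \<longlonglongrightarrow> (\<integral>w. L w (T t y) \<partial>Om)"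
  proof (rule integral_dominated_convergence[where w = "\<lambda>_. b * (M * norm y + C\<^sup>2 * norm y)"])
    show "(\<lambda>w. L w (P y + TN n t y)) \<in> borel_measurable Om" for n
      by (rule functional_field_measurable[OF L(1) SM_const])
    show "AE w in Om. norm (L w (P y + TN n t y)) \<le> b * (M * norm y + C\<^sup>2 * norm y)" for n
      by (intro AE_I2 order_trans[OF functional_fieldD(2)[OF L(1)]] mult_left_mono norm_triangle_mono P_norm TN_norm L(2))
    show "AE w in Om. (\<lambda>n. L w (P y + TN n t y)) \<longlonglongrightarrow> L w (T t y)"
      unfolding T_def by (intro AE_I2 bounded_linear.tendsto[OF bl] tendsto_add tendsto_const TN_lim)
  qed (use mT in auto)
  moreover have "(\<integral>w. L w (Q.SN n w (J.SN n (\<tau> t w) y)) \<partial>Om) = (\<integral>w. L w (P y + TN n t y) \<partial>Om)" for n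
    by (rule expectation_TN[OF L ind])
  ultimately show ?thesis by (simp only:) (rule LIMSEQ_unique)
qed

end

section \<open>Products of commuting blocks\<close>

lemma comp_chain_cong:
  "(\<And>k. k \<in> {1..n} \<Longrightarrow> F k = G k) \<Longrightarrow> comp_chain F n = comp_chain G n"
  by (induction n) auto

lemma comp_chain_bounded_op:
  "(\<And>k. k \<in> {1..n} \<Longrightarrow> bounded_op (F k)) \<Longrightarrow> bounded_op (comp_chain F n)"
proof (induction n)
  case (Suc n)
  have "bounded_op (comp_chain F n)" by (rule Suc.IH) (simp add: Suc.prems)
  moreover have "bounded_op (F (Suc n))" by (rule Suc.prems) simp
  ultimately show ?case using bounded_op_comp by (simp add: comp_def)
qed (simp add: bounded_op_id)

lemma comp_chain_norm:
  assumes "\<And>k x. k \<in> {1..n} \<Longrightarrow> norm (F k x) \<le> N k * norm x" "\<And>k. k \<in> {1..n} \<Longrightarrow> 0 \<le> N k"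
  shows "norm (comp_chain F n x) \<le> (\<Prod>k\<in>{1..n}. N k) * norm x"
  using assms
proof (induction n arbitrary: x)
  case (Suc n)
  have "norm (comp_chain F n (F (Suc n) x)) \<le> (\<Prod>k\<in>{1..n}. N k) * norm (F (Suc n) x)"
    by (rule Suc.IH) (simp_all add: Suc.prems)
  also have "\<dots> \<le> (\<Prod>k\<in>{1..n}. N k) * (N (Suc n) * norm x)"
    using Suc.prems by (intro mult_left_mono prod_nonneg) auto
  finally show ?case by (simp add: mult_ac)
qed simp

lemma comp_chain_commute:
  "(\<And>k x. k \<in> {1..n} \<Longrightarrow> U (F k x) = F k (U x)) \<Longrightarrow> U (comp_chain F n x) = comp_chain F n (U x)"
  by (induction n arbitrary: x) auto

lemma comp_chain_SM:
  fixes F :: "nat \<Rightarrow> 'w \<Rightarrow> 'a::complex_banach \<Rightarrow> 'a"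
  assumes "\<And>k x. k \<in> {1..n} \<Longrightarrow> SM M (\<lambda>w. F k w x)" "\<And>k w. k \<in> {1..n} \<Longrightarrow> bounded_op (F k w)" "SM M f"
  shows "SM M (\<lambda>w. comp_chain (\<lambda>k. F k w) n (f w))"
  using assms
proof (induction n arbitrary: f)
  case (Suc n)
  have "SM M (\<lambda>w. F (Suc n) w (f w))"
    by (rule SM_compose[OF Suc.prems(1) linear_continuous_on[OF bounded_opD(3)[OF Suc.prems(2)]] Suc.prems(3)]) auto
  then have "SM M (\<lambda>w. comp_chain (\<lambda>k. F k w) n (F (Suc n) w (f w)))"
    by (intro Suc.IH) (simp_all add: Suc.prems)
  then show ?case by simp
qed simp

lemma powr_le_one_plus:
  assumes "0 \<le> (x::real)" "1 \<le> p" shows "x \<le> 1 + x powr p"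
proof (cases "x \<le> 1")
  case False
  then have "x powr 1 \<le> x powr p" using assms by (intro powr_mono) auto
  then show ?thesis using False by simp
qed (simp add: add_increasing2)

text \<open>Instead of Hoelder's inequality, \<open>x \<le> r (1 + (x / r)^p)\<close> is integrated
  with \<open>r\<close> slightly above the norm, which gives the constant 2.\<close>

lemma Lp_integrable:
  fixes f :: "(nat \<Rightarrow> real) \<Rightarrow> 'a::real_normed_vector"
  assumes f: "SM Om f" and fin: "(\<integral>\<^sup>+w. ennreal (norm (f w) powr p) \<partial>Om) < \<infinity>" and p: "1 < p"
  shows "integrable Om (\<lambda>w. norm (f w))" "(\<integral>w. norm (f w) \<partial>Om) \<le> 2 * Lp_norm Om p f"
proof -
  have [measurable]: "(\<lambda>w. norm (f w)) \<in> borel_measurable Om"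
    by (rule SM_measurable[OF SM_continuous[OF _ f]]) (intro continuous_intros)
  have ip: "integrable Om (\<lambda>w. norm (f w) powr p)"
    by (rule integrableI_bounded) (use fin in auto)
  have bd: "norm (f w) \<le> r * (1 + norm (f w) powr p / r powr p)" if "0 < r" for r w
  proof -
    have "norm (f w) / r \<le> 1 + (norm (f w) / r) powr p"
      using that p by (intro powr_le_one_plus) auto
    then show ?thesis using that by (simp add: powr_divide field_simps)
  qed
  show int: "integrable Om (\<lambda>w. norm (f w))"
    by (rule Bochner_Integration.integrable_bound[of _ "\<lambda>w. 1 * (1 + norm (f w) powr p / 1 powr p)"])
      (use bd[of 1] ip in auto)
  define I where "I = (\<integral>w. norm (f w) powr p \<partial>Om)"
  have I0: "0 \<le> I" by (simp add: I_def)
  have "(\<integral>\<^sup>+w. ennreal (norm (f w) powr p) \<partial>Om) = ennreal I"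
    unfolding I_def by (rule nn_integral_eq_integral[OF ip]) simp
  then have N: "Lp_norm Om p f = I powr (1/p)" using I0 by (simp add: Lp_norm_def)
  show "(\<integral>w. norm (f w) \<partial>Om) \<le> 2 * Lp_norm Om p f"
  \<comment> \<open>Taking \<open>y / 2\<close> strictly above the norm avoids division by 0 when
    the norm vanishes.\<close>
  proof (rule dense_ge)
    fix y assume "2 * Lp_norm Om p f < y"
    then have r: "I powr (1/p) < y / 2" by (simp add: N)
    then have r0: "0 < y / 2" by (rule le_less_trans[rotated]) simp
    have "I = (I powr (1/p)) powr p" using I0 p by (simp add: powr_powr)
    also have "\<dots> \<le> (y/2) powr p" using r p by (intro powr_mono2) auto
    finally have I: "I / (y/2) powr p \<le> 1" using r0 by (simp add: divide_le_eq)
    have "(\<integral>w. norm (f w) \<partial>Om) \<le> (\<integral>w. y/2 * (1 + norm (f w) powr p / (y/2) powr p) \<partial>Om)"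
      by (intro integral_mono int Bochner_Integration.integrable_mult_right Bochner_Integration.integrable_add
        Bochner_Integration.integrable_divide ip bd r0) simp
    also have "\<dots> = y/2 * (1 + I / (y/2) powr p)"
      using ip by (simp add: I_def Om.prob_space[unfolded space_Om])
    also have "\<dots> \<le> y/2 * 2" using I r0 by (intro mult_left_mono) auto
    finally show "(\<integral>w. norm (f w) \<partial>Om) \<le> y" by simp
  qed
qed

lemma bounded_SM_Lp:
  fixes f :: "(nat \<Rightarrow> real) \<Rightarrow> 'a::real_normed_vector"
  assumes f: "SM Om f" and b: "\<And>w. norm (f w) \<le> b" and p: "0 < p"
  shows "f \<in> Lp Om p" "Lp_norm Om p f \<le> b"
proof -
  have b0: "0 \<le> b" using b norm_ge_zero order_trans by blast
  have "(\<integral>\<^sup>+w. ennreal (norm (f w) powr p) \<partial>Om) \<le> (\<integral>\<^sup>+w. ennreal (b powr p) \<partial>Om)"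
    using b p by (intro nn_integral_mono ennreal_leI powr_mono2) auto
  also have "\<dots> = ennreal (b powr p)" by (simp add: Om.emeasure_space_1[unfolded space_Om])
  finally have le: "(\<integral>\<^sup>+w. ennreal (norm (f w) powr p) \<partial>Om) \<le> ennreal (b powr p)" .
  show "f \<in> Lp Om p" unfolding Lp_def
    using SM_strongly_measurable[OF f] le by (auto intro: le_less_trans)
  have "enn2real (\<integral>\<^sup>+w. ennreal (norm (f w) powr p) \<partial>Om) \<le> b powr p"
    using enn2real_mono[OF le] by simp
  then have "Lp_norm Om p f \<le> (b powr p) powr (1/p)"
    unfolding Lp_norm_def using p by (intro powr_mono2) auto
  then show "Lp_norm Om p f \<le> b" using b0 p by (simp add: powr_powr)
qed

lemma Lp_add_scaleC:
  fixes f g :: "(nat \<Rightarrow> real) \<Rightarrow> 'a::complex_banach"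
  assumes "f \<in> Lp Om p" "g \<in> Lp Om p" and p: "0 < p"
  shows "(\<lambda>w. f w + c *\<^sub>C g w) \<in> Lp Om p"
proof -
  obtain f' where f': "SM Om f'" "AE w in Om. f w = f' w" "(\<integral>\<^sup>+x. ennreal (norm (f' x) powr p) \<partial>Om) < \<infinity>"
    using assms(1) by (rule Lp_SM)
  obtain g' where g': "SM Om g'" "AE w in Om. g w = g' w" "(\<integral>\<^sup>+x. ennreal (norm (g' x) powr p) \<partial>Om) < \<infinity>"
    using assms(2) by (rule Lp_SM)
  let ?h = "\<lambda>w. f' w + c *\<^sub>C g' w"
  have sm: "SM Om ?h" by (intro SM_add SM_scaleC f' g') simp
  have ae: "AE w in Om. f w + c *\<^sub>C g w = ?h w" using f'(2) g'(2) by eventually_elim simp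
  obtain s where s: "\<And>n::nat. finite (s n ` space Om) \<and> (\<forall>y. s n -` {y} \<inter> space Om \<in> sets Om)"
    "AE w in Om. (\<lambda>n. s n w) \<longlonglongrightarrow> ?h w"
    using SM_strongly_measurable[OF sm] unfolding strongly_measurable_def by blast
  have "AE w in Om. (\<lambda>n. s n w) \<longlonglongrightarrow> f w + c *\<^sub>C g w" using s(2) ae by eventually_elim simp
  then have "strongly_measurable Om (\<lambda>w. f w + c *\<^sub>C g w)"
    unfolding strongly_measurable_def using s(1) by blast
  moreover have "(\<integral>\<^sup>+w. ennreal (norm (f w + c *\<^sub>C g w) powr p) \<partial>Om) < \<infinity>"
  proof -
    let ?a = "ennreal (3 powr p)" and ?c = "ennreal (cmod c powr p)"
    have "(\<integral>\<^sup>+w. ennreal (norm (f w + c *\<^sub>C g w) powr p) \<partial>Om) = (\<integral>\<^sup>+w. ennreal (norm (?h w) powr p) \<partial>Om)"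
      by (rule nn_integral_cong_AE) (use ae in \<open>eventually_elim, simp\<close>)
    also have "\<dots> \<le> (\<integral>\<^sup>+w. ?a * (ennreal (norm (f' w) powr p) + ?c * ennreal (norm (g' w) powr p)) \<partial>Om)"
    proof (rule nn_integral_mono)
      fix w
      have "norm (?h w) powr p \<le> (norm (f' w) + cmod c * norm (g' w) + 0) powr p"
        using p norm_triangle_ineq[of "f' w" "c *\<^sub>C g' w"] by (intro powr_mono2) (auto simp: norm_scaleC)
      also have "\<dots> \<le> 3 powr p * (norm (f' w) powr p + (cmod c * norm (g' w)) powr p + 0 powr p)"
        using p by (intro powr_add3) auto
      also have "\<dots> = 3 powr p * (norm (f' w) powr p + cmod c powr p * norm (g' w) powr p)"
        by (simp add: powr_mult)
      finally show "ennreal (norm (?h w) powr p) \<le> ?a * (ennreal (norm (f' w) powr p) + ?c * ennreal (norm (g' w) powr p))"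
        by (simp add: ennreal_leI flip: ennreal_mult ennreal_plus)
    qed
    also have "\<dots> = ?a * ((\<integral>\<^sup>+w. ennreal (norm (f' w) powr p) \<partial>Om) + ?c * (\<integral>\<^sup>+w. ennreal (norm (g' w) powr p) \<partial>Om))"
      using measurable_norm_powr[OF f'(1)] measurable_norm_powr[OF g'(1)]
      by (simp add: nn_integral_cmult nn_integral_add)
    also have "\<dots> < \<infinity>" using f'(3) g'(3) by (simp add: ennreal_mult_less_top)
    finally show ?thesis .
  qed
  ultimately show ?thesis by (simp add: Lp_def)
qed

text \<open>What the product argument uses of each block: bounds, measurability, dependence on its
  own coordinates only, commutation of \<open>q\<close> with the \<open>j\<close> of the other
  blocks, and the one-operator formula tested against any functional independent of the
  block.\<close>

locale commuting_blocks =
  fixes d :: nat and p :: real and j q :: "nat \<Rightarrow> (nat \<Rightarrow> real) \<Rightarrow> 'a::complex_banach \<Rightarrow> 'a" and N :: "nat \<Rightarrow> real"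
    and B :: "nat \<Rightarrow> nat set" and \<tau> :: "nat \<Rightarrow> real \<Rightarrow> (nat \<Rightarrow> real) \<Rightarrow> nat \<Rightarrow> real" and T :: "nat \<Rightarrow> real \<Rightarrow> 'a \<Rightarrow> 'a"
  assumes refl: "reflexive_space TYPE('a)" and p: "1 < p"
    and bop: "k \<in> {1..d} \<Longrightarrow> bounded_op (j k w)" "k \<in> {1..d} \<Longrightarrow> bounded_op (q k w)"
    and bd: "k \<in> {1..d} \<Longrightarrow> norm (j k w x) \<le> N k * norm x" "k \<in> {1..d} \<Longrightarrow> norm (q k w x) \<le> N k * norm x"
    and N0: "k \<in> {1..d} \<Longrightarrow> 0 \<le> N k"
    and jq_SM: "k \<in> {1..d} \<Longrightarrow> SM Om (\<lambda>w. j k w x)" "k \<in> {1..d} \<Longrightarrow> SM Om (\<lambda>w. q k w x)"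
    and block: "k \<in> {1..d} \<Longrightarrow> (\<And>n. n \<in> B k \<Longrightarrow> w n = w' n) \<Longrightarrow> j k w = j k w'"
      "k \<in> {1..d} \<Longrightarrow> (\<And>n. n \<in> B k \<Longrightarrow> w n = w' n) \<Longrightarrow> q k w = q k w'"
    and disj: "k \<noteq> l \<Longrightarrow> B k \<inter> B l = {}"
    and comm: "k \<in> {1..d} \<Longrightarrow> l \<in> {1..d} \<Longrightarrow> k \<noteq> l \<Longrightarrow> q k w (j l w' x) = j l w' (q k w x)"
    and \<tau>_measurable: "\<tau> k t \<in> measurable Om Om"
    and \<tau>_outside: "n \<notin> B k \<Longrightarrow> \<tau> k t w n = w n"
    and \<tau>_block: "(\<And>n. n \<in> B k \<Longrightarrow> w n = w' n) \<Longrightarrow> n \<in> B k \<Longrightarrow> \<tau> k t w n = \<tau> k t w' n"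
    and expectation_T: "k \<in> {1..d} \<Longrightarrow> functional_field L b \<Longrightarrow> 0 \<le> b \<Longrightarrow> (\<And>w n v. n \<in> B k \<Longrightarrow> L (w(n := v)) = L w) \<Longrightarrow> 0 \<le> r \<Longrightarrow>
       (\<integral>w. L w (q k w (j k (\<tau> k r w) y)) \<partial>Om) = (\<integral>w. L w (T k r y) \<partial>Om)"
begin

definition "NN = (\<Prod>k\<in>{1..d}. N k)"
definition JJ :: "'a \<Rightarrow> (nat \<Rightarrow> real) \<Rightarrow> 'a" where "JJ x w = comp_chain (\<lambda>k. j k w) d x"
definition QQ :: "(nat \<Rightarrow> real) \<Rightarrow> 'a \<Rightarrow> 'a" where "QQ w = comp_chain (\<lambda>k. q k w) d"

lemma NN0: "0 \<le> NN"
  unfolding NN_def by (intro prod_nonneg) (auto simp: N0)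

lemma JJ_norm: "norm (JJ x w) \<le> NN * norm x"
  unfolding JJ_def NN_def by (intro comp_chain_norm bd N0)

lemma QQ_norm: "norm (QQ w x) \<le> NN * norm x"
  unfolding QQ_def NN_def by (intro comp_chain_norm bd N0)

lemma QQ_bop: "bounded_op (QQ w)"
  unfolding QQ_def by (intro comp_chain_bounded_op bop)

lemma JJ_SM: "SM Om (JJ x)"
  unfolding JJ_def[abs_def] by (intro comp_chain_SM jq_SM bop SM_const)

lemma QQ_SM: "SM Om f \<Longrightarrow> SM Om (\<lambda>w. QQ w (f w))"
  unfolding QQ_def by (intro comp_chain_SM jq_SM bop)

lemma J_bounded_into_Lp: "bounded_into_Lp Om p JJ"
  unfolding bounded_into_Lp_def
proof (intro conjI allI exI[of _ NN])
  fix x y :: 'a and c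
  show "JJ x \<in> Lp Om p" "Lp_norm Om p (JJ x) \<le> NN * norm x"
    using bounded_SM_Lp[OF JJ_SM JJ_norm] p by auto
  have "bounded_op (comp_chain (\<lambda>k. j k w) d)" for w by (intro comp_chain_bounded_op bop)
  then show "AE w in Om. JJ (x + c *\<^sub>C y) w = JJ x w + c *\<^sub>C JJ y w"
    by (simp add: JJ_def bounded_opD)
qed

text \<open>An everywhere measurable representative; for an arbitrary member of the class
  \<open>QQ w (f w)\<close> need not be measurable.\<close>

definition Sm :: "((nat \<Rightarrow> real) \<Rightarrow> 'a) \<Rightarrow> (nat \<Rightarrow> real) \<Rightarrow> 'a" where
  "Sm f = (SOME f'. SM Om f' \<and> (AE w in Om. f w = f' w))"

text \<open>The weak integral of \<open>QQ w (f w)\<close>; it exists by reflexivity.\<close>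
definition Qop :: "((nat \<Rightarrow> real) \<Rightarrow> 'a) \<Rightarrow> 'a" where
  "Qop f = (SOME x. \<forall>\<phi>\<in>dual_space. \<phi> x = (\<integral>w. \<phi> (QQ w (Sm f w)) \<partial>Om))"

lemma weak_integrable:
  assumes f: "SM Om f" and int: "integrable Om (\<lambda>w. norm (f w))" and phi: "\<phi> \<in> dual_space"
  shows "integrable Om (\<lambda>w. \<phi> (QQ w (f w)))"
    "cmod (\<integral>w. \<phi> (QQ w (f w)) \<partial>Om) \<le> dual_norm \<phi> * (NN * (\<integral>w. norm (f w) \<partial>Om))"
proof -
  \<comment> \<open>A negative value would force the space to be zero, where the supremum is over
    zeros only.\<close>
  have n0: "0 \<le> dual_norm \<phi>"
  proof (rule ccontr)
    assume neg: "\<not> 0 \<le> dual_norm \<phi>"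
    have "x = 0" for x :: 'a
    proof (rule ccontr)
      assume "x \<noteq> 0"
      then have "dual_norm \<phi> * norm x < 0" using neg by (intro mult_neg_pos) auto
      then show False using dual_norm_bound[OF phi, of x] norm_ge_zero[of "\<phi> x"] by linarith
    qed
    then have "dual_norm \<phi> = (SUP x\<in>{x::'a. norm x \<le> 1}. 0)"
      unfolding dual_norm_def using dual_spaceD(4)[OF phi] by (metis norm_zero)
    moreover have "{x::'a. norm x \<le> 1} \<noteq> {}" by (auto intro: exI[of _ 0])
    ultimately show False using neg by simp
  qed
  have m: "(\<lambda>w. \<phi> (QQ w (f w))) \<in> borel_measurable Om"
    by (rule SM_measurable[OF SM_continuous[OF linear_continuous_on[OF dual_spaceD(3)[OF phi]] QQ_SM[OF f]]])
  have le: "cmod (\<phi> (QQ w (f w))) \<le> dual_norm \<phi> * (NN * norm (f w))" for w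
    using dual_norm_bound[OF phi, of "QQ w (f w)"] mult_left_mono[OF QQ_norm n0] by (rule order_trans)
  have int': "integrable Om (\<lambda>w. dual_norm \<phi> * (NN * norm (f w)))" using int by simp
  show i: "integrable Om (\<lambda>w. \<phi> (QQ w (f w)))"
    by (rule Bochner_Integration.integrable_bound[OF int' m]) (auto intro!: AE_I2 order_trans[OF le] abs_ge_self)
  have "cmod (\<integral>w. \<phi> (QQ w (f w)) \<partial>Om) \<le> (\<integral>w. cmod (\<phi> (QQ w (f w))) \<partial>Om)" by (rule integral_norm_bound)
  also have "\<dots> \<le> (\<integral>w. dual_norm \<phi> * (NN * norm (f w)) \<partial>Om)"
    by (intro integral_mono int' le integrable_norm i)
  finally show "cmod (\<integral>w. \<phi> (QQ w (f w)) \<partial>Om) \<le> dual_norm \<phi> * (NN * (\<integral>w. norm (f w) \<partial>Om))" by simp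
qed

text \<open>The weak integral is linear and bounded in the functional, that is, an element of the
  bidual.\<close>

lemma weak_integral_exists:
  assumes f: "SM Om f" and int: "integrable Om (\<lambda>w. norm (f w))"
  shows "\<exists>x. \<forall>\<phi>\<in>dual_space. \<phi> x = (\<integral>w. \<phi> (QQ w (f w)) \<partial>Om)"
proof -
  have "(\<lambda>\<phi>. \<integral>w. \<phi> (QQ w (f w)) \<partial>Om) \<in> (bidual_space :: (('a \<Rightarrow> complex) \<Rightarrow> complex) set)"
    unfolding bidual_space_def mem_Collect_eq
  proof (intro conjI ballI allI exI[of _ "NN * (\<integral>w. norm (f w) \<partial>Om)"])
    fix \<phi> \<psi> :: "'a \<Rightarrow> complex" assume *: "\<phi> \<in> dual_space" "\<psi> \<in> dual_space"
    show "(\<integral>w. \<phi> (QQ w (f w)) + \<psi> (QQ w (f w)) \<partial>Om) = (\<integral>w. \<phi> (QQ w (f w)) \<partial>Om) + (\<integral>w. \<psi> (QQ w (f w)) \<partial>Om)"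
      by (intro Bochner_Integration.integral_add weak_integrable(1)[OF f int] *)
  next
    fix \<phi> :: "'a \<Rightarrow> complex" assume *: "\<phi> \<in> dual_space"
    show "cmod (\<integral>w. \<phi> (QQ w (f w)) \<partial>Om) \<le> NN * (\<integral>w. norm (f w) \<partial>Om) * dual_norm \<phi>"
      using weak_integrable(2)[OF f int *] by (simp add: mult_ac)
  qed simp
  then show ?thesis using refl unfolding reflexive_space_def by fastforce
qed

text \<open>Frees later arguments from the choices in \<open>Sm\<close> and \<open>Qop\<close>: any
  measurable representative computes the value.\<close>

lemma Qop_eq:
  assumes f: "f \<in> Lp Om p" and f': "SM Om f'" "AE w in Om. f w = f' w" and phi: "\<phi> \<in> dual_space"
  shows "\<phi> (Qop f) = (\<integral>w. \<phi> (QQ w (f' w)) \<partial>Om)"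
proof -
  have Sm: "SM Om (Sm f)" "AE w in Om. f w = Sm f w"
    using someI[of "\<lambda>f'. SM Om f' \<and> (AE w in Om. f w = f' w)", OF conjI[OF f']] by (auto simp: Sm_def)
  have "(\<integral>\<^sup>+w. ennreal (norm (f w) powr p) \<partial>Om) = (\<integral>\<^sup>+w. ennreal (norm (Sm f w) powr p) \<partial>Om)"
    by (rule nn_integral_cong_AE) (use Sm(2) in \<open>eventually_elim, simp\<close>)
  then have "integrable Om (\<lambda>w. norm (Sm f w))" using f by (intro Lp_integrable(1)[OF Sm(1) _ p]) (simp add: Lp_def)
  then have "\<forall>\<phi>\<in>dual_space. \<phi> (Qop f) = (\<integral>w. \<phi> (QQ w (Sm f w)) \<partial>Om)"
    unfolding Qop_def by (rule someI_ex[OF weak_integral_exists[OF Sm(1)]])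
  then have "\<phi> (Qop f) = (\<integral>w. \<phi> (QQ w (Sm f w)) \<partial>Om)" using phi by blast
  also have "\<dots> = (\<integral>w. \<phi> (QQ w (f' w)) \<partial>Om)"
  proof (rule integral_cong_AE)
    show "(\<lambda>w. \<phi> (QQ w (Sm f w))) \<in> borel_measurable Om" "(\<lambda>w. \<phi> (QQ w (f' w))) \<in> borel_measurable Om"
      using SM_measurable[OF SM_continuous[OF linear_continuous_on[OF dual_spaceD(3)[OF phi]] QQ_SM]] Sm(1) f'(1) by blast+
    show "AE w in Om. \<phi> (QQ w (Sm f w)) = \<phi> (QQ w (f' w))" using Sm(2) f'(2) by eventually_elim simp
  qed
  finally show ?thesis .
qed

lemma Q_bounded_from_Lp: "bounded_from_Lp Om p Qop"
  unfolding bounded_from_Lp_def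
proof (intro conjI ballI impI allI exI[of _ "NN * 2"])
  fix f g :: "(nat \<Rightarrow> real) \<Rightarrow> 'a" assume fg: "f \<in> Lp Om p" "g \<in> Lp Om p"
  obtain f' where f': "SM Om f'" "AE w in Om. f w = f' w" "(\<integral>\<^sup>+x. ennreal (norm (f' x) powr p) \<partial>Om) < \<infinity>"
    "Lp_norm Om p f = Lp_norm Om p f'" using fg(1) by (rule Lp_SM)
  obtain g' where g': "SM Om g'" "AE w in Om. g w = g' w" "(\<integral>\<^sup>+x. ennreal (norm (g' x) powr p) \<partial>Om) < \<infinity>"
    "Lp_norm Om p g = Lp_norm Om p g'" using fg(2) by (rule Lp_SM)
  note fi = Lp_integrable[OF f'(1,3) p] and gi = Lp_integrable[OF g'(1,3) p]
  show "Qop f = Qop g" if "AE w in Om. f w = g w"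
  proof (rule dual_separates)
    fix \<phi> :: "'a \<Rightarrow> complex" assume phi: "\<phi> \<in> dual_space"
    have "AE w in Om. g w = f' w" using that f'(2) by eventually_elim simp
    then show "\<phi> (Qop f) = \<phi> (Qop g)"
      using Qop_eq[OF fg(1) f'(1,2) phi] Qop_eq[OF fg(2) f'(1) _ phi] by simp
  qed
  show "norm (Qop f) \<le> NN * 2 * Lp_norm Om p f"
  proof (rule norm_le_dual)
    fix \<phi> :: "'a \<Rightarrow> complex" assume phi: "\<phi> \<in> dual_space" "\<And>y. cmod (\<phi> y) \<le> norm y"
    have dn: "dual_norm \<phi> \<le> 1" by (intro dual_norm_le order_trans[OF phi(2)])
    have "cmod (\<phi> (Qop f)) \<le> dual_norm \<phi> * (NN * (\<integral>w. norm (f' w) \<partial>Om))"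
      unfolding Qop_eq[OF fg(1) f'(1,2) phi(1)] by (rule weak_integrable(2)[OF f'(1) fi(1) phi(1)])
    also have "\<dots> \<le> 1 * (NN * (\<integral>w. norm (f' w) \<partial>Om))"
      using dn NN0 by (intro mult_right_mono) auto
    also have "\<dots> \<le> 1 * (NN * (2 * Lp_norm Om p f'))"
      using NN0 fi(2) by (intro mult_left_mono) auto
    finally show "cmod (\<phi> (Qop f)) \<le> NN * 2 * Lp_norm Om p f" by (simp add: f'(4))
  qed
  fix c
  let ?h = "\<lambda>w. f' w + c *\<^sub>C g' w"
  have sm: "SM Om ?h" by (intro SM_add SM_scaleC f' g') simp
  have ae: "AE w in Om. f w + c *\<^sub>C g w = ?h w" using f'(2) g'(2) by eventually_elim simp
  have lp: "(\<lambda>w. f w + c *\<^sub>C g w) \<in> Lp Om p"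
    by (rule Lp_add_scaleC[OF fg _]) (use p in simp)
  show "Qop (\<lambda>w. f w + c *\<^sub>C g w) = Qop f + c *\<^sub>C Qop g"
  proof (rule dual_separates)
    fix \<phi> :: "'a \<Rightarrow> complex" assume phi: "\<phi> \<in> dual_space"
    have "\<phi> (Qop (\<lambda>w. f w + c *\<^sub>C g w)) = (\<integral>w. \<phi> (QQ w (?h w)) \<partial>Om)" by (rule Qop_eq[OF lp sm ae phi])
    also have "\<dots> = (\<integral>w. \<phi> (QQ w (f' w)) + c * \<phi> (QQ w (g' w)) \<partial>Om)"
      by (simp add: bounded_opD(1,2)[OF QQ_bop] dual_spaceD(1,2)[OF phi])
    also have "\<dots> = (\<integral>w. \<phi> (QQ w (f' w)) \<partial>Om) + c * (\<integral>w. \<phi> (QQ w (g' w)) \<partial>Om)"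
      by (subst Bochner_Integration.integral_add)
        (use weak_integrable(1)[OF f'(1) fi(1) phi] weak_integrable(1)[OF g'(1) gi(1) phi] in simp_all)
    also have "\<dots> = \<phi> (Qop f + c *\<^sub>C Qop g)"
      by (simp add: dual_spaceD(1,2)[OF phi] Qop_eq[OF fg(1) f'(1,2) phi] Qop_eq[OF fg(2) g'(1,2) phi])
    finally show "\<phi> (Qop (\<lambda>w. f w + c *\<^sub>C g w)) = \<phi> (Qop f + c *\<^sub>C Qop g)" .
  qed
qed

text \<open>Composition operators reverse the order: the first operator of the chain corresponds to
  the first map applied to \<open>w\<close>, so the new map goes on the outside.\<close>

fun \<sigma> :: "(nat \<Rightarrow> real) \<Rightarrow> nat \<Rightarrow> (nat \<Rightarrow> real) \<Rightarrow> nat \<Rightarrow> real" where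
  "\<sigma> t 0 w = w"
| "\<sigma> t (Suc m) w = \<tau> (Suc m) (t (Suc m)) (\<sigma> t m w)"

lemma comp_chain_flows: "comp_chain (\<lambda>k f w. f (\<tau> k (t k) w)) m f = (\<lambda>w. f (\<sigma> t m w))"
  by (induction m arbitrary: f) auto

lemma \<sigma>_measurable: "\<sigma> t m \<in> measurable Om Om"
proof (induction m)
  case (Suc m)
  then show ?case using measurable_compose[OF Suc \<tau>_measurable] by simp
qed simp

lemma \<sigma>_block:
  assumes "n \<in> B k"
  shows "\<sigma> t m w n = (if k \<in> {1..m} then \<tau> k (t k) w n else w n)"
  using assms
proof (induction m arbitrary: n)
  case (Suc m)
  show ?case
  proof (cases "k = Suc m")
    case True
    have "\<sigma> t m w n = w n" if "n \<in> B k" for n using Suc.IH[OF that] True by simp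
    then show ?thesis using \<tau>_block[of k "\<sigma> t m w" w n] Suc.prems True by simp
  next
    case False
    then have "n \<notin> B (Suc m)" using disj[of k "Suc m"] Suc.prems by blast
    then show ?thesis using Suc.IH[OF Suc.prems] False by (auto simp: \<tau>_outside)
  qed
qed simp

text \<open>\<open>j k\<close> sees only its own block, and there the combined flow acts as the
  \<open>k\<close>-th flow alone.\<close>

lemma JJ_\<sigma>: "JJ x (\<sigma> t d w) = comp_chain (\<lambda>k. j k (\<tau> k (t k) w)) d x"
proof -
  have "j k (\<sigma> t d w) = j k (\<tau> k (t k) w)" if k: "k \<in> {1..d}" for k
  proof (rule block(1)[OF k])
    show "\<sigma> t d w n = \<tau> k (t k) w n" if "n \<in> B k" for n using \<sigma>_block[OF that] k by simp
  qed
  then have "comp_chain (\<lambda>k. j k (\<sigma> t d w)) d = comp_chain (\<lambda>k. j k (\<tau> k (t k) w)) d"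
    by (rule comp_chain_cong)
  then show ?thesis by (simp add: JJ_def)
qed

text \<open>Induction removes the last block. Its \<open>q\<close> is moved past the
  \<open>j\<close> of the earlier blocks, so that \<open>q\<close> and \<open>j\<close> of the last
  block become adjacent; the earlier blocks together with \<open>\<phi>\<close> form a functional
  field independent of it.\<close>

lemma expectation_chain:
  assumes t: "\<And>k. k \<in> {1..d} \<Longrightarrow> 0 \<le> t k" and phi: "\<phi> \<in> dual_space" and m: "m \<le> d"
  shows "(\<integral>w. \<phi> (comp_chain (\<lambda>k. q k w) m (comp_chain (\<lambda>k. j k (\<tau> k (t k) w)) m y)) \<partial>Om) = \<phi> (comp_chain (\<lambda>k. T k (t k)) m y)"
  using m
proof (induction m arbitrary: y)
  case 0
  then show ?case by (simp add: Om.prob_space[unfolded space_Om])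
next
  case (Suc m)
  let ?j = "\<lambda>w k. j k (\<tau> k (t k) w)" and ?q = "\<lambda>w k. q k w"
  have md: "k \<in> {1..d}" if "k \<in> {1..m}" for k using that Suc.prems by auto
  have Sd: "Suc m \<in> {1..d}" using Suc.prems by auto
  define L where "L = (\<lambda>w x. \<phi> (comp_chain (?q w) m (comp_chain (?j w) m x)))"
  let ?n = "\<Prod>k\<in>{1..m}. N k"
  let ?b = "\<bar>dual_norm \<phi>\<bar> * (?n * ?n)"
  have n0: "0 \<le> ?n" by (intro prod_nonneg) (rule N0, rule md)
  have jb: "bounded_op (comp_chain (?j w) m)" and qb: "bounded_op (comp_chain (?q w) m)" for w
    by (rule comp_chain_bounded_op, rule bop, rule md, assumption)+
  have L: "functional_field L ?b"
    unfolding functional_field_def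
  proof (intro conjI allI)
    show "L w \<in> dual_space" for w
      unfolding L_def by (rule dual_space_comp[OF phi bounded_op_comp[OF qb jb]])
    show "SM Om (\<lambda>w. L w x)" for x
      unfolding L_def
      by (intro SM_continuous[OF linear_continuous_on[OF dual_spaceD(3)[OF phi]]] comp_chain_SM jq_SM bop md
        SM_const SM_preserving[OF \<tau>_measurable jq_SM(1)])
    show "cmod (L w x) \<le> ?b * norm x" for w x
    proof -
      let ?y = "comp_chain (?j w) m x"
      have "norm (comp_chain (?q w) m ?y) \<le> ?n * norm ?y" by (intro comp_chain_norm bd N0 md)
      also have "\<dots> \<le> ?n * (?n * norm x)"
        by (intro mult_left_mono n0 comp_chain_norm bd N0 md)
      finally have le: "norm (comp_chain (?q w) m ?y) \<le> ?n * (?n * norm x)" .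
      have "cmod (L w x) \<le> dual_norm \<phi> * norm (comp_chain (?q w) m ?y)"
        unfolding L_def by (rule dual_norm_bound[OF phi])
      also have "\<dots> \<le> \<bar>dual_norm \<phi>\<bar> * norm (comp_chain (?q w) m ?y)" by (intro mult_right_mono) auto
      also have "\<dots> \<le> \<bar>dual_norm \<phi>\<bar> * (?n * (?n * norm x))" by (intro mult_left_mono le) auto
      finally show ?thesis by (simp add: mult.assoc)
    qed
  qed
  have ind: "L (w(n := v)) = L w" if n: "n \<in> B (Suc m)" for w n v
  proof -
    have eq: "(w(n := v)) i = w i" if "k \<in> {1..m}" "i \<in> B k" for k i
      using disj[of k "Suc m"] that n by auto
    have "comp_chain (?q (w(n := v))) m = comp_chain (?q w) m"
      by (rule comp_chain_cong) (rule block(2)[OF md eq])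
    moreover have "comp_chain (?j (w(n := v))) m = comp_chain (?j w) m"
      by (rule comp_chain_cong) (rule block(1)[OF md \<tau>_block[OF eq]])
    ultimately show ?thesis by (simp add: L_def)
  qed
  have swap: "q (Suc m) w (comp_chain (?j w) m z) = comp_chain (?j w) m (q (Suc m) w z)" for w z
  proof (rule comp_chain_commute)
    fix k x assume "k \<in> {1..m}"
    then show "q (Suc m) w (?j w k x) = ?j w k (q (Suc m) w x)" by (intro comm Sd md) auto
  qed
  have "(\<integral>w. \<phi> (comp_chain (?q w) (Suc m) (comp_chain (?j w) (Suc m) y)) \<partial>Om)
    = (\<integral>w. L w (q (Suc m) w (j (Suc m) (\<tau> (Suc m) (t (Suc m)) w) y)) \<partial>Om)"
    by (simp add: L_def swap)
  also have "\<dots> = (\<integral>w. L w (T (Suc m) (t (Suc m)) y) \<partial>Om)"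
    by (rule expectation_T[OF Sd L _ ind t[OF Sd]]) (use n0 in auto)
  also have "\<dots> = \<phi> (comp_chain (\<lambda>k. T k (t k)) m (T (Suc m) (t (Suc m)) y))"
    unfolding L_def using Suc by simp
  finally show ?case by simp
qed

lemma dilation:
  assumes t: "\<And>k. k \<in> {1..d} \<Longrightarrow> 0 \<le> t k"
  shows "comp_chain (\<lambda>k. T k (t k)) d x = Qop (comp_chain (\<lambda>k f w. f (\<tau> k (t k) w)) d (JJ x))"
proof (rule dual_separates)
  fix \<phi> :: "'a \<Rightarrow> complex" assume phi: "\<phi> \<in> dual_space"
  have sm: "SM Om (\<lambda>w. JJ x (\<sigma> t d w))" by (rule SM_preserving[OF \<sigma>_measurable JJ_SM])
  have lp: "(\<lambda>w. JJ x (\<sigma> t d w)) \<in> Lp Om p"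
    using bounded_SM_Lp(1)[OF sm JJ_norm] p by simp
  have "\<phi> (Qop (\<lambda>w. JJ x (\<sigma> t d w))) = (\<integral>w. \<phi> (QQ w (JJ x (\<sigma> t d w))) \<partial>Om)"
    by (rule Qop_eq[OF lp sm _ phi]) simp
  also have "\<dots> = \<phi> (comp_chain (\<lambda>k. T k (t k)) d x)"
    unfolding JJ_\<sigma> QQ_def by (rule expectation_chain[OF t phi order_refl])
  finally show "\<phi> (comp_chain (\<lambda>k. T k (t k)) d x) = \<phi> (Qop (comp_chain (\<lambda>k f w. f (\<tau> k (t k) w)) d (JJ x)))"
    by (simp add: comp_chain_flows)
qed

end

section \<open>Blocks from an \<open>H\<^sup>\<infinity>\<close> calculus\<close>

text \<open>The last clause puts \<open>j\<close> in the bicommutant of the family \<open>R\<close>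
  over \<open>Z\<close>; through it the commutation of resolvents of different operators reaches
  their random operators.\<close>

definition random_operator ::
  "nat set \<Rightarrow> complex set \<Rightarrow> (complex \<Rightarrow> 'a \<Rightarrow> 'a) \<Rightarrow> real \<Rightarrow> ((nat \<Rightarrow> real) \<Rightarrow> 'a::complex_banach \<Rightarrow> 'a) \<Rightarrow> bool" where
  "random_operator B Z R N j \<longleftrightarrow> (\<forall>w. bounded_op (j w)) \<and> (\<forall>w x. norm (j w x) \<le> N * norm x)
     \<and> (\<forall>x. SM Om (\<lambda>w. j w x)) \<and> (\<forall>w w'. (\<forall>n\<in>B. w n = w' n) \<longrightarrow> j w = j w')
     \<and> (\<forall>U w x. bounded_op U \<longrightarrow> (\<forall>z\<in>Z. \<forall>x. U (R z x) = R z (U x)) \<longrightarrow> U (j w x) = j w (U x))"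

lemma random_operatorD:
  assumes "random_operator B Z R N j"
  shows "bounded_op (j w)" "norm (j w x) \<le> N * norm x" "SM Om (\<lambda>w. j w x)"
    "(\<And>n. n \<in> B \<Longrightarrow> w n = w' n) \<Longrightarrow> j w = j w'"
    "bounded_op U \<Longrightarrow> (\<And>z x. z \<in> Z \<Longrightarrow> U (R z x) = R z (U x)) \<Longrightarrow> U (j w x) = j w (U x)"
  using assms unfolding random_operator_def by blast+

lemma (in random_series) SL_random_operator: "random_operator (insert s (range a)) S R (M + C) SL"
  unfolding random_operator_def
proof (intro conjI allI impI)
  show "SL w = SL w'" if "\<forall>n\<in>insert s (range a). w n = w' n" for w w'
    by (rule SL_cong) (use that in blast)
  show "U (SL w x) = SL w (U x)" if "bounded_op U" "\<forall>z\<in>S. \<forall>x. U (R z x) = R z (U x)" for U w x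
    by (rule SL_commute) (use that in \<open>simp add: commutes_def\<close>)
qed (rule SL_bop SL_norm SL_SM)+

text \<open>One block with its angle and constants hidden: of these only a bound \<open>N\<close>
  and a set \<open>Z\<close> of resolvent points stay visible.\<close>

definition dilation_pair ::
  "'a::complex_banach uop \<Rightarrow> nat set \<Rightarrow> (real \<Rightarrow> (nat \<Rightarrow> real) \<Rightarrow> nat \<Rightarrow> real) \<Rightarrow> complex set \<Rightarrow> real
    \<Rightarrow> ((nat \<Rightarrow> real) \<Rightarrow> 'a \<Rightarrow> 'a) \<Rightarrow> ((nat \<Rightarrow> real) \<Rightarrow> 'a \<Rightarrow> 'a) \<Rightarrow> bool" where
  "dilation_pair A B \<tau> Z N j q \<longleftrightarrow> 0 \<le> N \<and> (\<forall>z\<in>Z. in_resolvent_set z A)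
    \<and> random_operator B Z (\<lambda>z. resolvent z A) N j \<and> random_operator B Z (\<lambda>z. resolvent z A) N q
    \<and> (\<forall>L b r y. functional_field L b \<longrightarrow> 0 \<le> b \<longrightarrow> (\<forall>w n v. n \<in> B \<longrightarrow> L (w(n := v)) = L w) \<longrightarrow> 0 \<le> r \<longrightarrow>
         (\<integral>w. L w (q w (j (\<tau> r w) y)) \<partial>Om) = (\<integral>w. L w (semigroup A r y) \<partial>Om))"

lemma dilation_pairD:
  assumes "dilation_pair A B \<tau> Z N j q"
  shows "0 \<le> N" "z \<in> Z \<Longrightarrow> in_resolvent_set z A"
    "random_operator B Z (\<lambda>z. resolvent z A) N j" "random_operator B Z (\<lambda>z. resolvent z A) N q"
    "functional_field L b \<Longrightarrow> 0 \<le> b \<Longrightarrow> (\<And>w n v. n \<in> B \<Longrightarrow> L (w(n := v)) = L w) \<Longrightarrow> 0 \<le> r \<Longrightarrow>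
       (\<integral>w. L w (q w (j (\<tau> r w) y)) \<partial>Om) = (\<integral>w. L w (semigroup A r y) \<partial>Om)"
  using assms unfolding dilation_pair_def by blast+

lemma Hinfty_dilation_pair:
  fixes A :: "'a::complex_banach uop" and a :: "bool \<times> int \<Rightarrow> nat"
  assumes refl: "reflexive_space TYPE('a)" and th: "0 < \<theta>" "\<theta> < pi / 2" and H: "has_Hinfty_calculus A \<theta>"
    and a: "inj a" "s \<notin> range a" and c: "\<And>n. c n \<in> borel_measurable borel" "\<And>\<kappa> v. c (a \<kappa>) v = lam \<kappa> (clip v) / (2 * pi)"
  shows "\<exists>j q N Z. dilation_pair A (insert s (range a)) (flow s (range a) c) Z N j q"
proof -
  obtain \<theta>0 M C where g: "generator_family (\<lambda>z. resolvent z A) \<theta>0 M C A" and Z: "\<forall>z\<in>cosector \<theta>0. in_resolvent_set z A"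
    using Hinfty_generator_family[OF refl th H] by blast
  interpret generator_family "\<lambda>z. resolvent z A" \<theta>0 M C A by (rule g)
  interpret dilation_block "\<lambda>z. resolvent z A" \<theta>0 M C s a c by unfold_locales (fact a c)+
  show ?thesis
    unfolding dilation_pair_def
  proof (intro exI conjI allI impI)
    show "0 \<le> M + C" using M C by simp
    show "random_operator (insert s (range a)) S (\<lambda>z. resolvent z A) (M + C) J.SL" by (rule J.SL_random_operator)
    show "random_operator (insert s (range a)) S (\<lambda>z. resolvent z A) (M + C) Q.SL" by (rule Q.SL_random_operator)
    show "(\<integral>w. L w (Q.SL w (J.SL (flow s (range a) c r w) y)) \<partial>Om) = (\<integral>w. L w (semigroup A r y) \<partial>Om)"
      if "functional_field L b" "0 \<le> b" "\<forall>w n v. n \<in> insert s (range a) \<longrightarrow> L (w(n := v)) = L w" "0 \<le> r" for L b r y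
      unfolding semigroup_eq_T[OF that(4)] using expectation_T[OF that(1,2)] that(3) by blast
  qed (fact Z)
qed

text \<open>Coordinates are labelled by the block together with \<open>None\<close> for the position
  \<open>u\<close> or \<open>Some \<kappa>\<close> for a phase; the injective encoding makes the
  blocks disjoint.\<close>

definition sidx :: "nat \<Rightarrow> nat" where "sidx k = to_nat (k, None :: (bool \<times> int) option)"
definition aidx :: "nat \<Rightarrow> bool \<times> int \<Rightarrow> nat" where "aidx k \<kappa> = to_nat (k, Some \<kappa>)"
text \<open>One speed function serves all blocks. At indices \<open>sidx k\<close> its value is
  unspecified, but the flows read it only at phase coordinates.\<close>

definition freq :: "nat \<Rightarrow> real \<Rightarrow> real" where
  "freq n v = lam (the (snd (from_nat n :: nat \<times> (bool \<times> int) option))) (clip v) / (2 * pi)"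

lemma idx_eq [simp]: "aidx k \<kappa> = aidx l \<kappa>' \<longleftrightarrow> k = l \<and> \<kappa> = \<kappa>'" "sidx k = sidx l \<longleftrightarrow> k = l" "sidx k \<noteq> aidx l \<kappa>" "aidx l \<kappa> \<noteq> sidx k"
  by (auto simp: sidx_def aidx_def)

lemma freq_aidx: "freq (aidx k \<kappa>) v = lam \<kappa> (clip v) / (2 * pi)"
  by (simp add: freq_def aidx_def)

lemma freq_measurable: "freq n \<in> borel_measurable borel"
  unfolding freq_def
  by (intro borel_measurable_continuous_onI continuous_intros continuous_on_clip lam_cont) simp

lemma resolvent_bounded: "in_resolvent_set z A \<Longrightarrow> bounded_op (resolvent z A)"
proof -
  assume "in_resolvent_set z A"
  then have "is_resolvent z A (resolvent z A)"
    unfolding in_resolvent_set_def resolvent_def by (rule someI_ex)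
  then show ?thesis by (simp add: is_resolvent_def)
qed

theorem theorem4p7:
  fixes A :: "nat \<Rightarrow> 'a::complex_banach uop"
    and \<theta> :: "nat \<Rightarrow> real"
    and d :: nat and p :: real
  assumes "reflexive_space TYPE('a)"
    and "finite_cotype TYPE('a)"
    and "dual_finite_cotype TYPE('a)"
    and "d \<ge> 1"
    and "\<forall>k\<in>{1..d}. sectorial_op (A k)"
    and "\<forall>j\<in>{1..d}. \<forall>k\<in>{1..d}. commuting_uops (A j) (A k)"
    and "\<forall>k\<in>{1..d}. 0 < \<theta> k \<and> \<theta> k < pi / 2 \<and> has_Hinfty_calculus (A k) (\<theta> k)"
    and "1 < p"
  shows "\<exists>(\<Omega> :: (nat \<Rightarrow> real) measure) (U :: nat \<Rightarrow> real \<Rightarrow> ((nat \<Rightarrow> real) \<Rightarrow> 'a) \<Rightarrow> ((nat \<Rightarrow> real) \<Rightarrow> 'a))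
            J Q.
           (\<forall>k\<in>{1..d}. isometric_C0_group \<Omega> p (U k))
         \<and> (\<forall>j\<in>{1..d}. \<forall>k\<in>{1..d}. commuting_Lp_groups \<Omega> p (U j) (U k))
         \<and> bounded_into_Lp \<Omega> p J \<and> bounded_from_Lp \<Omega> p Q
         \<and> (\<forall>t :: nat \<Rightarrow> real. (\<forall>k\<in>{1..d}. 0 \<le> t k) \<longrightarrow>
              (\<forall>x. comp_chain (\<lambda>k. semigroup (A k) (t k)) d x
                   = Q (comp_chain (\<lambda>k. U k (t k)) d (J x))))"
proof -
  define B where "B = (\<lambda>k. insert (sidx k) (range (aidx k)))"
  define \<tau> where "\<tau> = (\<lambda>k. flow (sidx k) (range (aidx k)) freq)"
  have s_a: "sidx k \<notin> range (aidx l)" for k l by auto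
  have inj: "inj (aidx k)" for k by (simp add: inj_def)
  have "\<forall>k\<in>{1..d}. \<exists>j q N Z. dilation_pair (A k) (B k) (\<tau> k) Z N j q"
  proof
    fix k assume "k \<in> {1..d}"
    then have "0 < \<theta> k" "\<theta> k < pi / 2" "has_Hinfty_calculus (A k) (\<theta> k)" using assms(7) by auto
    from Hinfty_dilation_pair[OF assms(1) this inj s_a freq_measurable freq_aidx]
    show "\<exists>j q N Z. dilation_pair (A k) (B k) (\<tau> k) Z N j q" unfolding B_def \<tau>_def .
  qed
  then obtain j q N Z where blk: "\<And>k. k \<in> {1..d} \<Longrightarrow> dilation_pair (A k) (B k) (\<tau> k) (Z k) (N k) (j k) (q k)"
    by metis
  have rj: "random_operator (B k) (Z k) (\<lambda>z. resolvent z (A k)) (N k) (j k)"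
    and rq: "random_operator (B k) (Z k) (\<lambda>z. resolvent z (A k)) (N k) (q k)" if "k \<in> {1..d}" for k
    using dilation_pairD[OF blk[OF that]] by blast+
  interpret commuting_blocks d p j q N B \<tau> "\<lambda>k. semigroup (A k)"
  proof
    fix k l and w w' :: "nat \<Rightarrow> real" and x :: 'a
    show "reflexive_space TYPE('a)" "1 < p" by fact+
    show "\<tau> k t \<in> measurable Om Om" for t unfolding \<tau>_def by (rule flow_measurable[OF freq_measurable])
    show "\<tau> k t w n = w n" if "n \<notin> B k" for n t using that by (auto simp: \<tau>_def flow_def B_def)
    show "\<tau> k t w n = \<tau> k t w' n" if "\<And>n. n \<in> B k \<Longrightarrow> w n = w' n" "n \<in> B k" for n t
      using that(1)[of n] that(1)[of "sidx k"] that(2) by (simp add: \<tau>_def flow_def B_def)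
    show "k \<noteq> l \<Longrightarrow> B k \<inter> B l = {}" by (auto simp: B_def)
    assume k: "k \<in> {1..d}"
    show "bounded_op (j k w)" "bounded_op (q k w)" "norm (j k w x) \<le> N k * norm x" "norm (q k w x) \<le> N k * norm x"
      "SM Om (\<lambda>w. j k w x)" "SM Om (\<lambda>w. q k w x)"
      using random_operatorD(1-3)[OF rj[OF k]] random_operatorD(1-3)[OF rq[OF k]] by blast+
    show "0 \<le> N k" using dilation_pairD(1)[OF blk[OF k]] .
    show "j k w = j k w'" "q k w = q k w'" if "\<And>n. n \<in> B k \<Longrightarrow> w n = w' n"
      using random_operatorD(4)[OF rj[OF k]] random_operatorD(4)[OF rq[OF k]] that by blast+
    show "(\<integral>w. L w (q k w (j k (\<tau> k r w) y)) \<partial>Om) = (\<integral>w. L w (semigroup (A k) r y) \<partial>Om)"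
      if "functional_field L b" "0 \<le> b" "\<And>w n v. n \<in> B k \<Longrightarrow> L (w(n := v)) = L w" "0 \<le> r" for L b r y
      by (rule dilation_pairD(5)[OF blk[OF k] that])
    assume l: "l \<in> {1..d}" and kl: "k \<noteq> l"
    have rc: "resolvent z (A l) (resolvent z' (A k) y) = resolvent z' (A k) (resolvent z (A l) y)"
      if "z \<in> Z l" "z' \<in> Z k" for z z' y
      using assms(6) dilation_pairD(2)[OF blk[OF k]] dilation_pairD(2)[OF blk[OF l]] that k l
      unfolding commuting_uops_def by (metis comp_apply)
    \<comment> \<open>Two bicommutant steps: the resolvents of \<open>A l\<close> commute with those
      of \<open>A k\<close>, hence with \<open>q k w\<close>; so \<open>q k w\<close> commutes with
      the resolvents of \<open>A l\<close>, hence with \<open>j l w'\<close>.\<close>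
    show "q k w (j l w' x) = j l w' (q k w x)"
    proof (rule random_operatorD(5)[OF rj[OF l] random_operatorD(1)[OF rq[OF k]]])
      fix z y assume z: "z \<in> Z l"
      then have "in_resolvent_set z (A l)" by (rule dilation_pairD(2)[OF blk[OF l]])
      then show "q k w (resolvent z (A l) y) = resolvent z (A l) (q k w y)"
        by (intro random_operatorD(5)[OF rq[OF k], symmetric] resolvent_bounded rc z)
    qed
  qed
  show ?thesis
  proof (intro exI[of _ Om] exI[of _ "\<lambda>k t f w. f (\<tau> k t w)"] exI[of _ JJ] exI[of _ Qop] conjI ballI allI impI)
    fix k assume "k \<in> {1..d}"
    show "isometric_C0_group Om p (\<lambda>t (f :: _ \<Rightarrow> 'a) w. f (\<tau> k t w))"
      unfolding \<tau>_def by (rule flow_group[OF freq_measurable s_a]) (use assms(8) in simp)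
    fix l
    show "commuting_Lp_groups Om p (\<lambda>t (f :: _ \<Rightarrow> 'a) w. f (\<tau> l t w)) (\<lambda>t f w. f (\<tau> k t w))"
    proof (cases "k = l")
      \<comment> \<open>The pairs include equal indices, where commutation is the group law.\<close>
      case True
      then show ?thesis unfolding commuting_Lp_groups_def \<tau>_def
        by (simp add: flow_add[OF s_a, symmetric] add.commute)
    next
      case False
      then have "range (aidx k) \<inter> range (aidx l) = {}" by auto
      then show ?thesis unfolding commuting_Lp_groups_def \<tau>_def
        by (simp add: flow_commute[OF s_a s_a \<open>range (aidx k) \<inter> range (aidx l) = {}\<close>])
    qed
  qed (use J_bounded_into_Lp Q_bounded_from_Lp dilation in auto)
qed

end
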